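(* Let $R$ be the homogeneous coordinate ring of a $0$-dimensional scheme $\mathbb{X}$ in $\mathbb{P}^n$, and let $\widetilde{R}\cong S[x_0]$ be the truncated integral closure of $R$ in its homogeneous ring of quotients (setting and notation as in the context). Then: (a) The injective homomorphism of graded $K$-algebras $\phi: R\to \widetilde{R}\cong S[x_0]$, $\phi(f)=f^{\rm deh}x_0^k$ for $f\in R_k$, induces a homomorphism of graded $K[x_0]$-modules $$\Phi:\ \Omega^1_{R/K}\longrightarrow \Omega^1_{\widetilde{R}/K}\ \cong\ S[x_0]\,dx_0\ \oplus\ K[x_0]\otimes_K\Omega^1_{S/K}$$ which is given by $\Phi(f\,dx_i)=f^{\rm deh}x_i\,x_0^k\,dx_0 + x_0^{k+1}\otimes f^{\rm deh}dx_i$ for $i=1,\dots,n$, and by $\Phi(f\,dx_0)=f^{\rm deh}x_0^k\,dx_0$, for $f\in R_k$. (b) For $i\ge 2r_{\mathbb{X}}+1$, the map $\Phi_i: (\Omega^1_{R/K})_i\to(\Omega^1_{\widetilde{R}/K})_i$ is an isomorphism of $K$-vector spaces. (c) We have $\mathrm{HP}(\Omega^1_{R/K})=\deg(\mathbb{X})+\dim_K(\Omega^1_{S/K})$ and $\mathrm{ri}(\Omega^1_{R/K})\le 2r_{\mathbb{X}}+1$. (d) We have $T\Omega^1_{R/K}=\mathrm{Ker}(\Phi)$.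
   Context: Let $K$ be a perfect field, $n\ge 1$, $P=K[X_0,\dots,X_n]$ with the standard grading, and $\mathbb{X}\subseteq\mathbb{P}^n$ a $0$-dimensional subscheme over $K$ with saturated homogeneous vanishing ideal $I_{\mathbb{X}}\subseteq P$. Put $R=P/I_{\mathbb{X}}$ and let $x_i$ be the image of $X_i$ in $R$. Assume no point of the support of $\mathbb{X}$ lies on the hyperplane $X_0=0$; then $x_0$ is a non-zerodivisor of $R$. Let $S=R/\langle x_0-1\rangle$ (the affine coordinate ring, a finite dimensional $K$-algebra); for $f\in R$ let $f^{\rm deh}\in S$ be its image (dehomogenization), and denote the images of $x_1,\dots,x_n$ in $S$ again by $x_1,\dots,x_n$. Let $\mathrm{HF}_{\mathbb{X}}(i)=\dim_K R_i$, let $\deg(\mathbb{X})=\dim_K S$ be its value for $i\gg0$, and let $r_{\mathbb{X}}$ be the least integer with $\mathrm{HF}_{\mathbb{X}}(i)=\deg(\mathbb{X})$ for all $i\ge r_{\mathbb{X}}$. The homogeneous ring of quotients is $Q^h(R)=\{a/b\mid a,b\in R,\ b \text{ homogeneous non-zerodivisor}\}$. The truncated integral closure $\widetilde{R}$ is the subring of $Q^h(R)$ generated by all homogeneous elements of non-negative degree; it is identified with $S[x_0]$ ($S$ in degree $0$, $x_0$ in degree $1$) by $f\mapsto f^{\rm deh}x_0^d$ for homogeneous $f$ of degree $d$. $\Omega^1_{A/K}$ denotes the module of Kähler differentials, graded so that $\deg(df)=\deg(f)$ for homogeneous $f$. For a finitely generated graded $R$-module $M$: $\mathrm{HF}_M(i)=\dim_K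 M_i$, $\mathrm{HP}(M)$ is the constant value of $\mathrm{HF}_M(i)$ for $i\gg0$, and $\mathrm{ri}(M)=\min\{i\in\mathbb{Z}\mid \mathrm{HF}_M(j)=\mathrm{HP}(M)\text{ for all }j\ge i\}$. The torsion submodule is $T\Omega^1_{R/K}=\{w\in\Omega^1_{R/K}\mid rw=0\text{ for some homogeneous non-zerodivisor }r\in R\}$. *)

theory Defs
  imports
    "Jordan_Normal_Form.VS_Connect"
    "HOL-Library.Poly_Mapping"
    "HOL-Algebra.QuotRing"
    "HOL-Algebra.Generated_Rings"
    "HOL-Algebra.UnivPoly"
begin

text \<open>
  Throughout, \<open>'k\<close> is the base field, \<open>K = class_ring\<close> is the corresponding record, and a
  \<open>K\<close>-algebra is a record of type \<open>('k, 'a) module\<close>, which carries both a ring structure and a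
  scalar multiplication. A grading is the family \<open>G :: int \<Rightarrow> 'a set\<close> of its components.
\<close>

section \<open>Algebras and modules\<close>

abbreviation base_field :: "'k::field ring" where
  "base_field \<equiv> class_ring"

definition perfect_field :: "'k::field itself \<Rightarrow> bool" where
  "perfect_field _ \<longleftrightarrow> CHAR('k) = 0 \<or> (\<forall>x::'k. \<exists>y. y ^ CHAR('k) = x)"

definition alg_map :: "('k, 'a, 'z) module_scheme \<Rightarrow> 'k \<Rightarrow> 'a" where
  "alg_map A c = c \<odot>\<^bsub>A\<^esub> \<one>\<^bsub>A\<^esub>"

text \<open>\<open>alg_via h A\<close> is the ring \<open>A\<close> regarded as an algebra along \<open>h\<close>.\<close>

definition alg_via :: "('r \<Rightarrow> 'a) \<Rightarrow> ('a, 'z) ring_scheme \<Rightarrow> ('r, 'a) module" where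
  "alg_via h A = \<lparr>carrier = carrier A, mult = monoid.mult A, one = \<one>\<^bsub>A\<^esub>,
     zero = \<zero>\<^bsub>A\<^esub>, add = ring.add A, smult = (\<lambda>c x. h c \<otimes>\<^bsub>A\<^esub> x)\<rparr>"

definition restrict_scalars ::
    "('r \<Rightarrow> 'a) \<Rightarrow> ('a, 'm, 'z) module_scheme \<Rightarrow> ('r, 'm) module" where
  "restrict_scalars h M = \<lparr>carrier = carrier M, mult = monoid.mult M, one = \<one>\<^bsub>M\<^esub>,
     zero = \<zero>\<^bsub>M\<^esub>, add = ring.add M, smult = (\<lambda>c x. h c \<odot>\<^bsub>M\<^esub> x)\<rparr>"

text \<open>
  The quotient of an algebra by an ideal and of a module by a submodule. The ring part is the
  one of \<^const>\<open>FactRing\<close>; for modules the fields \<open>mult\<close> and \<open>one\<close> carry no information.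
\<close>

definition quot_mod :: "('r, 'a, 'z) module_scheme \<Rightarrow> 'a set \<Rightarrow> ('r, 'a set) module" where
  "quot_mod M N = \<lparr>carrier = a_rcosets\<^bsub>M\<^esub> N, mult = rcoset_mult M N, one = N +>\<^bsub>M\<^esub> \<one>\<^bsub>M\<^esub>,
     zero = N, add = set_add M, smult = (\<lambda>c X. \<Union>x\<in>X. N +>\<^bsub>M\<^esub> (c \<odot>\<^bsub>M\<^esub> x))\<rparr>"

text \<open>The free \<open>A\<close>-module on a set \<open>X\<close>: finitely supported functions.\<close>

definition free_mod :: "('a, 'z) ring_scheme \<Rightarrow> 'x set \<Rightarrow> ('a, 'x \<Rightarrow> 'a) module" where
  "free_mod A X = \<lparr>carrier = {w. (\<forall>x\<in>X. w x \<in> carrier A) \<and> (\<forall>x. x \<notin> X \<longrightarrow> w x = \<zero>\<^bsub>A\<^esub>) \<and>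
                                 finite {x. w x \<noteq> \<zero>\<^bsub>A\<^esub>}},
     mult = (\<lambda>v w x. \<zero>\<^bsub>A\<^esub>), one = (\<lambda>x. \<zero>\<^bsub>A\<^esub>), zero = (\<lambda>x. \<zero>\<^bsub>A\<^esub>),
     add = (\<lambda>v w x. v x \<oplus>\<^bsub>A\<^esub> w x), smult = (\<lambda>a w x. a \<otimes>\<^bsub>A\<^esub> w x)\<rparr>"

definition free_gen :: "('a, 'z) ring_scheme \<Rightarrow> 'x \<Rightarrow> 'x \<Rightarrow> 'a" where
  "free_gen A x = (\<lambda>y. if y = x then \<one>\<^bsub>A\<^esub> else \<zero>\<^bsub>A\<^esub>)"

text \<open>
  Extension of scalars \<open>B \<otimes>\<^sub>K N\<close> of a \<open>K\<close>-module \<open>N\<close> to a \<open>K\<close>-algebra \<open>B\<close>: the \<open>B\<close>-module with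
  generators \<open>1 \<otimes> m\<close> for \<open>m \<in> N\<close>, subject to \<open>K\<close>-linearity in \<open>m\<close>.
\<close>

definition base_change_rels ::
    "('k::field, 'b, 'y) module_scheme \<Rightarrow> ('k, 'm, 'z) module_scheme \<Rightarrow> ('m \<Rightarrow> 'b) set" where
  "base_change_rels B N =
     (let F = free_mod B (carrier N); e = free_gen B in
      {e (m \<oplus>\<^bsub>N\<^esub> n) \<ominus>\<^bsub>F\<^esub> (e m \<oplus>\<^bsub>F\<^esub> e n) | m n. m \<in> carrier N \<and> n \<in> carrier N} \<union>
      {e (c \<odot>\<^bsub>N\<^esub> m) \<ominus>\<^bsub>F\<^esub> alg_map B c \<odot>\<^bsub>F\<^esub> e m | c m. m \<in> carrier N})"

definition base_change_sub ::
    "('k::field, 'b, 'y) module_scheme \<Rightarrow> ('k, 'm, 'z) module_scheme \<Rightarrow> ('m \<Rightarrow> 'b) set" where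
  "base_change_sub B N = LinearCombinations.module.span B (free_mod B (carrier N)) (base_change_rels B N)"

definition base_change ::
    "('k::field, 'b, 'y) module_scheme \<Rightarrow> ('k, 'm, 'z) module_scheme
      \<Rightarrow> ('b, ('m \<Rightarrow> 'b) set) module" where
  "base_change B N = quot_mod (free_mod B (carrier N)) (base_change_sub B N)"

definition tensor ::
    "('k::field, 'b, 'y) module_scheme \<Rightarrow> ('k, 'm, 'z) module_scheme \<Rightarrow> 'b \<Rightarrow> 'm
      \<Rightarrow> ('m \<Rightarrow> 'b) set" where
  "tensor B N b m = b \<odot>\<^bsub>base_change B N\<^esub>
     (base_change_sub B N +>\<^bsub>free_mod B (carrier N)\<^esub> free_gen B m)"

section \<open>Polynomial rings in one variable\<close>

text \<open>
  \<open>poly_alg1 A\<close> is \<open>A[x\<^sub>0]\<close> as a \<open>K\<close>-algebra (the scalar multiplication of \<^term>\<open>UP A\<close> itself is by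
  \<open>A\<close>), and \<open>poly_scalar A x : K[x\<^sub>0] \<rightarrow> A\<close> is the substitution of \<open>x\<close> for \<open>x\<^sub>0\<close>.
\<close>

abbreviation Kx0 :: "('k::field, nat \<Rightarrow> 'k) up_ring" where
  "Kx0 \<equiv> UP base_field"

definition poly_alg1 :: "('k::field, 'a, 'z) module_scheme \<Rightarrow> ('k, nat \<Rightarrow> 'a) module" where
  "poly_alg1 A = alg_via (\<lambda>c. up_ring.monom (UP A) (alg_map A c) 0) (UP A)"

definition poly_grade :: "('k::field, 'a, 'z) module_scheme \<Rightarrow> int \<Rightarrow> (nat \<Rightarrow> 'a) set" where
  "poly_grade A i = (if i < 0 then {\<zero>\<^bsub>UP A\<^esub>}
                     else {up_ring.monom (UP A) a (nat i) | a. a \<in> carrier A})"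

definition poly_scalar ::
    "('k::field, 'a, 'z) module_scheme \<Rightarrow> 'a \<Rightarrow> (nat \<Rightarrow> 'k) \<Rightarrow> 'a" where
  "poly_scalar A x = UnivPoly.eval base_field A (alg_map A) x"

section \<open>Kaehler differentials\<close>

text \<open>
  \<open>\<Omega>\<^sup>1\<close> of a \<open>K\<close>-algebra \<open>A\<close>: the \<open>A\<close>-module with generators \<open>da\<close> for \<open>a \<in> A\<close>, subject to
  additivity, the Leibniz rule and \<open>K\<close>-linearity.
\<close>

definition kaehler_rels :: "('k::field, 'a, 'z) module_scheme \<Rightarrow> ('a \<Rightarrow> 'a) set" where
  "kaehler_rels A =
     (let F = free_mod A (carrier A); e = free_gen A in
      {e (a \<oplus>\<^bsub>A\<^esub> b) \<ominus>\<^bsub>F\<^esub> (e a \<oplus>\<^bsub>F\<^esub> e b) | a b. a \<in> carrier A \<and> b \<in> carrier A} \<union>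
      {e (a \<otimes>\<^bsub>A\<^esub> b) \<ominus>\<^bsub>F\<^esub> (a \<odot>\<^bsub>F\<^esub> e b \<oplus>\<^bsub>F\<^esub> b \<odot>\<^bsub>F\<^esub> e a) | a b. a \<in> carrier A \<and> b \<in> carrier A} \<union>
      {e (c \<odot>\<^bsub>A\<^esub> a) \<ominus>\<^bsub>F\<^esub> alg_map A c \<odot>\<^bsub>F\<^esub> e a | c a. a \<in> carrier A})"

definition kaehler_sub :: "('k::field, 'a, 'z) module_scheme \<Rightarrow> ('a \<Rightarrow> 'a) set" where
  "kaehler_sub A = LinearCombinations.module.span A (free_mod A (carrier A)) (kaehler_rels A)"

definition kaehler :: "('k::field, 'a, 'z) module_scheme \<Rightarrow> ('a, ('a \<Rightarrow> 'a) set) module" where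
  "kaehler A = quot_mod (free_mod A (carrier A)) (kaehler_sub A)"

definition kd :: "('k::field, 'a, 'z) module_scheme \<Rightarrow> 'a \<Rightarrow> ('a \<Rightarrow> 'a) set" where
  "kd A a = kaehler_sub A +>\<^bsub>free_mod A (carrier A)\<^esub> free_gen A a"

definition kaehler_K :: "('k::field, 'a, 'z) module_scheme \<Rightarrow> ('k, ('a \<Rightarrow> 'a) set) module" where
  "kaehler_K A = restrict_scalars (alg_map A) (kaehler A)"

text \<open>The grading of \<open>\<Omega>\<^sup>1\<close> with \<open>deg (df) = deg f\<close> for homogeneous \<open>f\<close>.\<close>

definition kaehler_grade ::
    "('k::field, 'a, 'z) module_scheme \<Rightarrow> (int \<Rightarrow> 'a set) \<Rightarrow> int \<Rightarrow> ('a \<Rightarrow> 'a) set set" where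
  "kaehler_grade A G i = LinearCombinations.module.span base_field (kaehler_K A)
     {f \<odot>\<^bsub>kaehler A\<^esub> kd A g | f g j k. f \<in> G j \<and> g \<in> G k \<and> j + k = i}"

text \<open>
  The map induced by an algebra homomorphism \<open>\<phi> : A \<rightarrow> B\<close>: an element of \<open>\<Omega>\<^sup>1\<close> of \<open>A\<close> is the class of
  a formal sum \<open>\<Sum> w(a) da\<close>, and it is sent to \<open>\<Sum> \<phi>(w(a)) d\<phi>(a)\<close>.
\<close>

definition kaehler_map ::
    "('k::field, 'a, 'y) module_scheme \<Rightarrow> ('k, 'b, 'z) module_scheme \<Rightarrow> ('a \<Rightarrow> 'b)
      \<Rightarrow> ('a \<Rightarrow> 'a) set \<Rightarrow> ('b \<Rightarrow> 'b) set" where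
  "kaehler_map A B \<phi> X = the_elem ((\<lambda>w.
     \<Oplus>\<^bsub>kaehler B\<^esub>a \<in> {a \<in> carrier A. w a \<noteq> \<zero>\<^bsub>A\<^esub>}. \<phi> (w a) \<odot>\<^bsub>kaehler B\<^esub> kd B (\<phi> a)) ` X)"

section \<open>Graded objects\<close>

definition graded_alg_hom ::
    "('k::field, 'a, 'y) module_scheme \<Rightarrow> (int \<Rightarrow> 'a set) \<Rightarrow>
     ('k, 'b, 'z) module_scheme \<Rightarrow> (int \<Rightarrow> 'b set) \<Rightarrow> ('a \<Rightarrow> 'b) \<Rightarrow> bool" where
  "graded_alg_hom A G B H f \<longleftrightarrow> f \<in> Ring.ring_hom A B \<and>
     (\<forall>c. \<forall>a\<in>carrier A. f (c \<odot>\<^bsub>A\<^esub> a) = c \<odot>\<^bsub>B\<^esub> f a) \<and> (\<forall>i. f ` G i \<subseteq> H i)"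

definition graded_alg_iso ::
    "('k::field, 'a, 'y) module_scheme \<Rightarrow> (int \<Rightarrow> 'a set) \<Rightarrow>
     ('k, 'b, 'z) module_scheme \<Rightarrow> (int \<Rightarrow> 'b set) \<Rightarrow> ('a \<Rightarrow> 'b) \<Rightarrow> bool" where
  "graded_alg_iso A G B H f \<longleftrightarrow> graded_alg_hom A G B H f \<and>
     bij_betw f (carrier A) (carrier B) \<and> (\<forall>i. f ` G i = H i)"

definition graded_mod_hom ::
    "('r, 'y) ring_scheme \<Rightarrow> ('r, 'm, 'u) module_scheme \<Rightarrow> (int \<Rightarrow> 'm set) \<Rightarrow>
     ('r, 'n, 'v) module_scheme \<Rightarrow> (int \<Rightarrow> 'n set) \<Rightarrow> ('m \<Rightarrow> 'n) \<Rightarrow> bool" where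
  "graded_mod_hom R M G N H f \<longleftrightarrow> mod_hom R M N f \<and> (\<forall>i. f ` G i \<subseteq> H i)"

definition graded_mod_iso ::
    "('r, 'y) ring_scheme \<Rightarrow> ('r, 'm, 'u) module_scheme \<Rightarrow> (int \<Rightarrow> 'm set) \<Rightarrow>
     ('r, 'n, 'v) module_scheme \<Rightarrow> (int \<Rightarrow> 'n set) \<Rightarrow> ('m \<Rightarrow> 'n) \<Rightarrow> bool" where
  "graded_mod_iso R M G N H f \<longleftrightarrow> graded_mod_hom R M G N H f \<and>
     bij_betw f (carrier M) (carrier N) \<and> (\<forall>i. f ` G i = H i)"

definition hilbert_fun :: "('k::field, 'm, 'z) module_scheme \<Rightarrow> (int \<Rightarrow> 'm set) \<Rightarrow> int \<Rightarrow> nat" where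
  "hilbert_fun V G i = vectorspace.dim base_field (V\<lparr>carrier := G i\<rparr>)"

definition hilbert_const :: "(int \<Rightarrow> nat) \<Rightarrow> nat" where
  "hilbert_const h = (THE c. \<forall>\<^sub>F i in at_top. h i = c)"

definition regularity_index :: "(int \<Rightarrow> nat) \<Rightarrow> int" where
  "regularity_index h = (LEAST i. \<forall>j\<ge>i. h j = hilbert_const h)"

text \<open>Homogeneous non-zerodivisors, and the graded ring of fractions with these denominators.\<close>

definition hom_nzd :: "('a, 'z) ring_scheme \<Rightarrow> (int \<Rightarrow> 'a set) \<Rightarrow> int \<Rightarrow> 'a set" where
  "hom_nzd A G e = {b \<in> G e. b \<in> carrier A \<and> (\<forall>a\<in>carrier A. a \<otimes>\<^bsub>A\<^esub> b = \<zero>\<^bsub>A\<^esub> \<longrightarrow> a = \<zero>\<^bsub>A\<^esub>)}"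

definition hfrac ::
    "('a, 'z) ring_scheme \<Rightarrow> (int \<Rightarrow> 'a set) \<Rightarrow> 'a \<Rightarrow> 'a \<Rightarrow> ('a \<times> 'a) set" where
  "hfrac A G a b = {(c, d). c \<in> carrier A \<and> d \<in> (\<Union>e. hom_nzd A G e) \<and> a \<otimes>\<^bsub>A\<^esub> d = c \<otimes>\<^bsub>A\<^esub> b}"

definition hom_quot ::
    "('k::field, 'a, 'z) module_scheme \<Rightarrow> (int \<Rightarrow> 'a set) \<Rightarrow> ('k, ('a \<times> 'a) set) module" where
  "hom_quot A G = \<lparr>carrier = {hfrac A G a b | a b. a \<in> carrier A \<and> b \<in> (\<Union>e. hom_nzd A G e)},
     mult = (\<lambda>X Y. \<Union>(a, b)\<in>X. \<Union>(c, d)\<in>Y. hfrac A G (a \<otimes>\<^bsub>A\<^esub> c) (b \<otimes>\<^bsub>A\<^esub> d)),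
     one = hfrac A G \<one>\<^bsub>A\<^esub> \<one>\<^bsub>A\<^esub>,
     zero = hfrac A G \<zero>\<^bsub>A\<^esub> \<one>\<^bsub>A\<^esub>,
     add = (\<lambda>X Y. \<Union>(a, b)\<in>X. \<Union>(c, d)\<in>Y. hfrac A G (a \<otimes>\<^bsub>A\<^esub> d \<oplus>\<^bsub>A\<^esub> c \<otimes>\<^bsub>A\<^esub> b) (b \<otimes>\<^bsub>A\<^esub> d)),
     smult = (\<lambda>k X. \<Union>(a, b)\<in>X. hfrac A G (k \<odot>\<^bsub>A\<^esub> a) b)\<rparr>"

definition hom_quot_grade ::
    "('a, 'z) ring_scheme \<Rightarrow> (int \<Rightarrow> 'a set) \<Rightarrow> int \<Rightarrow> ('a \<times> 'a) set set" where
  "hom_quot_grade A G d = {hfrac A G a b | a b e. a \<in> G (e + d) \<and> b \<in> hom_nzd A G e}"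

section \<open>The coordinate rings of a zero-dimensional scheme\<close>

text \<open>
  \<open>P = K[X\<^sub>0,\<dots>,X\<^sub>n]\<close>: the index type is \<open>'n option\<close> with \<open>'n\<close> finite, where \<open>None\<close> stands for \<open>0\<close>
  and the elements of \<open>'n\<close> stand for \<open>1,\<dots>,n\<close>. Hence \<open>n = CARD('n) \<ge> 1\<close> is arbitrary.
\<close>

type_synonym ('n, 'k) mpoly = "('n option \<Rightarrow>\<^sub>0 nat) \<Rightarrow>\<^sub>0 'k"

definition poly_ring :: "('k::field, ('n::finite, 'k) mpoly) module" where
  "poly_ring = \<lparr>carrier = UNIV, mult = (*), one = 1, zero = 0, add = (+),
     smult = (\<lambda>c f. Poly_Mapping.single 0 c * f)\<rparr>"

definition mvar :: "'n option \<Rightarrow> ('n::finite, 'k::field) mpoly" where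
  "mvar v = Poly_Mapping.single (Poly_Mapping.single v 1) 1"

definition homogeneous :: "int \<Rightarrow> ('n::finite, 'k::field) mpoly \<Rightarrow> bool" where
  "homogeneous d f \<longleftrightarrow>
     (\<forall>m\<in>Poly_Mapping.keys f. int (\<Sum>v\<in>UNIV. Poly_Mapping.lookup m v) = d)"

definition homogeneous_ideal :: "('n::finite, 'k::field) mpoly set \<Rightarrow> bool" where
  "homogeneous_ideal I \<longleftrightarrow> ideal I poly_ring \<and>
     genideal poly_ring {f \<in> I. \<exists>d. homogeneous d f} = I"

definition saturated :: "('n::finite, 'k::field) mpoly set \<Rightarrow> bool" where
  "saturated I \<longleftrightarrow> (\<forall>f. (\<exists>N::nat. \<forall>g. homogeneous (int N) g \<longrightarrow> f * g \<in> I) \<longrightarrow> f \<in> I)"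

text \<open>The underlying space of the scheme \<open>Proj (P/I)\<close>.\<close>

definition proj_points :: "('n::finite, 'k::field) mpoly set \<Rightarrow> ('n, 'k) mpoly set set" where
  "proj_points I = {p. primeideal p poly_ring \<and> homogeneous_ideal p \<and> I \<subseteq> p \<and> \<not> range mvar \<subseteq> p}"

text \<open>
  \<open>I\<close> is the saturated homogeneous vanishing ideal of a 0-dimensional subscheme of projective
  \<open>n\<close>-space: its space of points is nonempty and admits no proper specialization.
\<close>

definition zero_dim_scheme :: "('n::finite, 'k::field) mpoly set \<Rightarrow> bool" where
  "zero_dim_scheme I \<longleftrightarrow> homogeneous_ideal I \<and> saturated I \<and> proj_points I \<noteq> {} \<and>
     (\<forall>p\<in>proj_points I. \<forall>q\<in>proj_points I. p \<subseteq> q \<longrightarrow> p = q)"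

definition coord_ring ::
    "('n::finite, 'k::field) mpoly set \<Rightarrow> ('k, ('n, 'k) mpoly set) module" where
  "coord_ring I = quot_mod poly_ring I"

definition coord_grade ::
    "('n::finite, 'k::field) mpoly set \<Rightarrow> int \<Rightarrow> ('n, 'k) mpoly set set" where
  "coord_grade I i = {I +>\<^bsub>poly_ring\<^esub> f | f. homogeneous i f}"

definition xR :: "('n::finite, 'k::field) mpoly set \<Rightarrow> 'n option \<Rightarrow> ('n, 'k) mpoly set" where
  "xR I v = I +>\<^bsub>poly_ring\<^esub> mvar v"

text \<open>\<open>S = R/\<langle>x\<^sub>0 - 1\<rangle>\<close> and the dehomogenization \<open>R \<rightarrow> S\<close>.\<close>

definition deh_ideal ::
    "('n::finite, 'k::field) mpoly set \<Rightarrow> ('n, 'k) mpoly set set" where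
  "deh_ideal I =
     genideal (coord_ring I) {xR I None \<ominus>\<^bsub>coord_ring I\<^esub> \<one>\<^bsub>coord_ring I\<^esub>}"

definition aff_ring ::
    "('n::finite, 'k::field) mpoly set \<Rightarrow> ('k, ('n, 'k) mpoly set set) module" where
  "aff_ring I = quot_mod (coord_ring I) (deh_ideal I)"

definition deh ::
    "('n::finite, 'k::field) mpoly set \<Rightarrow> ('n, 'k) mpoly set \<Rightarrow> ('n, 'k) mpoly set set" where
  "deh I f = deh_ideal I +>\<^bsub>coord_ring I\<^esub> f"

definition scheme_degree :: "('n::finite, 'k::field) mpoly set \<Rightarrow> nat" where
  "scheme_degree I = vectorspace.dim base_field (aff_ring I)"

definition r_index :: "('n::finite, 'k::field) mpoly set \<Rightarrow> int" where
  "r_index I = (LEAST i. \<forall>j\<ge>i. hilbert_fun (coord_ring I) (coord_grade I) j = scheme_degree I)"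

text \<open>The truncated integral closure, as a graded subring of the homogeneous ring of quotients.\<close>

definition tic_ring ::
    "('n::finite, 'k::field) mpoly set
      \<Rightarrow> ('k, (('n, 'k) mpoly set \<times> ('n, 'k) mpoly set) set) module" where
  "tic_ring I = (let Q = hom_quot (coord_ring I) (coord_grade I) in
     Q\<lparr>carrier := generate_ring Q (\<Union>d\<in>{0..}. hom_quot_grade (coord_ring I) (coord_grade I) d)\<rparr>)"

definition tic_grade ::
    "('n::finite, 'k::field) mpoly set \<Rightarrow> int
      \<Rightarrow> (('n, 'k) mpoly set \<times> ('n, 'k) mpoly set) set set" where
  "tic_grade I d = hom_quot_grade (coord_ring I) (coord_grade I) d \<inter> carrier (tic_ring I)"

definition tic_emb ::
    "('n::finite, 'k::field) mpoly set \<Rightarrow> ('n, 'k) mpoly set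
      \<Rightarrow> (('n, 'k) mpoly set \<times> ('n, 'k) mpoly set) set" where
  "tic_emb I f = hfrac (coord_ring I) (coord_grade I) f \<one>\<^bsub>coord_ring I\<^esub>"

text \<open>
  The identification of the truncated integral closure with \<open>S[x\<^sub>0]\<close>; it is determined by the
  displayed formula, where the dehomogenization of \<open>a/b\<close> is \<open>a\<^sup>d\<^sup>e\<^sup>h (b\<^sup>d\<^sup>e\<^sup>h)\<^sup>-\<^sup>1\<close>.
\<close>

definition is_tic_iso ::
    "('n::finite, 'k::field) mpoly set
      \<Rightarrow> ((('n, 'k) mpoly set \<times> ('n, 'k) mpoly set) set \<Rightarrow> nat \<Rightarrow> ('n, 'k) mpoly set set)
      \<Rightarrow> bool" where
  "is_tic_iso I \<psi> \<longleftrightarrow>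
     graded_alg_iso (tic_ring I) (tic_grade I)
       (poly_alg1 (aff_ring I)) (poly_grade (aff_ring I)) \<psi> \<and>
     (\<forall>(d::nat) e. \<forall>a\<in>coord_grade I (e + int d). \<forall>b\<in>hom_nzd (coord_ring I) (coord_grade I) e.
        deh I b \<in> Units (aff_ring I) \<and>
        \<psi> (hfrac (coord_ring I) (coord_grade I) a b) =
          up_ring.monom (UP (aff_ring I))
            (deh I a \<otimes>\<^bsub>aff_ring I\<^esub> inv\<^bsub>aff_ring I\<^esub> deh I b) d)"

section \<open>The modules of differentials of the coordinate rings\<close>

text \<open>\<open>K[x\<^sub>0]\<close> acts through \<open>x\<^sub>0 \<in> R\<close> and through its image in the truncated integral closure.\<close>

definition kaehler_R ::
    "('n::finite, 'k::field) mpoly set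
      \<Rightarrow> (nat \<Rightarrow> 'k, (('n, 'k) mpoly set \<Rightarrow> ('n, 'k) mpoly set) set) module" where
  "kaehler_R I = restrict_scalars (poly_scalar (coord_ring I) (xR I None)) (kaehler (coord_ring I))"

definition kaehler_tic ::
    "('n::finite, 'k::field) mpoly set
      \<Rightarrow> (nat \<Rightarrow> 'k, ((('n, 'k) mpoly set \<times> ('n, 'k) mpoly set) set
                       \<Rightarrow> (('n, 'k) mpoly set \<times> ('n, 'k) mpoly set) set) set) module" where
  "kaehler_tic I =
     restrict_scalars (poly_scalar (tic_ring I) (tic_emb I (xR I None))) (kaehler (tic_ring I))"

abbreviation kaehler_R_grade where
  "kaehler_R_grade I \<equiv> kaehler_grade (coord_ring I) (coord_grade I)"

abbreviation kaehler_tic_grade where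
  "kaehler_tic_grade I \<equiv> kaehler_grade (tic_ring I) (tic_grade I)"

definition Phi ::
    "('n::finite, 'k::field) mpoly set
      \<Rightarrow> (('n, 'k) mpoly set \<Rightarrow> ('n, 'k) mpoly set) set
      \<Rightarrow> ((('n, 'k) mpoly set \<times> ('n, 'k) mpoly set) set
           \<Rightarrow> (('n, 'k) mpoly set \<times> ('n, 'k) mpoly set) set) set" where
  "Phi I = kaehler_map (coord_ring I) (tic_ring I) (tic_emb I)"

text \<open>
  \<open>S[x\<^sub>0]dx\<^sub>0 \<oplus> K[x\<^sub>0] \<otimes>\<^sub>K \<Omega>\<^sup>1\<close> (with \<open>\<Omega>\<^sup>1\<close> that of \<open>S\<close>) as a graded \<open>K[x\<^sub>0]\<close>-module; the pair
  \<open>(p, t)\<close> stands for \<open>p dx\<^sub>0 + t\<close>, where \<open>dx\<^sub>0\<close> has degree \<open>1\<close> and \<open>\<Omega>\<^sup>1\<close> has degree \<open>0\<close>.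
\<close>

definition split_mod ::
    "('n::finite, 'k::field) mpoly set
      \<Rightarrow> (nat \<Rightarrow> 'k, (nat \<Rightarrow> ('n, 'k) mpoly set set) \<times>
           ((('n, 'k) mpoly set set \<Rightarrow> ('n, 'k) mpoly set set) set \<Rightarrow> nat \<Rightarrow> 'k) set) module" where
  "split_mod I =
     direct_sum
       (alg_via (poly_scalar (poly_alg1 (aff_ring I))
                  (up_ring.monom (UP (aff_ring I)) \<one>\<^bsub>aff_ring I\<^esub> 1))
         (poly_alg1 (aff_ring I)))
       (base_change Kx0 (kaehler_K (aff_ring I)))"

definition x0_tensor ::
    "('n::finite, 'k::field) mpoly set \<Rightarrow> nat
      \<Rightarrow> (('n, 'k) mpoly set set \<Rightarrow> ('n, 'k) mpoly set set) set
      \<Rightarrow> ((('n, 'k) mpoly set set \<Rightarrow> ('n, 'k) mpoly set set) set \<Rightarrow> nat \<Rightarrow> 'k) set" where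
  "x0_tensor I k w = tensor Kx0 (kaehler_K (aff_ring I)) (up_ring.monom Kx0 1 k) w"

definition split_grade ::
    "('n::finite, 'k::field) mpoly set \<Rightarrow> int
      \<Rightarrow> ((nat \<Rightarrow> ('n, 'k) mpoly set set) \<times>
           ((('n, 'k) mpoly set set \<Rightarrow> ('n, 'k) mpoly set set) set \<Rightarrow> nat \<Rightarrow> 'k) set) set" where
  "split_grade I i = poly_grade (aff_ring I) (i - 1) \<times>
     (if i < 0 then {\<zero>\<^bsub>base_change Kx0 (kaehler_K (aff_ring I))\<^esub>}
      else {x0_tensor I (nat i) w | w. w \<in> carrier (kaehler (aff_ring I))})"

text \<open>
  The identification of the differentials of the truncated integral closure with this module,
  relative to the identification \<open>\<psi>\<close> of the ring itself with \<open>S[x\<^sub>0]\<close>: it sends \<open>p dx\<^sub>0\<close> to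
  \<open>(p, 0)\<close> and, for \<open>s, t \<in> S\<close>, \<open>s x\<^sub>0\<^sup>k dt\<close> to \<open>(0, x\<^sub>0\<^sup>k \<otimes> s dt)\<close>. These elements generate, so it
  is determined by \<open>\<psi>\<close>.
\<close>

definition is_split_iso ::
    "('n::finite, 'k::field) mpoly set
      \<Rightarrow> ((('n, 'k) mpoly set \<times> ('n, 'k) mpoly set) set \<Rightarrow> nat \<Rightarrow> ('n, 'k) mpoly set set)
      \<Rightarrow> (((('n, 'k) mpoly set \<times> ('n, 'k) mpoly set) set
             \<Rightarrow> (('n, 'k) mpoly set \<times> ('n, 'k) mpoly set) set) set
           \<Rightarrow> (nat \<Rightarrow> ('n, 'k) mpoly set set) \<times>
             ((('n, 'k) mpoly set set \<Rightarrow> ('n, 'k) mpoly set set) set \<Rightarrow> nat \<Rightarrow> 'k) set)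
      \<Rightarrow> bool" where
  "is_split_iso I \<psi> \<Theta> \<longleftrightarrow>
     graded_mod_iso Kx0 (kaehler_tic I) (kaehler_tic_grade I) (split_mod I) (split_grade I) \<Theta> \<and>
     (\<forall>p\<in>carrier (tic_ring I).
        \<Theta> (p \<odot>\<^bsub>kaehler (tic_ring I)\<^esub> kd (tic_ring I) (tic_emb I (xR I None))) =
          (\<psi> p, \<zero>\<^bsub>base_change Kx0 (kaehler_K (aff_ring I))\<^esub>)) \<and>
     (\<forall>p\<in>carrier (tic_ring I). \<forall>q\<in>carrier (tic_ring I).
      \<forall>s\<in>carrier (aff_ring I). \<forall>t\<in>carrier (aff_ring I). \<forall>k.
        \<psi> p = up_ring.monom (UP (aff_ring I)) s k \<longrightarrow>
        \<psi> q = up_ring.monom (UP (aff_ring I)) t 0 \<longrightarrow>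
        \<Theta> (p \<odot>\<^bsub>kaehler (tic_ring I)\<^esub> kd (tic_ring I) q) =
          (\<zero>\<^bsub>UP (aff_ring I)\<^esub>,
           x0_tensor I k (s \<odot>\<^bsub>kaehler (aff_ring I)\<^esub> kd (aff_ring I) t)))"

definition torsion_R ::
    "('n::finite, 'k::field) mpoly set \<Rightarrow> (('n, 'k) mpoly set \<Rightarrow> ('n, 'k) mpoly set) set set" where
  "torsion_R I = {w \<in> carrier (kaehler (coord_ring I)).
     \<exists>r \<in> (\<Union>e. hom_nzd (coord_ring I) (coord_grade I) e).
       r \<odot>\<^bsub>kaehler (coord_ring I)\<^esub> w = \<zero>\<^bsub>kaehler (coord_ring I)\<^esub>}"

end

theory Submission
  imports Defs "Jordan_Normal_Form.DL_Rank"
begin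

text \<open>
  Sending a homogeneous \<open>f\<close> of degree \<open>k\<close> to \<open>f\<^sup>d\<^sup>e\<^sup>h x\<^sub>0\<^sup>k\<close> embeds \<open>R\<close> into \<open>S[x\<^sub>0]\<close>, and this is bijective
  in the degrees from \<open>r\<close> on. There the inverse \<open>lft\<close> provides homogeneous lifts of the elements of
  \<open>S\<close>. In degree \<open>n \<ge> 2 r + 1\<close> the map \<open>\<Phi>\<close> is inverted by sending \<open>x\<^sub>0\<^sup>n s dt\<close> to
  \<open>lft s d(lft t) - r lft(st) dx\<^sub>0\<close>, with \<open>t\<close> lifted to degree \<open>r\<close> and \<open>s\<close> to degree \<open>n - r\<close>: the room of
  \<open>r\<close> degrees on either side is what makes this satisfy the Leibniz rule and bilinearity, hence be well
  defined on the differentials of \<open>S\<close>. The Hilbert polynomial and the regularity bound follow. For the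
  torsion, multiplication by \<open>x\<^sub>0\<^bsup>2r+1\<^esup>\<close> moves an element of the kernel of \<open>\<Phi>\<close> into the degrees where
  \<open>\<Phi>\<close> is injective; conversely a homogeneous non-zerodivisor becomes a unit times a power of \<open>x\<^sub>0\<close> in
  \<open>S[x\<^sub>0]\<close>, and \<open>x\<^sub>0\<close> is injective on the differentials of \<open>S[x\<^sub>0]\<close>.

  That dehomogenization has these properties comes from the absence of points on \<open>x\<^sub>0 = 0\<close>: a homogeneous
  ideal that contains \<open>I\<close> and \<open>x\<^sub>0\<close> lies in no homogeneous prime but the irrelevant ones, hence contains
  all polynomials of large degree.
\<close>

section \<open>Additive maps and finitely supported functions\<close>

text \<open>The inverse in degree n has values in the differentials of \<open>R\<close>, and
  \<open>S\<close> does not act on these. So the universal property cannot be applied to derivations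
  into an \<open>S\<close>-module; it is needed for biadditive maps \<beta>(a, b), standing for a
  db, into a mere abelian group, with the Leibniz rule in the form \<beta>(a, bc) = \<beta>(ab, c) +
  \<beta>(ac, b). The multiple of dx_0 originates in d(x_0^a t) = x_0^a dt + a t x_0^(a-1) dx_0:
  subtracting the second summand makes the result independent of the degree a in which t is
  represented. The constant 2r+1 comes from the Leibniz rule for a factor of degree one: its product
  with t in degree r lies in degree r+1, which leaves n-r-1 for s, and lifts are guaranteed only
  from degree r on. General factors follow because the elements satisfying the rule form a
  subalgebra of \<open>S\<close>. Identities between additive maps are checked on generators
  throughout; \<open>asum\<close>, the closure under finite sums, allows this even when the modules
  involved have different rings of scalars.\<close>

inductive_set asum :: "('m, 'z) ring_scheme \<Rightarrow> 'm set \<Rightarrow> 'm set" for M B where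
  asum_zero: "\<zero>\<^bsub>M\<^esub> \<in> asum M B"
| asum_base: "b \<in> B \<Longrightarrow> b \<in> asum M B"
| asum_add: "x \<in> asum M B \<Longrightarrow> y \<in> asum M B \<Longrightarrow> x \<oplus>\<^bsub>M\<^esub> y \<in> asum M B"

lemma asum_subset:
  assumes "abelian_monoid M" "B \<subseteq> carrier M" shows "asum M B \<subseteq> carrier M"
proof
  interpret abelian_monoid M by fact
  fix x assume "x \<in> asum M B" then show "x \<in> carrier M"
    by (induction) (use assms in auto)
qed

lemma asum_mono: "asum M B \<subseteq> asum M C" if "B \<subseteq> asum M C"
proof
  fix x assume "x \<in> asum M B" then show "x \<in> asum M C"
    by induction (use that in \<open>auto intro: asum.intros\<close>)
qed

lemma asum_finsum:
  assumes "abelian_monoid M" "B \<subseteq> carrier M" "finite J" "\<And>j. j \<in> J \<Longrightarrow> f j \<in> asum M B"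
  shows "finsum M f J \<in> asum M B"
proof -
  interpret abelian_monoid M by fact
  have sub: "asum M B \<subseteq> carrier M" by (rule asum_subset) fact+
  show ?thesis using assms(3,4)
  proof (induction J)
    case empty then show ?case by (simp add: asum_zero)
  next
    case (insert j J)
    then have "finsum M f (insert j J) = f j \<oplus>\<^bsub>M\<^esub> finsum M f J"
      using sub by (intro finsum_insert) auto
    then show ?case using insert by (auto intro: asum_add)
  qed
qed

text \<open>Only additivity is recorded: the maps below connect modules over different rings
  (\<open>R\<close>, \<open>S\<close>, polynomial and fraction rings), and compatibility with
  scalars is proved separately wherever it is meant.\<close>

definition add_hom :: "('m, 'y) ring_scheme \<Rightarrow> ('n, 'z) ring_scheme \<Rightarrow> ('m \<Rightarrow> 'n) \<Rightarrow> bool" where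
  "add_hom M N f \<longleftrightarrow> f \<in> carrier M \<rightarrow> carrier N \<and>
     (\<forall>x\<in>carrier M. \<forall>y\<in>carrier M. f (x \<oplus>\<^bsub>M\<^esub> y) = f x \<oplus>\<^bsub>N\<^esub> f y)"

lemma add_homI:
  "(\<And>x. x \<in> carrier M \<Longrightarrow> f x \<in> carrier N) \<Longrightarrow>
   (\<And>x y. x \<in> carrier M \<Longrightarrow> y \<in> carrier M \<Longrightarrow> f (x \<oplus>\<^bsub>M\<^esub> y) = f x \<oplus>\<^bsub>N\<^esub> f y) \<Longrightarrow> add_hom M N f"
  by (auto simp: add_hom_def)

lemma add_hom_closed: "add_hom M N f \<Longrightarrow> x \<in> carrier M \<Longrightarrow> f x \<in> carrier N"
  by (auto simp: add_hom_def)

lemma add_hom_add: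
  "add_hom M N f \<Longrightarrow> x \<in> carrier M \<Longrightarrow> y \<in> carrier M \<Longrightarrow> f (x \<oplus>\<^bsub>M\<^esub> y) = f x \<oplus>\<^bsub>N\<^esub> f y"
  by (auto simp: add_hom_def)

lemma add_hom_zero:
  assumes "add_hom M N f" "abelian_group M" "abelian_group N" shows "f \<zero>\<^bsub>M\<^esub> = \<zero>\<^bsub>N\<^esub>"
proof -
  interpret M: abelian_group M by fact
  interpret N: abelian_group N by fact
  have "f \<zero>\<^bsub>M\<^esub> \<oplus>\<^bsub>N\<^esub> f \<zero>\<^bsub>M\<^esub> = f \<zero>\<^bsub>M\<^esub>"
    using add_hom_add[OF assms(1), of "\<zero>\<^bsub>M\<^esub>" "\<zero>\<^bsub>M\<^esub>"] by simp
  then show ?thesis using add_hom_closed[OF assms(1), of "\<zero>\<^bsub>M\<^esub>"] by simp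
qed

lemma add_hom_neg:
  assumes "add_hom M N f" "abelian_group M" "abelian_group N" "x \<in> carrier M"
  shows "f (\<ominus>\<^bsub>M\<^esub> x) = \<ominus>\<^bsub>N\<^esub> f x"
proof -
  interpret M: abelian_group M by fact
  interpret N: abelian_group N by fact
  have "f (\<ominus>\<^bsub>M\<^esub> x) \<oplus>\<^bsub>N\<^esub> f x = \<zero>\<^bsub>N\<^esub>"
    using add_hom_add[OF assms(1), of "\<ominus>\<^bsub>M\<^esub> x" x] assms(4) add_hom_zero[OF assms(1-3)]
    by (simp add: M.l_neg)
  then show ?thesis
    using add_hom_closed[OF assms(1)] assms(4) by (metis M.a_inv_closed N.minus_equality)
qed

lemma add_hom_minus:
  assumes "add_hom M N f" "abelian_group M" "abelian_group N" "x \<in> carrier M" "y \<in> carrier M"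
  shows "f (x \<ominus>\<^bsub>M\<^esub> y) = f x \<ominus>\<^bsub>N\<^esub> f y"
  using add_hom_add[OF assms(1), of x "\<ominus>\<^bsub>M\<^esub> y"] add_hom_neg[OF assms(1-3)] assms
  by (simp add: a_minus_def abelian_group.a_inv_closed)

text \<open>The proof principle behind most identities below: a carrier is known to be the
  \<open>asum\<close> of simple elements (monomials, products a db, homogeneous elements), and two
  additive maps are compared there.\<close>

lemma add_hom_eqI:
  assumes "add_hom M N f" "add_hom M N g" "abelian_group M" "abelian_group N" "B \<subseteq> carrier M"
    "\<And>b. b \<in> B \<Longrightarrow> f b = g b" "x \<in> asum M B"
  shows "f x = g x"
proof -
  interpret M: abelian_group M by fact
  have "asum M B \<subseteq> carrier M" by (rule asum_subset) (fact M.abelian_monoid_axioms assms)+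
  from assms(7) this show ?thesis
    by (induction) (auto simp: assms(6) add_hom_zero[OF assms(1,3,4)] add_hom_zero[OF assms(2,3,4)]
        add_hom_add[OF assms(1)] add_hom_add[OF assms(2)] subset_iff)
qed

lemma add_hom_comp: "add_hom M N f \<Longrightarrow> add_hom N L g \<Longrightarrow> add_hom M L (\<lambda>x. g (f x))"
  by (auto simp: add_hom_def Pi_iff)

lemma add_hom_sum:
  assumes "add_hom M N f" "add_hom M N g" "abelian_group N"
  shows "add_hom M N (\<lambda>x. f x \<oplus>\<^bsub>N\<^esub> g x)"
proof -
  interpret N: abelian_group N by fact
  show ?thesis using assms(1,2) by (auto simp: add_hom_def Pi_iff N.a_ac)
qed

lemma add_hom_finsum:
  assumes "add_hom M N f" "abelian_group M" "abelian_group N" "finite J" "h \<in> J \<rightarrow> carrier M"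
  shows "f (finsum M h J) = finsum N (\<lambda>j. f (h j)) J"
proof -
  interpret M: abelian_group M by fact
  interpret N: abelian_group N by fact
  show ?thesis using assms(4,5)
  proof (induction J)
    case empty then show ?case by (simp add: add_hom_zero[OF assms(1-3)])
  next
    case (insert j J)
    have "(\<lambda>j. f (h j)) \<in> insert j J \<rightarrow> carrier N"
      using insert.prems add_hom_closed[OF assms(1)] by fastforce
    then show ?case using insert add_hom_add[OF assms(1)]
      by (auto simp: Pi_iff)
  qed
qed

definition fsupp :: "('a, 'z) ring_scheme \<Rightarrow> 'x set \<Rightarrow> ('x \<Rightarrow> 'a) set" where
  "fsupp A X = {w. (\<forall>x\<in>X. w x \<in> carrier A) \<and> (\<forall>x. x \<notin> X \<longrightarrow> w x = \<zero>\<^bsub>A\<^esub>) \<and> finite {x. w x \<noteq> \<zero>\<^bsub>A\<^esub>}}"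

text \<open>The additive extension of (a, x) \<mapsto> \<beta> a x to finitely supported functions.
  It serves for maps out of free modules, out of polynomials and out of coefficient sequences alike;
  \<beta> only has to be additive in a, so no ring needs to act on \<open>H\<close>.\<close>

definition suml :: "('a, 'z) ring_scheme \<Rightarrow> ('h, 'y) ring_scheme \<Rightarrow> 'x set \<Rightarrow> ('a \<Rightarrow> 'x \<Rightarrow> 'h)
    \<Rightarrow> ('x \<Rightarrow> 'a) \<Rightarrow> 'h" where
  "suml A H X \<beta> w = (\<Oplus>\<^bsub>H\<^esub>x \<in> {x \<in> X. w x \<noteq> \<zero>\<^bsub>A\<^esub>}. \<beta> (w x) x)"

locale suml_loc = A: abelian_group A + H: abelian_group H
  for A :: "('a, 'y) ring_scheme" and H :: "('h, 'z) ring_scheme" +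
  fixes X :: "'x set" and \<beta> :: "'a \<Rightarrow> 'x \<Rightarrow> 'h"
  assumes \<beta>_add: "\<And>x. x \<in> X \<Longrightarrow> add_hom A H (\<lambda>a. \<beta> a x)"
begin

lemma \<beta>_zero: "x \<in> X \<Longrightarrow> \<beta> \<zero>\<^bsub>A\<^esub> x = \<zero>\<^bsub>H\<^esub>"
  using add_hom_zero[OF \<beta>_add A.abelian_group_axioms H.abelian_group_axioms] .

lemma \<beta>_closed: "x \<in> X \<Longrightarrow> a \<in> carrier A \<Longrightarrow> \<beta> a x \<in> carrier H"
  using add_hom_closed[OF \<beta>_add] .

text \<open>The support of a sum may shrink by cancellation, so additivity is shown after moving all
  sums to a common finite index set. The padding is harmless because \<beta> vanishes at
  zero.\<close>

lemma suml_superset: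
  assumes "w \<in> fsupp A X" "finite U" "{x \<in> X. w x \<noteq> \<zero>\<^bsub>A\<^esub>} \<subseteq> U" "U \<subseteq> X"
  shows "suml A H X \<beta> w = (\<Oplus>\<^bsub>H\<^esub>x \<in> U. \<beta> (w x) x)"
  unfolding suml_def
  by (rule H.add.finprod_mono_neutral_cong_left)
     (use assms in \<open>auto simp: fsupp_def intro!: \<beta>_zero \<beta>_closed\<close>)

lemma suml_closed: "w \<in> fsupp A X \<Longrightarrow> suml A H X \<beta> w \<in> carrier H"
  unfolding suml_def by (intro H.finsum_closed) (auto simp: fsupp_def intro!: \<beta>_closed)

lemma fsupp_add: "v \<in> fsupp A X \<Longrightarrow> w \<in> fsupp A X \<Longrightarrow> (\<lambda>x. v x \<oplus>\<^bsub>A\<^esub> w x) \<in> fsupp A X"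
  by (auto simp: fsupp_def intro: rev_finite_subset[of "{x. v x \<noteq> \<zero>\<^bsub>A\<^esub>} \<union> {x. w x \<noteq> \<zero>\<^bsub>A\<^esub>}"])

lemma suml_add:
  assumes "v \<in> fsupp A X" "w \<in> fsupp A X"
  shows "suml A H X \<beta> (\<lambda>x. v x \<oplus>\<^bsub>A\<^esub> w x) = suml A H X \<beta> v \<oplus>\<^bsub>H\<^esub> suml A H X \<beta> w"
proof -
  let ?U = "{x \<in> X. v x \<noteq> \<zero>\<^bsub>A\<^esub>} \<union> {x \<in> X. w x \<noteq> \<zero>\<^bsub>A\<^esub>}"
  have fin: "finite ?U" using assms by (auto simp: fsupp_def)
  have "suml A H X \<beta> (\<lambda>x. v x \<oplus>\<^bsub>A\<^esub> w x) = (\<Oplus>\<^bsub>H\<^esub>x \<in> ?U. \<beta> (v x \<oplus>\<^bsub>A\<^esub> w x) x)"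
    by (rule suml_superset[OF fsupp_add[OF assms] fin]) auto
  also have "\<dots> = (\<Oplus>\<^bsub>H\<^esub>x \<in> ?U. \<beta> (v x) x \<oplus>\<^bsub>H\<^esub> \<beta> (w x) x)"
    using assms by (intro H.finsum_cong') (auto simp: fsupp_def add_hom_add[OF \<beta>_add] intro!: \<beta>_closed)
  also have "\<dots> = (\<Oplus>\<^bsub>H\<^esub>x \<in> ?U. \<beta> (v x) x) \<oplus>\<^bsub>H\<^esub> (\<Oplus>\<^bsub>H\<^esub>x \<in> ?U. \<beta> (w x) x)"
    using assms by (intro H.finsum_addf) (auto simp: fsupp_def intro!: \<beta>_closed)
  also have "\<dots> = suml A H X \<beta> v \<oplus>\<^bsub>H\<^esub> suml A H X \<beta> w"
    using suml_superset[OF assms(1) fin] suml_superset[OF assms(2) fin] by auto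
  finally show ?thesis .
qed

lemma suml_single:
  assumes "x \<in> X" "a \<in> carrier A"
  shows "suml A H X \<beta> (\<lambda>y. if y = x then a else \<zero>\<^bsub>A\<^esub>) = \<beta> a x"
proof -
  have w: "(\<lambda>y. if y = x then a else \<zero>\<^bsub>A\<^esub>) \<in> fsupp A X"
    using assms by (auto simp: fsupp_def)
  have "suml A H X \<beta> (\<lambda>y. if y = x then a else \<zero>\<^bsub>A\<^esub>) = (\<Oplus>\<^bsub>H\<^esub>y \<in> {x}. \<beta> (if y = x then a else \<zero>\<^bsub>A\<^esub>) y)"
    by (rule suml_superset[OF w]) (use assms in \<open>auto split: if_splits\<close>)
  then show ?thesis using assms \<beta>_closed by auto
qed

end

lemma suml_fun_add:
  assumes "abelian_group A" "abelian_group H" "w \<in> fsupp A X"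
    "\<And>x a. x \<in> X \<Longrightarrow> a \<in> carrier A \<Longrightarrow> \<beta> a x \<in> carrier H"
    "\<And>x a. x \<in> X \<Longrightarrow> a \<in> carrier A \<Longrightarrow> \<gamma> a x \<in> carrier H"
  shows "suml A H X (\<lambda>a x. \<beta> a x \<oplus>\<^bsub>H\<^esub> \<gamma> a x) w = suml A H X \<beta> w \<oplus>\<^bsub>H\<^esub> suml A H X \<gamma> w"
proof -
  interpret H: abelian_group H by fact
  show ?thesis unfolding suml_def
    using assms(3-5) by (intro H.finsum_addf) (auto simp: fsupp_def)
qed

lemma suml_cong:
  assumes "abelian_group H" "w \<in> fsupp A X"
    "\<And>x a. x \<in> X \<Longrightarrow> a \<in> carrier A \<Longrightarrow> \<beta> a x = \<gamma> a x"
    "\<And>x a. x \<in> X \<Longrightarrow> a \<in> carrier A \<Longrightarrow> \<gamma> a x \<in> carrier H"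
  shows "suml A H X \<beta> w = suml A H X \<gamma> w"
proof -
  interpret H: abelian_group H by fact
  show ?thesis unfolding suml_def
    using assms(2-4) by (intro H.finsum_cong') (auto simp: fsupp_def)
qed

text \<open>The induction runs over a finite set that contains the support: the value at one point
  is split off, and the remainder is supported on the smaller set. A point outside \<open>X\<close>
  carries the value zero and is simply dropped.\<close>

lemma fsupp_induct [consumes 2, case_names zero single add]:
  assumes "abelian_group A" "w \<in> fsupp A X"
    and "P (\<lambda>x. \<zero>\<^bsub>A\<^esub>)"
    and "\<And>x a. x \<in> X \<Longrightarrow> a \<in> carrier A \<Longrightarrow> P (\<lambda>y. if y = x then a else \<zero>\<^bsub>A\<^esub>)"
    and "\<And>v w. v \<in> fsupp A X \<Longrightarrow> w \<in> fsupp A X \<Longrightarrow> P v \<Longrightarrow> P w \<Longrightarrow> P (\<lambda>x. v x \<oplus>\<^bsub>A\<^esub> w x)"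
  shows "P w"
proof -
  interpret A: abelian_group A by fact
  have "\<And>w. w \<in> fsupp A X \<Longrightarrow> {x. w x \<noteq> \<zero>\<^bsub>A\<^esub>} \<subseteq> U \<Longrightarrow> P w" if "finite U" for U
    using that
  proof (induction U)
    case empty
    then have "w = (\<lambda>x. \<zero>\<^bsub>A\<^esub>)" by auto
    then show ?case using assms(3) by simp
  next
    case (insert u U)
    show ?case
    proof (cases "u \<in> X")
      case False
      then have "{x. w x \<noteq> \<zero>\<^bsub>A\<^esub>} \<subseteq> U" using insert.prems by (auto simp: fsupp_def)
      then show ?thesis using insert by blast
    next
      case True
      let ?v = "w(u := \<zero>\<^bsub>A\<^esub>)" and ?s = "\<lambda>y. if y = u then w u else \<zero>\<^bsub>A\<^esub>"
      have wc: "w x \<in> carrier A" for x using insert.prems by (cases "x \<in> X") (auto simp: fsupp_def)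
      have v: "?v \<in> fsupp A X" using insert.prems True
        by (auto simp: fsupp_def intro: rev_finite_subset[of "{x. w x \<noteq> \<zero>\<^bsub>A\<^esub>}"])
      have s: "?s \<in> fsupp A X" using insert.prems True by (auto simp: fsupp_def)
      have eq: "w = (\<lambda>x. ?s x \<oplus>\<^bsub>A\<^esub> ?v x)" using wc by auto
      have "P ?v" by (rule insert.IH[OF v]) (use insert.prems in auto)
      moreover have "P ?s" using assms(4)[OF True wc] .
      ultimately show ?thesis using assms(5)[OF s v] eq by metis
    qed
  qed
  then show ?thesis using assms(2) by (auto simp: fsupp_def)
qed

section \<open>Quotients and modules given by generators and relations\<close>

lemma free_mod_simps:
  "carrier (free_mod A X) = fsupp A X" "\<zero>\<^bsub>free_mod A X\<^esub> = (\<lambda>x. \<zero>\<^bsub>A\<^esub>)"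
  "add (free_mod A X) = (\<lambda>v w x. v x \<oplus>\<^bsub>A\<^esub> w x)" "smult (free_mod A X) = (\<lambda>a w x. a \<otimes>\<^bsub>A\<^esub> w x)"
  by (simp_all add: free_mod_def fsupp_def)

lemma module_free_mod: assumes "cring A" shows "Module.module A (free_mod A X)"
proof -
  interpret A: cring A by fact
  interpret suml_loc A A X "\<lambda>a x. \<zero>\<^bsub>A\<^esub>"
    by unfold_locales (auto simp: add_hom_def)
  have car: "w x \<in> carrier A" if "w \<in> fsupp A X" for w x
    using that by (cases "x \<in> X") (auto simp: fsupp_def)
  show ?thesis
  proof (intro module_criteria assms)
    show "\<forall>v\<in>carrier (free_mod A X). \<exists>neg_v\<in>carrier (free_mod A X).
        v \<oplus>\<^bsub>free_mod A X\<^esub> neg_v = \<zero>\<^bsub>free_mod A X\<^esub>"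
    proof
      fix v assume v: "v \<in> carrier (free_mod A X)"
      then have vc: "\<And>x. v x \<in> carrier A" using car by (auto simp: free_mod_simps)
      have "(\<lambda>x. \<ominus>\<^bsub>A\<^esub> v x) \<in> fsupp A X"
        using v by (auto simp: free_mod_simps fsupp_def intro: rev_finite_subset[of "{x. v x \<noteq> \<zero>\<^bsub>A\<^esub>}"])
      then show "\<exists>neg_v\<in>carrier (free_mod A X). v \<oplus>\<^bsub>free_mod A X\<^esub> neg_v = \<zero>\<^bsub>free_mod A X\<^esub>"
        using vc by (intro bexI[of _ "\<lambda>x. \<ominus>\<^bsub>A\<^esub> v x"]) (auto simp: free_mod_simps A.r_neg)
    qed
    show "\<zero>\<^bsub>free_mod A X\<^esub> \<in> carrier (free_mod A X)" by (auto simp: free_mod_simps fsupp_def)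
    have "(\<lambda>x. c \<otimes>\<^bsub>A\<^esub> v x) \<in> fsupp A X" if "c \<in> carrier A" "v \<in> fsupp A X" for c v
      using that by (auto simp: fsupp_def intro: rev_finite_subset[of "{x. v x \<noteq> \<zero>\<^bsub>A\<^esub>}"])
    then show "\<forall>c v. c \<in> carrier A \<and> v \<in> carrier (free_mod A X) \<longrightarrow> c \<odot>\<^bsub>free_mod A X\<^esub> v \<in> carrier (free_mod A X)"
      by (auto simp: free_mod_simps)
  qed (auto simp: free_mod_simps fsupp_add car A.a_ac A.l_distr A.r_distr A.m_assoc intro!: ext)
qed

lemma abelian_group_minus_zero: "abelian_group M \<Longrightarrow> \<ominus>\<^bsub>M\<^esub> \<zero>\<^bsub>M\<^esub> = \<zero>\<^bsub>M\<^esub>"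
  by (metis abelian_group.a_inv_closed abelian_group.r_neg abelian_group_def abelian_monoid.l_zero
      abelian_monoid.zero_closed)

lemma abelian_group_minus_eq_zero:
  assumes "abelian_group M" "x \<in> carrier M" "y \<in> carrier M"
  shows "x \<ominus>\<^bsub>M\<^esub> y = \<zero>\<^bsub>M\<^esub> \<longleftrightarrow> x = y"
proof -
  interpret abelian_group M by fact
  show ?thesis
  proof
    assume "x \<ominus>\<^bsub>M\<^esub> y = \<zero>\<^bsub>M\<^esub>"
    then have "\<ominus>\<^bsub>M\<^esub> (\<ominus>\<^bsub>M\<^esub> y) = x" using assms(2,3) by (intro minus_equality) (auto simp: a_minus_def)
    then show "x = y" using assms(3) by simp
  next
    assume "x = y" then show "x \<ominus>\<^bsub>M\<^esub> y = \<zero>\<^bsub>M\<^esub>" using assms(3) by (simp add: a_minus_def r_neg)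
  qed
qed

text \<open>Negatives are multiples by \<ominus>\<one>. With this, the cosets of a submodule fall
  under the theory of abelian subgroups.\<close>

lemma submodule_abelian_subgroup:
  assumes "Module.module A F" "LinearCombinations.submodule A N F"
  shows "abelian_subgroup N F"
proof -
  interpret F: Module.module A F by fact
  interpret N: LinearCombinations.submodule A N F by fact
  have "\<ominus>\<^bsub>F\<^esub> x \<in> N" if "x \<in> N" for x
    using N.smult_closed[OF F.R.a_inv_closed[OF F.R.one_closed] that] F.smult_minus_1[of x] that N.subset
    by (metis subsetD)
  then have "subgroup N (add_monoid F)"
    using N.subset N.m_closed N.zero_closed
    by (intro subgroup.intro) (auto simp: a_inv_def[symmetric])
  then show ?thesis
    by (intro abelian_subgroupI3 additive_subgroup.intro F.abelian_group_axioms)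
qed

locale quotient_module = F: Module.module A F
  for A :: "('a, 'y) ring_scheme" and F :: "('a, 'f, 'z) module_scheme" +
  fixes N :: "'f set"
  assumes submod: "LinearCombinations.submodule A N F"
begin

interpretation N: abelian_subgroup N F
  by (rule submodule_abelian_subgroup) (fact F.module_axioms submod)+

lemma quot_eq_iff:
  assumes "x \<in> carrier F" "y \<in> carrier F"
  shows "N +>\<^bsub>F\<^esub> x = N +>\<^bsub>F\<^esub> y \<longleftrightarrow> x \<ominus>\<^bsub>F\<^esub> y \<in> N"
  using assms N.a_rcos_module[of y x] N.a_rcos_self[of x] N.a_repr_independence'[of x y]
  by (auto simp: a_minus_def)

lemma quot_carrier: "carrier (quot_mod F N) = (\<lambda>x. N +>\<^bsub>F\<^esub> x) ` carrier F"
  by (auto simp: quot_mod_def A_RCOSETS_def' )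

lemma quot_closed: "x \<in> carrier F \<Longrightarrow> N +>\<^bsub>F\<^esub> x \<in> carrier (quot_mod F N)"
  by (auto simp: quot_carrier)

lemma quot_cases:
  assumes "Y \<in> carrier (quot_mod F N)" obtains x where "x \<in> carrier F" "Y = N +>\<^bsub>F\<^esub> x"
  using assms by (auto simp: quot_carrier)

lemma quot_zero: "\<zero>\<^bsub>quot_mod F N\<^esub> = N +>\<^bsub>F\<^esub> \<zero>\<^bsub>F\<^esub>"
  by (simp add: quot_mod_def F.a_coset_add_zero N.a_subset)

lemma quot_zero_iff: "x \<in> carrier F \<Longrightarrow> N +>\<^bsub>F\<^esub> x = \<zero>\<^bsub>quot_mod F N\<^esub> \<longleftrightarrow> x \<in> N"
  using quot_eq_iff[of x "\<zero>\<^bsub>F\<^esub>"] abelian_group_minus_zero[OF F.abelian_group_axioms]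
  by (simp add: quot_zero a_minus_def)

lemma quot_add:
  "x \<in> carrier F \<Longrightarrow> y \<in> carrier F \<Longrightarrow>
   (N +>\<^bsub>F\<^esub> x) \<oplus>\<^bsub>quot_mod F N\<^esub> (N +>\<^bsub>F\<^esub> y) = N +>\<^bsub>F\<^esub> (x \<oplus>\<^bsub>F\<^esub> y)"
  by (simp add: quot_mod_def N.a_rcos_sum)

text \<open>The scalar multiple in \<open>quot_mod\<close> is a union over the representatives of
  the class. All its members are the same coset, since differences of representatives stay in
  \<open>N\<close> after scaling, and the union is over a nonempty set.\<close>

lemma quot_smult:
  assumes "c \<in> carrier A" "x \<in> carrier F"
  shows "c \<odot>\<^bsub>quot_mod F N\<^esub> (N +>\<^bsub>F\<^esub> x) = N +>\<^bsub>F\<^esub> (c \<odot>\<^bsub>F\<^esub> x)"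
proof -
  interpret S: LinearCombinations.submodule A N F by (fact submod)
  have "N +>\<^bsub>F\<^esub> (c \<odot>\<^bsub>F\<^esub> z) = N +>\<^bsub>F\<^esub> (c \<odot>\<^bsub>F\<^esub> x)" if "z \<in> N +>\<^bsub>F\<^esub> x" for z
  proof -
    have z: "z \<in> carrier F" using N.a_elemrcos_carrier[OF assms(2) that] .
    have "z \<ominus>\<^bsub>F\<^esub> x \<in> N" using N.a_rcos_module[OF assms(2) z] that by (simp add: a_minus_def)
    then have "c \<odot>\<^bsub>F\<^esub> (z \<ominus>\<^bsub>F\<^esub> x) \<in> N" using S.smult_closed assms by auto
    then show ?thesis using assms z
      by (subst quot_eq_iff) (auto simp: a_minus_def F.smult_r_distr F.smult_r_minus)
  qed
  then have "(\<Union>z\<in>N +>\<^bsub>F\<^esub> x. N +>\<^bsub>F\<^esub> (c \<odot>\<^bsub>F\<^esub> z)) = (\<Union>z\<in>N +>\<^bsub>F\<^esub> x. N +>\<^bsub>F\<^esub> (c \<odot>\<^bsub>F\<^esub> x))"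
    by (rule SUP_cong[OF refl])
  also have "\<dots> = N +>\<^bsub>F\<^esub> (c \<odot>\<^bsub>F\<^esub> x)" using N.a_rcos_self[OF assms(2)] by blast
  finally show ?thesis by (simp add: quot_mod_def)
qed

lemma module_quot: "Module.module A (quot_mod F N)"
proof -
  let ?Q = "quot_mod F N" and ?c = "\<lambda>x. N +>\<^bsub>F\<^esub> x"
  have neg: "\<forall>v\<in>carrier ?Q. \<exists>w\<in>carrier ?Q. v \<oplus>\<^bsub>?Q\<^esub> w = \<zero>\<^bsub>?Q\<^esub>"
  proof
    fix v assume "v \<in> carrier ?Q"
    then obtain x where x: "x \<in> carrier F" "v = ?c x" by (rule quot_cases)
    then have "v \<oplus>\<^bsub>?Q\<^esub> ?c (\<ominus>\<^bsub>F\<^esub> x) = \<zero>\<^bsub>?Q\<^esub>" by (simp add: quot_add quot_zero F.r_neg)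
    with x show "\<exists>w\<in>carrier ?Q. v \<oplus>\<^bsub>?Q\<^esub> w = \<zero>\<^bsub>?Q\<^esub>"
      using quot_closed[of "\<ominus>\<^bsub>F\<^esub> x"] by blast
  qed
  show ?thesis
  proof (rule module_criteria[OF F.R.cring_axioms _ _ neg])
    show "\<zero>\<^bsub>?Q\<^esub> \<in> carrier ?Q" using quot_closed[of "\<zero>\<^bsub>F\<^esub>"] by (simp only: quot_zero F.M.zero_closed)
    show "\<forall>v w. v \<in> carrier ?Q \<and> w \<in> carrier ?Q \<longrightarrow> v \<oplus>\<^bsub>?Q\<^esub> w \<in> carrier ?Q"
      unfolding quot_carrier by (auto simp: quot_add)
    show "\<forall>c v. c \<in> carrier A \<and> v \<in> carrier ?Q \<longrightarrow> c \<odot>\<^bsub>?Q\<^esub> v \<in> carrier ?Q"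
      unfolding quot_carrier by (auto simp: quot_smult)
    show "\<forall>v w. v \<in> carrier ?Q \<and> w \<in> carrier ?Q \<longrightarrow> v \<oplus>\<^bsub>?Q\<^esub> w = w \<oplus>\<^bsub>?Q\<^esub> v"
      unfolding quot_carrier by (auto simp: quot_add F.M.a_comm)
    show "\<forall>v w x. v \<in> carrier ?Q \<and> w \<in> carrier ?Q \<and> x \<in> carrier ?Q \<longrightarrow>
        v \<oplus>\<^bsub>?Q\<^esub> w \<oplus>\<^bsub>?Q\<^esub> x = v \<oplus>\<^bsub>?Q\<^esub> (w \<oplus>\<^bsub>?Q\<^esub> x)"
      unfolding quot_carrier by (auto simp: quot_add F.M.a_assoc)
    show "\<forall>v\<in>carrier ?Q. v \<oplus>\<^bsub>?Q\<^esub> \<zero>\<^bsub>?Q\<^esub> = v"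
      unfolding quot_carrier by (auto simp: quot_add quot_zero)
    show "\<forall>v\<in>carrier ?Q. \<one>\<^bsub>A\<^esub> \<odot>\<^bsub>?Q\<^esub> v = v"
      unfolding quot_carrier by (auto simp: quot_smult)
    show "\<forall>a b v. a \<in> carrier A \<and> b \<in> carrier A \<and> v \<in> carrier ?Q \<longrightarrow>
        (a \<oplus>\<^bsub>A\<^esub> b) \<odot>\<^bsub>?Q\<^esub> v = a \<odot>\<^bsub>?Q\<^esub> v \<oplus>\<^bsub>?Q\<^esub> b \<odot>\<^bsub>?Q\<^esub> v"
      unfolding quot_carrier by (auto simp: quot_smult quot_add F.smult_l_distr)
    show "\<forall>a v w. a \<in> carrier A \<and> v \<in> carrier ?Q \<and> w \<in> carrier ?Q \<longrightarrow>
        a \<odot>\<^bsub>?Q\<^esub> (v \<oplus>\<^bsub>?Q\<^esub> w) = a \<odot>\<^bsub>?Q\<^esub> v \<oplus>\<^bsub>?Q\<^esub> a \<odot>\<^bsub>?Q\<^esub> w"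
      unfolding quot_carrier by (auto simp: quot_smult quot_add F.smult_r_distr)
    show "\<forall>a b v. a \<in> carrier A \<and> b \<in> carrier A \<and> v \<in> carrier ?Q \<longrightarrow>
        (a \<otimes>\<^bsub>A\<^esub> b) \<odot>\<^bsub>?Q\<^esub> v = a \<odot>\<^bsub>?Q\<^esub> (b \<odot>\<^bsub>?Q\<^esub> v)"
      unfolding quot_carrier by (auto simp: quot_smult F.smult_assoc1)
  qed
qed

end

text \<open>One construction for both kinds of modules given by generators and relations:
  differentials, with a generator da for every a in the ring, and base change, with a generator 1
  \<otimes> m for every m in the module.\<close>

locale presented_module = A: cring A for A :: "('a, 'y) ring_scheme" +
  fixes X :: "'x set" and rels :: "('x \<Rightarrow> 'a) set"
  assumes rels: "rels \<subseteq> fsupp A X"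
begin

abbreviation "F \<equiv> free_mod A X"
definition "N = LinearCombinations.module.span A F rels"
definition "Q = quot_mod F N"
definition "gen x = N +>\<^bsub>F\<^esub> free_gen A x"

lemma module_F: "Module.module A F" by (rule module_free_mod) (fact A.cring_axioms)

lemma rels_carrier: "rels \<subseteq> carrier F" using rels by (simp add: free_mod_simps)

lemma submodule_N: "LinearCombinations.submodule A N F"
  unfolding N_def by (rule module.span_is_submodule[OF module_F rels_carrier])

sublocale QM: quotient_module A F N
  by (intro quotient_module.intro quotient_module_axioms.intro module_F submodule_N)

lemma module_Q: "Module.module A Q" unfolding Q_def by (rule QM.module_quot)

lemma free_gen_closed: "x \<in> X \<Longrightarrow> free_gen A x \<in> carrier F"
  by (auto simp: free_mod_simps fsupp_def free_gen_def)

lemma gen_closed: "x \<in> X \<Longrightarrow> gen x \<in> carrier Q"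
  unfolding gen_def Q_def by (intro QM.quot_closed free_gen_closed)

lemma smult_gen:
  assumes "x \<in> X" "a \<in> carrier A"
  shows "a \<odot>\<^bsub>Q\<^esub> gen x = N +>\<^bsub>F\<^esub> (\<lambda>y. if y = x then a else \<zero>\<^bsub>A\<^esub>)"
proof -
  have "a \<odot>\<^bsub>F\<^esub> free_gen A x = (\<lambda>y. if y = x then a else \<zero>\<^bsub>A\<^esub>)"
    using assms by (auto simp: free_mod_simps free_gen_def)
  then show ?thesis unfolding gen_def Q_def
    by (subst QM.quot_smult) (use assms free_gen_closed in auto)
qed

lemma Q_asum: "carrier Q = asum Q {a \<odot>\<^bsub>Q\<^esub> gen x | a x. a \<in> carrier A \<and> x \<in> X}"
proof
  interpret Q: Module.module A Q by (rule module_Q)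
  show "asum Q {a \<odot>\<^bsub>Q\<^esub> gen x | a x. a \<in> carrier A \<and> x \<in> X} \<subseteq> carrier Q"
    by (rule asum_subset) (auto intro: Q.abelian_monoid_axioms gen_closed)
  show "carrier Q \<subseteq> asum Q {a \<odot>\<^bsub>Q\<^esub> gen x | a x. a \<in> carrier A \<and> x \<in> X}"
  proof
    fix y assume "y \<in> carrier Q"
    then obtain w where w: "w \<in> fsupp A X" "y = N +>\<^bsub>F\<^esub> w"
      unfolding Q_def by (auto elim: QM.quot_cases simp: free_mod_simps)
    from A.abelian_group_axioms w(1)
    have "N +>\<^bsub>F\<^esub> w \<in> asum Q {a \<odot>\<^bsub>Q\<^esub> gen x | a x. a \<in> carrier A \<and> x \<in> X}"
    proof (induction rule: fsupp_induct)
      case zero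
      then show ?case using asum_zero[of Q] by (simp add: Q_def QM.quot_zero free_mod_simps)
    next
      case (single x a)
      then show ?case by (intro asum_base) (auto simp flip: smult_gen)
    next
      case (add v w)
      then show ?case using QM.quot_add[of v w] asum_add[of "N +>\<^bsub>F\<^esub> v" Q _ "N +>\<^bsub>F\<^esub> w"]
        by (simp add: Q_def free_mod_simps)
    qed
    then show "y \<in> asum Q {a \<odot>\<^bsub>Q\<^esub> gen x | a x. a \<in> carrier A \<and> x \<in> X}" using w by simp
  qed
qed

text \<open>Because \<open>H\<close> is only a group, a map that kills the relations need not kill
  their span; all scalar multiples of relations have to go to zero. Then the extension is constant
  on cosets, and \<open>the_elem\<close> reads off its value.\<close>

lemma lift:
  assumes H: "abelian_group H"
    and \<beta>: "\<And>x. x \<in> X \<Longrightarrow> add_hom A H (\<lambda>a. \<beta> a x)"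
    and kill: "\<And>a w. a \<in> carrier A \<Longrightarrow> w \<in> rels \<Longrightarrow> suml A H X \<beta> (a \<odot>\<^bsub>F\<^esub> w) = \<zero>\<^bsub>H\<^esub>"
  shows "add_hom Q H (\<lambda>Y. the_elem (suml A H X \<beta> ` Y))"
    and "\<And>a x. a \<in> carrier A \<Longrightarrow> x \<in> X \<Longrightarrow>
      the_elem (suml A H X \<beta> ` (a \<odot>\<^bsub>Q\<^esub> gen x)) = \<beta> a x"
proof -
  interpret H: abelian_group H by (fact H)
  interpret F: Module.module A F by (rule module_F)
  interpret suml_loc A H X \<beta> by unfold_locales (use \<beta> in auto)
  interpret N: abelian_subgroup N F
    by (rule submodule_abelian_subgroup) (fact module_F submodule_N)+
  let ?s = "suml A H X \<beta>" let ?L = "\<lambda>Y. the_elem (suml A H X \<beta> ` Y)"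
  have s: "add_hom F H ?s"
    by (rule add_homI) (auto simp: free_mod_simps suml_closed suml_add)
  have N0: "?s w = \<zero>\<^bsub>H\<^esub>" if wN: "w \<in> N" for w
  proof -
    from wN obtain a B where w: "w = QM.F.lincomb a B" "finite B" "B \<subseteq> rels" "a \<in> B \<rightarrow> carrier A"
      by (auto simp: N_def QM.F.span_def)
    have "?s w = (\<Oplus>\<^bsub>H\<^esub>v\<in>B. ?s (a v \<odot>\<^bsub>F\<^esub> v))"
      unfolding w(1) QM.F.lincomb_def
      by (rule add_hom_finsum[OF s]) (use w rels_carrier in \<open>auto intro!: QM.F.abelian_group_axioms H\<close>)
    also have "\<dots> = (\<Oplus>\<^bsub>H\<^esub>v\<in>B. \<zero>\<^bsub>H\<^esub>)"
      by (rule H.finsum_cong') (use w kill in auto)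
    finally show ?thesis by simp
  qed
  have L: "?L (N +>\<^bsub>F\<^esub> w) = ?s w" if w: "w \<in> carrier F" for w
  proof -
    have "?s z = ?s w" if "z \<in> N +>\<^bsub>F\<^esub> w" for z
    proof -
      have z: "z \<in> carrier F" using N.a_elemrcos_carrier[OF w that] .
      have "z \<ominus>\<^bsub>F\<^esub> w \<in> N" using N.a_rcos_module[OF w z] that by (simp add: a_minus_def)
      then have "?s z \<ominus>\<^bsub>H\<^esub> ?s w = \<zero>\<^bsub>H\<^esub>"
        using N0 add_hom_minus[OF s QM.F.abelian_group_axioms H z w] by simp
      then show ?thesis
        using abelian_group_minus_eq_zero[OF H add_hom_closed[OF s z] add_hom_closed[OF s w]] by (rule iffD1[rotated])
    qed
    then have "?s ` (N +>\<^bsub>F\<^esub> w) = {?s w}" using N.a_rcos_self[OF w] by blast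
    then show ?thesis by (simp only: the_elem_eq)
  qed
  show "add_hom Q H ?L"
  proof (rule add_homI)
    fix Y Z assume "Y \<in> carrier Q" "Z \<in> carrier Q"
    then obtain y z where "y \<in> carrier F" "Y = N +>\<^bsub>F\<^esub> y" "z \<in> carrier F" "Z = N +>\<^bsub>F\<^esub> z"
      unfolding Q_def QM.quot_carrier by blast
    then show "?L (Y \<oplus>\<^bsub>Q\<^esub> Z) = ?L Y \<oplus>\<^bsub>H\<^esub> ?L Z"
      unfolding Q_def by (simp add: L QM.quot_add add_hom_add[OF s])
  next
    fix Y assume "Y \<in> carrier Q"
    then obtain y where "y \<in> carrier F" "Y = N +>\<^bsub>F\<^esub> y" unfolding Q_def QM.quot_carrier by blast
    then show "?L Y \<in> carrier H" by (simp only: L add_hom_closed[OF s])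
  qed
  show "?L (a \<odot>\<^bsub>Q\<^esub> gen x) = \<beta> a x" if "a \<in> carrier A" "x \<in> X" for a x
  proof -
    have c: "(\<lambda>y. if y = x then a else \<zero>\<^bsub>A\<^esub>) \<in> carrier F"
      using that by (auto simp: free_mod_simps fsupp_def)
    show ?thesis using that by (simp only: smult_gen L[OF c] suml_single)
  qed
qed

end

section \<open>Restriction of scalars\<close>

lemma restrict_scalars_simps [simp]:
  "carrier (restrict_scalars h M) = carrier M" "\<zero>\<^bsub>restrict_scalars h M\<^esub> = \<zero>\<^bsub>M\<^esub>"
  "add (restrict_scalars h M) = add M" "smult (restrict_scalars h M) = (\<lambda>c x. h c \<odot>\<^bsub>M\<^esub> x)"
  by (simp_all add: restrict_scalars_def)

lemma module_restrict_scalars: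
  assumes "Module.module A M" "cring R" "h \<in> Ring.ring_hom R A"
  shows "Module.module R (restrict_scalars h M)"
proof -
  interpret M: Module.module A M by fact
  have h: "\<And>c. c \<in> carrier R \<Longrightarrow> h c \<in> carrier A" using ring_hom_closed[OF assms(3)] .
  show ?thesis
  proof (rule module_criteria[OF assms(2)])
    show "\<forall>v\<in>carrier (restrict_scalars h M). \<exists>w\<in>carrier (restrict_scalars h M).
        v \<oplus>\<^bsub>restrict_scalars h M\<^esub> w = \<zero>\<^bsub>restrict_scalars h M\<^esub>"
      using M.M.r_neg M.M.a_inv_closed by fastforce
  qed (use h ring_hom_mult[OF assms(3)] ring_hom_add[OF assms(3)] ring_hom_one[OF assms(3)] in
      \<open>auto simp: M.M.a_ac M.smult_l_distr M.smult_r_distr M.smult_assoc1\<close>)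
qed

lemma asum_cong:
  assumes "\<zero>\<^bsub>M\<^esub> = \<zero>\<^bsub>N\<^esub>" "add M = add N" shows "asum M B = asum N B"
proof -
  have "x \<in> asum N B" if "x \<in> asum M B" "\<zero>\<^bsub>M\<^esub> = \<zero>\<^bsub>N\<^esub>" "add M = add N" for x and M :: "('a, 'b) ring_scheme" and N :: "('a, 'c) ring_scheme"
    using that(1) by induction (use that(2,3) in \<open>auto intro: asum.intros\<close>)
  moreover have "x \<in> asum M B" if "x \<in> asum N B" for x
    using that by induction (use assms(1,2)[symmetric] in \<open>auto intro: asum.intros\<close>)
  ultimately show ?thesis using assms by blast
qed

lemma asum_restrict_scalars [simp]: "asum (restrict_scalars h M) B = asum M B"
  by (rule asum_cong) auto

text \<open>The scalars are absorbed by the generating set. This turns the span that defines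
  \<open>kaehler_grade\<close> into a set of plain sums, to which the comparison of additive maps
  applies.\<close>

lemma span_eq_asum:
  assumes "Module.module K V" "B \<subseteq> carrier V" "\<And>c b. c \<in> carrier K \<Longrightarrow> b \<in> B \<Longrightarrow> c \<odot>\<^bsub>V\<^esub> b \<in> B"
  shows "LinearCombinations.module.span K V B = asum V B"
proof
  interpret V: Module.module K V by fact
  show "V.span B \<subseteq> asum V B"
  proof
    fix v assume "v \<in> V.span B"
    then obtain a A where v: "v = V.lincomb a A" "finite A" "A \<subseteq> B" "a \<in> A \<rightarrow> carrier K"
      by (auto simp: V.span_def)
    show "v \<in> asum V B" unfolding v(1) V.lincomb_def
      by (rule asum_finsum) (use v assms(2,3) V.M.abelian_monoid_axioms in \<open>auto intro!: asum_base assms(3)\<close>)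
  qed
  have s: "LinearCombinations.submodule K (V.span B) V" by (rule V.span_is_submodule) fact
  show "asum V B \<subseteq> V.span B"
  proof
    fix v assume "v \<in> asum V B" then show "v \<in> V.span B"
      by induction (use V.in_own_span[OF assms(2)] s in \<open>auto simp: LinearCombinations.submodule_def\<close>)
  qed
qed

section \<open>Algebras over a field\<close>

locale kalgebra = A: cring A for A :: "('k::field, 'a, 'z) module_scheme" +
  assumes alg: "algebra base_field A"
begin

lemma smult_closed [simp, intro]: "a \<in> carrier A \<Longrightarrow> c \<odot>\<^bsub>A\<^esub> a \<in> carrier A"
  using algebra.axioms(1)[OF alg] module.smult_closed[of base_field A c a] by simp

lemma smult_add: "a \<in> carrier A \<Longrightarrow> b \<in> carrier A \<Longrightarrow> c \<odot>\<^bsub>A\<^esub> (a \<oplus>\<^bsub>A\<^esub> b) = c \<odot>\<^bsub>A\<^esub> a \<oplus>\<^bsub>A\<^esub> c \<odot>\<^bsub>A\<^esub> b"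
  using module.smult_r_distr[OF algebra.axioms(1)[OF alg], of c a b] by simp

lemma smult_plus: "a \<in> carrier A \<Longrightarrow> (c + c') \<odot>\<^bsub>A\<^esub> a = c \<odot>\<^bsub>A\<^esub> a \<oplus>\<^bsub>A\<^esub> c' \<odot>\<^bsub>A\<^esub> a"
  using module.smult_l_distr[OF algebra.axioms(1)[OF alg], of c c' a] by (simp add: class_ring_simps)

lemma smult_times: "a \<in> carrier A \<Longrightarrow> (c * c') \<odot>\<^bsub>A\<^esub> a = c \<odot>\<^bsub>A\<^esub> (c' \<odot>\<^bsub>A\<^esub> a)"
  using module.smult_assoc1[OF algebra.axioms(1)[OF alg], of c c' a] by (simp add: class_ring_simps)

lemma smult_one [simp]: "a \<in> carrier A \<Longrightarrow> 1 \<odot>\<^bsub>A\<^esub> a = a"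
  using module.smult_one[OF algebra.axioms(1)[OF alg], of a] by (simp add: class_ring_simps)

lemma smult_mult: "a \<in> carrier A \<Longrightarrow> b \<in> carrier A \<Longrightarrow> (c \<odot>\<^bsub>A\<^esub> a) \<otimes>\<^bsub>A\<^esub> b = c \<odot>\<^bsub>A\<^esub> (a \<otimes>\<^bsub>A\<^esub> b)"
  using algebra.smult_assoc2[OF alg, of c a b] by simp

lemma smult_mult_right:
  "a \<in> carrier A \<Longrightarrow> b \<in> carrier A \<Longrightarrow> a \<otimes>\<^bsub>A\<^esub> (c \<odot>\<^bsub>A\<^esub> b) = c \<odot>\<^bsub>A\<^esub> (a \<otimes>\<^bsub>A\<^esub> b)"
  using smult_mult[of b a c] A.m_comm by simp

lemma alg_map_closed [simp, intro]: "alg_map A c \<in> carrier A"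
  by (simp add: alg_map_def)

lemma alg_map_mult: "a \<in> carrier A \<Longrightarrow> alg_map A c \<otimes>\<^bsub>A\<^esub> a = c \<odot>\<^bsub>A\<^esub> a"
  by (simp add: alg_map_def smult_mult smult_times smult_plus)

lemma alg_map_hom: "alg_map A \<in> Ring.ring_hom base_field A"
proof (rule ring_hom_memI)
  fix x y :: 'k
  show "alg_map A (x \<otimes>\<^bsub>base_field\<^esub> y) = alg_map A x \<otimes>\<^bsub>A\<^esub> alg_map A y"
    by (simp add: alg_map_mult class_ring_simps) (simp add: alg_map_def smult_times[symmetric] smult_mult)
qed (auto simp: alg_map_def smult_mult smult_times smult_plus class_ring_simps)

lemma smult_zero_right [simp]: "c \<odot>\<^bsub>A\<^esub> \<zero>\<^bsub>A\<^esub> = \<zero>\<^bsub>A\<^esub>"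
  using smult_mult_right[of "\<zero>\<^bsub>A\<^esub>" "\<zero>\<^bsub>A\<^esub>" c] by simp

lemma smult_zero_left [simp]: "a \<in> carrier A \<Longrightarrow> 0 \<odot>\<^bsub>A\<^esub> a = \<zero>\<^bsub>A\<^esub>"
  using smult_plus[of a 0 0] smult_closed[of a 0] by simp

lemma vectorspace_A: "vectorspace base_field A"
  by (intro vectorspace.intro class_field algebra.axioms(1)[OF alg])

end

lemma kalgebraI: "algebra base_field A \<Longrightarrow> kalgebra A"
  by (intro kalgebra.intro kalgebra_axioms.intro) (auto simp: algebra_def)

section \<open>Differentials\<close>

context kalgebra
begin

abbreviation "\<Omega> \<equiv> kaehler A"
abbreviation "d \<equiv> kd A"

lemma kaehler_rels_fsupp: "kaehler_rels A \<subseteq> fsupp A (carrier A)"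
proof -
  interpret F: Module.module A "free_mod A (carrier A)" by (rule module_free_mod) (fact A.cring_axioms)
  have "free_gen A a \<in> carrier (free_mod A (carrier A))" if "a \<in> carrier A" for a
    using that by (auto simp: free_mod_simps fsupp_def free_gen_def)
  then have "kaehler_rels A \<subseteq> carrier (free_mod A (carrier A))"
    unfolding kaehler_rels_def Let_def by auto
  then show ?thesis by (simp add: free_mod_simps)
qed

sublocale P: presented_module A "carrier A" "kaehler_rels A"
  by unfold_locales (rule kaehler_rels_fsupp)

lemma P_Q: "P.Q = \<Omega>" and P_gen: "P.gen = d" and P_N: "P.N = kaehler_sub A"
  by (auto simp: P.Q_def P.N_def P.gen_def kaehler_def kaehler_sub_def kd_def fun_eq_iff)

sublocale \<Omega>: Module.module A \<Omega>
  using P.module_Q by (simp only: P_Q)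

lemma kd_closed [simp, intro]: "a \<in> carrier A \<Longrightarrow> d a \<in> carrier \<Omega>"
  using P.gen_closed by (simp only: P_Q P_gen)

lemma kaehler_asum: "carrier \<Omega> = asum \<Omega> {a \<odot>\<^bsub>\<Omega>\<^esub> d b | a b. a \<in> carrier A \<and> b \<in> carrier A}"
  using P.Q_asum by (simp only: P_Q P_gen)

lemma cls_add: "u \<in> carrier P.F \<Longrightarrow> v \<in> carrier P.F \<Longrightarrow>
    (kaehler_sub A +>\<^bsub>P.F\<^esub> u) \<oplus>\<^bsub>\<Omega>\<^esub> (kaehler_sub A +>\<^bsub>P.F\<^esub> v) = kaehler_sub A +>\<^bsub>P.F\<^esub> (u \<oplus>\<^bsub>P.F\<^esub> v)"
  using P.QM.quot_add[of u v] by (simp only: P_N P_Q[unfolded P.Q_def P_N])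

lemma cls_smult: "a \<in> carrier A \<Longrightarrow> v \<in> carrier P.F \<Longrightarrow>
    a \<odot>\<^bsub>\<Omega>\<^esub> (kaehler_sub A +>\<^bsub>P.F\<^esub> v) = kaehler_sub A +>\<^bsub>P.F\<^esub> (a \<odot>\<^bsub>P.F\<^esub> v)"
  using P.QM.quot_smult[of a v] by (simp only: P_N P_Q[unfolded P.Q_def P_N])

lemma kd_rel:
  assumes "u \<ominus>\<^bsub>P.F\<^esub> v \<in> kaehler_rels A" "u \<in> carrier P.F" "v \<in> carrier P.F"
  shows "kaehler_sub A +>\<^bsub>P.F\<^esub> u = kaehler_sub A +>\<^bsub>P.F\<^esub> v"
  using P.QM.quot_eq_iff[OF assms(2,3)] P.QM.F.in_own_span[OF P.rels_carrier] assms(1)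
  unfolding P.N_def[symmetric] P_N by blast

lemma kd_add:
  assumes "a \<in> carrier A" "b \<in> carrier A" shows "d (a \<oplus>\<^bsub>A\<^esub> b) = d a \<oplus>\<^bsub>\<Omega>\<^esub> d b"
proof -
  let ?u = "free_gen A (a \<oplus>\<^bsub>A\<^esub> b)" and ?v = "free_gen A a \<oplus>\<^bsub>P.F\<^esub> free_gen A b"
  have "?u \<ominus>\<^bsub>P.F\<^esub> ?v \<in> kaehler_rels A" using assms unfolding kaehler_rels_def Let_def by blast
  then have "kaehler_sub A +>\<^bsub>P.F\<^esub> ?u = kaehler_sub A +>\<^bsub>P.F\<^esub> ?v"
    using assms by (intro kd_rel P.QM.F.M.a_closed P.free_gen_closed A.a_closed)
  then show ?thesis using assms unfolding kd_def by (simp only: cls_add P.free_gen_closed)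
qed

lemma kd_mult:
  assumes "a \<in> carrier A" "b \<in> carrier A"
  shows "d (a \<otimes>\<^bsub>A\<^esub> b) = a \<odot>\<^bsub>\<Omega>\<^esub> d b \<oplus>\<^bsub>\<Omega>\<^esub> b \<odot>\<^bsub>\<Omega>\<^esub> d a"
proof -
  let ?u = "free_gen A (a \<otimes>\<^bsub>A\<^esub> b)" and ?v = "a \<odot>\<^bsub>P.F\<^esub> free_gen A b \<oplus>\<^bsub>P.F\<^esub> b \<odot>\<^bsub>P.F\<^esub> free_gen A a"
  have "?u \<ominus>\<^bsub>P.F\<^esub> ?v \<in> kaehler_rels A" using assms unfolding kaehler_rels_def Let_def by blast
  then have "kaehler_sub A +>\<^bsub>P.F\<^esub> ?u = kaehler_sub A +>\<^bsub>P.F\<^esub> ?v"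
    using assms by (intro kd_rel P.QM.F.M.a_closed P.free_gen_closed A.m_closed P.QM.F.smult_closed)
  then show ?thesis using assms unfolding kd_def
    by (simp only: cls_add cls_smult P.free_gen_closed P.QM.F.smult_closed)
qed

lemma kd_smult:
  assumes "a \<in> carrier A" shows "d (c \<odot>\<^bsub>A\<^esub> a) = alg_map A c \<odot>\<^bsub>\<Omega>\<^esub> d a"
proof -
  let ?u = "free_gen A (c \<odot>\<^bsub>A\<^esub> a)" and ?v = "alg_map A c \<odot>\<^bsub>P.F\<^esub> free_gen A a"
  have "?u \<ominus>\<^bsub>P.F\<^esub> ?v \<in> kaehler_rels A" using assms unfolding kaehler_rels_def Let_def by blast
  then have "kaehler_sub A +>\<^bsub>P.F\<^esub> ?u = kaehler_sub A +>\<^bsub>P.F\<^esub> ?v"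
    using assms by (intro kd_rel P.free_gen_closed P.QM.F.smult_closed smult_closed alg_map_closed)
  then show ?thesis using assms unfolding kd_def
    by (simp only: cls_smult P.free_gen_closed alg_map_closed)
qed

lemma suml_kaehler_hom:
  assumes "abelian_group H" "\<And>b. b \<in> carrier A \<Longrightarrow> add_hom A H (\<lambda>a. \<beta> a b)"
  shows "add_hom P.F H (suml A H (carrier A) \<beta>)"
    and "a \<in> carrier A \<Longrightarrow> b \<in> carrier A \<Longrightarrow> suml A H (carrier A) \<beta> (a \<odot>\<^bsub>P.F\<^esub> free_gen A b) = \<beta> a b"
proof -
  interpret H: abelian_group H by (fact assms)
  interpret s: suml_loc A H "carrier A" \<beta> by unfold_locales (rule assms(2))
  show "add_hom P.F H (suml A H (carrier A) \<beta>)"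
    by (rule add_homI) (auto simp: free_mod_simps s.suml_closed s.suml_add)
  assume a: "a \<in> carrier A" "b \<in> carrier A"
  then have "a \<odot>\<^bsub>P.F\<^esub> free_gen A b = (\<lambda>y. if y = b then a else \<zero>\<^bsub>A\<^esub>)"
    by (auto simp: free_mod_simps free_gen_def)
  then show "suml A H (carrier A) \<beta> (a \<odot>\<^bsub>P.F\<^esub> free_gen A b) = \<beta> a b" using s.suml_single a by simp
qed

text \<open>This form of the universal property does not presuppose a module structure on the target.\<close>

lemma kaehler_lift:
  assumes H: "abelian_group H"
    and l: "\<And>b. b \<in> carrier A \<Longrightarrow> add_hom A H (\<lambda>a. \<beta> a b)"
    and r: "\<And>a. a \<in> carrier A \<Longrightarrow> add_hom A H (\<beta> a)"
    and leibniz: "\<And>a b c. a \<in> carrier A \<Longrightarrow> b \<in> carrier A \<Longrightarrow> c \<in> carrier A \<Longrightarrow>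
      \<beta> a (b \<otimes>\<^bsub>A\<^esub> c) = \<beta> (a \<otimes>\<^bsub>A\<^esub> b) c \<oplus>\<^bsub>H\<^esub> \<beta> (a \<otimes>\<^bsub>A\<^esub> c) b"
    and scal: "\<And>a b c. a \<in> carrier A \<Longrightarrow> b \<in> carrier A \<Longrightarrow> \<beta> a (c \<odot>\<^bsub>A\<^esub> b) = \<beta> (c \<odot>\<^bsub>A\<^esub> a) b"
  shows "add_hom \<Omega> H (\<lambda>Y. the_elem (suml A H (carrier A) \<beta> ` Y))"
    and "\<And>a b. a \<in> carrier A \<Longrightarrow> b \<in> carrier A \<Longrightarrow>
      the_elem (suml A H (carrier A) \<beta> ` (a \<odot>\<^bsub>\<Omega>\<^esub> d b)) = \<beta> a b"
proof -
  interpret H: abelian_group H by (fact H)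
  let ?s = "suml A H (carrier A) \<beta>"
  have s: "add_hom P.F H ?s" by (rule suml_kaehler_hom(1)[OF H]) (rule l)
  have s1: "?s (a \<odot>\<^bsub>P.F\<^esub> free_gen A b) = \<beta> a b" if "a \<in> carrier A" "b \<in> carrier A" for a b
    by (rule suml_kaehler_hom(2)[OF H _ that]) (rule l)
  have \<beta>c: "\<beta> a b \<in> carrier H" if "a \<in> carrier A" "b \<in> carrier A" for a b
    using add_hom_closed[OF l] that by blast
  note cl = P.free_gen_closed P.QM.F.smult_closed P.QM.F.M.a_closed
  have s2: "?s (a \<odot>\<^bsub>P.F\<^esub> (b \<odot>\<^bsub>P.F\<^esub> free_gen A c)) = \<beta> (a \<otimes>\<^bsub>A\<^esub> b) c"
    if "a \<in> carrier A" "b \<in> carrier A" "c \<in> carrier A" for a b c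
    using P.QM.F.smult_assoc1[OF that(1,2) cl(1)[OF that(3)]] s1[OF A.m_closed[OF that(1,2)] that(3)] by simp
  \<comment> \<open>Each relation is a difference u - v, so it suffices that multiples of u and of v
    have equal images. The three kinds of relations then correspond to additivity in the second
    slot, the Leibniz rule and compatibility with scalars from \<open>K\<close>.\<close>
  have kill0: "?s (a \<odot>\<^bsub>P.F\<^esub> (u \<ominus>\<^bsub>P.F\<^esub> v)) = \<zero>\<^bsub>H\<^esub>"
    if "a \<in> carrier A" "u \<in> carrier P.F" "v \<in> carrier P.F" "?s (a \<odot>\<^bsub>P.F\<^esub> u) = ?s (a \<odot>\<^bsub>P.F\<^esub> v)" for a u v
  proof -
    have "a \<odot>\<^bsub>P.F\<^esub> (u \<ominus>\<^bsub>P.F\<^esub> v) = a \<odot>\<^bsub>P.F\<^esub> u \<ominus>\<^bsub>P.F\<^esub> a \<odot>\<^bsub>P.F\<^esub> v"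
      using that(1-3) by (simp add: a_minus_def P.QM.F.smult_r_distr P.QM.F.smult_r_minus)
    then show ?thesis
      using add_hom_minus[OF s P.QM.F.abelian_group_axioms H, of "a \<odot>\<^bsub>P.F\<^esub> u" "a \<odot>\<^bsub>P.F\<^esub> v"]
        that cl(2) add_hom_closed[OF s, of "a \<odot>\<^bsub>P.F\<^esub> v"] by (simp add: a_minus_def H.r_neg)
  qed
  have sadd: "?s (a \<odot>\<^bsub>P.F\<^esub> (u \<oplus>\<^bsub>P.F\<^esub> v)) = ?s (a \<odot>\<^bsub>P.F\<^esub> u) \<oplus>\<^bsub>H\<^esub> ?s (a \<odot>\<^bsub>P.F\<^esub> v)"
    if "a \<in> carrier A" "u \<in> carrier P.F" "v \<in> carrier P.F" for a u v
    using that by (simp add: P.QM.F.smult_r_distr add_hom_add[OF s])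
  have kill: "?s (a \<odot>\<^bsub>P.F\<^esub> w) = \<zero>\<^bsub>H\<^esub>" if a: "a \<in> carrier A" and w: "w \<in> kaehler_rels A" for a w
    using w unfolding kaehler_rels_def Let_def
  proof (elim UnE CollectE exE conjE)
    fix b c assume w: "w = free_gen A (b \<oplus>\<^bsub>A\<^esub> c) \<ominus>\<^bsub>P.F\<^esub> (free_gen A b \<oplus>\<^bsub>P.F\<^esub> free_gen A c)"
      and bc: "b \<in> carrier A" "c \<in> carrier A"
    show ?thesis unfolding w
      by (rule kill0) (use a bc in \<open>simp_all add: cl sadd s1 add_hom_add[OF r]\<close>)
  next
    fix b c assume w: "w = free_gen A (b \<otimes>\<^bsub>A\<^esub> c) \<ominus>\<^bsub>P.F\<^esub>
        (b \<odot>\<^bsub>P.F\<^esub> free_gen A c \<oplus>\<^bsub>P.F\<^esub> c \<odot>\<^bsub>P.F\<^esub> free_gen A b)"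
      and bc: "b \<in> carrier A" "c \<in> carrier A"
    show ?thesis unfolding w
      by (rule kill0) (use a bc in \<open>simp_all add: cl sadd s1 s2 leibniz\<close>)
  next
    fix c b assume w: "w = free_gen A (c \<odot>\<^bsub>A\<^esub> b) \<ominus>\<^bsub>P.F\<^esub> alg_map A c \<odot>\<^bsub>P.F\<^esub> free_gen A b"
      and b: "b \<in> carrier A"
    show ?thesis unfolding w
      by (rule kill0) (use a b in \<open>simp_all add: cl s1 s2 scal A.m_comm[of a] alg_map_mult\<close>)
  qed
  note P.lift[of H \<beta>, unfolded P_Q P_gen]
  then show "add_hom \<Omega> H (\<lambda>Y. the_elem (?s ` Y))"
    "\<And>a b. a \<in> carrier A \<Longrightarrow> b \<in> carrier A \<Longrightarrow> the_elem (?s ` (a \<odot>\<^bsub>\<Omega>\<^esub> d b)) = \<beta> a b"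
    using H l kill by blast+
qed

end

section \<open>Finite-dimensional vector spaces\<close>

text \<open>An independent subset of \<open>W\<close> is independent in the whole space, so its size
  is bounded by the dimension; a maximal one generates \<open>W\<close>.\<close>

lemma (in vectorspace) fin_dim_subspace:
  assumes fd: "fin_dim" and W: "VectorSpace.subspace K W V"
  shows "vectorspace.fin_dim K (vs W)"
proof -
  interpret W: vectorspace K "vs W" by (rule subspace_is_vs[OF W])
  have sm: "LinearCombinations.submodule K W V" using W by (rule is_module)
  have WV: "W \<subseteq> carrier V" using sm by (simp add: LinearCombinations.submodule_def)
  let ?P = "\<lambda>S. S \<subseteq> carrier (vs W) \<and> W.lin_indpt S"
  have "finite S \<and> card S \<le> dim" if "?P S" for S
  proof -
    have "S \<subseteq> W" "lin_indpt S" using that span_li_not_depend(2)[OF _ sm, of S] by auto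
    then show ?thesis using li_le_dim[OF fd, of S] WV by auto
  qed
  moreover have "?P {}" by (simp add: W.lin_dep_def)
  ultimately obtain A where A: "finite A" "maximal A ?P"
    using maximal_exists[of ?P dim "{}"] by blast
  then have "W.gen_set A" "A \<subseteq> carrier (vs W)" using W.max_li_is_gen by (auto simp: maximal_def)
  with A(1) show ?thesis unfolding W.fin_dim_def by blast
qed

text \<open>A basis of \<open>W\<close> is an independent set of the whole space with as many
  elements as the dimension requires, hence already a basis of it.\<close>

lemma (in vectorspace) subspace_eq_carrier:
  assumes fd: "fin_dim" and W: "VectorSpace.subspace K W V" and dim: "vectorspace.dim K (vs W) = dim"
  shows "W = carrier V"
proof -
  interpret W: vectorspace K "vs W" by (rule subspace_is_vs[OF W])
  have sm: "LinearCombinations.submodule K W V" using W by (rule is_module)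
  have WV: "W \<subseteq> carrier V" using sm by (simp add: LinearCombinations.submodule_def)
  have "W.fin_dim" by (rule fin_dim_subspace[OF fd W])
  then obtain B where B: "finite B" "W.basis B" using W.finite_basis_exists by blast
  then have BW: "B \<subseteq> W" "W.lin_indpt B" by (auto simp: W.basis_def)
  then have "lin_indpt B" using span_li_not_depend(2)[OF BW(1) sm] by simp
  moreover have "card B = dim" using W.dim_basis[OF B] dim by simp
  ultimately have "basis B" using dim_li_is_basis[OF fd B(1)] BW WV by auto
  then have "carrier V = span B" by (simp add: basis_def)
  also have "\<dots> \<subseteq> W" by (rule span_is_subset[OF BW(1) sm])
  finally show ?thesis using WV by blast
qed

lemma linear_mapI:
  assumes "vectorspace K V" "vectorspace K W" "f \<in> carrier V \<rightarrow> carrier W"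
    "\<And>x y. x \<in> carrier V \<Longrightarrow> y \<in> carrier V \<Longrightarrow> f (x \<oplus>\<^bsub>V\<^esub> y) = f x \<oplus>\<^bsub>W\<^esub> f y"
    "\<And>c x. c \<in> carrier K \<Longrightarrow> x \<in> carrier V \<Longrightarrow> f (c \<odot>\<^bsub>V\<^esub> x) = c \<odot>\<^bsub>W\<^esub> f x"
  shows "linear_map K V W f"
  using assms
  by (intro linear_map.intro mod_hom.intro mod_hom_axioms.intro)
     (auto simp: vectorspace_def LinearCombinations.module_hom_def)

lemma dim_linear_image:
  assumes "vectorspace K V" "vectorspace K W" "vectorspace.fin_dim K V" "linear_map K V W f"
    "inj_on f (carrier V)" "f ` carrier V = carrier W"
  shows "vectorspace.fin_dim K W" "vectorspace.dim K W = vectorspace.dim K V"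
  by (rule linear_map.surj_fin_dim[OF assms(4) assms(3) assms(6)])
     (rule linear_map.dim_eq[OF assms(4) assms(3) assms(5,6), symmetric])

text \<open>The kernel has dimension zero, so by rank and nullity the image is a subspace of full
  dimension.\<close>

lemma linear_inj_surj:
  assumes V: "vectorspace K V" and fd: "vectorspace.fin_dim K V" and f: "linear_map K V V f" and "inj_on f (carrier V)"
  shows "f ` carrier V = carrier V"
proof -
  interpret linear_map K V V f by (fact f)
  have im: "im = f ` carrier V" by (simp add: im_def)
  have s: "VectorSpace.subspace K im V" by (rule imT_is_subspace)
  have d: "vectorspace.dim K (V\<lparr>carrier := im\<rparr>) = vectorspace.dim K V"
    using rank_nullity_main(1)[OF fd] inj_imp_dim_ker0[OF assms(4)] by linarith
  show ?thesis using vectorspace.subspace_eq_carrier[OF V fd s d] unfolding im .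
qed

text \<open>Finite dimension comes from the two embedded summands, whose subspace sum is everything.
  The dimension is then rank plus nullity for the first projection, whose kernel is the copy of
  \<open>W\<close>.\<close>

lemma dim_direct_sum:
  assumes V: "vectorspace K V" "vectorspace.fin_dim K V" and W: "vectorspace K W" "vectorspace.fin_dim K W"
  shows "vectorspace.fin_dim K (direct_sum V W)"
    "vectorspace.dim K (direct_sum V W) = vectorspace.dim K V + vectorspace.dim K W"
proof -
  interpret V: vectorspace K V by fact
  interpret W: vectorspace K W by fact
  interpret D: vectorspace K "direct_sum V W" by (rule direct_sum_is_vs) fact+
  have D: "carrier (direct_sum V W) = carrier V \<times> carrier W" "\<zero>\<^bsub>direct_sum V W\<^esub> = (\<zero>\<^bsub>V\<^esub>, \<zero>\<^bsub>W\<^esub>)"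
    "add (direct_sum V W) = (\<lambda>v w. (fst v \<oplus>\<^bsub>V\<^esub> fst w, snd v \<oplus>\<^bsub>W\<^esub> snd w))"
    "smult (direct_sum V W) = (\<lambda>c v. (c \<odot>\<^bsub>V\<^esub> fst v, c \<odot>\<^bsub>W\<^esub> snd v))"
    by (simp_all add: direct_sum_def)
  let ?i = "\<lambda>v. (v, \<zero>\<^bsub>W\<^esub>)" and ?j = "\<lambda>w. (\<zero>\<^bsub>V\<^esub>, w)"
  have i: "linear_map K V (direct_sum V W) ?i" by (rule linear_mapI) (auto simp: D V.vectorspace_axioms D.vectorspace_axioms)
  have j: "linear_map K W (direct_sum V W) ?j" by (rule linear_mapI) (auto simp: D W.vectorspace_axioms D.vectorspace_axioms)
  have p: "linear_map K (direct_sum V W) V fst" by (rule linear_mapI) (auto simp: D V.vectorspace_axioms D.vectorspace_axioms)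
  let ?A = "carrier V \<times> {\<zero>\<^bsub>W\<^esub>}" and ?B = "{\<zero>\<^bsub>V\<^esub>} \<times> carrier W"
  have A: "mod_hom.im V ?i = ?A" and B: "mod_hom.im W ?j = ?B"
    using i j by (auto simp: linear_map_def mod_hom.im_def)
  have sA: "VectorSpace.subspace K ?A (direct_sum V W)" and sB: "VectorSpace.subspace K ?B (direct_sum V W)"
    using linear_map.imT_is_subspace[OF i] linear_map.imT_is_subspace[OF j] unfolding A B .
  have vA: "vectorspace K (D.vs ?A)" and vB: "vectorspace K (D.vs ?B)"
    by (rule D.subspace_is_vs[OF sA], rule D.subspace_is_vs[OF sB])
  have lA: "linear_map K V (D.vs ?A) ?i"
    by (rule linear_mapI[OF V(1) vA]) (simp_all add: D Pi_iff)
  have lB: "linear_map K W (D.vs ?B) ?j"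
    by (rule linear_mapI[OF W(1) vB]) (simp_all add: D Pi_iff)
  have fA: "vectorspace.fin_dim K (D.vs ?A)"
    by (rule linear_map.surj_fin_dim[OF lA V(2)]) auto
  have fB: "vectorspace.fin_dim K (D.vs ?B)" and dB: "vectorspace.dim K (D.vs ?B) = W.dim"
    using dim_linear_image[OF W(1) vB W(2) lB] by (auto simp: inj_on_def)
  interpret p: linear_map K "direct_sum V W" V fst by (fact p)
  have sum: "D.subspace_sum ?A ?B = carrier (direct_sum V W)"
  proof -
    have "v \<in> (\<lambda>(x, y). x \<oplus>\<^bsub>direct_sum V W\<^esub> y) ` {(x, y). x \<in> ?A \<and> y \<in> ?B}" if "v \<in> carrier V \<times> carrier W" for v
      by (rule image_eqI[of _ _ "((fst v, \<zero>\<^bsub>W\<^esub>), (\<zero>\<^bsub>V\<^esub>, snd v))"]) (use that in \<open>auto simp: D\<close>)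
    then show ?thesis unfolding D.submodule_sum_def D(1) by (auto simp: D)
  qed
  show fd: "D.fin_dim"
    using D.fin_dim_subspace_sum[OF sA sB fA fB] unfolding sum by simp
  have ker: "p.ker = ?B" by (auto simp: p.ker_def D)
  have im: "p.im = carrier V" by (auto simp: p.im_def D image_iff)
  show "D.dim = V.dim + W.dim" using p.rank_nullity_main(1)[OF fd] unfolding ker im using dB by simp
qed

lemma fin_dimI_asum:
  assumes V: "vectorspace K V" and B: "finite B" "B \<subseteq> carrier V"
    and "carrier V = asum V {c \<odot>\<^bsub>V\<^esub> b | c b. c \<in> carrier K \<and> b \<in> B}"
  shows "vectorspace.fin_dim K V"
proof -
  interpret V: vectorspace K V by fact
  have s: "LinearCombinations.submodule K (V.span B) V" by (rule V.span_is_submodule) fact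
  have "v \<in> V.span B" if "v \<in> asum V {c \<odot>\<^bsub>V\<^esub> b | c b. c \<in> carrier K \<and> b \<in> B}" for v
    using that by induction (use V.in_own_span[OF B(2)] s in \<open>auto simp: LinearCombinations.submodule_def\<close>)
  then have "V.gen_set B" using assms(4) V.span_is_subset2[OF B(2)] by auto
  then show ?thesis unfolding V.fin_dim_def using B by blast
qed

section \<open>Induced maps and gradings on differentials\<close>

context kalgebra
begin

lemma smult_kd_smult:
  "a \<in> carrier A \<Longrightarrow> b \<in> carrier A \<Longrightarrow> a \<odot>\<^bsub>\<Omega>\<^esub> d (c \<odot>\<^bsub>A\<^esub> b) = (c \<odot>\<^bsub>A\<^esub> a) \<odot>\<^bsub>\<Omega>\<^esub> d b"
  using \<Omega>.smult_assoc1[of a "alg_map A c" "d b"] A.m_comm[of a "alg_map A c"]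
  by (simp add: kd_smult alg_map_mult)

lemma smult_kd_mult:
  "a \<in> carrier A \<Longrightarrow> b \<in> carrier A \<Longrightarrow> c \<in> carrier A \<Longrightarrow>
   a \<odot>\<^bsub>\<Omega>\<^esub> d (b \<otimes>\<^bsub>A\<^esub> c) = (a \<otimes>\<^bsub>A\<^esub> b) \<odot>\<^bsub>\<Omega>\<^esub> d c \<oplus>\<^bsub>\<Omega>\<^esub> (a \<otimes>\<^bsub>A\<^esub> c) \<odot>\<^bsub>\<Omega>\<^esub> d b"
  by (simp add: kd_mult \<Omega>.smult_r_distr \<Omega>.smult_assoc1)

lemma kd_hom: "a \<in> carrier A \<Longrightarrow> add_hom A \<Omega> (\<lambda>b. a \<odot>\<^bsub>\<Omega>\<^esub> d b)"
  and kd_hom_left: "b \<in> carrier A \<Longrightarrow> add_hom A \<Omega> (\<lambda>a. a \<odot>\<^bsub>\<Omega>\<^esub> d b)"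
  by (auto intro!: add_homI simp: kd_add \<Omega>.smult_r_distr \<Omega>.smult_l_distr)

lemma kd_one [simp]: "d \<one>\<^bsub>A\<^esub> = \<zero>\<^bsub>\<Omega>\<^esub>"
  using kd_mult[of "\<one>\<^bsub>A\<^esub>" "\<one>\<^bsub>A\<^esub>"] by simp

text \<open>The factor a in front avoids the exponent n - 1, so that n = 0 needs no exception;
  \<open>kd_pow_Suc\<close> recovers the usual derivative of a power.\<close>

lemma kd_pow:
  assumes a: "a \<in> carrier A"
  shows "a \<odot>\<^bsub>\<Omega>\<^esub> d (a [^]\<^bsub>A\<^esub> (n::nat)) = (of_nat n \<odot>\<^bsub>A\<^esub> a [^]\<^bsub>A\<^esub> n) \<odot>\<^bsub>\<Omega>\<^esub> d a"
proof (induction n)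
  case 0
  then show ?case using a by simp
next
  case (Suc n)
  let ?p = "a [^]\<^bsub>A\<^esub> n"
  have p: "?p \<in> carrier A" using a by simp
  have "a \<odot>\<^bsub>\<Omega>\<^esub> d (a [^]\<^bsub>A\<^esub> Suc n) = (a \<otimes>\<^bsub>A\<^esub> ?p) \<odot>\<^bsub>\<Omega>\<^esub> d a \<oplus>\<^bsub>\<Omega>\<^esub> (a \<otimes>\<^bsub>A\<^esub> a) \<odot>\<^bsub>\<Omega>\<^esub> d ?p"
    using a p by (simp add: smult_kd_mult)
  also have "(a \<otimes>\<^bsub>A\<^esub> a) \<odot>\<^bsub>\<Omega>\<^esub> d ?p = (a \<otimes>\<^bsub>A\<^esub> (of_nat n \<odot>\<^bsub>A\<^esub> ?p)) \<odot>\<^bsub>\<Omega>\<^esub> d a"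
    using a p Suc by (simp add: \<Omega>.smult_assoc1)
  also have "a \<otimes>\<^bsub>A\<^esub> (of_nat n \<odot>\<^bsub>A\<^esub> ?p) = of_nat n \<odot>\<^bsub>A\<^esub> (?p \<otimes>\<^bsub>A\<^esub> a)"
    using a p by (simp add: smult_mult_right A.m_comm)
  finally show ?case using a p by (simp add: \<Omega>.smult_l_distr[symmetric] A.m_comm[of a ?p] smult_plus)
qed

text \<open>Both slots of a db are additive. Sums in b are resolved while a is a generator, then
  sums in a while b is arbitrary.\<close>

lemma kaehler_asum_gen:
  assumes B: "B \<subseteq> carrier A" "carrier A = asum A B"
  shows "carrier \<Omega> = asum \<Omega> {a \<odot>\<^bsub>\<Omega>\<^esub> d b | a b. a \<in> B \<and> b \<in> B}" (is "_ = ?S")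
proof
  show "?S \<subseteq> carrier \<Omega>"
    by (rule asum_subset) (use B in \<open>auto intro!: \<Omega>.M.abelian_monoid_axioms \<Omega>.smult_closed\<close>)
  have 1: "a \<odot>\<^bsub>\<Omega>\<^esub> d b \<in> ?S" if a: "a \<in> B" and b: "b \<in> asum A B" for a b
    using b
  proof induction
    case asum_zero
    then show ?case using add_hom_zero[OF kd_hom A.abelian_group_axioms \<Omega>.M.abelian_group_axioms] a B
      by (auto simp: asum.asum_zero)
  next
    case (asum_base b)
    then show ?case using a by (blast intro: asum.asum_base)
  next
    case (asum_add x y)
    then have "x \<in> carrier A" "y \<in> carrier A" "a \<in> carrier A" using a B by auto
    then have "a \<odot>\<^bsub>\<Omega>\<^esub> d (x \<oplus>\<^bsub>A\<^esub> y) = a \<odot>\<^bsub>\<Omega>\<^esub> d x \<oplus>\<^bsub>\<Omega>\<^esub> a \<odot>\<^bsub>\<Omega>\<^esub> d y"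
      by (intro add_hom_add[OF kd_hom])
    then show ?case using asum_add.IH by (simp only: asum.asum_add)
  qed
  have 2: "a \<odot>\<^bsub>\<Omega>\<^esub> d b \<in> ?S" if b: "b \<in> asum A B" and a: "a \<in> asum A B" for a b
    using a
  proof induction
    case asum_zero
    then show ?case using b B by (auto simp: asum.asum_zero)
  next
    case (asum_base a)
    then show ?case using b 1 by blast
  next
    case (asum_add x y)
    then have "x \<in> carrier A" "y \<in> carrier A" "b \<in> carrier A" using b B by auto
    then have "(x \<oplus>\<^bsub>A\<^esub> y) \<odot>\<^bsub>\<Omega>\<^esub> d b = x \<odot>\<^bsub>\<Omega>\<^esub> d b \<oplus>\<^bsub>\<Omega>\<^esub> y \<odot>\<^bsub>\<Omega>\<^esub> d b"
      by (intro add_hom_add[OF kd_hom_left])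
    then show ?case using asum_add.IH by (simp only: asum.asum_add)
  qed
  show "carrier \<Omega> \<subseteq> ?S"
    unfolding kaehler_asum by (rule asum_mono) (use 2 B in blast)
qed

lemma module_kaehler_K: "Module.module base_field (kaehler_K A)"
  unfolding kaehler_K_def by (rule module_restrict_scalars[OF \<Omega>.module_axioms _ alg_map_hom]) (rule class_cring.is_cring)

lemma vectorspace_kaehler_K: "vectorspace base_field (kaehler_K A)"
  by (intro vectorspace.intro class_field module_kaehler_K)

lemma kaehler_K_simps [simp]:
  "carrier (kaehler_K A) = carrier \<Omega>" "\<zero>\<^bsub>kaehler_K A\<^esub> = \<zero>\<^bsub>\<Omega>\<^esub>" "add (kaehler_K A) = add \<Omega>"
  "smult (kaehler_K A) = (\<lambda>c x. alg_map A c \<odot>\<^bsub>\<Omega>\<^esub> x)"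
  by (simp_all add: kaehler_K_def)

definition "kaehler_homs G i = {f \<odot>\<^bsub>\<Omega>\<^esub> d g | f g j k. f \<in> G j \<and> g \<in> G k \<and> j + k = (i::int)}"

lemma kaehler_homs_carrier: "(\<And>j. G j \<subseteq> carrier A) \<Longrightarrow> kaehler_homs G i \<subseteq> carrier \<Omega>"
  unfolding kaehler_homs_def by (auto intro!: \<Omega>.smult_closed)

text \<open>A scalar is absorbed by the coefficient, c (f dg) = (c f) dg. This is where the
  components \<open>G j\<close> have to be closed under scalars.\<close>

lemma kaehler_grade_asum:
  assumes G: "\<And>j. G j \<subseteq> carrier A" "\<And>j c a. a \<in> G j \<Longrightarrow> c \<odot>\<^bsub>A\<^esub> a \<in> G j"
  shows "kaehler_grade A G i = asum \<Omega> (kaehler_homs G i)"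
proof -
  have "kaehler_grade A G i = asum (kaehler_K A) (kaehler_homs G i)"
    unfolding kaehler_grade_def kaehler_homs_def[symmetric]
  proof (rule span_eq_asum[OF module_kaehler_K])
    show "kaehler_homs G i \<subseteq> carrier (kaehler_K A)" using kaehler_homs_carrier[of G i, OF G(1)] by simp
    fix c :: 'k and w assume "w \<in> kaehler_homs G i"
    then obtain f g j k where w: "w = f \<odot>\<^bsub>\<Omega>\<^esub> d g" "f \<in> G j" "g \<in> G k" "j + k = i"
      unfolding kaehler_homs_def by blast
    then have c: "f \<in> carrier A" "g \<in> carrier A" using G(1) by auto
    have "c \<odot>\<^bsub>kaehler_K A\<^esub> w = (c \<odot>\<^bsub>A\<^esub> f) \<odot>\<^bsub>\<Omega>\<^esub> d g"
      unfolding w(1) using c \<Omega>.smult_assoc1[of "alg_map A c" f "d g"] by (simp add: alg_map_mult)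
    then show "c \<odot>\<^bsub>kaehler_K A\<^esub> w \<in> kaehler_homs G i"
      using w G(2) unfolding kaehler_homs_def by blast
  qed
  then show ?thesis by (simp add: kaehler_K_def)
qed

lemma kaehler_grade_submodule:
  assumes G: "\<And>j. G j \<subseteq> carrier A"
  shows "LinearCombinations.submodule base_field (kaehler_grade A G i) (kaehler_K A)"
  unfolding kaehler_grade_def kaehler_homs_def[symmetric]
  by (rule module.span_is_submodule[OF module_kaehler_K]) (use kaehler_homs_carrier[of G i, OF G] in simp)

lemma vectorspace_kaehler_grade:
  assumes G: "\<And>j. G j \<subseteq> carrier A"
  shows "vectorspace base_field ((kaehler_K A)\<lparr>carrier := kaehler_grade A G i\<rparr>)"
  by (rule vectorspace.subspace_is_vs[OF vectorspace_kaehler_K])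
     (intro VectorSpace.subspace.intro vectorspace_kaehler_K kaehler_grade_submodule G)

end

locale kalgebra_hom = A: kalgebra A + B: kalgebra B
  for A :: "('k::field, 'a, 'y) module_scheme" and B :: "('k, 'b, 'z) module_scheme" +
  fixes \<phi> :: "'a \<Rightarrow> 'b"
  assumes hom: "\<phi> \<in> Ring.ring_hom A B"
    and hom_smult: "\<And>c a. a \<in> carrier A \<Longrightarrow> \<phi> (c \<odot>\<^bsub>A\<^esub> a) = c \<odot>\<^bsub>B\<^esub> \<phi> a"
begin

lemma hom_closed [simp, intro]: "a \<in> carrier A \<Longrightarrow> \<phi> a \<in> carrier B"
  using ring_hom_closed[OF hom] .

lemma hom_add: "a \<in> carrier A \<Longrightarrow> b \<in> carrier A \<Longrightarrow> \<phi> (a \<oplus>\<^bsub>A\<^esub> b) = \<phi> a \<oplus>\<^bsub>B\<^esub> \<phi> b"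
  using ring_hom_add[OF hom] .

lemma hom_mult: "a \<in> carrier A \<Longrightarrow> b \<in> carrier A \<Longrightarrow> \<phi> (a \<otimes>\<^bsub>A\<^esub> b) = \<phi> a \<otimes>\<^bsub>B\<^esub> \<phi> b"
  using ring_hom_mult[OF hom] .

lemma hom_one: "\<phi> \<one>\<^bsub>A\<^esub> = \<one>\<^bsub>B\<^esub>" using ring_hom_one[OF hom] .

lemma add_hom: "add_hom A B \<phi>" by (rule add_homI) (auto simp: hom_add)

lemma hom_zero: "\<phi> \<zero>\<^bsub>A\<^esub> = \<zero>\<^bsub>B\<^esub>"
  by (rule add_hom_zero[OF add_hom]) (rule A.A.abelian_group_axioms B.A.abelian_group_axioms)+

lemma hom_alg_map: "\<phi> (alg_map A c) = alg_map B c" by (simp add: alg_map_def hom_smult hom_one)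

lemma kaehler_map_hom: "add_hom A.\<Omega> B.\<Omega> (kaehler_map A B \<phi>)"
  and kaehler_map_kd: "\<And>a b. a \<in> carrier A \<Longrightarrow> b \<in> carrier A \<Longrightarrow>
    kaehler_map A B \<phi> (a \<odot>\<^bsub>A.\<Omega>\<^esub> A.d b) = \<phi> a \<odot>\<^bsub>B.\<Omega>\<^esub> B.d (\<phi> b)"
proof -
  let ?\<beta> = "\<lambda>a b. \<phi> a \<odot>\<^bsub>B.\<Omega>\<^esub> B.d (\<phi> b)"
  \<comment> \<open>The defining sum ranges over the support of the formal sum, so
    \<open>kaehler_map\<close> is literally the map that \<open>kaehler_lift\<close> produces from
    (a, b) \<mapsto> \<phi>(a) d\<phi>(b).\<close>
  have eq: "kaehler_map A B \<phi> = (\<lambda>Y. the_elem (suml A B.\<Omega> (carrier A) ?\<beta> ` Y))"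
    by (simp add: kaehler_map_def suml_def fun_eq_iff)
  have H: "abelian_group B.\<Omega>" by (rule B.\<Omega>.abelian_group_axioms)
  have l: "\<And>b. b \<in> carrier A \<Longrightarrow> add_hom A B.\<Omega> (\<lambda>a. ?\<beta> a b)"
    by (auto intro!: add_homI B.\<Omega>.smult_closed simp: hom_add B.\<Omega>.smult_l_distr)
  have r: "\<And>a. a \<in> carrier A \<Longrightarrow> add_hom A B.\<Omega> (?\<beta> a)"
    by (auto intro!: add_homI B.\<Omega>.smult_closed simp: hom_add B.kd_add B.\<Omega>.smult_r_distr)
  have m: "\<And>a b c. a \<in> carrier A \<Longrightarrow> b \<in> carrier A \<Longrightarrow> c \<in> carrier A \<Longrightarrow>
      ?\<beta> a (b \<otimes>\<^bsub>A\<^esub> c) = ?\<beta> (a \<otimes>\<^bsub>A\<^esub> b) c \<oplus>\<^bsub>B.\<Omega>\<^esub> ?\<beta> (a \<otimes>\<^bsub>A\<^esub> c) b"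
    by (simp add: hom_mult B.smult_kd_mult)
  have s: "\<And>a b c. a \<in> carrier A \<Longrightarrow> b \<in> carrier A \<Longrightarrow> ?\<beta> a (c \<odot>\<^bsub>A\<^esub> b) = ?\<beta> (c \<odot>\<^bsub>A\<^esub> a) b"
    by (simp add: hom_smult B.smult_kd_smult)
  show "add_hom A.\<Omega> B.\<Omega> (kaehler_map A B \<phi>)"
    unfolding eq by (rule A.kaehler_lift(1)[OF H]) (fact l r m s)+
  show "kaehler_map A B \<phi> (a \<odot>\<^bsub>A.\<Omega>\<^esub> A.d b) = ?\<beta> a b" if "a \<in> carrier A" "b \<in> carrier A" for a b
    unfolding eq by (rule A.kaehler_lift(2)[OF H]) (fact l r m s that)+
qed

text \<open>The lift is only known to be additive; semilinearity along \<phi> is checked on the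
  products b dc.\<close>

lemma kaehler_map_smult:
  assumes a: "a \<in> carrier A" and w: "w \<in> carrier A.\<Omega>"
  shows "kaehler_map A B \<phi> (a \<odot>\<^bsub>A.\<Omega>\<^esub> w) = \<phi> a \<odot>\<^bsub>B.\<Omega>\<^esub> kaehler_map A B \<phi> w"
proof (rule add_hom_eqI[where M = A.\<Omega> and N = B.\<Omega> and B = "{a \<odot>\<^bsub>A.\<Omega>\<^esub> A.d b | a b. a \<in> carrier A \<and> b \<in> carrier A}"])
  show "add_hom A.\<Omega> B.\<Omega> (\<lambda>w. kaehler_map A B \<phi> (a \<odot>\<^bsub>A.\<Omega>\<^esub> w))"
    by (rule add_homI) (use a in \<open>auto simp: A.\<Omega>.smult_r_distr add_hom_add[OF kaehler_map_hom] add_hom_closed[OF kaehler_map_hom]\<close>)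
  show "add_hom A.\<Omega> B.\<Omega> (\<lambda>w. \<phi> a \<odot>\<^bsub>B.\<Omega>\<^esub> kaehler_map A B \<phi> w)"
    by (rule add_homI) (use a in \<open>auto simp: B.\<Omega>.smult_r_distr add_hom_add[OF kaehler_map_hom] add_hom_closed[OF kaehler_map_hom]\<close>)
  show "w \<in> asum A.\<Omega> {a \<odot>\<^bsub>A.\<Omega>\<^esub> A.d b |a b. a \<in> carrier A \<and> b \<in> carrier A}"
    using w A.kaehler_asum by simp
  fix v assume "v \<in> {a \<odot>\<^bsub>A.\<Omega>\<^esub> A.d b |a b. a \<in> carrier A \<and> b \<in> carrier A}"
  then obtain b c where v: "v = b \<odot>\<^bsub>A.\<Omega>\<^esub> A.d c" "b \<in> carrier A" "c \<in> carrier A" by blast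
  then show "kaehler_map A B \<phi> (a \<odot>\<^bsub>A.\<Omega>\<^esub> v) = \<phi> a \<odot>\<^bsub>B.\<Omega>\<^esub> kaehler_map A B \<phi> v"
    using a A.\<Omega>.smult_assoc1[of a b "A.d c", symmetric] B.\<Omega>.smult_assoc1[of "\<phi> a" "\<phi> b" "B.d (\<phi> c)"]
    by (simp add: kaehler_map_kd hom_mult)
qed (auto intro!: A.\<Omega>.abelian_group_axioms B.\<Omega>.abelian_group_axioms A.\<Omega>.smult_closed)

end

section \<open>Base change to a polynomial ring\<close>

lemma UP_cring_K: "UP_cring (base_field :: 'k::field ring)"
  by (simp add: UP_cring_def class_cring.is_cring)

lemma Kx0_monom:
  shows "up_ring.monom Kx0 (c::'k::field) n \<in> carrier Kx0"
    and "up_ring.monom Kx0 (c * c') (n + m) = up_ring.monom Kx0 c n \<otimes>\<^bsub>Kx0\<^esub> up_ring.monom Kx0 c' m"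
    and "up_ring.monom Kx0 (c * c') n = c \<odot>\<^bsub>Kx0\<^esub> up_ring.monom Kx0 c' n"
proof -
  interpret UP_cring "base_field :: 'k ring" Kx0 by (rule UP_cring_K)
  show "up_ring.monom Kx0 c n \<in> carrier Kx0"
    "up_ring.monom Kx0 (c * c') (n + m) = up_ring.monom Kx0 c n \<otimes>\<^bsub>Kx0\<^esub> up_ring.monom Kx0 c' m"
    "up_ring.monom Kx0 (c * c') n = c \<odot>\<^bsub>Kx0\<^esub> up_ring.monom Kx0 c' n"
    using monom_closed[of c n] monom_mult[of c c' n m] monom_mult_smult[of c c' n] by (simp_all add: class_ring_simps)
qed

lemma kalgebra_Kx0: "kalgebra (Kx0 :: ('k::field, nat \<Rightarrow> 'k) up_ring)"
  by (rule kalgebraI) (rule UP_cring.UP_algebra[OF UP_cring_K])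

text \<open>A degree bound amounts to finite support on the natural numbers. Hence
  \<open>suml\<close> can be applied to polynomials, and induction over finite support is available
  for them.\<close>

lemma carrier_UP: "carrier (UP R) = fsupp R UNIV" if "cring R"
proof -
  interpret UP_cring R "UP R" by (rule UP_cring.intro) (rule that)
  have "finite {n. f n \<noteq> \<zero>\<^bsub>R\<^esub>} \<longleftrightarrow> (\<exists>n. bound \<zero>\<^bsub>R\<^esub> n f)" for f
  proof
    assume "finite {n. f n \<noteq> \<zero>\<^bsub>R\<^esub>}"
    then obtain n where "{n. f n \<noteq> \<zero>\<^bsub>R\<^esub>} \<subseteq> {..n}" by (metis finite_nat_iff_bounded_le)
    then have "bound \<zero>\<^bsub>R\<^esub> n f" by (intro bound.intro) (auto simp: subset_iff not_le[symmetric])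
    then show "\<exists>n. bound \<zero>\<^bsub>R\<^esub> n f" ..
  next
    assume "\<exists>n. bound \<zero>\<^bsub>R\<^esub> n f"
    then obtain n where "bound \<zero>\<^bsub>R\<^esub> n f" ..
    then have "{n. f n \<noteq> \<zero>\<^bsub>R\<^esub>} \<subseteq> {..n}" by (auto simp: bound_def not_le[symmetric])
    then show "finite {n. f n \<noteq> \<zero>\<^bsub>R\<^esub>}" by (rule finite_subset) simp
  qed
  then show ?thesis by (auto simp: UP_def up_def fsupp_def)
qed

lemma UP_fun_simps:
  assumes "cring R"
  shows "\<zero>\<^bsub>UP R\<^esub> = (\<lambda>n. \<zero>\<^bsub>R\<^esub>)"
    "p \<in> carrier (UP R) \<Longrightarrow> q \<in> carrier (UP R) \<Longrightarrow> p \<oplus>\<^bsub>UP R\<^esub> q = (\<lambda>n. p n \<oplus>\<^bsub>R\<^esub> q n)"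
    "a \<in> carrier R \<Longrightarrow> up_ring.monom (UP R) a n = (\<lambda>k. if k = n then a else \<zero>\<^bsub>R\<^esub>)"
    "p \<in> carrier (UP R) \<Longrightarrow> up_ring.coeff (UP R) p = p"
    "a \<in> carrier R \<Longrightarrow> p \<in> carrier (UP R) \<Longrightarrow> a \<odot>\<^bsub>UP R\<^esub> p = (\<lambda>n. a \<otimes>\<^bsub>R\<^esub> p n)"
  by (auto simp: UP_def)

lemma UP_asum:
  assumes R: "cring R"
  shows "carrier (UP R) = asum (UP R) {up_ring.monom (UP R) a n | a n. a \<in> carrier R}"
proof -
  interpret UP_cring R "UP R" by (rule UP_cring.intro) (rule R)
  have "w \<in> asum (UP R) {up_ring.monom (UP R) a n | a n. a \<in> carrier R}" if "w \<in> fsupp R UNIV" for w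
    using R.abelian_group_axioms that
  proof (induction rule: fsupp_induct)
    case zero
    then show ?case using asum_zero[of "UP R"] by (simp add: UP_fun_simps[OF R])
  next
    case (single n a)
    then show ?case by (intro asum_base) (auto simp flip: UP_fun_simps(3)[OF R])
  next
    case (add v w)
    then show ?case using asum_add[of v "UP R" _ w] by (simp add: UP_fun_simps[OF R] carrier_UP[OF R])
  qed
  moreover have "asum (UP R) {up_ring.monom (UP R) a n | a n. a \<in> carrier R} \<subseteq> carrier (UP R)"
    by (rule asum_subset) (auto intro: P.abelian_monoid_axioms)
  ultimately show ?thesis by (auto simp: carrier_UP[OF R])
qed

context presented_module
begin

lemma suml_hom:
  assumes "abelian_group H" "\<And>x. x \<in> X \<Longrightarrow> add_hom A H (\<lambda>a. \<beta> a x)"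
  shows "add_hom F H (suml A H X \<beta>)"
    and "\<And>a x. a \<in> carrier A \<Longrightarrow> x \<in> X \<Longrightarrow> suml A H X \<beta> (a \<odot>\<^bsub>F\<^esub> free_gen A x) = \<beta> a x"
    and "\<And>a b x. a \<in> carrier A \<Longrightarrow> b \<in> carrier A \<Longrightarrow> x \<in> X \<Longrightarrow>
      suml A H X \<beta> (a \<odot>\<^bsub>F\<^esub> (b \<odot>\<^bsub>F\<^esub> free_gen A x)) = \<beta> (a \<otimes>\<^bsub>A\<^esub> b) x"
proof -
  interpret H: abelian_group H by (fact assms)
  interpret s: suml_loc A H X \<beta> by unfold_locales (rule assms(2))
  show "add_hom F H (suml A H X \<beta>)"
    by (rule add_homI) (auto simp: free_mod_simps s.suml_closed s.suml_add)
  show 1: "suml A H X \<beta> (a \<odot>\<^bsub>F\<^esub> free_gen A x) = \<beta> a x" if "a \<in> carrier A" "x \<in> X" for a x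
  proof -
    have "a \<odot>\<^bsub>F\<^esub> free_gen A x = (\<lambda>y. if y = x then a else \<zero>\<^bsub>A\<^esub>)"
      using that by (auto simp: free_mod_simps free_gen_def)
    then show ?thesis using s.suml_single that by simp
  qed
  show "suml A H X \<beta> (a \<odot>\<^bsub>F\<^esub> (b \<odot>\<^bsub>F\<^esub> free_gen A x)) = \<beta> (a \<otimes>\<^bsub>A\<^esub> b) x"
    if "a \<in> carrier A" "b \<in> carrier A" "x \<in> X" for a b x
    using QM.F.smult_assoc1[OF that(1,2) free_gen_closed[OF that(3)]] 1[OF A.m_closed[OF that(1,2)] that(3)] by simp
qed

text \<open>Relations are differences of two expressions u and v; instead of killing all multiples
  of u - v it is enough to give the multiples of u and of v the same value.\<close>

lemma lift_difference:
  assumes H: "abelian_group H" and \<beta>: "\<And>x. x \<in> X \<Longrightarrow> add_hom A H (\<lambda>a. \<beta> a x)"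
    and rel: "\<And>w. w \<in> rels \<Longrightarrow> \<exists>u\<in>carrier F. \<exists>v\<in>carrier F. w = u \<ominus>\<^bsub>F\<^esub> v \<and>
      (\<forall>a\<in>carrier A. suml A H X \<beta> (a \<odot>\<^bsub>F\<^esub> u) = suml A H X \<beta> (a \<odot>\<^bsub>F\<^esub> v))"
  shows "\<exists>L. add_hom Q H L \<and> (\<forall>a\<in>carrier A. \<forall>x\<in>X. L (a \<odot>\<^bsub>Q\<^esub> gen x) = \<beta> a x)"
proof -
  interpret H: abelian_group H by (fact H)
  let ?s = "suml A H X \<beta>"
  have s: "add_hom F H ?s" by (rule suml_hom(1)[OF H]) (rule \<beta>)
  have kill: "?s (a \<odot>\<^bsub>F\<^esub> w) = \<zero>\<^bsub>H\<^esub>" if a: "a \<in> carrier A" and "w \<in> rels" for a w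
  proof -
    obtain u v where uv: "u \<in> carrier F" "v \<in> carrier F" "w = u \<ominus>\<^bsub>F\<^esub> v" "?s (a \<odot>\<^bsub>F\<^esub> u) = ?s (a \<odot>\<^bsub>F\<^esub> v)"
      using rel[OF \<open>w \<in> rels\<close>] a by blast
    have "a \<odot>\<^bsub>F\<^esub> w = a \<odot>\<^bsub>F\<^esub> u \<ominus>\<^bsub>F\<^esub> a \<odot>\<^bsub>F\<^esub> v"
      using uv(1-3) a by (simp add: a_minus_def QM.F.smult_r_distr QM.F.smult_r_minus)
    then show ?thesis
      using add_hom_minus[OF s QM.F.abelian_group_axioms H, of "a \<odot>\<^bsub>F\<^esub> u" "a \<odot>\<^bsub>F\<^esub> v"]
        QM.F.smult_closed a uv add_hom_closed[OF s, of "a \<odot>\<^bsub>F\<^esub> v"] by (simp add: a_minus_def H.r_neg)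
  qed
  note lift[of H \<beta>, OF H]
  then show ?thesis using \<beta> kill by blast
qed

end

locale kspace = V: vectorspace base_field N for N :: "('k::field, 'm, 'z) module_scheme"
begin

abbreviation "BC \<equiv> base_change Kx0 N"

sublocale KX: kalgebra Kx0 by (rule kalgebra_Kx0)

sublocale BP: presented_module Kx0 "carrier N" "base_change_rels Kx0 N"
proof unfold_locales
  interpret F: Module.module Kx0 "free_mod Kx0 (carrier N)" by (rule module_free_mod) (fact KX.A.cring_axioms)
  have "free_gen Kx0 a \<in> carrier (free_mod Kx0 (carrier N))" if "a \<in> carrier N" for a
    using that by (auto simp: free_mod_simps fsupp_def free_gen_def)
  moreover have "c \<odot>\<^bsub>N\<^esub> m \<in> carrier N" if "m \<in> carrier N" for c m using that V.smult_closed[of c m] by simp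
  ultimately have "base_change_rels Kx0 N \<subseteq> carrier (free_mod Kx0 (carrier N))"
    unfolding base_change_rels_def Let_def
    by (auto intro!: F.M.minus_closed F.M.a_closed F.smult_closed V.M.a_closed kalgebra.alg_map_closed[OF kalgebra_Kx0])
  then show "base_change_rels Kx0 N \<subseteq> fsupp Kx0 (carrier N)" by (simp add: free_mod_simps)
qed

lemma BP_Q: "BP.Q = BC" and BP_N: "BP.N = base_change_sub Kx0 N"
  by (auto simp: BP.Q_def BP.N_def base_change_def base_change_sub_def)

lemma tensor_eq: "tensor Kx0 N p m = p \<odot>\<^bsub>BC\<^esub> BP.gen m"
  by (simp add: tensor_def BP.gen_def BP_N)

sublocale BC: Module.module Kx0 BC
  using BP.module_Q by (simp only: BP_Q)

abbreviation "gen \<equiv> BP.gen"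

lemma gen_closed [simp, intro]: "m \<in> carrier N \<Longrightarrow> gen m \<in> carrier BC"
  using BP.gen_closed by (simp only: BP_Q)

lemma N_smult_closed [simp, intro]: "m \<in> carrier N \<Longrightarrow> c \<odot>\<^bsub>N\<^esub> m \<in> carrier N"
  using V.smult_closed[of c m] by simp

lemma BC_asum: "carrier BC = asum BC {p \<odot>\<^bsub>BC\<^esub> gen m | p m. p \<in> carrier Kx0 \<and> m \<in> carrier N}"
  using BP.Q_asum by (simp only: BP_Q)

lemma gen_rel:
  assumes "u \<ominus>\<^bsub>BP.F\<^esub> v \<in> base_change_rels Kx0 N" "u \<in> carrier BP.F" "v \<in> carrier BP.F"
  shows "BP.N +>\<^bsub>BP.F\<^esub> u = BP.N +>\<^bsub>BP.F\<^esub> v"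
  using BP.QM.quot_eq_iff[OF assms(2,3)] BP.QM.F.in_own_span[OF BP.rels_carrier] assms(1)
  unfolding BP.N_def[symmetric] by blast

lemma gen_add:
  assumes "m \<in> carrier N" "n \<in> carrier N" shows "gen (m \<oplus>\<^bsub>N\<^esub> n) = gen m \<oplus>\<^bsub>BC\<^esub> gen n"
proof -
  let ?u = "free_gen Kx0 (m \<oplus>\<^bsub>N\<^esub> n)" and ?v = "free_gen Kx0 m \<oplus>\<^bsub>BP.F\<^esub> free_gen Kx0 n"
  have "?u \<ominus>\<^bsub>BP.F\<^esub> ?v \<in> base_change_rels Kx0 N" using assms unfolding base_change_rels_def Let_def by blast
  then have "BP.N +>\<^bsub>BP.F\<^esub> ?u = BP.N +>\<^bsub>BP.F\<^esub> ?v"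
    using assms by (intro gen_rel BP.QM.F.M.a_closed BP.free_gen_closed V.M.a_closed)
  then show ?thesis using assms BP.QM.quot_add[OF BP.free_gen_closed BP.free_gen_closed]
    unfolding BP.gen_def BP_Q[symmetric] BP.Q_def by simp
qed

lemma gen_smult:
  assumes "m \<in> carrier N" shows "gen (c \<odot>\<^bsub>N\<^esub> m) = alg_map Kx0 c \<odot>\<^bsub>BC\<^esub> gen m"
proof -
  let ?u = "free_gen Kx0 (c \<odot>\<^bsub>N\<^esub> m)" and ?v = "alg_map Kx0 c \<odot>\<^bsub>BP.F\<^esub> free_gen Kx0 m"
  have "?u \<ominus>\<^bsub>BP.F\<^esub> ?v \<in> base_change_rels Kx0 N" using assms unfolding base_change_rels_def Let_def by blast
  then have "BP.N +>\<^bsub>BP.F\<^esub> ?u = BP.N +>\<^bsub>BP.F\<^esub> ?v"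
    using assms by (intro gen_rel BP.free_gen_closed BP.QM.F.smult_closed N_smult_closed KX.alg_map_closed)
  then show ?thesis using assms BP.QM.quot_smult[OF KX.alg_map_closed BP.free_gen_closed]
    unfolding BP.gen_def BP_Q[symmetric] BP.Q_def by simp
qed

text \<open>Universal property for biadditive maps that are balanced over \<open>K\<close>. As the
  target is only a group, it covers the coefficient maps into \<open>N\<close>, which are not linear
  over the polynomial ring, as well as maps into the differentials of the fraction ring.\<close>

lemma base_change_lift:
  assumes H: "abelian_group H"
    and l: "\<And>m. m \<in> carrier N \<Longrightarrow> add_hom Kx0 H (\<lambda>p. \<beta> p m)"
    and r: "\<And>p. p \<in> carrier Kx0 \<Longrightarrow> add_hom N H (\<beta> p)"
    and scal: "\<And>p m c. p \<in> carrier Kx0 \<Longrightarrow> m \<in> carrier N \<Longrightarrow> \<beta> p (c \<odot>\<^bsub>N\<^esub> m) = \<beta> (c \<odot>\<^bsub>Kx0\<^esub> p) m"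
  shows "\<exists>L. add_hom BC H L \<and> (\<forall>p\<in>carrier Kx0. \<forall>m\<in>carrier N. L (p \<odot>\<^bsub>BC\<^esub> gen m) = \<beta> p m)"
proof -
  let ?s = "suml Kx0 H (carrier N) \<beta>"
  have s: "add_hom BP.F H ?s" by (rule BP.suml_hom(1)[OF H]) (rule l)
  have s1: "?s (p \<odot>\<^bsub>BP.F\<^esub> free_gen Kx0 m) = \<beta> p m" if "p \<in> carrier Kx0" "m \<in> carrier N" for p m
    by (rule BP.suml_hom(2)[OF H _ that]) (rule l)
  have s2: "?s (p \<odot>\<^bsub>BP.F\<^esub> (q \<odot>\<^bsub>BP.F\<^esub> free_gen Kx0 m)) = \<beta> (p \<otimes>\<^bsub>Kx0\<^esub> q) m"
    if "p \<in> carrier Kx0" "q \<in> carrier Kx0" "m \<in> carrier N" for p q m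
    by (rule BP.suml_hom(3)[OF H _ that]) (rule l)
  note cl = BP.free_gen_closed BP.QM.F.smult_closed BP.QM.F.M.a_closed
  have sadd: "?s (a \<odot>\<^bsub>BP.F\<^esub> (u \<oplus>\<^bsub>BP.F\<^esub> v)) = ?s (a \<odot>\<^bsub>BP.F\<^esub> u) \<oplus>\<^bsub>H\<^esub> ?s (a \<odot>\<^bsub>BP.F\<^esub> v)"
    if "a \<in> carrier Kx0" "u \<in> carrier BP.F" "v \<in> carrier BP.F" for a u v
    using that by (simp add: BP.QM.F.smult_r_distr add_hom_add[OF s])
  have "\<exists>L. add_hom BP.Q H L \<and> (\<forall>p\<in>carrier Kx0. \<forall>m\<in>carrier N. L (p \<odot>\<^bsub>BP.Q\<^esub> gen m) = \<beta> p m)"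
  proof (rule BP.lift_difference[OF H l])
    fix w assume "w \<in> base_change_rels Kx0 N"
    then show "\<exists>u\<in>carrier BP.F. \<exists>v\<in>carrier BP.F. w = u \<ominus>\<^bsub>BP.F\<^esub> v \<and>
      (\<forall>a\<in>carrier Kx0. ?s (a \<odot>\<^bsub>BP.F\<^esub> u) = ?s (a \<odot>\<^bsub>BP.F\<^esub> v))"
      unfolding base_change_rels_def Let_def
    proof (elim UnE CollectE exE conjE)
      fix m n assume w: "w = free_gen Kx0 (m \<oplus>\<^bsub>N\<^esub> n) \<ominus>\<^bsub>BP.F\<^esub> (free_gen Kx0 m \<oplus>\<^bsub>BP.F\<^esub> free_gen Kx0 n)"
        and mn: "m \<in> carrier N" "n \<in> carrier N"
      show ?thesis
        by (rule bexI[of _ "free_gen Kx0 (m \<oplus>\<^bsub>N\<^esub> n)"], rule bexI[of _ "free_gen Kx0 m \<oplus>\<^bsub>BP.F\<^esub> free_gen Kx0 n"])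
           (use w mn in \<open>simp_all add: cl sadd s1 add_hom_add[OF r]\<close>)
    next
      fix c m assume w: "w = free_gen Kx0 (c \<odot>\<^bsub>N\<^esub> m) \<ominus>\<^bsub>BP.F\<^esub> alg_map Kx0 c \<odot>\<^bsub>BP.F\<^esub> free_gen Kx0 m"
        and m: "m \<in> carrier N"
      show ?thesis
        by (rule bexI[of _ "free_gen Kx0 (c \<odot>\<^bsub>N\<^esub> m)"], rule bexI[of _ "alg_map Kx0 c \<odot>\<^bsub>BP.F\<^esub> free_gen Kx0 m"])
           (use w m in \<open>simp_all add: cl s1 s2 scal KX.A.m_comm[of _ "alg_map Kx0 c"] KX.alg_map_mult\<close>)
    qed
  qed
  then show ?thesis by (simp only: BP_Q)
qed

definition "x0pow k m = tensor Kx0 N (up_ring.monom Kx0 1 k) m"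

lemma monom_closed [simp, intro]: "up_ring.monom Kx0 (c::'k) k \<in> carrier Kx0"
  using Kx0_monom(1) .

lemma x0pow_hom: "add_hom N BC (x0pow k)"
  by (rule add_homI) (auto simp: x0pow_def tensor_eq gen_add BC.smult_r_distr intro!: BC.smult_closed)

lemma x0pow_closed [simp, intro]: "m \<in> carrier N \<Longrightarrow> x0pow k m \<in> carrier BC"
  using add_hom_closed[OF x0pow_hom] .

lemma monom_gen: 
  assumes "m \<in> carrier N"
  shows "up_ring.monom Kx0 c k \<odot>\<^bsub>BC\<^esub> gen m = x0pow k (c \<odot>\<^bsub>N\<^esub> m)"
proof -
  have "up_ring.monom Kx0 c k = up_ring.monom Kx0 1 k \<otimes>\<^bsub>Kx0\<^esub> alg_map Kx0 c"
    using Kx0_monom(3)[of c 1 k] KX.A.m_comm[of "up_ring.monom Kx0 1 k" "alg_map Kx0 c"]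
    by (simp add: KX.alg_map_mult class_ring_simps)
  then show ?thesis using assms BC.smult_assoc1[of "up_ring.monom Kx0 1 k" "alg_map Kx0 c" "gen m"]
    by (simp add: x0pow_def tensor_eq gen_smult)
qed

lemma monom_x0pow:
  assumes "m \<in> carrier N"
  shows "up_ring.monom Kx0 c j \<odot>\<^bsub>BC\<^esub> x0pow k m = x0pow (j + k) (c \<odot>\<^bsub>N\<^esub> m)"
proof -
  have "up_ring.monom Kx0 c j \<odot>\<^bsub>BC\<^esub> x0pow k m = (up_ring.monom Kx0 c j \<otimes>\<^bsub>Kx0\<^esub> up_ring.monom Kx0 1 k) \<odot>\<^bsub>BC\<^esub> gen m"
    using assms by (simp add: x0pow_def tensor_eq BC.smult_assoc1)
  also have "up_ring.monom Kx0 c j \<otimes>\<^bsub>Kx0\<^esub> up_ring.monom Kx0 1 k = up_ring.monom Kx0 c (j + k)"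
    using Kx0_monom(2)[of c 1 j k] by (simp add: class_ring_simps)
  finally show ?thesis using monom_gen[OF assms] by simp
qed

lemma BC_asum_x0pow: "carrier BC = asum BC {x0pow k m | k m. m \<in> carrier N}"
proof
  show "asum BC {x0pow k m | k m. m \<in> carrier N} \<subseteq> carrier BC"
    by (rule asum_subset) (auto intro: BC.M.abelian_monoid_axioms)
  have "p \<odot>\<^bsub>BC\<^esub> gen m \<in> asum BC {x0pow k m | k m. m \<in> carrier N}"
    if m: "m \<in> carrier N" and p: "p \<in> asum Kx0 {up_ring.monom Kx0 a n | a n. a \<in> carrier base_field}" for p m
    using p
  proof induction
    case asum_zero
    then show ?case using m by (simp add: asum.asum_zero)
  next
    case (asum_base b)
    then obtain a n where "b = up_ring.monom Kx0 a n" by blast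
    then have "b \<odot>\<^bsub>BC\<^esub> gen m = x0pow n (a \<odot>\<^bsub>N\<^esub> m)" using monom_gen[OF m] by simp
    then show ?case using N_smult_closed[OF m] by (intro asum.asum_base) blast
  next
    case (asum_add x y)
    then have "x \<in> carrier Kx0" "y \<in> carrier Kx0" using UP_asum[OF class_cring.is_cring] by auto
    then have "(x \<oplus>\<^bsub>Kx0\<^esub> y) \<odot>\<^bsub>BC\<^esub> gen m = x \<odot>\<^bsub>BC\<^esub> gen m \<oplus>\<^bsub>BC\<^esub> y \<odot>\<^bsub>BC\<^esub> gen m"
      using m by (simp add: BC.smult_l_distr)
    then show ?case using asum_add.IH by (simp only: asum.asum_add)
  qed
  then show "carrier BC \<subseteq> asum BC {x0pow k m | k m. m \<in> carrier N}"
    unfolding BC_asum UP_asum[OF class_cring.is_cring] by (intro asum_mono) blast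
qed

text \<open>The coefficient of x_0^n comes from the balanced map (p, m) \<mapsto> p_n m. One map is
  obtained for each n, and choice combines them; \<open>bcoef_zeroD\<close> will show that together
  they separate the elements of the base change.\<close>

lemma bcoef_ex: "\<exists>C. \<forall>n. add_hom BC N (\<lambda>t. C t n) \<and>
    (\<forall>p\<in>carrier Kx0. \<forall>m\<in>carrier N. C (p \<odot>\<^bsub>BC\<^esub> gen m) n = p n \<odot>\<^bsub>N\<^esub> m)"
proof -
  have "\<exists>L. add_hom BC N L \<and> (\<forall>p\<in>carrier Kx0. \<forall>m\<in>carrier N. L (p \<odot>\<^bsub>BC\<^esub> gen m) = p n \<odot>\<^bsub>N\<^esub> m)" for n
  proof (rule base_change_lift[OF V.M.abelian_group_axioms])
    note fs = UP_fun_simps[OF class_cring.is_cring[where 'a='k]]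
    show "add_hom Kx0 N (\<lambda>p. p n \<odot>\<^bsub>N\<^esub> m)" if "m \<in> carrier N" for m
      using that V.smult_l_distr[of _ _ m] by (auto intro!: add_homI simp: fs(2))
    show "add_hom N N (\<lambda>m. p n \<odot>\<^bsub>N\<^esub> m)" for p :: "nat \<Rightarrow> 'k"
      using V.smult_r_distr[of "p n"] by (auto intro!: add_homI)
    show "p n \<odot>\<^bsub>N\<^esub> (c \<odot>\<^bsub>N\<^esub> m) = (c \<odot>\<^bsub>Kx0\<^esub> p) n \<odot>\<^bsub>N\<^esub> m" if "p \<in> carrier Kx0" "m \<in> carrier N" for p c m
      using that V.smult_assoc1[of "p n" c m] fs(5)[of c p] by (simp add: class_ring_simps mult.commute)
  qed
  then have "\<forall>n. \<exists>L. add_hom BC N L \<and> (\<forall>p\<in>carrier Kx0. \<forall>m\<in>carrier N. L (p \<odot>\<^bsub>BC\<^esub> gen m) = p n \<odot>\<^bsub>N\<^esub> m)" by blast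
  then obtain L where "\<forall>n. add_hom BC N (L n) \<and> (\<forall>p\<in>carrier Kx0. \<forall>m\<in>carrier N. L n (p \<odot>\<^bsub>BC\<^esub> gen m) = p n \<odot>\<^bsub>N\<^esub> m)"
    by (auto dest: choice)
  then show ?thesis by (intro exI[of _ "\<lambda>t n. L n t"]) simp
qed

definition "bcoef = (SOME C. \<forall>n. add_hom BC N (\<lambda>t. C t n) \<and>
    (\<forall>p\<in>carrier Kx0. \<forall>m\<in>carrier N. C (p \<odot>\<^bsub>BC\<^esub> gen m) n = p n \<odot>\<^bsub>N\<^esub> m))"

lemma bcoef_hom: "add_hom BC N (\<lambda>t. bcoef t n)"
  and bcoef_gen: "p \<in> carrier Kx0 \<Longrightarrow> m \<in> carrier N \<Longrightarrow> bcoef (p \<odot>\<^bsub>BC\<^esub> gen m) n = p n \<odot>\<^bsub>N\<^esub> m"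
  using someI_ex[OF bcoef_ex] unfolding bcoef_def[symmetric] by blast+

lemma bcoef_x0pow: "m \<in> carrier N \<Longrightarrow> bcoef (x0pow k m) = (\<lambda>n. if n = k then m else \<zero>\<^bsub>N\<^esub>)"
  using V.smult_one[of m] V.smult_l_null[of m] UP_fun_simps(3)[OF class_cring.is_cring[where 'a='k], of 1 k]
  by (auto simp: x0pow_def tensor_eq bcoef_gen fun_eq_iff)

lemma bcoef_zero: "bcoef \<zero>\<^bsub>BC\<^esub> = (\<lambda>n. \<zero>\<^bsub>N\<^esub>)"
  using add_hom_zero[OF bcoef_hom BC.M.abelian_group_axioms V.M.abelian_group_axioms] by auto

lemma bcoef_add: "s \<in> carrier BC \<Longrightarrow> t \<in> carrier BC \<Longrightarrow> bcoef (s \<oplus>\<^bsub>BC\<^esub> t) = (\<lambda>n. bcoef s n \<oplus>\<^bsub>N\<^esub> bcoef t n)"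
  using add_hom_add[OF bcoef_hom] by auto

lemma bcoef_fsupp:
  assumes "t \<in> carrier BC" shows "bcoef t \<in> fsupp N UNIV"
proof -
  interpret suml_loc N N "UNIV :: nat set" "\<lambda>a x. \<zero>\<^bsub>N\<^esub>"
    by unfold_locales (auto simp: add_hom_def)
  have "t \<in> asum BC {x0pow k m | k m. m \<in> carrier N}" using assms BC_asum_x0pow by simp
  then show ?thesis
  proof induction
    case asum_zero
    then show ?case by (simp add: bcoef_zero fsupp_def)
  next
    case (asum_base b)
    then show ?case by (auto simp: bcoef_x0pow fsupp_def)
  next
    case (asum_add x y)
    then show ?case using BC_asum_x0pow by (simp add: bcoef_add fsupp_add)
  qed
qed

end

section \<open>Polynomials over an algebra\<close>

text \<open>Transport of structure along a bijection. It is applied with the identity to records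
  that share their ring operations, and along \<open>W\<close> to the fraction ring, whose
  operations are unions of classes and would be awkward to verify directly.\<close>

lemma cring_transport:
  assumes A: "cring A" and bij: "bij_betw f (carrier A) (carrier B)"
    and ops: "\<And>x y. x \<in> carrier A \<Longrightarrow> y \<in> carrier A \<Longrightarrow> f x \<oplus>\<^bsub>B\<^esub> f y = f (x \<oplus>\<^bsub>A\<^esub> y)"
      "\<And>x y. x \<in> carrier A \<Longrightarrow> y \<in> carrier A \<Longrightarrow> f x \<otimes>\<^bsub>B\<^esub> f y = f (x \<otimes>\<^bsub>A\<^esub> y)"
      "f \<one>\<^bsub>A\<^esub> = \<one>\<^bsub>B\<^esub>" "f \<zero>\<^bsub>A\<^esub> = \<zero>\<^bsub>B\<^esub>"
  shows "cring B"
proof -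
  interpret A: cring A by (fact A)
  have im: "carrier B = f ` carrier A" using bij by (simp add: bij_betw_def)
  have o: "f (\<ominus>\<^bsub>A\<^esub> x) \<in> carrier B" "f (\<ominus>\<^bsub>A\<^esub> x) \<oplus>\<^bsub>B\<^esub> f x = \<zero>\<^bsub>B\<^esub>" if "x \<in> carrier A" for x
    using that ops by (auto simp: im A.l_neg)
  show ?thesis
  proof (intro cringI abelian_groupI comm_monoidI)
    show "\<exists>y\<in>carrier B. y \<oplus>\<^bsub>B\<^esub> x = \<zero>\<^bsub>B\<^esub>" if "x \<in> carrier B" for x
      using that o unfolding im by blast
    show "\<zero>\<^bsub>B\<^esub> \<in> carrier B" "\<one>\<^bsub>B\<^esub> \<in> carrier B"
      unfolding im ops(3,4)[symmetric] by auto
    show "\<zero>\<^bsub>B\<^esub> \<oplus>\<^bsub>B\<^esub> x = x" "\<one>\<^bsub>B\<^esub> \<otimes>\<^bsub>B\<^esub> x = x" if "x \<in> carrier B" for x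
      using that unfolding im ops(3,4)[symmetric] by (auto simp: ops(1,2))
  qed (unfold im, auto simp: ops(1,2) A.a_ac A.m_ac A.l_distr A.r_distr)
qed

lemma kalgebra_transport:
  assumes A: "kalgebra A" and bij: "bij_betw f (carrier A) (carrier B)"
    and ops: "\<And>x y. x \<in> carrier A \<Longrightarrow> y \<in> carrier A \<Longrightarrow> f x \<oplus>\<^bsub>B\<^esub> f y = f (x \<oplus>\<^bsub>A\<^esub> y)"
      "\<And>x y. x \<in> carrier A \<Longrightarrow> y \<in> carrier A \<Longrightarrow> f x \<otimes>\<^bsub>B\<^esub> f y = f (x \<otimes>\<^bsub>A\<^esub> y)"
      "f \<one>\<^bsub>A\<^esub> = \<one>\<^bsub>B\<^esub>" "f \<zero>\<^bsub>A\<^esub> = \<zero>\<^bsub>B\<^esub>"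
      "\<And>c x. x \<in> carrier A \<Longrightarrow> c \<odot>\<^bsub>B\<^esub> f x = f (c \<odot>\<^bsub>A\<^esub> x)"
  shows "kalgebra B"
proof -
  interpret A: kalgebra A by (fact A)
  have im: "carrier B = f ` carrier A" using bij by (simp add: bij_betw_def)
  show ?thesis
  proof (rule kalgebraI, intro algebraI class_cring.is_cring)
    show "cring B" using A.A.cring_axioms bij ops(1-4) by (rule cring_transport)
  qed (unfold im, auto simp: ops A.smult_plus A.smult_add A.smult_times A.smult_mult class_ring_simps)
qed

lemma alg_via_simps [simp]:
  "carrier (alg_via h A) = carrier A" "\<zero>\<^bsub>alg_via h A\<^esub> = \<zero>\<^bsub>A\<^esub>" "\<one>\<^bsub>alg_via h A\<^esub> = \<one>\<^bsub>A\<^esub>"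
  "add (alg_via h A) = add A" "monoid.mult (alg_via h A) = monoid.mult A"
  "smult (alg_via h A) = (\<lambda>c x. h c \<otimes>\<^bsub>A\<^esub> x)"
  by (simp_all add: alg_via_def)

lemma algebra_alg_via:
  assumes A: "cring A" and K: "cring K" and h: "h \<in> Ring.ring_hom K A"
  shows "algebra K (alg_via h A)"
proof -
  interpret A: cring A by (fact A)
  have c: "cring (alg_via h A)"
    by (rule cring_transport[OF A, of id]) auto
  show ?thesis
    by (rule algebraI[OF K c])
       (use ring_hom_closed[OF h] in \<open>auto simp: ring_hom_add[OF h] ring_hom_mult[OF h] ring_hom_one[OF h]
          A.l_distr A.r_distr A.m_assoc\<close>)
qed

context kalgebra
begin

abbreviation "T \<equiv> poly_alg1 A"
definition "pmon a n = up_ring.monom (UP A) a n"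

lemma UP_A: "UP_cring A" by (rule UP_cring.intro) (rule A.cring_axioms)

lemma pmon_fun: "a \<in> carrier A \<Longrightarrow> pmon a n = (\<lambda>k. if k = n then a else \<zero>\<^bsub>A\<^esub>)"
  by (simp add: pmon_def UP_fun_simps[OF A.cring_axioms])

lemma T_fun:
  "\<zero>\<^bsub>T\<^esub> = (\<lambda>n. \<zero>\<^bsub>A\<^esub>)" "carrier T = fsupp A UNIV" "carrier T = carrier (UP A)"
  "p \<in> carrier T \<Longrightarrow> q \<in> carrier T \<Longrightarrow> p \<oplus>\<^bsub>T\<^esub> q = (\<lambda>n. p n \<oplus>\<^bsub>A\<^esub> q n)"
  "\<one>\<^bsub>T\<^esub> = pmon \<one>\<^bsub>A\<^esub> 0"
proof -
  interpret UP_cring A "UP A" by (rule UP_A)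
  show "\<zero>\<^bsub>T\<^esub> = (\<lambda>n. \<zero>\<^bsub>A\<^esub>)" "carrier T = fsupp A UNIV" "carrier T = carrier (UP A)"
    "p \<in> carrier T \<Longrightarrow> q \<in> carrier T \<Longrightarrow> p \<oplus>\<^bsub>T\<^esub> q = (\<lambda>n. p n \<oplus>\<^bsub>A\<^esub> q n)"
    "\<one>\<^bsub>T\<^esub> = pmon \<one>\<^bsub>A\<^esub> 0"
    by (simp_all add: poly_alg1_def UP_fun_simps[OF A.cring_axioms] carrier_UP[OF A.cring_axioms] pmon_def)
qed

lemma T_coeff [simp, intro]: "p \<in> carrier T \<Longrightarrow> p n \<in> carrier A"
  by (auto simp: T_fun fsupp_def)

lemma const_hom: "(\<lambda>c. up_ring.monom (UP A) (alg_map A c) 0) \<in> Ring.ring_hom base_field (UP A)"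
proof -
  interpret UP_cring A "UP A" by (rule UP_A)
  show ?thesis
  proof (rule ring_hom_memI)
    fix x y :: 'k
    show "monom (UP A) (alg_map A (x \<otimes>\<^bsub>base_field\<^esub> y)) 0 = monom (UP A) (alg_map A x) 0 \<otimes>\<^bsub>UP A\<^esub> monom (UP A) (alg_map A y) 0"
      using monom_mult[of "alg_map A x" "alg_map A y" 0 0] ring_hom_mult[OF alg_map_hom, of x y] by simp
    show "monom (UP A) (alg_map A (x \<oplus>\<^bsub>base_field\<^esub> y)) 0 = monom (UP A) (alg_map A x) 0 \<oplus>\<^bsub>UP A\<^esub> monom (UP A) (alg_map A y) 0"
      using ring_hom_add[OF alg_map_hom, of x y] by simp
    show "monom (UP A) (alg_map A \<one>\<^bsub>base_field\<^esub>) 0 = \<one>\<^bsub>UP A\<^esub>"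
      using ring_hom_one[OF alg_map_hom] by simp
  qed simp
qed

lemma kalgebra_T: "kalgebra T"
proof -
  interpret UP_cring A "UP A" by (rule UP_A)
  show ?thesis unfolding poly_alg1_def
    by (rule kalgebraI) (rule algebra_alg_via[OF UP_cring class_cring.is_cring const_hom])
qed

lemma pmon_closed [simp, intro]: "a \<in> carrier A \<Longrightarrow> pmon a n \<in> carrier T"
  using UP_ring.monom_closed[of A a n] UP_A
  by (simp add: pmon_def T_fun(3) UP_ring_def UP_cring_def A.ring_axioms)

lemma pmon_coeff: "a \<in> carrier A \<Longrightarrow> pmon a n k = (if k = n then a else \<zero>\<^bsub>A\<^esub>)"
  by (simp add: pmon_fun)

lemma pmon_add: "a \<in> carrier A \<Longrightarrow> b \<in> carrier A \<Longrightarrow> pmon (a \<oplus>\<^bsub>A\<^esub> b) n = pmon a n \<oplus>\<^bsub>T\<^esub> pmon b n"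
  by (rule ext) (simp add: T_fun(4) pmon_coeff)

lemma pmon_zero [simp]: "pmon \<zero>\<^bsub>A\<^esub> n = \<zero>\<^bsub>T\<^esub>" by (auto simp: T_fun(1) pmon_fun)

lemma pmon_mult: "a \<in> carrier A \<Longrightarrow> b \<in> carrier A \<Longrightarrow> pmon a n \<otimes>\<^bsub>T\<^esub> pmon b m = pmon (a \<otimes>\<^bsub>A\<^esub> b) (n + m)"
proof -
  interpret UP_cring A "UP A" by (rule UP_A)
  show "a \<in> carrier A \<Longrightarrow> b \<in> carrier A \<Longrightarrow> pmon a n \<otimes>\<^bsub>T\<^esub> pmon b m = pmon (a \<otimes>\<^bsub>A\<^esub> b) (n + m)"
    using monom_mult[of a b n m] by (simp add: pmon_def poly_alg1_def)
qed

lemma T_smult_pmon: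
  assumes "a \<in> carrier A" shows "c \<odot>\<^bsub>T\<^esub> pmon a n = pmon (c \<odot>\<^bsub>A\<^esub> a) n"
proof -
  have "c \<odot>\<^bsub>T\<^esub> pmon a n = pmon (alg_map A c) 0 \<otimes>\<^bsub>T\<^esub> pmon a n" by (simp add: poly_alg1_def pmon_def)
  then show ?thesis using assms by (simp add: pmon_mult alg_map_mult)
qed

lemma T_asum: "carrier T = asum T {pmon a n | a n. a \<in> carrier A}"
proof -
  have "asum T B = asum (UP A) B" for B by (rule asum_cong) (simp_all add: poly_alg1_def)
  then show ?thesis using UP_asum[OF A.cring_axioms] by (simp add: T_fun(3) pmon_def)
qed

lemma pmon_inj: "a \<in> carrier A \<Longrightarrow> b \<in> carrier A \<Longrightarrow> pmon a n = pmon b n \<longleftrightarrow> a = b"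
  by (metis pmon_coeff)

lemma pmon_pow: "pmon \<one>\<^bsub>A\<^esub> 1 [^]\<^bsub>T\<^esub> (n::nat) = pmon \<one>\<^bsub>A\<^esub> n"
proof -
  interpret T: kalgebra T by (rule kalgebra_T)
  show ?thesis by (induction n) (simp_all add: T_fun(5) pmon_mult)
qed

lemma poly_scalar_hom:
  assumes y: "y \<in> carrier A"
  shows "poly_scalar A y \<in> Ring.ring_hom Kx0 A"
    and "poly_scalar A y (up_ring.monom Kx0 c n) = c \<odot>\<^bsub>A\<^esub> y [^]\<^bsub>A\<^esub> n"
proof -
  interpret UP_pre_univ_prop base_field A "alg_map A" Kx0
    using class_cring.is_cring A.cring_axioms alg_map_hom
    by (simp add: UP_pre_univ_prop_def ring_hom_cring_def ring_hom_cring_axioms_def UP_cring_def)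
  show "poly_scalar A y \<in> Ring.ring_hom Kx0 A" unfolding poly_scalar_def by (rule eval_ring_hom[OF y])
  show "poly_scalar A y (up_ring.monom Kx0 c n) = c \<odot>\<^bsub>A\<^esub> y [^]\<^bsub>A\<^esub> n"
    unfolding poly_scalar_def using eval_monom[of c y n] y by (simp add: alg_map_mult)
qed

end

section \<open>The truncated integral closure as a polynomial ring\<close>

text \<open>\<open>h\<close> is the dehomogenization and \<open>comp n\<close> the projection onto the component of degree \<open>n\<close>.\<close>

locale graded_deh = R: kalgebra R + S: kalgebra S + h: kalgebra_hom R S h
  for R :: "('k::field, 'a, 'y) module_scheme" and S :: "('k, 's, 'z) module_scheme" and h :: "'a \<Rightarrow> 's" +
  fixes G :: "int \<Rightarrow> 'a set" and comp :: "nat \<Rightarrow> 'a \<Rightarrow> 'a" and x :: 'a and X :: "'a set" and r :: nat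
  assumes G_sub: "G i \<subseteq> carrier R"
    and G_zero: "\<zero>\<^bsub>R\<^esub> \<in> G i"
    and G_add: "a \<in> G i \<Longrightarrow> b \<in> G i \<Longrightarrow> a \<oplus>\<^bsub>R\<^esub> b \<in> G i"
    and G_smult: "a \<in> G i \<Longrightarrow> c \<odot>\<^bsub>R\<^esub> a \<in> G i"
    and G_mult: "a \<in> G i \<Longrightarrow> b \<in> G j \<Longrightarrow> a \<otimes>\<^bsub>R\<^esub> b \<in> G (i + j)"
    and G_one: "\<one>\<^bsub>R\<^esub> \<in> G 0"
    and G_neg: "i < 0 \<Longrightarrow> G i = {\<zero>\<^bsub>R\<^esub>}"
    and comp_hom: "add_hom R R (comp n)"
    and comp_G: "a \<in> G (int m) \<Longrightarrow> comp n a = (if n = m then a else \<zero>\<^bsub>R\<^esub>)"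
    and R_asum: "carrier R = asum R (\<Union>n. G (int n))"
    and x_G: "x \<in> G 1" and h_x: "h x = \<one>\<^bsub>S\<^esub>"
    and h_inj: "inj_on h (G i)"
    and h_surj: "int r \<le> i \<Longrightarrow> h ` G i = carrier S"
    and X_G: "X \<subseteq> G 1" and X_fin: "finite X"
    and G_gen: "G (int (Suc n)) = asum R {v \<otimes>\<^bsub>R\<^esub> f | v f. v \<in> X \<and> f \<in> G (int n)}"
    and G_gen0: "G 0 = range (alg_map R)"
    and S_fin: "vectorspace.fin_dim base_field S"
    and S_one: "\<one>\<^bsub>S\<^esub> \<noteq> \<zero>\<^bsub>S\<^esub>"
begin

section \<open>The embedding of R into S[x_0]\<close>

sublocale T: kalgebra "poly_alg1 S" by (rule S.kalgebra_T)

abbreviation "TT \<equiv> poly_alg1 S"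
abbreviation "mn \<equiv> S.pmon"

lemma G_carrier [intro]: "a \<in> G i \<Longrightarrow> a \<in> carrier R" using G_sub by auto

lemma x_carrier [simp, intro]: "x \<in> carrier R" using x_G by auto

lemma xpow_G: "x [^]\<^bsub>R\<^esub> (n::nat) \<in> G (int n)"
proof (induction n)
  case 0 then show ?case by (simp add: G_one)
next
  case (Suc n) then show ?case using G_mult[OF Suc x_G] by (simp add: add.commute)
qed

lemma h_xpow: "h (x [^]\<^bsub>R\<^esub> (n::nat)) = \<one>\<^bsub>S\<^esub>"
  by (induction n) (simp_all add: h.hom_one h.hom_mult h_x)

lemma h_eqD: "a \<in> G i \<Longrightarrow> b \<in> G i \<Longrightarrow> h a = h b \<Longrightarrow> a = b"
  using h_inj by (auto dest: inj_onD)

lemma comp_closed [simp, intro]: "a \<in> carrier R \<Longrightarrow> comp n a \<in> carrier R"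
  using add_hom_closed[OF comp_hom] .

lemma comp_mem: "a \<in> carrier R \<Longrightarrow> comp n a \<in> G (int n)"
  unfolding R_asum
proof (induction rule: asum.induct)
  case asum_zero
  then show ?case using add_hom_zero[OF comp_hom] R.A.abelian_group_axioms G_zero by auto
next
  case (asum_base b)
  then show ?case using comp_G G_zero by auto
next
  case (asum_add x y)
  then have "x \<in> carrier R" "y \<in> carrier R" by (simp_all add: R_asum)
  then show ?case using asum_add.IH by (simp add: add_hom_add[OF comp_hom] G_add)
qed

text \<open>This is the map \<phi> of the theorem: the coefficient of x_0^n is the dehomogenized
  component of degree n.\<close>

definition "\<chi> a = (\<lambda>n. h (comp n a))"

lemma \<chi>_G: "a \<in> G (int n) \<Longrightarrow> \<chi> a = mn (h a) n"
  using S.pmon_coeff[OF h.hom_closed[OF G_carrier], of a "int n" n]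
  by (intro ext) (auto simp: \<chi>_def comp_G h.hom_zero)

lemma \<chi>_zero: "\<chi> \<zero>\<^bsub>R\<^esub> = \<zero>\<^bsub>TT\<^esub>"
  using \<chi>_G[OF G_zero, of 0] by (simp add: h.hom_zero)

lemma \<chi>_fun_add: "a \<in> carrier R \<Longrightarrow> b \<in> carrier R \<Longrightarrow> \<chi> (a \<oplus>\<^bsub>R\<^esub> b) = (\<lambda>n. \<chi> a n \<oplus>\<^bsub>S\<^esub> \<chi> b n)"
  by (simp add: \<chi>_def add_hom_add[OF comp_hom] h.hom_add)

text \<open>By definition only a function on degrees. Finite support is inherited from sums of
  homogeneous elements, on each of which the value is a monomial.\<close>

lemma \<chi>_closed [simp, intro]: "a \<in> carrier R \<Longrightarrow> \<chi> a \<in> carrier TT"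
  unfolding R_asum
proof (induction rule: asum.induct)
  case asum_zero
  then show ?case by (simp add: \<chi>_zero)
next
  case (asum_base b)
  then obtain n where "b \<in> G (int n)" by blast
  then show ?case by (auto simp: \<chi>_G)
next
  case (asum_add a b)
  then have "a \<in> carrier R" "b \<in> carrier R" by (simp_all add: R_asum)
  then show ?case using asum_add.IH T.A.a_closed by (simp add: \<chi>_fun_add flip: S.T_fun(4))
qed

lemma \<chi>_add: "a \<in> carrier R \<Longrightarrow> b \<in> carrier R \<Longrightarrow> \<chi> (a \<oplus>\<^bsub>R\<^esub> b) = \<chi> a \<oplus>\<^bsub>TT\<^esub> \<chi> b"
  by (simp add: \<chi>_fun_add S.T_fun(4))

lemma homog_carrier: "(\<Union>n. G (int n)) \<subseteq> carrier R" using G_sub by auto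

lemma add_hom_G_eqI:
  assumes "add_hom R N f" "add_hom R N g" "abelian_group N"
    "\<And>a n. a \<in> G (int n) \<Longrightarrow> f a = g a" "a \<in> carrier R"
  shows "f a = g a"
  by (rule add_hom_eqI[OF assms(1,2) R.A.abelian_group_axioms assms(3) homog_carrier])
     (use assms(4,5) R_asum in auto)

lemma \<chi>_mult:
  assumes a: "a \<in> carrier R" and b: "b \<in> carrier R"
  shows "\<chi> (a \<otimes>\<^bsub>R\<^esub> b) = \<chi> a \<otimes>\<^bsub>TT\<^esub> \<chi> b"
proof -
  have 1: "\<chi> (a \<otimes>\<^bsub>R\<^esub> b) = \<chi> a \<otimes>\<^bsub>TT\<^esub> \<chi> b" if a: "a \<in> G (int n)" and b: "b \<in> carrier R" for a b n
  proof (rule add_hom_G_eqI[of TT "\<lambda>b. \<chi> (a \<otimes>\<^bsub>R\<^esub> b)" "\<lambda>b. \<chi> a \<otimes>\<^bsub>TT\<^esub> \<chi> b", OF _ _ _ _ b])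
    have ac: "a \<in> carrier R" using a by auto
    show "add_hom R TT (\<lambda>b. \<chi> (a \<otimes>\<^bsub>R\<^esub> b))" "add_hom R TT (\<lambda>b. \<chi> a \<otimes>\<^bsub>TT\<^esub> \<chi> b)"
      using ac by (auto intro!: add_homI simp: R.A.r_distr \<chi>_add T.A.r_distr)
    fix b m assume b: "b \<in> G (int m)"
    then have "a \<otimes>\<^bsub>R\<^esub> b \<in> G (int (n + m))" using G_mult[OF a b] by simp
    then have "\<chi> (a \<otimes>\<^bsub>R\<^esub> b) = mn (h (a \<otimes>\<^bsub>R\<^esub> b)) (n + m)" by (rule \<chi>_G)
    then show "\<chi> (a \<otimes>\<^bsub>R\<^esub> b) = \<chi> a \<otimes>\<^bsub>TT\<^esub> \<chi> b"
      using a b G_carrier[OF a] G_carrier[OF b] by (simp add: \<chi>_G S.pmon_mult h.hom_mult)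
  qed (rule T.A.abelian_group_axioms)
  show ?thesis
  proof (rule add_hom_G_eqI[of TT "\<lambda>a. \<chi> (a \<otimes>\<^bsub>R\<^esub> b)" "\<lambda>a. \<chi> a \<otimes>\<^bsub>TT\<^esub> \<chi> b", OF _ _ _ _ a])
    show "add_hom R TT (\<lambda>a. \<chi> (a \<otimes>\<^bsub>R\<^esub> b))" "add_hom R TT (\<lambda>a. \<chi> a \<otimes>\<^bsub>TT\<^esub> \<chi> b)"
      using b by (auto intro!: add_homI simp: R.A.l_distr \<chi>_add T.A.l_distr)
  qed (use 1 b T.A.abelian_group_axioms in auto)
qed

lemma \<chi>_one: "\<chi> \<one>\<^bsub>R\<^esub> = \<one>\<^bsub>TT\<^esub>"
  using \<chi>_G[of "\<one>\<^bsub>R\<^esub>" 0] G_one by (simp add: S.T_fun(5) h.hom_one)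

lemma \<chi>_smult: "a \<in> carrier R \<Longrightarrow> \<chi> (c \<odot>\<^bsub>R\<^esub> a) = c \<odot>\<^bsub>TT\<^esub> \<chi> a"
proof (rule add_hom_G_eqI[of TT "\<lambda>a. \<chi> (c \<odot>\<^bsub>R\<^esub> a)" "\<lambda>a. c \<odot>\<^bsub>TT\<^esub> \<chi> a"])
  show "add_hom R TT (\<lambda>a. \<chi> (c \<odot>\<^bsub>R\<^esub> a))" "add_hom R TT (\<lambda>a. c \<odot>\<^bsub>TT\<^esub> \<chi> a)"
    by (auto intro!: add_homI simp: R.smult_add \<chi>_add T.smult_add)
  show "\<chi> (c \<odot>\<^bsub>R\<^esub> a) = c \<odot>\<^bsub>TT\<^esub> \<chi> a" if "a \<in> G (int n)" for a n
    using that G_smult[OF that, of c] G_carrier[OF that]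
    by (simp add: \<chi>_G S.T_smult_pmon h.hom_smult)
qed (auto intro: T.A.abelian_group_axioms)

sublocale \<chi>: kalgebra_hom R TT \<chi>
  by unfold_locales (auto intro!: ring_hom_memI simp: \<chi>_mult \<chi>_add \<chi>_one \<chi>_smult)

text \<open>Almost all components vanish because \<chi> a is a polynomial and \<open>h\<close>,
  being injective on each degree, detects the vanishing of a component.\<close>

lemma comp_fsupp:
  assumes "a \<in> carrier R" shows "(\<lambda>n. comp n a) \<in> fsupp R UNIV"
proof -
  have *: "h (comp n a) = \<zero>\<^bsub>S\<^esub> \<longleftrightarrow> comp n a = \<zero>\<^bsub>R\<^esub>" for n
    using h_eqD[OF comp_mem[OF assms] G_zero] h.hom_zero by metis
  have "\<chi> a \<in> fsupp S UNIV" using \<chi>_closed[OF assms] by (simp only: S.T_fun(2))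
  then show ?thesis using assms by (auto simp: fsupp_def \<chi>_def *)
qed

text \<open>The sum of the components reproduces a: this is clear for homogeneous elements, and both
  sides are additive.\<close>

lemma comp_zeroD:
  assumes a: "a \<in> carrier R" and z: "\<And>n. comp n a = \<zero>\<^bsub>R\<^esub>" shows "a = \<zero>\<^bsub>R\<^esub>"
proof -
  interpret s: suml_loc R R "UNIV :: nat set" "\<lambda>b n. b"
    by unfold_locales (auto simp: add_hom_def)
  let ?f = "\<lambda>a. suml R R UNIV (\<lambda>b n. b) (\<lambda>n. comp n a)"
  have "?f a = a"
  proof (rule add_hom_G_eqI[of R ?f "\<lambda>a. a", OF _ _ _ _ a])
    show "add_hom R R ?f"
      by (rule add_homI) (simp_all add: s.suml_closed comp_fsupp add_hom_add[OF comp_hom] s.suml_add)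
    show "add_hom R R (\<lambda>a. a)" by (rule add_homI) auto
    show "?f a = a" if "a \<in> G (int n)" for a n
      using that G_carrier[OF that] s.suml_single[of n a] by (simp add: comp_G)
  qed (rule R.A.abelian_group_axioms)
  moreover have "?f a = \<zero>\<^bsub>R\<^esub>" using z by (simp add: suml_def)
  ultimately show ?thesis by simp
qed

lemma \<chi>_inj: "inj_on \<chi> (carrier R)"
proof (rule inj_onI)
  fix a b assume ab: "a \<in> carrier R" "b \<in> carrier R" "\<chi> a = \<chi> b"
  have "h (comp n a) = h (comp n b)" for n using ab(3) by (simp add: \<chi>_def fun_eq_iff)
  then have eq: "comp n a = comp n b" for n by (rule h_eqD[OF comp_mem comp_mem, OF ab(1,2)])
  have "comp n (a \<ominus>\<^bsub>R\<^esub> b) = \<zero>\<^bsub>R\<^esub>" for n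
  proof -
    have "comp n (a \<ominus>\<^bsub>R\<^esub> b) = comp n a \<ominus>\<^bsub>R\<^esub> comp n b"
      by (rule add_hom_minus[OF comp_hom R.A.abelian_group_axioms R.A.abelian_group_axioms ab(1,2)])
    moreover have "comp n a \<ominus>\<^bsub>R\<^esub> comp n b = \<zero>\<^bsub>R\<^esub>"
      using abelian_group_minus_eq_zero[OF R.A.abelian_group_axioms comp_closed[OF ab(1)] comp_closed[OF ab(2)]]
        eq[of n] by blast
    ultimately show ?thesis by (rule trans)
  qed
  then have "a \<ominus>\<^bsub>R\<^esub> b = \<zero>\<^bsub>R\<^esub>" by (rule comp_zeroD[OF R.A.minus_closed[OF ab(1,2)]])
  then show "a = b" using abelian_group_minus_eq_zero[OF R.A.abelian_group_axioms ab(1,2)] by blast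
qed

section \<open>Homogeneous lifts of elements of S\<close>

definition lft :: "nat \<Rightarrow> 's \<Rightarrow> 'a" where "lft n = inv_into (G (int n)) h"

lemma lft: assumes "r \<le> n" "s \<in> carrier S" shows "lft n s \<in> G (int n)" "h (lft n s) = s"
  using h_surj[of "int n"] assms inv_into_into[of s h "G (int n)"] f_inv_into_f[of s h "G (int n)"]
  by (auto simp: lft_def)

lemma lft_h: "r \<le> n \<Longrightarrow> a \<in> G (int n) \<Longrightarrow> lft n (h a) = a"
  using h_inj by (simp add: lft_def inv_into_f_f)

lemma lft_eqI: "r \<le> n \<Longrightarrow> a \<in> G (int n) \<Longrightarrow> h a = s \<Longrightarrow> lft n s = a"
  using lft_h by auto

lemma lft_carrier [intro]: "r \<le> n \<Longrightarrow> s \<in> carrier S \<Longrightarrow> lft n s \<in> carrier R"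
  using lft(1) by auto

lemma lft_hom: "r \<le> n \<Longrightarrow> add_hom S R (lft n)"
  by (rule add_homI) (auto simp: lft intro!: lft_eqI G_add simp: h.hom_add lft_carrier)

text \<open>The product is homogeneous of degree n + m and has the required dehomogenization, and a
  lift to a given degree is unique. All identities between lifts rest on this uniqueness.\<close>

lemma lft_mult:
  assumes "r \<le> n" "s \<in> carrier S" "a \<in> G (int m)"
  shows "lft n s \<otimes>\<^bsub>R\<^esub> a = lft (n + m) (s \<otimes>\<^bsub>S\<^esub> h a)"
  using assms G_mult[OF lft(1)[OF assms(1,2)] assms(3)] G_carrier[OF assms(3)] lft_carrier[OF assms(1,2)]
  by (intro lft_eqI[symmetric]) (auto simp: h.hom_mult lft)

lemma lft_smult: "r \<le> n \<Longrightarrow> s \<in> carrier S \<Longrightarrow> lft n (c \<odot>\<^bsub>S\<^esub> s) = c \<odot>\<^bsub>R\<^esub> lft n s"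
  by (intro lft_eqI) (auto simp: lft G_smult h.hom_smult lft_carrier)

lemma pmon_nzd_coeff:
  assumes p: "p \<in> carrier TT" and u: "u \<in> carrier S"
  shows "(p \<otimes>\<^bsub>TT\<^esub> mn u n) (k + n) = p k \<otimes>\<^bsub>S\<^esub> u"
proof (rule add_hom_eqI[of TT S "\<lambda>p. (p \<otimes>\<^bsub>TT\<^esub> mn u n) (k + n)" "\<lambda>p. p k \<otimes>\<^bsub>S\<^esub> u" "{mn a n | a n. a \<in> carrier S}"])
  show "add_hom TT S (\<lambda>p. (p \<otimes>\<^bsub>TT\<^esub> mn u n) (k + n))"
  proof (rule add_homI)
    fix v w assume "v \<in> carrier TT" "w \<in> carrier TT"
    then show "((v \<oplus>\<^bsub>TT\<^esub> w) \<otimes>\<^bsub>TT\<^esub> mn u n) (k + n) = (v \<otimes>\<^bsub>TT\<^esub> mn u n) (k + n) \<oplus>\<^bsub>S\<^esub> (w \<otimes>\<^bsub>TT\<^esub> mn u n) (k + n)"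
      using S.pmon_closed[OF u, of n] by (simp add: T.A.l_distr S.T_fun(4)[OF T.A.m_closed T.A.m_closed])
  qed (use u in auto)
  show "add_hom TT S (\<lambda>p. p k \<otimes>\<^bsub>S\<^esub> u)"
    using u by (auto intro!: add_homI simp: S.T_fun(4) S.A.l_distr S.T_coeff)
  show "p \<in> asum TT {mn a n | a n. a \<in> carrier S}" using p S.T_asum by simp
  show "(b \<otimes>\<^bsub>TT\<^esub> mn u n) (k + n) = b k \<otimes>\<^bsub>S\<^esub> u" if b: "b \<in> {mn a n | a n. a \<in> carrier S}" for b
    using b u by (auto simp: S.pmon_mult S.pmon_coeff)
qed (auto intro: T.A.abelian_group_axioms S.A.abelian_group_axioms)

text \<open>Multiplication by u x_0^n shifts the coefficients by n and multiplies them by the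
  invertible element u.\<close>

lemma pmon_unit_nzd:
  assumes p: "p \<in> carrier TT" and u: "u \<in> Units S" and z: "p \<otimes>\<^bsub>TT\<^esub> mn u n = \<zero>\<^bsub>TT\<^esub>"
  shows "p = \<zero>\<^bsub>TT\<^esub>"
proof -
  have uc: "u \<in> carrier S" using u by auto
  have "p k = \<zero>\<^bsub>S\<^esub>" for k
  proof -
    have "p k \<otimes>\<^bsub>S\<^esub> u = \<zero>\<^bsub>S\<^esub>" using pmon_nzd_coeff[OF p uc, of n k] z by (simp add: S.T_fun(1))
    then have "p k \<otimes>\<^bsub>S\<^esub> u \<otimes>\<^bsub>S\<^esub> inv\<^bsub>S\<^esub> u = \<zero>\<^bsub>S\<^esub>" using u by simp
    then show ?thesis using u uc S.T_coeff[OF p, of k] by (simp add: S.A.m_assoc)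
  qed
  then show ?thesis by (simp add: S.T_fun(1) fun_eq_iff)
qed

section \<open>Homogeneous fractions as polynomials over S\<close>

definition "D = (\<Union>e. hom_nzd R G e)"

lemma R_one: "\<one>\<^bsub>R\<^esub> \<noteq> \<zero>\<^bsub>R\<^esub>" using S_one h.hom_one h.hom_zero by metis

lemma hom_nzdD:
  assumes "b \<in> hom_nzd R G e"
  shows "b \<in> G e" "b \<in> carrier R" "\<And>a. a \<in> carrier R \<Longrightarrow> a \<otimes>\<^bsub>R\<^esub> b = \<zero>\<^bsub>R\<^esub> \<Longrightarrow> a = \<zero>\<^bsub>R\<^esub>" "0 \<le> e"
proof -
  show *: "b \<in> G e" "b \<in> carrier R" "\<And>a. a \<in> carrier R \<Longrightarrow> a \<otimes>\<^bsub>R\<^esub> b = \<zero>\<^bsub>R\<^esub> \<Longrightarrow> a = \<zero>\<^bsub>R\<^esub>"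
    using assms by (auto simp: hom_nzd_def)
  show "0 \<le> e"
  proof (rule ccontr)
    assume "\<not> 0 \<le> e"
    then have "b = \<zero>\<^bsub>R\<^esub>" using G_neg[of e] *(1) by auto
    then show False using *(3)[of "\<one>\<^bsub>R\<^esub>"] R_one by simp
  qed
qed

text \<open>Multiplication by a homogeneous non-zerodivisor is injective in large degrees, hence so is
  multiplication by its dehomogenization on the finite-dimensional space \<open>S\<close>.\<close>

lemma hom_nzd_unit:
  assumes b: "b \<in> hom_nzd R G e" shows "h b \<in> Units S"
proof -
  note bD = hom_nzdD[OF b]
  have hb: "h b \<in> carrier S" using bD by simp
  have lin: "linear_map base_field S S (\<lambda>s. s \<otimes>\<^bsub>S\<^esub> h b)"
    by (rule linear_mapI) (use hb S.vectorspace_A in \<open>auto simp: S.A.l_distr S.smult_mult\<close>)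
  have "inj_on (\<lambda>s. s \<otimes>\<^bsub>S\<^esub> h b) (carrier S)"
  proof (rule inj_onI)
    fix s t assume st: "s \<in> carrier S" "t \<in> carrier S" "s \<otimes>\<^bsub>S\<^esub> h b = t \<otimes>\<^bsub>S\<^esub> h b"
    \<comment> \<open>The equation is pulled back to forms: both elements lift to degree r, and
      their products with b lie in degree r + e, where dehomogenization is injective.\<close>
    let ?s = "lft r s" and ?t = "lft r t"
    have m: "?s \<in> G (int r)" "?t \<in> G (int r)" "h ?s = s" "h ?t = t" using st lft by auto
    then have c: "?s \<in> carrier R" "?t \<in> carrier R" by auto
    have "?s \<otimes>\<^bsub>R\<^esub> b = ?t \<otimes>\<^bsub>R\<^esub> b"
      by (rule h_eqD[of _ "int r + e"]) (use m c bD st in \<open>auto simp: G_mult h.hom_mult\<close>)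
    then have "(?s \<ominus>\<^bsub>R\<^esub> ?t) \<otimes>\<^bsub>R\<^esub> b = \<zero>\<^bsub>R\<^esub>"
      using c bD(2) by (simp add: a_minus_def R.A.l_distr R.A.l_minus R.A.r_neg)
    then have "?s \<ominus>\<^bsub>R\<^esub> ?t = \<zero>\<^bsub>R\<^esub>" using bD(3) c by simp
    then have "?s = ?t" using c by simp
    then show "s = t" using m by metis
  qed
  then have "(\<lambda>s. s \<otimes>\<^bsub>S\<^esub> h b) ` carrier S = carrier S"
    by (rule linear_inj_surj[OF S.vectorspace_A S_fin lin])
  then obtain s where "s \<in> carrier S" "s \<otimes>\<^bsub>S\<^esub> h b = \<one>\<^bsub>S\<^esub>" by (metis S.A.one_closed imageE)
  then show ?thesis using hb S.A.m_comm unfolding Units_def by auto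
qed

lemma \<chi>_hom_nzd: "b \<in> hom_nzd R G e \<Longrightarrow> \<chi> b = mn (h b) (nat e)"
  using \<chi>_G[of b "nat e"] hom_nzdD[of b e] by simp

lemma D_nzd: "b \<in> D \<Longrightarrow> p \<in> carrier TT \<Longrightarrow> p \<otimes>\<^bsub>TT\<^esub> \<chi> b = \<zero>\<^bsub>TT\<^esub> \<Longrightarrow> p = \<zero>\<^bsub>TT\<^esub>"
  unfolding D_def using \<chi>_hom_nzd hom_nzd_unit pmon_unit_nzd by (metis UN_E)

lemma D_carrier [intro]: "b \<in> D \<Longrightarrow> b \<in> carrier R" by (auto simp: D_def hom_nzd_def)

lemma hom_nzd_mult:
  assumes b: "b \<in> hom_nzd R G e" and b': "b' \<in> hom_nzd R G e'"
  shows "b \<otimes>\<^bsub>R\<^esub> b' \<in> hom_nzd R G (e + e')"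
proof -
  note B = hom_nzdD[OF b] hom_nzdD[OF b']
  have "a = \<zero>\<^bsub>R\<^esub>" if a: "a \<in> carrier R" "a \<otimes>\<^bsub>R\<^esub> (b \<otimes>\<^bsub>R\<^esub> b') = \<zero>\<^bsub>R\<^esub>" for a
  proof (rule B(3)[OF a(1)], rule B(7))
    show "(a \<otimes>\<^bsub>R\<^esub> b) \<otimes>\<^bsub>R\<^esub> b' = \<zero>\<^bsub>R\<^esub>" using a B by (simp only: R.A.m_assoc)
  qed (use a(1) B(2) in simp)
  moreover have "b \<otimes>\<^bsub>R\<^esub> b' \<in> G (e + e')" "b \<otimes>\<^bsub>R\<^esub> b' \<in> carrier R" using B by (simp_all add: G_mult)
  ultimately show ?thesis unfolding hom_nzd_def by blast
qed

lemma D_mult: "b \<in> D \<Longrightarrow> b' \<in> D \<Longrightarrow> b \<otimes>\<^bsub>R\<^esub> b' \<in> D"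
  using hom_nzd_mult unfolding D_def by blast

text \<open>Under the injective map \<chi> the power becomes the monomial with unit coefficient 1 in
  degree n, which annihilates only zero.\<close>

lemma xpow_hom_nzd: "x [^]\<^bsub>R\<^esub> (n::nat) \<in> hom_nzd R G (int n)"
proof -
  have "a = \<zero>\<^bsub>R\<^esub>" if a: "a \<in> carrier R" "a \<otimes>\<^bsub>R\<^esub> x [^]\<^bsub>R\<^esub> n = \<zero>\<^bsub>R\<^esub>" for a
  proof -
    have "\<chi> a \<otimes>\<^bsub>TT\<^esub> mn \<one>\<^bsub>S\<^esub> n = \<zero>\<^bsub>TT\<^esub>"
      using \<chi>_mult[of a "x [^]\<^bsub>R\<^esub> n"] a \<chi>_G[OF xpow_G, of n] by (simp add: h_xpow \<chi>_zero)
    then have "\<chi> a = \<zero>\<^bsub>TT\<^esub>" using pmon_unit_nzd a by blast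
    then show ?thesis using inj_onD[OF \<chi>_inj, of a "\<zero>\<^bsub>R\<^esub>"] a by (simp add: \<chi>_zero)
  qed
  then show ?thesis using xpow_G by (auto simp: hom_nzd_def)
qed

lemma xpow_D: "x [^]\<^bsub>R\<^esub> (n::nat) \<in> D" using xpow_hom_nzd unfolding D_def by blast

lemma one_D: "\<one>\<^bsub>R\<^esub> \<in> D" using xpow_D[of 0] by simp

text \<open>\<open>W p\<close> is the fraction corresponding to \<open>p \<in> S[x\<^sub>0]\<close>; it is the inverse of the
  identification of the truncated integral closure with \<open>S[x\<^sub>0]\<close>.\<close>

definition "W p = {(a, b). a \<in> carrier R \<and> b \<in> D \<and> \<chi> a = \<chi> b \<otimes>\<^bsub>TT\<^esub> p}"

text \<open>Applying \<chi> to the equation a d = c b and cancelling \<chi> b, a non-zerodivisor by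
  \<open>D_nzd\<close>, turns the defining condition of the fraction class into \<chi> c = (\<chi>
  d) p. So the class depends on p alone.\<close>

lemma W_hfrac:
  assumes p: "p \<in> carrier TT" and ab: "a \<in> carrier R" "b \<in> D" "\<chi> a = \<chi> b \<otimes>\<^bsub>TT\<^esub> p"
  shows "hfrac R G a b = W p"
proof -
  have "a \<otimes>\<^bsub>R\<^esub> d = c \<otimes>\<^bsub>R\<^esub> b \<longleftrightarrow> \<chi> c = \<chi> d \<otimes>\<^bsub>TT\<^esub> p" if c: "c \<in> carrier R" and d: "d \<in> D" for c d
  proof -
    have dc: "d \<in> carrier R" "b \<in> carrier R" using d ab by auto
    have "a \<otimes>\<^bsub>R\<^esub> d = c \<otimes>\<^bsub>R\<^esub> b \<longleftrightarrow> \<chi> a \<otimes>\<^bsub>TT\<^esub> \<chi> d = \<chi> c \<otimes>\<^bsub>TT\<^esub> \<chi> b"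
      using inj_on_eq_iff[OF \<chi>_inj, of "a \<otimes>\<^bsub>R\<^esub> d" "c \<otimes>\<^bsub>R\<^esub> b"] c dc ab by (simp add: \<chi>_mult)
    also have "\<dots> \<longleftrightarrow> (\<chi> d \<otimes>\<^bsub>TT\<^esub> p) \<otimes>\<^bsub>TT\<^esub> \<chi> b = \<chi> c \<otimes>\<^bsub>TT\<^esub> \<chi> b"
      using dc p ab by (simp add: T.A.m_ac)
    also have "\<dots> \<longleftrightarrow> (\<chi> d \<otimes>\<^bsub>TT\<^esub> p \<ominus>\<^bsub>TT\<^esub> \<chi> c) \<otimes>\<^bsub>TT\<^esub> \<chi> b = \<zero>\<^bsub>TT\<^esub>"
      using dc p c by (simp add: a_minus_def T.A.l_distr T.A.l_minus
          T.A.r_right_minus_eq[unfolded a_minus_def])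
    also have "\<dots> \<longleftrightarrow> \<chi> d \<otimes>\<^bsub>TT\<^esub> p \<ominus>\<^bsub>TT\<^esub> \<chi> c = \<zero>\<^bsub>TT\<^esub>"
    proof
      assume "(\<chi> d \<otimes>\<^bsub>TT\<^esub> p \<ominus>\<^bsub>TT\<^esub> \<chi> c) \<otimes>\<^bsub>TT\<^esub> \<chi> b = \<zero>\<^bsub>TT\<^esub>"
      then show "\<chi> d \<otimes>\<^bsub>TT\<^esub> p \<ominus>\<^bsub>TT\<^esub> \<chi> c = \<zero>\<^bsub>TT\<^esub>"
        by (rule D_nzd[OF ab(2), rotated]) (use dc p c in simp)
    qed (use dc in simp)
    also have "\<dots> \<longleftrightarrow> \<chi> c = \<chi> d \<otimes>\<^bsub>TT\<^esub> p" using dc p c by auto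
    finally show ?thesis .
  qed
  then show ?thesis unfolding hfrac_def W_def D_def[symmetric] by auto
qed

text \<open>A single denominator x_0^r serves for every polynomial: x_0^r times s x_0^n lies in
  degree r + n, where s has a lift.\<close>

lemma W_numerator:
  assumes p: "p \<in> carrier TT"
  shows "\<exists>a\<in>carrier R. \<chi> a = \<chi> (x [^]\<^bsub>R\<^esub> r) \<otimes>\<^bsub>TT\<^esub> p"
proof -
  have xr: "x [^]\<^bsub>R\<^esub> r \<in> carrier R" by simp
  have "p \<in> asum TT {mn a n | a n. a \<in> carrier S}" using p S.T_asum by simp
  then show ?thesis
  proof (induction)
    case asum_zero
    then show ?case using xr by (intro bexI[of _ "\<zero>\<^bsub>R\<^esub>"]) (auto simp: \<chi>_zero)
  next
    case (asum_base q)
    then obtain s n where q: "q = mn s n" "s \<in> carrier S" by blast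
    have "\<chi> (lft (r + n) s) = \<chi> (x [^]\<^bsub>R\<^esub> r) \<otimes>\<^bsub>TT\<^esub> q"
      using q \<chi>_G[OF lft(1), of "r + n" s] \<chi>_G[OF xpow_G, of r]
      by (simp add: h_xpow S.pmon_mult lft)
    then show ?case using lft_carrier[of "r + n" s] q by auto
  next
    case (asum_add p q)
    then obtain a b where "a \<in> carrier R" "\<chi> a = \<chi> (x [^]\<^bsub>R\<^esub> r) \<otimes>\<^bsub>TT\<^esub> p"
      "b \<in> carrier R" "\<chi> b = \<chi> (x [^]\<^bsub>R\<^esub> r) \<otimes>\<^bsub>TT\<^esub> q" by blast
    moreover have "p \<in> carrier TT" "q \<in> carrier TT" using asum_add.hyps S.T_asum by auto
    ultimately show ?case using xr by (intro bexI[of _ "a \<oplus>\<^bsub>R\<^esub> b"]) (auto simp: \<chi>_add T.A.r_distr)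
  qed
qed

lemma W_cases:
  assumes "p \<in> carrier TT"
  obtains a b where "a \<in> carrier R" "b \<in> D" "\<chi> a = \<chi> b \<otimes>\<^bsub>TT\<^esub> p" "W p = hfrac R G a b" "(a, b) \<in> W p"
  using W_numerator[OF assms] W_hfrac[OF assms _ xpow_D] xpow_D unfolding W_def by blast

lemma W_inj: "inj_on W (carrier TT)"
proof (rule inj_onI)
  fix p q assume pq: "p \<in> carrier TT" "q \<in> carrier TT" "W p = W q"
  obtain a b where ab: "a \<in> carrier R" "b \<in> D" "\<chi> a = \<chi> b \<otimes>\<^bsub>TT\<^esub> p" "(a, b) \<in> W p" using W_cases[OF pq(1)] by metis
  then have "\<chi> a = \<chi> b \<otimes>\<^bsub>TT\<^esub> q" using ab(4)[unfolded pq(3)] by (simp add: W_def)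
  then have "(p \<ominus>\<^bsub>TT\<^esub> q) \<otimes>\<^bsub>TT\<^esub> \<chi> b = \<zero>\<^bsub>TT\<^esub>"
    using ab pq D_carrier[OF ab(2)]
    by (simp add: a_minus_def T.A.l_distr T.A.l_minus T.A.m_comm[of p] T.A.m_comm[of q] T.A.r_neg)
  then have "p \<ominus>\<^bsub>TT\<^esub> q = \<zero>\<^bsub>TT\<^esub>" using D_nzd[OF ab(2)] pq by simp
  then show "p = q" using pq by simp
qed

abbreviation "Q \<equiv> hom_quot R G"

text \<open>A union of equal sets over nonempty index sets. It evaluates the operations of
  \<open>hom_quot\<close>, which are unions over all representatives.\<close>

lemma Q_op:
  assumes "p \<in> carrier TT" "q \<in> carrier TT"
    and "\<And>a b c d. (a, b) \<in> W p \<Longrightarrow> (c, d) \<in> W q \<Longrightarrow> f a b c d = Z"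
  shows "(\<Union>(a, b)\<in>W p. \<Union>(c, d)\<in>W q. f a b c d) = Z"
proof -
  obtain a b where ab: "(a, b) \<in> W p" using W_cases[OF assms(1)] by metis
  obtain c d where cd: "(c, d) \<in> W q" using W_cases[OF assms(2)] by metis
  show ?thesis using assms(3) ab cd by fastforce
qed

lemma W_add:
  assumes pq: "p \<in> carrier TT" "q \<in> carrier TT" shows "W p \<oplus>\<^bsub>Q\<^esub> W q = W (p \<oplus>\<^bsub>TT\<^esub> q)"
proof -
  have "(\<Union>(a, b)\<in>W p. \<Union>(c, d)\<in>W q. hfrac R G (a \<otimes>\<^bsub>R\<^esub> d \<oplus>\<^bsub>R\<^esub> c \<otimes>\<^bsub>R\<^esub> b) (b \<otimes>\<^bsub>R\<^esub> d)) = W (p \<oplus>\<^bsub>TT\<^esub> q)"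
  proof (rule Q_op[OF pq])
    fix a b c d assume "(a, b) \<in> W p" "(c, d) \<in> W q"
    then have *: "a \<in> carrier R" "b \<in> D" "\<chi> a = \<chi> b \<otimes>\<^bsub>TT\<^esub> p" "c \<in> carrier R" "d \<in> D" "\<chi> c = \<chi> d \<otimes>\<^bsub>TT\<^esub> q"
      "b \<in> carrier R" "d \<in> carrier R" by (auto simp: W_def)
    show "hfrac R G (a \<otimes>\<^bsub>R\<^esub> d \<oplus>\<^bsub>R\<^esub> c \<otimes>\<^bsub>R\<^esub> b) (b \<otimes>\<^bsub>R\<^esub> d) = W (p \<oplus>\<^bsub>TT\<^esub> q)"
      by (rule W_hfrac) (use * pq in \<open>simp_all add: D_mult \<chi>_add \<chi>_mult T.A.r_distr T.A.m_ac\<close>)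
  qed
  then show ?thesis by (simp add: hom_quot_def)
qed

lemma W_mult:
  assumes pq: "p \<in> carrier TT" "q \<in> carrier TT" shows "W p \<otimes>\<^bsub>Q\<^esub> W q = W (p \<otimes>\<^bsub>TT\<^esub> q)"
proof -
  have "(\<Union>(a, b)\<in>W p. \<Union>(c, d)\<in>W q. hfrac R G (a \<otimes>\<^bsub>R\<^esub> c) (b \<otimes>\<^bsub>R\<^esub> d)) = W (p \<otimes>\<^bsub>TT\<^esub> q)"
  proof (rule Q_op[OF pq])
    fix a b c d assume "(a, b) \<in> W p" "(c, d) \<in> W q"
    then have *: "a \<in> carrier R" "b \<in> D" "\<chi> a = \<chi> b \<otimes>\<^bsub>TT\<^esub> p" "c \<in> carrier R" "d \<in> D" "\<chi> c = \<chi> d \<otimes>\<^bsub>TT\<^esub> q"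
      "b \<in> carrier R" "d \<in> carrier R" by (auto simp: W_def)
    show "hfrac R G (a \<otimes>\<^bsub>R\<^esub> c) (b \<otimes>\<^bsub>R\<^esub> d) = W (p \<otimes>\<^bsub>TT\<^esub> q)"
      by (rule W_hfrac) (use * pq in \<open>simp_all add: D_mult \<chi>_mult T.A.m_ac\<close>)
  qed
  then show ?thesis by (simp add: hom_quot_def)
qed

lemma W_smult:
  assumes p: "p \<in> carrier TT" shows "c \<odot>\<^bsub>Q\<^esub> W p = W (c \<odot>\<^bsub>TT\<^esub> p)"
proof -
  have 1: "hfrac R G (c \<odot>\<^bsub>R\<^esub> a) b = W (c \<odot>\<^bsub>TT\<^esub> p)" if "(a, b) \<in> W p" for a b
  proof -
    from that have *: "a \<in> carrier R" "b \<in> D" "\<chi> a = \<chi> b \<otimes>\<^bsub>TT\<^esub> p" "b \<in> carrier R" by (auto simp: W_def)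
    show ?thesis by (rule W_hfrac) (use * p in \<open>simp_all add: \<chi>_smult T.smult_mult_right\<close>)
  qed
  obtain a b where "(a, b) \<in> W p" using W_cases[OF p] by metis
  then have "(\<Union>(a, b)\<in>W p. hfrac R G (c \<odot>\<^bsub>R\<^esub> a) b) = W (c \<odot>\<^bsub>TT\<^esub> p)" using 1 by fastforce
  then show ?thesis by (simp add: hom_quot_def)
qed

lemma hfrac_\<chi>: "a \<in> carrier R \<Longrightarrow> hfrac R G a \<one>\<^bsub>R\<^esub> = W (\<chi> a)"
  by (rule W_hfrac) (auto simp: one_D \<chi>_one)

lemma W_one: "\<one>\<^bsub>Q\<^esub> = W \<one>\<^bsub>TT\<^esub>" and W_zero: "\<zero>\<^bsub>Q\<^esub> = W \<zero>\<^bsub>TT\<^esub>"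
  using hfrac_\<chi>[of "\<one>\<^bsub>R\<^esub>"] hfrac_\<chi>[of "\<zero>\<^bsub>R\<^esub>"] by (simp_all add: hom_quot_def \<chi>_one \<chi>_zero)

lemma Q_carrier: "carrier Q = {hfrac R G a b | a b. a \<in> carrier R \<and> b \<in> D}"
  by (simp add: hom_quot_def D_def)

lemma W_Q: "p \<in> carrier TT \<Longrightarrow> W p \<in> carrier Q"
  unfolding Q_carrier by (erule W_cases) blast

text \<open>The negative in \<open>Q\<close> is a definite description over all fractions, including
  those outside the image of \<open>W\<close>, and no ring structure on \<open>Q\<close> is at hand.
  Uniqueness is therefore verified on representatives. The result is needed because
  \<open>generate_ring\<close> closes its generators under negatives.\<close>

lemma W_uminus:
  assumes p: "p \<in> carrier TT" shows "\<ominus>\<^bsub>Q\<^esub> W p = W (\<ominus>\<^bsub>TT\<^esub> p)"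
proof -
  have u: "y = W (\<ominus>\<^bsub>TT\<^esub> p)" if y: "y \<in> carrier Q" "W p \<oplus>\<^bsub>Q\<^esub> y = \<zero>\<^bsub>Q\<^esub>" for y
  proof -
    obtain c d where cd: "y = hfrac R G c d" "c \<in> carrier R" "d \<in> D" using y(1) unfolding Q_carrier by blast
    obtain a b where ab: "a \<in> carrier R" "b \<in> D" "\<chi> a = \<chi> b \<otimes>\<^bsub>TT\<^esub> p" "W p = hfrac R G a b" "(a, b) \<in> W p"
      using W_cases[OF p] by metis
    have car: "b \<in> carrier R" "d \<in> carrier R" using ab cd by auto
    have mem: "(c, d) \<in> hfrac R G c d" using cd by (simp add: hfrac_def D_def)
    \<comment> \<open>The numerator a d + c b represents the sum, and the sum is the class of zero;
      so \<chi> of this numerator vanishes, and the factor \<chi> b can be cancelled.\<close>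
    have "hfrac R G (a \<otimes>\<^bsub>R\<^esub> d \<oplus>\<^bsub>R\<^esub> c \<otimes>\<^bsub>R\<^esub> b) (b \<otimes>\<^bsub>R\<^esub> d) \<subseteq> W p \<oplus>\<^bsub>Q\<^esub> y"
      using ab(5) mem unfolding hom_quot_def cd(1) by fastforce
    moreover have "(a \<otimes>\<^bsub>R\<^esub> d \<oplus>\<^bsub>R\<^esub> c \<otimes>\<^bsub>R\<^esub> b, b \<otimes>\<^bsub>R\<^esub> d) \<in> hfrac R G (a \<otimes>\<^bsub>R\<^esub> d \<oplus>\<^bsub>R\<^esub> c \<otimes>\<^bsub>R\<^esub> b) (b \<otimes>\<^bsub>R\<^esub> d)"
      using ab cd car D_mult[of b d] by (simp add: hfrac_def D_def)
    ultimately have "(a \<otimes>\<^bsub>R\<^esub> d \<oplus>\<^bsub>R\<^esub> c \<otimes>\<^bsub>R\<^esub> b, b \<otimes>\<^bsub>R\<^esub> d) \<in> W \<zero>\<^bsub>TT\<^esub>"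
      using y(2) W_zero by blast
    then have "\<chi> (a \<otimes>\<^bsub>R\<^esub> d \<oplus>\<^bsub>R\<^esub> c \<otimes>\<^bsub>R\<^esub> b) = \<zero>\<^bsub>TT\<^esub>" using car by (simp add: W_def \<chi>_mult)
    then have "(\<chi> d \<otimes>\<^bsub>TT\<^esub> p \<oplus>\<^bsub>TT\<^esub> \<chi> c) \<otimes>\<^bsub>TT\<^esub> \<chi> b = \<zero>\<^bsub>TT\<^esub>"
      using ab cd car p by (simp add: \<chi>_add \<chi>_mult T.A.l_distr T.A.r_distr T.A.m_ac)
    then have "\<chi> d \<otimes>\<^bsub>TT\<^esub> p \<oplus>\<^bsub>TT\<^esub> \<chi> c = \<zero>\<^bsub>TT\<^esub>"
      by (rule D_nzd[OF ab(2), rotated]) (use car cd p in simp)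
    then have "\<chi> c = \<chi> d \<otimes>\<^bsub>TT\<^esub> (\<ominus>\<^bsub>TT\<^esub> p)"
      using car cd p T.A.minus_equality[of "\<chi> c" "\<chi> d \<otimes>\<^bsub>TT\<^esub> p"] T.A.a_comm[of "\<chi> c" "\<chi> d \<otimes>\<^bsub>TT\<^esub> p"]
      by (simp add: T.A.r_minus)
    then show ?thesis using W_hfrac[of "\<ominus>\<^bsub>TT\<^esub> p" c d] cd p by simp
  qed
  have e: "W p \<oplus>\<^bsub>Q\<^esub> W (\<ominus>\<^bsub>TT\<^esub> p) = \<zero>\<^bsub>Q\<^esub>" "W (\<ominus>\<^bsub>TT\<^esub> p) \<oplus>\<^bsub>Q\<^esub> W p = \<zero>\<^bsub>Q\<^esub>"
    using p by (simp_all add: W_add W_zero T.A.r_neg T.A.l_neg)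
  show ?thesis unfolding a_inv_def[of Q] m_inv_def[of "add_monoid Q"]
  proof (rule the_equality)
    show "W (\<ominus>\<^bsub>TT\<^esub> p) \<in> carrier (add_monoid Q) \<and> W p \<otimes>\<^bsub>add_monoid Q\<^esub> W (\<ominus>\<^bsub>TT\<^esub> p) = \<one>\<^bsub>add_monoid Q\<^esub> \<and>
        W (\<ominus>\<^bsub>TT\<^esub> p) \<otimes>\<^bsub>add_monoid Q\<^esub> W p = \<one>\<^bsub>add_monoid Q\<^esub>"
      using e W_Q[OF T.A.a_inv_closed[OF p]] by simp
  next
    fix y assume "y \<in> carrier (add_monoid Q) \<and> W p \<otimes>\<^bsub>add_monoid Q\<^esub> y = \<one>\<^bsub>add_monoid Q\<^esub> \<and>
        y \<otimes>\<^bsub>add_monoid Q\<^esub> W p = \<one>\<^bsub>add_monoid Q\<^esub>"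
    then show "y = W (\<ominus>\<^bsub>TT\<^esub> p)" by (intro u) simp_all
  qed
qed

definition "tic = Q\<lparr>carrier := generate_ring Q (\<Union>d\<in>{0..}. hom_quot_grade R G d)\<rparr>"
definition "tgrade d = hom_quot_grade R G d \<inter> carrier tic"

lemma tic_ops: "add tic = add Q" "monoid.mult tic = monoid.mult Q" "smult tic = smult Q"
  "\<one>\<^bsub>tic\<^esub> = \<one>\<^bsub>Q\<^esub>" "\<zero>\<^bsub>tic\<^esub> = \<zero>\<^bsub>Q\<^esub>"
  by (simp_all add: tic_def)

lemma hfrac_homog:
  assumes a: "a \<in> G (e + int d)" and b: "b \<in> hom_nzd R G e"
  shows "hfrac R G a b = W (mn (h a \<otimes>\<^bsub>S\<^esub> inv\<^bsub>S\<^esub> h b) d)"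
proof (rule W_hfrac)
  note bD = hom_nzdD[OF b] and u = hom_nzd_unit[OF b]
  have ac: "h a \<in> carrier S" using a by auto
  have a': "a \<in> G (int (nat e + d))" using a bD by simp
  show "\<chi> a = \<chi> b \<otimes>\<^bsub>TT\<^esub> mn (h a \<otimes>\<^bsub>S\<^esub> inv\<^bsub>S\<^esub> h b) d"
    using ac u by (simp add: \<chi>_G[OF a'] \<chi>_hom_nzd[OF b] S.pmon_mult S.A.Units_closed S.A.m_lcomm[of "h b"])
  show "mn (h a \<otimes>\<^bsub>S\<^esub> inv\<^bsub>S\<^esub> h b) d \<in> carrier TT" using ac u by auto
  show "a \<in> carrier R" using a by auto
  show "b \<in> D" using b by (auto simp: D_def)
qed

lemma W_pmon:
  assumes "s \<in> carrier S" shows "W (mn s d) \<in> hom_quot_grade R G (int d)"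
proof -
  have l: "lft (r + d) s \<in> G (int r + int d)" using lft(1)[of "r + d" s] assms by simp
  have "W (mn s d) = hfrac R G (lft (r + d) s) (x [^]\<^bsub>R\<^esub> r)"
    using hfrac_homog[OF l xpow_hom_nzd] lft(2)[of "r + d" s] assms by (simp add: h_xpow)
  then show ?thesis using l xpow_hom_nzd[of r] unfolding hom_quot_grade_def by blast
qed

text \<open>Homogeneous fractions of non-negative degree are images of monomials, and the image of
  \<open>W\<close> is closed under the ring operations. Conversely, every polynomial is a sum of
  monomials.\<close>

lemma carrier_tic: "carrier tic = W ` carrier TT"
proof -
  let ?H = "\<Union>d\<in>{0..}. hom_quot_grade R G d"
  have H: "?H \<subseteq> W ` carrier TT"
  proof
    fix y assume "y \<in> ?H"
    then obtain d a b e where y: "d \<ge> 0" "y = hfrac R G a b" "a \<in> G (e + d)" "b \<in> hom_nzd R G e"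
      unfolding hom_quot_grade_def by blast
    have "y = W (mn (h a \<otimes>\<^bsub>S\<^esub> inv\<^bsub>S\<^esub> h b) (nat d))" using hfrac_homog[of a e "nat d" b] y by simp
    moreover have "h a \<otimes>\<^bsub>S\<^esub> inv\<^bsub>S\<^esub> h b \<in> carrier S" using y hom_nzd_unit[OF y(4)] by auto
    ultimately show "y \<in> W ` carrier TT" by auto
  qed
  have "y \<in> W ` carrier TT" if "y \<in> generate_ring Q ?H" for y
    using that
  proof induction
    case one
    then show ?case using W_one by auto
  next
    case (incl h)
    then show ?case using H by blast
  next
    case (a_inv h)
    then show ?case by (auto simp: W_uminus)
  next
    case (eng_add h1 h2)
    then show ?case by (auto simp: W_add)
  next
    case (eng_mult h1 h2)
    then show ?case by (auto simp: W_mult)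
  qed
  moreover have "W p \<in> generate_ring Q ?H" if "p \<in> asum TT {mn a n | a n. a \<in> carrier S}" for p
    using that
  proof induction
    case asum_zero
    have "W (mn \<zero>\<^bsub>S\<^esub> 0) \<in> ?H" using W_pmon[of "\<zero>\<^bsub>S\<^esub>" 0] by force
    then show ?case by (auto intro: generate_ring.incl)
  next
    case (asum_base b)
    then obtain a n where "b = mn a n" "a \<in> carrier S" by blast
    then have "W b \<in> ?H" using W_pmon[of a n] by force
    then show ?case by (rule generate_ring.incl)
  next
    case (asum_add p q)
    then have "p \<in> carrier TT" "q \<in> carrier TT" using S.T_asum by auto
    then show ?case using asum_add.IH by (simp add: W_add[symmetric] generate_ring.eng_add)
  qed
  ultimately show ?thesis using S.T_asum by (auto simp: tic_def)
qed

lemma W_bij: "bij_betw W (carrier TT) (carrier tic)"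
  using W_inj by (simp add: bij_betw_def carrier_tic)

lemma kalgebra_tic: "kalgebra tic"
  by (rule kalgebra_transport[OF S.kalgebra_T W_bij])
     (simp_all add: tic_ops W_add W_mult W_one W_zero W_smult)

sublocale tic: kalgebra tic by (rule kalgebra_tic)

definition "\<psi> = inv_into (carrier TT) W"

lemma \<psi>_W [simp]: "p \<in> carrier TT \<Longrightarrow> \<psi> (W p) = p"
  using W_inj by (simp add: \<psi>_def)

lemma W_\<psi> [simp]: "y \<in> carrier tic \<Longrightarrow> W (\<psi> y) = y"
  by (simp add: \<psi>_def carrier_tic f_inv_into_f)

lemma W_tic [simp, intro]: "p \<in> carrier TT \<Longrightarrow> W p \<in> carrier tic" by (simp add: carrier_tic)

lemma tic_cases: assumes "y \<in> carrier tic" obtains p where "p \<in> carrier TT" "y = W p"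
  using assms by (auto simp: carrier_tic)

lemma W_ops:
  "p \<in> carrier TT \<Longrightarrow> q \<in> carrier TT \<Longrightarrow> W p \<oplus>\<^bsub>tic\<^esub> W q = W (p \<oplus>\<^bsub>TT\<^esub> q)"
  "p \<in> carrier TT \<Longrightarrow> q \<in> carrier TT \<Longrightarrow> W p \<otimes>\<^bsub>tic\<^esub> W q = W (p \<otimes>\<^bsub>TT\<^esub> q)"
  "p \<in> carrier TT \<Longrightarrow> c \<odot>\<^bsub>tic\<^esub> W p = W (c \<odot>\<^bsub>TT\<^esub> p)"
  "\<one>\<^bsub>tic\<^esub> = W \<one>\<^bsub>TT\<^esub>" "\<zero>\<^bsub>tic\<^esub> = W \<zero>\<^bsub>TT\<^esub>"
  by (simp_all add: tic_ops W_add W_mult W_one W_zero W_smult)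

sublocale W: kalgebra_hom TT tic W
  by unfold_locales (auto intro!: ring_hom_memI simp: W_ops)

sublocale \<psi>: kalgebra_hom tic TT \<psi>
  by unfold_locales (auto elim!: tic_cases intro!: ring_hom_memI simp: W_ops)

definition "emb f = hfrac R G f \<one>\<^bsub>R\<^esub>"

lemma emb_\<chi>: "f \<in> carrier R \<Longrightarrow> emb f = W (\<chi> f)" unfolding emb_def by (rule hfrac_\<chi>)

sublocale emb: kalgebra_hom R tic emb
  by unfold_locales (auto intro!: ring_hom_memI simp: emb_\<chi> W_ops \<chi>_add \<chi>_mult \<chi>_one \<chi>_smult)

lemma emb_inj: "inj_on emb (carrier R)"
  using W_inj \<chi>_inj by (auto simp: inj_on_def emb_\<chi>)

text \<open>In negative degree only zero survives the intersection: if a fraction a/b with deg a <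
  deg b equals some \<open>W p\<close>, then comparing the coefficients of \<chi> a = p (\<chi> b)
  from deg b on gives p h(b) = 0, and h(b) is a unit.\<close>

lemma tgrade_eq: "tgrade d = W ` poly_grade S d"
proof (cases "d < 0")
  case True
  have "y = W \<zero>\<^bsub>TT\<^esub>" if y: "y \<in> tgrade d" for y
  proof -
    obtain a b e where ab: "y = hfrac R G a b" "a \<in> G (e + d)" "b \<in> hom_nzd R G e"
      using y unfolding tgrade_def hom_quot_grade_def by blast
    obtain p where p: "p \<in> carrier TT" "y = W p" using y by (auto simp: tgrade_def carrier_tic)
    have bD: "b \<in> D" "a \<in> carrier R" using ab by (auto simp: D_def)
    have "(a, b) \<in> hfrac R G a b" using bD by (simp add: hfrac_def D_def)
    then have "(a, b) \<in> W p" by (simp only: ab(1)[symmetric] p(2)[symmetric])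
    then have eq: "\<chi> a = p \<otimes>\<^bsub>TT\<^esub> \<chi> b"
      using T.A.m_comm[OF p(1) \<chi>_closed[OF D_carrier[OF bD(1)]]] by (simp add: W_def)
    \<comment> \<open>The index k + e is at least the degree e of b, whereas a is homogeneous of
      degree e + d, which is smaller.\<close>
    have "p k \<otimes>\<^bsub>S\<^esub> h b = \<zero>\<^bsub>S\<^esub>" for k
    proof -
      have "p k \<otimes>\<^bsub>S\<^esub> h b = (p \<otimes>\<^bsub>TT\<^esub> \<chi> b) (k + nat e)"
        using pmon_nzd_coeff[OF p(1), of "h b" "nat e" k] hom_nzdD[OF ab(3)] \<chi>_hom_nzd[OF ab(3)] by simp
      also have "\<dots> = \<chi> a (k + nat e)" by (simp only: eq)
      also have "\<dots> = \<zero>\<^bsub>S\<^esub>"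
      proof (cases "e + d < 0")
        case True
        then have "a = \<zero>\<^bsub>R\<^esub>" using ab G_neg by auto
        then show ?thesis by (simp add: \<chi>_zero S.T_fun(1))
      next
        case False
        then have "\<chi> a = mn (h a) (nat (e + d))" using \<chi>_G[of a "nat (e + d)"] ab by simp
        then show ?thesis using \<open>d < 0\<close> False bD hom_nzdD(4)[OF ab(3)] by (auto simp: S.pmon_coeff)
      qed
      finally show ?thesis .
    qed
    then have "p \<otimes>\<^bsub>TT\<^esub> mn (h b) 0 = \<zero>\<^bsub>TT\<^esub>"
      using pmon_nzd_coeff[OF p(1), of "h b" 0] hom_nzdD[OF ab(3)] by (simp add: S.T_fun(1) fun_eq_iff)
    then have "p = \<zero>\<^bsub>TT\<^esub>" using pmon_unit_nzd[OF p(1) hom_nzd_unit[OF ab(3)]] by blast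
    then show ?thesis using p by simp
  qed
  moreover have "W \<zero>\<^bsub>TT\<^esub> \<in> tgrade d"
    using W_ops(5) hfrac_\<chi>[of "\<zero>\<^bsub>R\<^esub>"] G_zero xpow_hom_nzd[of 0]
    unfolding tgrade_def hom_quot_grade_def by (fastforce simp: \<chi>_zero)
  ultimately have "tgrade d = {W \<zero>\<^bsub>TT\<^esub>}" by blast
  moreover have "poly_grade S d = {\<zero>\<^bsub>TT\<^esub>}" using True by (simp add: poly_grade_def poly_alg1_def)
  ultimately show ?thesis by simp
next
  case False
  then obtain n where d: "d = int n" by (metis nonneg_int_cases not_le)
  have pg: "poly_grade S d = {mn a n | a. a \<in> carrier S}" by (simp add: d poly_grade_def S.pmon_def)
  have "y \<in> W ` poly_grade S d" if y: "y \<in> tgrade d" for y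
  proof -
    obtain a b e where ab: "y = hfrac R G a b" "a \<in> G (e + int n)" "b \<in> hom_nzd R G e"
      using y unfolding tgrade_def hom_quot_grade_def d by blast
    have "h a \<otimes>\<^bsub>S\<^esub> inv\<^bsub>S\<^esub> h b \<in> carrier S"
      using h.hom_closed[OF G_carrier[OF ab(2)]] hom_nzd_unit[OF ab(3)] by simp
    then show ?thesis unfolding ab(1) hfrac_homog[OF ab(2,3)] pg by blast
  qed
  moreover have "W (mn a n) \<in> tgrade d" if "a \<in> carrier S" for a
    using W_pmon[OF that, of n] that by (auto simp: tgrade_def d)
  ultimately show ?thesis unfolding pg by blast
qed

lemma tgrade_nat: "tgrade (int n) = {W (mn a n) | a. a \<in> carrier S}"
  by (auto simp: tgrade_eq poly_grade_def S.pmon_def)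

lemma tgrade_neg: "d < 0 \<Longrightarrow> tgrade d = {\<zero>\<^bsub>tic\<^esub>}"
  by (simp add: tgrade_eq poly_grade_def W_ops poly_alg1_def)

lemma \<psi>_iso: "graded_alg_iso tic tgrade TT (poly_grade S) \<psi>"
proof -
  have pg: "poly_grade S i \<subseteq> carrier TT" for i
  proof -
    have "\<zero>\<^bsub>UP S\<^esub> = \<zero>\<^bsub>TT\<^esub>" by (simp add: poly_alg1_def)
    then show ?thesis by (auto simp: poly_grade_def S.pmon_def[symmetric])
  qed
  have "\<psi> ` tgrade i = poly_grade S i" for i
    using pg[of i] by (force simp: tgrade_eq image_image)
  moreover have "bij_betw \<psi> (carrier tic) (carrier TT)"
    unfolding \<psi>_def by (rule bij_betw_inv_into[OF W_bij])
  ultimately show ?thesis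
    unfolding graded_alg_iso_def graded_alg_hom_def using \<psi>.hom \<psi>.hom_smult by simp
qed

lemma emb_graded: "graded_alg_hom R G tic tgrade emb"
proof -
  have "emb a \<in> tgrade i" if a: "a \<in> G i" for a i
  proof (cases "i < 0")
    case True
    then show ?thesis using a G_neg[of i] by (simp add: emb.hom_zero tgrade_neg)
  next
    case False
    then obtain n where i: "i = int n" by (metis nonneg_int_cases not_le)
    show ?thesis using a unfolding i by (auto simp: tgrade_nat emb_\<chi>[OF G_carrier[OF a]] \<chi>_G)
  qed
  then show ?thesis unfolding graded_alg_hom_def using emb.hom emb.hom_smult by auto
qed

lemma \<psi>_emb: "f \<in> G (int k) \<Longrightarrow> \<psi> (emb f) = mn (h f) k"
  using G_carrier[of f] by (simp add: emb_\<chi> \<chi>_G)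

lemma \<psi>_hfrac:
  "a \<in> G (e + int d) \<Longrightarrow> b \<in> hom_nzd R G e \<Longrightarrow> \<psi> (hfrac R G a b) = mn (h a \<otimes>\<^bsub>S\<^esub> inv\<^bsub>S\<^esub> h b) d"
  using hom_nzd_unit[of b e] G_carrier[of a] by (simp add: hfrac_homog)

end

section \<open>Differentials of the truncated integral closure\<close>

text \<open>The product rule splits off one factor a; the remaining term a d(a^n) is given by
  \<open>kd_pow\<close>.\<close>

lemma (in kalgebra) kd_pow_Suc:
  assumes a: "a \<in> carrier A"
  shows "d (a [^]\<^bsub>A\<^esub> Suc n) = (of_nat (Suc n) \<odot>\<^bsub>A\<^esub> a [^]\<^bsub>A\<^esub> n) \<odot>\<^bsub>\<Omega>\<^esub> d a"
proof -
  have p: "a [^]\<^bsub>A\<^esub> n \<in> carrier A" using a by simp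
  have "d (a [^]\<^bsub>A\<^esub> Suc n) = (a [^]\<^bsub>A\<^esub> n) \<odot>\<^bsub>\<Omega>\<^esub> d a \<oplus>\<^bsub>\<Omega>\<^esub> a \<odot>\<^bsub>\<Omega>\<^esub> d (a [^]\<^bsub>A\<^esub> n)"
    using a p by (simp add: kd_mult)
  also have "\<dots> = (a [^]\<^bsub>A\<^esub> n \<oplus>\<^bsub>A\<^esub> of_nat n \<odot>\<^bsub>A\<^esub> a [^]\<^bsub>A\<^esub> n) \<odot>\<^bsub>\<Omega>\<^esub> d a"
    using a p by (simp add: kd_pow \<Omega>.smult_l_distr)
  also have "a [^]\<^bsub>A\<^esub> n \<oplus>\<^bsub>A\<^esub> of_nat n \<odot>\<^bsub>A\<^esub> a [^]\<^bsub>A\<^esub> n = of_nat (Suc n) \<odot>\<^bsub>A\<^esub> a [^]\<^bsub>A\<^esub> n"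
    using p smult_plus[of "a [^]\<^bsub>A\<^esub> n" 1 "of_nat n"] by simp
  finally show ?thesis .
qed

lemma asum_image:
  assumes "add_hom M N f" "abelian_group M" "abelian_group N" "B \<subseteq> carrier M" "y \<in> asum M B"
  shows "f y \<in> asum N (f ` B)"
proof -
  interpret M: abelian_group M by fact
  have "asum M B \<subseteq> carrier M" by (rule asum_subset) (fact M.abelian_monoid_axioms assms)+
  from assms(5) this show ?thesis
    by induction (auto simp: add_hom_zero[OF assms(1-3)] add_hom_add[OF assms(1)] subset_iff intro: asum.intros)
qed

context graded_deh
begin

sublocale KS: kspace "kaehler_K S"
  by (rule kspace.intro) (rule S.vectorspace_kaehler_K)

abbreviation "BS \<equiv> base_change Kx0 (kaehler_K S)"
definition "split = direct_sum (alg_via (poly_scalar TT (mn \<one>\<^bsub>S\<^esub> 1)) TT) BS"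

lemma split_simps:
  "carrier split = carrier TT \<times> carrier BS" "\<zero>\<^bsub>split\<^esub> = (\<zero>\<^bsub>TT\<^esub>, \<zero>\<^bsub>BS\<^esub>)"
  "v \<oplus>\<^bsub>split\<^esub> w = (fst v \<oplus>\<^bsub>TT\<^esub> fst w, snd v \<oplus>\<^bsub>BS\<^esub> snd w)"
  "c \<odot>\<^bsub>split\<^esub> v = (poly_scalar TT (mn \<one>\<^bsub>S\<^esub> 1) c \<otimes>\<^bsub>TT\<^esub> fst v, c \<odot>\<^bsub>BS\<^esub> snd v)"
  by (simp_all add: split_def direct_sum_def)

lemma module_split: "Module.module Kx0 split"
  unfolding split_def
  by (intro direct_sum_is_module algebra.axioms(1)[OF algebra_alg_via] KS.BC.module_axioms
      T.A.cring_axioms KS.KX.A.cring_axioms T.poly_scalar_hom S.pmon_closed S.A.one_closed)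

sublocale split: Module.module Kx0 split by (rule module_split)

lemma split_ag: "abelian_group split" by (rule split.M.abelian_group_axioms)

lemma T_eqI:
  assumes "add_hom TT N f" "add_hom TT N g" "abelian_group N"
    "\<And>s i. s \<in> carrier S \<Longrightarrow> f (mn s i) = g (mn s i)" "p \<in> carrier TT"
  shows "f p = g p"
  by (rule add_hom_eqI[OF assms(1,2) T.A.abelian_group_axioms assms(3), of "{mn a n | a n. a \<in> carrier S}"])
     (use assms(4,5) S.T_asum in auto)

text \<open>The product rule for (s x_0^i) d(t x_0^j) gives j s t x_0^(i+j-1) dx_0 and x_0^(i+j) s
  dt. The subtraction is truncated only for i = j = 0, where the coefficient vanishes.\<close>

definition "\<beta>m s i t j =
  (mn (of_nat j \<odot>\<^bsub>S\<^esub> (s \<otimes>\<^bsub>S\<^esub> t)) (i + j - 1), KS.x0pow (i + j) (s \<odot>\<^bsub>S.\<Omega>\<^esub> S.d t))"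

text \<open>The biadditive extension of \<open>\<beta>m\<close> from monomials to polynomials:
  \<open>kaehler_lift\<close> asks for a map on all pairs of ring elements.\<close>

definition "\<beta>T p q = suml S split UNIV (\<lambda>s i. suml S split UNIV (\<lambda>t j. \<beta>m s i t j) q) p"

lemma \<beta>m_closed [simp, intro]: "s \<in> carrier S \<Longrightarrow> t \<in> carrier S \<Longrightarrow> \<beta>m s i t j \<in> carrier split"
  by (auto simp: \<beta>m_def split_simps intro!: KS.x0pow_closed)

lemma KS_x0pow_add: "v \<in> carrier S.\<Omega> \<Longrightarrow> w \<in> carrier S.\<Omega> \<Longrightarrow>
    KS.x0pow k (v \<oplus>\<^bsub>S.\<Omega>\<^esub> w) = KS.x0pow k v \<oplus>\<^bsub>BS\<^esub> KS.x0pow k w"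
  using add_hom_add[OF KS.x0pow_hom, of v w k] by simp

lemma \<beta>m_left: "t \<in> carrier S \<Longrightarrow> add_hom S split (\<lambda>s. \<beta>m s i t j)"
  by (rule add_homI)
     (simp_all add: \<beta>m_def split_simps S.A.l_distr S.smult_add S.pmon_add S.\<Omega>.smult_l_distr KS_x0pow_add)

lemma \<beta>m_right: "s \<in> carrier S \<Longrightarrow> add_hom S split (\<lambda>t. \<beta>m s i t j)"
  by (rule add_homI)
     (simp_all add: \<beta>m_def split_simps S.A.r_distr S.smult_add S.pmon_add S.\<Omega>.smult_r_distr S.kd_add KS_x0pow_add)

lemma TT_fsupp: "p \<in> carrier TT \<Longrightarrow> p \<in> fsupp S UNIV" by (simp add: S.T_fun(2))

lemma inner_hom:
  assumes s: "s \<in> carrier S"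
  shows "add_hom TT split (\<lambda>q. suml S split UNIV (\<lambda>t j. \<beta>m s i t j) q)"
    and "t \<in> carrier S \<Longrightarrow> suml S split UNIV (\<lambda>t j. \<beta>m s i t j) (mn t j) = \<beta>m s i t j"
proof -
  interpret suml_loc S split "UNIV :: nat set" "\<lambda>t j. \<beta>m s i t j"
    by (intro suml_loc.intro suml_loc_axioms.intro S.A.abelian_group_axioms split_ag \<beta>m_right s)
  show "add_hom TT split (\<lambda>q. suml S split UNIV (\<lambda>t j. \<beta>m s i t j) q)"
    by (rule add_homI) (simp_all add: suml_closed suml_add TT_fsupp S.T_fun(4))
  show "t \<in> carrier S \<Longrightarrow> suml S split UNIV (\<lambda>t j. \<beta>m s i t j) (mn t j) = \<beta>m s i t j"
    by (simp add: S.pmon_fun suml_single)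
qed

lemma inner_left:
  assumes q: "q \<in> carrier TT"
  shows "add_hom S split (\<lambda>s. suml S split UNIV (\<lambda>t j. \<beta>m s i t j) q)"
proof (rule add_homI)
  show "suml S split UNIV (\<lambda>t j. \<beta>m s i t j) q \<in> carrier split" if "s \<in> carrier S" for s
    using add_hom_closed[OF inner_hom(1)[OF that] q] .
  fix s s' assume s: "s \<in> carrier S" "s' \<in> carrier S"
  have "suml S split UNIV (\<lambda>t j. \<beta>m (s \<oplus>\<^bsub>S\<^esub> s') i t j) q = suml S split UNIV (\<lambda>t j. \<beta>m s i t j \<oplus>\<^bsub>split\<^esub> \<beta>m s' i t j) q"
    by (rule suml_cong[OF split_ag TT_fsupp[OF q]])
       (use s in \<open>auto simp: add_hom_add[OF \<beta>m_left] intro!: split.M.a_closed simp del: split_simps\<close>)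
  also have "\<dots> = suml S split UNIV (\<lambda>t j. \<beta>m s i t j) q \<oplus>\<^bsub>split\<^esub> suml S split UNIV (\<lambda>t j. \<beta>m s' i t j) q"
    by (rule suml_fun_add[OF S.A.abelian_group_axioms split_ag TT_fsupp[OF q]]) (use s in auto)
  finally show "suml S split UNIV (\<lambda>t j. \<beta>m (s \<oplus>\<^bsub>S\<^esub> s') i t j) q =
    suml S split UNIV (\<lambda>t j. \<beta>m s i t j) q \<oplus>\<^bsub>split\<^esub> suml S split UNIV (\<lambda>t j. \<beta>m s' i t j) q" .
qed

lemma \<beta>T_left: 
  assumes q: "q \<in> carrier TT"
  shows "add_hom TT split (\<lambda>p. \<beta>T p q)"
    and "s \<in> carrier S \<Longrightarrow> \<beta>T (mn s i) q = suml S split UNIV (\<lambda>t j. \<beta>m s i t j) q"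
proof -
  interpret suml_loc S split "UNIV :: nat set" "\<lambda>s i. suml S split UNIV (\<lambda>t j. \<beta>m s i t j) q"
    by (intro suml_loc.intro suml_loc_axioms.intro S.A.abelian_group_axioms split_ag inner_left q)
  show "add_hom TT split (\<lambda>p. \<beta>T p q)"
    unfolding \<beta>T_def by (rule add_homI) (simp_all add: suml_closed suml_add TT_fsupp S.T_fun(4))
  show "s \<in> carrier S \<Longrightarrow> \<beta>T (mn s i) q = suml S split UNIV (\<lambda>t j. \<beta>m s i t j) q"
    unfolding \<beta>T_def by (simp add: S.pmon_fun suml_single)
qed

lemma \<beta>T_right:
  assumes p: "p \<in> carrier TT" shows "add_hom TT split (\<beta>T p)"
proof (rule add_homI)
  show "\<beta>T p q \<in> carrier split" if "q \<in> carrier TT" for q using add_hom_closed[OF \<beta>T_left(1)[OF that] p] .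
  fix q q' assume q: "q \<in> carrier TT" "q' \<in> carrier TT"
  note qq = T.A.a_closed[OF q]
  show "\<beta>T p (q \<oplus>\<^bsub>TT\<^esub> q') = \<beta>T p q \<oplus>\<^bsub>split\<^esub> \<beta>T p q'"
  proof (rule T_eqI[OF \<beta>T_left(1)[OF qq] add_hom_sum[OF \<beta>T_left(1)[OF q(1)] \<beta>T_left(1)[OF q(2)] split_ag] split_ag _ p])
    fix s i assume s: "s \<in> carrier S"
    show "\<beta>T (mn s i) (q \<oplus>\<^bsub>TT\<^esub> q') = \<beta>T (mn s i) q \<oplus>\<^bsub>split\<^esub> \<beta>T (mn s i) q'"
      by (simp only: \<beta>T_left(2)[OF qq s] \<beta>T_left(2)[OF q(1) s] \<beta>T_left(2)[OF q(2) s] add_hom_add[OF inner_hom(1)[OF s] q])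
  qed
qed

lemma \<beta>T_pmon: "s \<in> carrier S \<Longrightarrow> t \<in> carrier S \<Longrightarrow> \<beta>T (mn s i) (mn t j) = \<beta>m s i t j"
  by (simp add: \<beta>T_left(2) inner_hom(2))

text \<open>In the first component the exponents j and k enter as coefficients and add up, which is
  the Leibniz rule for powers of x_0; in the second component it is the Leibniz rule on
  \<open>S\<close>.\<close>

lemma \<beta>m_leibniz:
  assumes "s \<in> carrier S" "t \<in> carrier S" "u \<in> carrier S"
  shows "\<beta>m s i (t \<otimes>\<^bsub>S\<^esub> u) (j + k) = \<beta>m (s \<otimes>\<^bsub>S\<^esub> t) (i + j) u k \<oplus>\<^bsub>split\<^esub> \<beta>m (s \<otimes>\<^bsub>S\<^esub> u) (i + k) t j"
proof -
  have "of_nat (j + k) \<odot>\<^bsub>S\<^esub> (s \<otimes>\<^bsub>S\<^esub> (t \<otimes>\<^bsub>S\<^esub> u)) =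
      of_nat k \<odot>\<^bsub>S\<^esub> (s \<otimes>\<^bsub>S\<^esub> t \<otimes>\<^bsub>S\<^esub> u) \<oplus>\<^bsub>S\<^esub> of_nat j \<odot>\<^bsub>S\<^esub> (s \<otimes>\<^bsub>S\<^esub> u \<otimes>\<^bsub>S\<^esub> t)"
    using assms by (simp add: S.smult_plus S.A.m_ac S.A.a_comm)
  then show ?thesis using assms
    by (simp add: \<beta>m_def split_simps S.smult_kd_mult KS_x0pow_add S.pmon_add ac_simps)
qed

lemma \<beta>T_mult_hom:
  assumes "p \<in> carrier TT" "q \<in> carrier TT"
  shows "add_hom TT split (\<lambda>q'. \<beta>T p (q \<otimes>\<^bsub>TT\<^esub> q'))" "add_hom TT split (\<lambda>q'. \<beta>T p (q' \<otimes>\<^bsub>TT\<^esub> q))"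
    "add_hom TT split (\<lambda>p'. \<beta>T (p' \<otimes>\<^bsub>TT\<^esub> p) q)" "add_hom TT split (\<lambda>p'. \<beta>T (p \<otimes>\<^bsub>TT\<^esub> p') q)"
proof -
  have m: "add_hom TT TT (\<lambda>a. b \<otimes>\<^bsub>TT\<^esub> a)" "add_hom TT TT (\<lambda>a. a \<otimes>\<^bsub>TT\<^esub> b)" if "b \<in> carrier TT" for b
    using that by (auto intro!: add_homI simp: T.A.r_distr T.A.l_distr)
  show "add_hom TT split (\<lambda>q'. \<beta>T p (q \<otimes>\<^bsub>TT\<^esub> q'))" "add_hom TT split (\<lambda>q'. \<beta>T p (q' \<otimes>\<^bsub>TT\<^esub> q))"
    using add_hom_comp[OF m(1)[OF assms(2)] \<beta>T_right[OF assms(1)]] add_hom_comp[OF m(2)[OF assms(2)] \<beta>T_right[OF assms(1)]] .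
  show "add_hom TT split (\<lambda>p'. \<beta>T (p' \<otimes>\<^bsub>TT\<^esub> p) q)" "add_hom TT split (\<lambda>p'. \<beta>T (p \<otimes>\<^bsub>TT\<^esub> p') q)"
    using add_hom_comp[OF m(2)[OF assms(1)] \<beta>T_left(1)[OF assms(2)]] add_hom_comp[OF m(1)[OF assms(1)] \<beta>T_left(1)[OF assms(2)]] .
qed

text \<open>Both sides are additive in each of the three arguments, so nested comparisons on
  monomials reduce the rule to \<open>\<beta>m_leibniz\<close>.\<close>

lemma \<beta>T_leibniz:
  assumes "p \<in> carrier TT" "q \<in> carrier TT" "q' \<in> carrier TT"
  shows "\<beta>T p (q \<otimes>\<^bsub>TT\<^esub> q') = \<beta>T (p \<otimes>\<^bsub>TT\<^esub> q) q' \<oplus>\<^bsub>split\<^esub> \<beta>T (p \<otimes>\<^bsub>TT\<^esub> q') q"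
proof (rule T_eqI[OF \<beta>T_left(1) add_hom_sum[OF \<beta>T_mult_hom(3) \<beta>T_mult_hom(3)] _ _ assms(1)])
  fix s i assume s: "s \<in> carrier S"
  then have ms: "mn s i \<in> carrier TT" by simp
  show "\<beta>T (mn s i) (q \<otimes>\<^bsub>TT\<^esub> q') = \<beta>T (mn s i \<otimes>\<^bsub>TT\<^esub> q) q' \<oplus>\<^bsub>split\<^esub> \<beta>T (mn s i \<otimes>\<^bsub>TT\<^esub> q') q"
  proof (rule T_eqI[OF \<beta>T_mult_hom(2) add_hom_sum[OF \<beta>T_mult_hom(4) \<beta>T_right] _ _ assms(2)])
    fix t j assume t: "t \<in> carrier S"
    then have mt: "mn t j \<in> carrier TT" by simp
    show "\<beta>T (mn s i) (mn t j \<otimes>\<^bsub>TT\<^esub> q') = \<beta>T (mn s i \<otimes>\<^bsub>TT\<^esub> mn t j) q' \<oplus>\<^bsub>split\<^esub> \<beta>T (mn s i \<otimes>\<^bsub>TT\<^esub> q') (mn t j)"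
    proof (rule T_eqI[OF \<beta>T_mult_hom(1) add_hom_sum[OF \<beta>T_right \<beta>T_mult_hom(4)] _ _ assms(3)])
      fix u k assume u: "u \<in> carrier S"
      show "\<beta>T (mn s i) (mn t j \<otimes>\<^bsub>TT\<^esub> mn u k) =
          \<beta>T (mn s i \<otimes>\<^bsub>TT\<^esub> mn t j) (mn u k) \<oplus>\<^bsub>split\<^esub> \<beta>T (mn s i \<otimes>\<^bsub>TT\<^esub> mn u k) (mn t j)"
        using s t u by (simp only: S.pmon_mult \<beta>T_pmon S.A.m_closed \<beta>m_leibniz)
    qed (use ms mt split_ag in auto)
  qed (use ms assms split_ag in auto)
qed (use assms split_ag in auto)

lemma \<beta>T_smult:
  assumes "p \<in> carrier TT" "q \<in> carrier TT"
  shows "\<beta>T p (c \<odot>\<^bsub>TT\<^esub> q) = \<beta>T (c \<odot>\<^bsub>TT\<^esub> p) q"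
proof -
  have m: "add_hom TT TT (\<lambda>a. c \<odot>\<^bsub>TT\<^esub> a)" by (auto intro!: add_homI simp: T.smult_add)
  show ?thesis
  proof (rule T_eqI[OF \<beta>T_left(1) add_hom_comp[OF m \<beta>T_left(1)] _ _ assms(1)])
    fix s i assume s: "s \<in> carrier S"
    then have ms: "mn s i \<in> carrier TT" by simp
    show "\<beta>T (mn s i) (c \<odot>\<^bsub>TT\<^esub> q) = \<beta>T (c \<odot>\<^bsub>TT\<^esub> mn s i) q"
    proof (rule T_eqI[OF add_hom_comp[OF m \<beta>T_right] \<beta>T_right _ _ assms(2)])
      fix t j assume t: "t \<in> carrier S"
      have "\<beta>m s i (c \<odot>\<^bsub>S\<^esub> t) j = \<beta>m (c \<odot>\<^bsub>S\<^esub> s) i t j"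
        using s t by (simp add: \<beta>m_def S.smult_mult_right S.smult_mult S.smult_kd_smult)
      then show "\<beta>T (mn s i) (c \<odot>\<^bsub>TT\<^esub> mn t j) = \<beta>T (c \<odot>\<^bsub>TT\<^esub> mn s i) (mn t j)"
        using s t by (simp add: S.T_smult_pmon \<beta>T_pmon)
    qed (use ms split_ag in auto)
  qed (use assms split_ag in auto)
qed

definition "\<Theta> = (\<lambda>Y. the_elem (suml tic split (carrier tic) (\<lambda>p q. \<beta>T (\<psi> p) (\<psi> q)) ` Y))"

lemma \<Theta>_hom: "add_hom tic.\<Omega> split \<Theta>"
  and \<Theta>_kd: "p \<in> carrier tic \<Longrightarrow> q \<in> carrier tic \<Longrightarrow> \<Theta> (p \<odot>\<^bsub>tic.\<Omega>\<^esub> tic.d q) = \<beta>T (\<psi> p) (\<psi> q)"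
proof -
  let ?\<beta> = "\<lambda>p q. \<beta>T (\<psi> p) (\<psi> q)"
  have l: "add_hom tic split (\<lambda>p. ?\<beta> p q)" if "q \<in> carrier tic" for q
    using add_hom_comp[OF \<psi>.add_hom \<beta>T_left(1)[OF \<psi>.hom_closed[OF that]]] .
  have r: "add_hom tic split (?\<beta> p)" if "p \<in> carrier tic" for p
    using add_hom_comp[OF \<psi>.add_hom \<beta>T_right[OF \<psi>.hom_closed[OF that]]] .
  have m: "?\<beta> a (b \<otimes>\<^bsub>tic\<^esub> c) = ?\<beta> (a \<otimes>\<^bsub>tic\<^esub> b) c \<oplus>\<^bsub>split\<^esub> ?\<beta> (a \<otimes>\<^bsub>tic\<^esub> c) b"
    if "a \<in> carrier tic" "b \<in> carrier tic" "c \<in> carrier tic" for a b c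
    using that by (simp only: \<psi>.hom_mult \<beta>T_leibniz \<psi>.hom_closed)
  have s: "?\<beta> a (c \<odot>\<^bsub>tic\<^esub> b) = ?\<beta> (c \<odot>\<^bsub>tic\<^esub> a) b" if "a \<in> carrier tic" "b \<in> carrier tic" for a b c
    using that by (simp only: \<psi>.hom_smult \<beta>T_smult \<psi>.hom_closed)
  show "add_hom tic.\<Omega> split \<Theta>"
    unfolding \<Theta>_def by (rule tic.kaehler_lift(1)[OF split_ag]) (fact l r m s)+
  show "\<Theta> (p \<odot>\<^bsub>tic.\<Omega>\<^esub> tic.d q) = \<beta>T (\<psi> p) (\<psi> q)" if "p \<in> carrier tic" "q \<in> carrier tic"
    unfolding \<Theta>_def by (rule tic.kaehler_lift(2)[OF split_ag]) (fact l r m s that)+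
qed

lemma \<Theta>_pmon: "s \<in> carrier S \<Longrightarrow> t \<in> carrier S \<Longrightarrow>
    \<Theta> (W (mn s i) \<odot>\<^bsub>tic.\<Omega>\<^esub> tic.d (W (mn t j))) = \<beta>m s i t j"
  by (simp add: \<Theta>_kd \<beta>T_pmon)

abbreviation "wmons \<equiv> {W (mn s i) | s i. s \<in> carrier S}"

lemma tic_asum: "carrier tic = asum tic wmons"
proof
  have "W p \<in> asum tic wmons" if "p \<in> carrier TT" for p
  proof -
    have "W p \<in> asum tic (W ` {mn a n | a n. a \<in> carrier S})"
      by (rule asum_image[OF W.add_hom T.A.abelian_group_axioms tic.A.abelian_group_axioms])
         (use that S.T_asum in auto)
    moreover have "W ` {mn a n | a n. a \<in> carrier S} = wmons" by blast
    ultimately show ?thesis by simp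
  qed
  then show "carrier tic \<subseteq> asum tic wmons" by (auto simp: carrier_tic)
  show "asum tic wmons \<subseteq> carrier tic" by (rule asum_subset) (auto intro: tic.A.abelian_monoid_axioms)
qed

lemma \<Omega>tic_asum: "carrier tic.\<Omega> = asum tic.\<Omega>
    {W (mn s i) \<odot>\<^bsub>tic.\<Omega>\<^esub> tic.d (W (mn t j)) | s i t j. s \<in> carrier S \<and> t \<in> carrier S}"
proof -
  have "{a \<odot>\<^bsub>tic.\<Omega>\<^esub> tic.d b | a b. a \<in> wmons \<and> b \<in> wmons} =
    {W (mn s i) \<odot>\<^bsub>tic.\<Omega>\<^esub> tic.d (W (mn t j)) | s i t j. s \<in> carrier S \<and> t \<in> carrier S}" by blast
  moreover have "wmons \<subseteq> carrier tic" by auto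
  ultimately show ?thesis using tic.kaehler_asum_gen[OF _ tic_asum] by simp
qed

lemma \<Omega>tic_eqI:
  assumes "add_hom tic.\<Omega> N f" "add_hom tic.\<Omega> N g" "abelian_group N"
    "\<And>s i t j. s \<in> carrier S \<Longrightarrow> t \<in> carrier S \<Longrightarrow>
      f (W (mn s i) \<odot>\<^bsub>tic.\<Omega>\<^esub> tic.d (W (mn t j))) = g (W (mn s i) \<odot>\<^bsub>tic.\<Omega>\<^esub> tic.d (W (mn t j)))"
    "w \<in> carrier tic.\<Omega>"
  shows "f w = g w"
  by (rule add_hom_eqI[OF assms(1,2) tic.\<Omega>.M.abelian_group_axioms assms(3), of
        "{W (mn s i) \<odot>\<^bsub>tic.\<Omega>\<^esub> tic.d (W (mn t j)) | s i t j. s \<in> carrier S \<and> t \<in> carrier S}"])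
     (use assms(4,5) \<Omega>tic_asum in \<open>auto intro!: tic.\<Omega>.smult_closed\<close>)

abbreviation "X0 \<equiv> emb x"

lemma X0_W: "X0 = W (mn \<one>\<^bsub>S\<^esub> 1)"
  using x_G \<chi>_G[of x 1] by (simp add: emb_\<chi> h_x)

lemma X0_closed [simp, intro]: "X0 \<in> carrier tic" by simp

lemma W_pow: "p \<in> carrier TT \<Longrightarrow> W p [^]\<^bsub>tic\<^esub> (n::nat) = W (p [^]\<^bsub>TT\<^esub> n)"
  by (induction n) (simp_all add: W_ops)

lemma X0_pow: "X0 [^]\<^bsub>tic\<^esub> (n::nat) = W (mn \<one>\<^bsub>S\<^esub> n)"
  by (simp add: X0_W W_pow S.pmon_pow[unfolded One_nat_def])

lemma W_mn_mult: "s \<in> carrier S \<Longrightarrow> t \<in> carrier S \<Longrightarrow> W (mn s i) \<otimes>\<^bsub>tic\<^esub> W (mn t j) = W (mn (s \<otimes>\<^bsub>S\<^esub> t) (i + j))"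
  by (simp add: W_ops S.pmon_mult)

abbreviation "ps \<equiv> poly_scalar tic X0"

lemma ps_monom: "ps (up_ring.monom Kx0 c n) = W (mn (c \<odot>\<^bsub>S\<^esub> \<one>\<^bsub>S\<^esub>) n)"
  using tic.poly_scalar_hom(2)[OF X0_closed, of c n] by (simp add: X0_pow W_ops S.T_smult_pmon)

lemma ps_closed [simp, intro]: "c \<in> carrier Kx0 \<Longrightarrow> ps c \<in> carrier tic"
  using ring_hom_closed[OF tic.poly_scalar_hom(1)[OF X0_closed]] .

abbreviation "KT \<equiv> restrict_scalars ps tic.\<Omega>"

lemma module_KT: "Module.module Kx0 KT"
  by (rule module_restrict_scalars[OF tic.\<Omega>.module_axioms KS.KX.A.cring_axioms tic.poly_scalar_hom(1)[OF X0_closed]])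

lemma Kx0_eqI:
  assumes "add_hom Kx0 N f" "add_hom Kx0 N g" "abelian_group N"
    "\<And>(c::'k) n. f (up_ring.monom Kx0 c n) = g (up_ring.monom Kx0 c n)" "p \<in> carrier Kx0"
  shows "f p = g p"
  by (rule add_hom_eqI[OF assms(1,2) KS.KX.A.abelian_group_axioms assms(3), of
        "{up_ring.monom Kx0 a n | a n. a \<in> carrier base_field}"])
     (use assms(4,5) UP_asum[OF class_cring.is_cring] in auto)

text \<open>The lift is additive by construction, but linear over the polynomial ring only by
  computation: the scalar and the differential are both reduced to monomials.\<close>

lemma \<Theta>_smult:
  assumes c: "c \<in> carrier Kx0" and w: "w \<in> carrier tic.\<Omega>"
  shows "\<Theta> (ps c \<odot>\<^bsub>tic.\<Omega>\<^esub> w) = c \<odot>\<^bsub>split\<^esub> \<Theta> w"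
proof -
  interpret KT: Module.module Kx0 KT by (rule module_KT)
  have KT: "c \<odot>\<^bsub>KT\<^esub> w = ps c \<odot>\<^bsub>tic.\<Omega>\<^esub> w" for c w by simp
  have \<Theta>c: "\<Theta> w \<in> carrier split" if "w \<in> carrier tic.\<Omega>" for w using add_hom_closed[OF \<Theta>_hom that] .
  show ?thesis
  proof (rule Kx0_eqI[of split "\<lambda>c. \<Theta> (ps c \<odot>\<^bsub>tic.\<Omega>\<^esub> w)" "\<lambda>c. c \<odot>\<^bsub>split\<^esub> \<Theta> w", OF _ _ split_ag _ c])
    show "add_hom Kx0 split (\<lambda>c. \<Theta> (ps c \<odot>\<^bsub>tic.\<Omega>\<^esub> w))"
    proof (rule add_homI)
      fix a b :: "nat \<Rightarrow> 'k" assume ab: "a \<in> carrier Kx0" "b \<in> carrier Kx0"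
      have "ps (a \<oplus>\<^bsub>Kx0\<^esub> b) \<odot>\<^bsub>tic.\<Omega>\<^esub> w = ps a \<odot>\<^bsub>tic.\<Omega>\<^esub> w \<oplus>\<^bsub>tic.\<Omega>\<^esub> ps b \<odot>\<^bsub>tic.\<Omega>\<^esub> w"
        using KT.smult_l_distr[of a b w] ab w by simp
      then show "\<Theta> (ps (a \<oplus>\<^bsub>Kx0\<^esub> b) \<odot>\<^bsub>tic.\<Omega>\<^esub> w) = \<Theta> (ps a \<odot>\<^bsub>tic.\<Omega>\<^esub> w) \<oplus>\<^bsub>split\<^esub> \<Theta> (ps b \<odot>\<^bsub>tic.\<Omega>\<^esub> w)"
        using add_hom_add[OF \<Theta>_hom tic.\<Omega>.smult_closed[OF ps_closed[OF ab(1)] w] tic.\<Omega>.smult_closed[OF ps_closed[OF ab(2)] w]]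
        by simp
    qed (use w \<Theta>c in auto)
    show "add_hom Kx0 split (\<lambda>c. c \<odot>\<^bsub>split\<^esub> \<Theta> w)"
      by (rule add_homI) (intro split.smult_closed split.smult_l_distr \<Theta>c w | assumption)+
    fix c :: 'k and n
    let ?m = "up_ring.monom Kx0 c n"
    have m: "?m \<in> carrier Kx0" by simp
    show "\<Theta> (ps ?m \<odot>\<^bsub>tic.\<Omega>\<^esub> w) = ?m \<odot>\<^bsub>split\<^esub> \<Theta> w"
    proof (rule \<Omega>tic_eqI[OF _ _ split_ag _ w])
      show "add_hom tic.\<Omega> split (\<lambda>w. \<Theta> (ps ?m \<odot>\<^bsub>tic.\<Omega>\<^esub> w))"
        by (rule add_hom_comp[OF _ \<Theta>_hom]) (use ps_closed[OF m] in \<open>auto intro!: add_homI simp: tic.\<Omega>.smult_r_distr\<close>)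
      show "add_hom tic.\<Omega> split (\<lambda>w. ?m \<odot>\<^bsub>split\<^esub> \<Theta> w)"
        by (rule add_hom_comp[OF \<Theta>_hom]) (intro add_homI split.smult_closed split.smult_r_distr m | assumption)+
      fix s i t j assume st: "s \<in> carrier S" "t \<in> carrier S"
      have "ps ?m \<odot>\<^bsub>tic.\<Omega>\<^esub> (W (mn s i) \<odot>\<^bsub>tic.\<Omega>\<^esub> tic.d (W (mn t j))) =
          W (mn (c \<odot>\<^bsub>S\<^esub> s) (n + i)) \<odot>\<^bsub>tic.\<Omega>\<^esub> tic.d (W (mn t j))"
        using st by (simp add: ps_monom tic.\<Omega>.smult_assoc1[symmetric] W_mn_mult S.smult_mult)
      then have 1: "\<Theta> (ps ?m \<odot>\<^bsub>tic.\<Omega>\<^esub> (W (mn s i) \<odot>\<^bsub>tic.\<Omega>\<^esub> tic.d (W (mn t j)))) = \<beta>m (c \<odot>\<^bsub>S\<^esub> s) (n + i) t j"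
        using st by (simp only: \<Theta>_pmon S.smult_closed)
      have p: "poly_scalar TT (mn \<one>\<^bsub>S\<^esub> 1) ?m = mn (c \<odot>\<^bsub>S\<^esub> \<one>\<^bsub>S\<^esub>) n"
        using T.poly_scalar_hom(2)[of "mn \<one>\<^bsub>S\<^esub> 1" c n] by (simp add: S.pmon_pow[unfolded One_nat_def] S.T_smult_pmon)
      have "mn (of_nat j \<odot>\<^bsub>S\<^esub> ((c \<odot>\<^bsub>S\<^esub> s) \<otimes>\<^bsub>S\<^esub> t)) (n + i + j - 1) = mn (c \<odot>\<^bsub>S\<^esub> \<one>\<^bsub>S\<^esub>) n \<otimes>\<^bsub>TT\<^esub> mn (of_nat j \<odot>\<^bsub>S\<^esub> (s \<otimes>\<^bsub>S\<^esub> t)) (i + j - 1)"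
      \<comment> \<open>For j = 0 both coefficients vanish, while the exponents may differ because
        of the truncated subtraction.\<close>
      proof (cases "j = 0")
        case True
        then show ?thesis using st by simp
      next
        case False
        then have "n + i + j - 1 = n + (i + j - 1)" by simp
        then show ?thesis using st
          by (simp add: S.pmon_mult S.smult_mult S.smult_times[symmetric] mult.commute)
      qed
      moreover have "?m \<odot>\<^bsub>BS\<^esub> KS.x0pow (i + j) (s \<odot>\<^bsub>S.\<Omega>\<^esub> S.d t) = KS.x0pow (n + i + j) ((c \<odot>\<^bsub>S\<^esub> s) \<odot>\<^bsub>S.\<Omega>\<^esub> S.d t)"
        using st KS.monom_x0pow[of "s \<odot>\<^bsub>S.\<Omega>\<^esub> S.d t" c n "i + j"] S.\<Omega>.smult_assoc1[of "alg_map S c" s "S.d t"]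
        by (simp add: S.alg_map_mult add.assoc)
      ultimately have "?m \<odot>\<^bsub>split\<^esub> \<beta>m s i t j = \<beta>m (c \<odot>\<^bsub>S\<^esub> s) (n + i) t j"
        by (simp add: \<beta>m_def split_simps p[unfolded One_nat_def])
      then show "\<Theta> (ps ?m \<odot>\<^bsub>tic.\<Omega>\<^esub> (W (mn s i) \<odot>\<^bsub>tic.\<Omega>\<^esub> tic.d (W (mn t j)))) =
          ?m \<odot>\<^bsub>split\<^esub> \<Theta> (W (mn s i) \<odot>\<^bsub>tic.\<Omega>\<^esub> tic.d (W (mn t j)))"
        unfolding 1 using st by (simp only: \<Theta>_pmon)
    qed
  qed
qed

end

section \<open>The inverse of the splitting map\<close>

context graded_deh
begin

definition "\<iota> s = W (mn s 0)"

sublocale \<iota>: kalgebra_hom S tic \<iota>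
proof unfold_locales
  show "\<iota> \<in> Ring.ring_hom S tic"
    by (rule ring_hom_memI) (simp_all add: \<iota>_def W_ops S.pmon_mult S.pmon_add S.T_fun(5))
qed (simp add: \<iota>_def W_ops S.T_smult_pmon)

abbreviation "L0 \<equiv> kaehler_map S tic \<iota>"

lemma L0_closed [simp, intro]: "w \<in> carrier S.\<Omega> \<Longrightarrow> L0 w \<in> carrier tic.\<Omega>"
  using add_hom_closed[OF \<iota>.kaehler_map_hom] .

text \<open>The inverse on the second summand: x_0^k \<otimes> w has to go to x_0^k times the image
  of w under the map induced by \<iota>, the inclusion of \<open>S\<close> as the constants. What
  has to be checked is that (c, w) \<mapsto> c w is balanced over \<open>K\<close>.\<close>

lemma \<Lambda>_ex: "\<exists>\<Lambda>. add_hom BS tic.\<Omega> \<Lambda> \<and>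
    (\<forall>c\<in>carrier Kx0. \<forall>w\<in>carrier S.\<Omega>. \<Lambda> (c \<odot>\<^bsub>BS\<^esub> KS.gen w) = ps c \<odot>\<^bsub>tic.\<Omega>\<^esub> L0 w)"
proof -
  interpret KT: Module.module Kx0 KT by (rule module_KT)
  have "\<exists>\<Lambda>. add_hom BS tic.\<Omega> \<Lambda> \<and>
    (\<forall>c\<in>carrier Kx0. \<forall>w\<in>carrier (kaehler_K S). \<Lambda> (c \<odot>\<^bsub>BS\<^esub> KS.gen w) = ps c \<odot>\<^bsub>tic.\<Omega>\<^esub> L0 w)"
  proof (rule KS.base_change_lift[OF tic.\<Omega>.M.abelian_group_axioms])
    show "add_hom Kx0 tic.\<Omega> (\<lambda>c. ps c \<odot>\<^bsub>tic.\<Omega>\<^esub> L0 w)" if "w \<in> carrier (kaehler_K S)" for w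
      using that KT.smult_l_distr[of _ _ "L0 w"] by (intro add_homI) auto
    show "add_hom (kaehler_K S) tic.\<Omega> (\<lambda>w. ps c \<odot>\<^bsub>tic.\<Omega>\<^esub> L0 w)" if "c \<in> carrier Kx0" for c
      using that by (intro add_homI) (auto simp: tic.\<Omega>.smult_r_distr add_hom_add[OF \<iota>.kaehler_map_hom])
    show "ps c \<odot>\<^bsub>tic.\<Omega>\<^esub> L0 (k \<odot>\<^bsub>kaehler_K S\<^esub> w) = ps (k \<odot>\<^bsub>Kx0\<^esub> c) \<odot>\<^bsub>tic.\<Omega>\<^esub> L0 w"
      if c: "c \<in> carrier Kx0" and w: "w \<in> carrier (kaehler_K S)" for c w k
    proof -
      \<comment> \<open>A constant polynomial acts on \<open>tic\<close> through the algebra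
        structure over \<open>K\<close>, and this agrees with its action on the differentials of
        \<open>S\<close>.\<close>
      have a: "alg_map Kx0 k = up_ring.monom Kx0 k 0"
      proof -
        have "\<one>\<^bsub>Kx0\<^esub> = up_ring.monom Kx0 (1::'k) 0" by (auto simp: UP_def class_ring_simps)
        then show ?thesis using Kx0_monom(3)[of k 1 0] by (simp add: alg_map_def)
      qed
      have "ps (k \<odot>\<^bsub>Kx0\<^esub> c) = ps (alg_map Kx0 k) \<otimes>\<^bsub>tic\<^esub> ps c"
        using c ring_hom_mult[OF tic.poly_scalar_hom(1)[OF X0_closed], of "alg_map Kx0 k" c]
        by (simp add: KS.KX.alg_map_mult)
      also have "ps (alg_map Kx0 k) = alg_map tic k"
        using tic.poly_scalar_hom(2)[OF X0_closed, of k 0] unfolding a by (simp add: alg_map_def)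
      finally show ?thesis using c w
        by (simp add: \<iota>.kaehler_map_smult \<iota>.hom_alg_map tic.\<Omega>.smult_assoc1[symmetric] tic.A.m_comm)
    qed
  qed
  then show ?thesis by simp
qed

definition "\<Lambda> = (SOME \<Lambda>. add_hom BS tic.\<Omega> \<Lambda> \<and>
    (\<forall>c\<in>carrier Kx0. \<forall>w\<in>carrier S.\<Omega>. \<Lambda> (c \<odot>\<^bsub>BS\<^esub> KS.gen w) = ps c \<odot>\<^bsub>tic.\<Omega>\<^esub> L0 w))"

lemma \<Lambda>_hom: "add_hom BS tic.\<Omega> \<Lambda>"
  and \<Lambda>_gen: "c \<in> carrier Kx0 \<Longrightarrow> w \<in> carrier S.\<Omega> \<Longrightarrow> \<Lambda> (c \<odot>\<^bsub>BS\<^esub> KS.gen w) = ps c \<odot>\<^bsub>tic.\<Omega>\<^esub> L0 w"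
  using someI_ex[OF \<Lambda>_ex] unfolding \<Lambda>_def[symmetric] by blast+

lemma \<Lambda>_x0pow:
  assumes "w \<in> carrier S.\<Omega>" shows "\<Lambda> (KS.x0pow k w) = W (mn \<one>\<^bsub>S\<^esub> k) \<odot>\<^bsub>tic.\<Omega>\<^esub> L0 w"
  by (simp only: KS.x0pow_def KS.tensor_eq \<Lambda>_gen[OF _ assms] KS.monom_closed ps_monom S.smult_one S.A.one_closed)

lemma \<Lambda>_kd:
  assumes "s \<in> carrier S" "t \<in> carrier S"
  shows "\<Lambda> (KS.x0pow k (s \<odot>\<^bsub>S.\<Omega>\<^esub> S.d t)) = W (mn s k) \<odot>\<^bsub>tic.\<Omega>\<^esub> tic.d (W (mn t 0))"
  using assms
  by (simp add: \<Lambda>_x0pow \<iota>.kaehler_map_kd tic.\<Omega>.smult_assoc1[symmetric] \<iota>_def W_mn_mult)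

definition "\<Xi> v = W (fst v) \<odot>\<^bsub>tic.\<Omega>\<^esub> tic.d X0 \<oplus>\<^bsub>tic.\<Omega>\<^esub> \<Lambda> (snd v)"

lemma \<Xi>_hom: "add_hom split tic.\<Omega> \<Xi>"
proof (rule add_homI)
  have c: "W p \<odot>\<^bsub>tic.\<Omega>\<^esub> tic.d X0 \<in> carrier tic.\<Omega>" if "p \<in> carrier TT" for p using that by simp
  have l: "\<Lambda> t \<in> carrier tic.\<Omega>" if "t \<in> carrier BS" for t using add_hom_closed[OF \<Lambda>_hom that] .
  show "\<Xi> v \<in> carrier tic.\<Omega>" if "v \<in> carrier split" for v
    using that c[of "fst v"] l[of "snd v"] by (auto simp: \<Xi>_def split_simps)
  fix v w assume "v \<in> carrier split" "w \<in> carrier split"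
  then have m: "fst v \<in> carrier TT" "fst w \<in> carrier TT" "snd v \<in> carrier BS" "snd w \<in> carrier BS"
    by (auto simp: split_simps)
  have "W (fst v \<oplus>\<^bsub>TT\<^esub> fst w) \<odot>\<^bsub>tic.\<Omega>\<^esub> tic.d X0 = W (fst v) \<odot>\<^bsub>tic.\<Omega>\<^esub> tic.d X0 \<oplus>\<^bsub>tic.\<Omega>\<^esub> W (fst w) \<odot>\<^bsub>tic.\<Omega>\<^esub> tic.d X0"
    using m tic.\<Omega>.smult_l_distr[of "W (fst v)" "W (fst w)" "tic.d X0"] by (simp add: W_ops)
  then show "\<Xi> (v \<oplus>\<^bsub>split\<^esub> w) = \<Xi> v \<oplus>\<^bsub>tic.\<Omega>\<^esub> \<Xi> w"
    using c[OF m(1)] c[OF m(2)] l[OF m(3)] l[OF m(4)]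
    by (simp add: \<Xi>_def split_simps add_hom_add[OF \<Lambda>_hom m(3,4)] tic.\<Omega>.M.a_ac)
qed

text \<open>By the product rule, d(t x_0^j) is x_0^j dt plus t d(x_0^j). These are the two
  components recorded in \<open>\<beta>m\<close>, so each generator is restored.\<close>

lemma \<Xi>_\<Theta>: assumes "w \<in> carrier tic.\<Omega>" shows "\<Xi> (\<Theta> w) = w"
proof (rule \<Omega>tic_eqI[OF add_hom_comp[OF \<Theta>_hom \<Xi>_hom] _ tic.\<Omega>.M.abelian_group_axioms _ assms])
  show "add_hom tic.\<Omega> tic.\<Omega> (\<lambda>w. w)" by (rule add_homI) auto
  fix s i t j assume st: "s \<in> carrier S" "t \<in> carrier S"
  have X: "W (mn \<one>\<^bsub>S\<^esub> j) = X0 [^]\<^bsub>tic\<^esub> j" by (simp only: X0_pow)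
  have W1: "W (mn t j) = W (mn \<one>\<^bsub>S\<^esub> j) \<otimes>\<^bsub>tic\<^esub> W (mn t 0)"
    using st W_mn_mult[of "\<one>\<^bsub>S\<^esub>" t j 0] by simp
  have Wc: "W (mn \<one>\<^bsub>S\<^esub> j) \<in> carrier tic" "W (mn t 0) \<in> carrier tic" "W (mn s i) \<in> carrier tic" using st by auto
  have "W (mn s i) \<odot>\<^bsub>tic.\<Omega>\<^esub> tic.d (W (mn t j)) =
      W (mn s (i + j)) \<odot>\<^bsub>tic.\<Omega>\<^esub> tic.d (W (mn t 0)) \<oplus>\<^bsub>tic.\<Omega>\<^esub> W (mn (s \<otimes>\<^bsub>S\<^esub> t) i) \<odot>\<^bsub>tic.\<Omega>\<^esub> tic.d (W (mn \<one>\<^bsub>S\<^esub> j))"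
    unfolding W1 tic.smult_kd_mult[OF Wc(3,1,2)] using st by (simp add: W_mn_mult)
  also have "W (mn (s \<otimes>\<^bsub>S\<^esub> t) i) \<odot>\<^bsub>tic.\<Omega>\<^esub> tic.d (W (mn \<one>\<^bsub>S\<^esub> j)) =
      W (mn (of_nat j \<odot>\<^bsub>S\<^esub> (s \<otimes>\<^bsub>S\<^esub> t)) (i + j - 1)) \<odot>\<^bsub>tic.\<Omega>\<^esub> tic.d X0"
  \<comment> \<open>For j = 0 the differential of 1 vanishes, in agreement with the coefficient
    zero; otherwise the power rule applies with exponent j - 1.\<close>
  proof (cases j)
    case 0
    have "W \<zero>\<^bsub>TT\<^esub> = \<zero>\<^bsub>tic\<^esub>" "W (mn \<one>\<^bsub>S\<^esub> 0) = \<one>\<^bsub>tic\<^esub>" by (simp_all add: W_ops S.T_fun(5))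
    then show ?thesis using 0 st by simp
  next
    case (Suc m)
    have "of_nat (Suc m) \<odot>\<^bsub>tic\<^esub> X0 [^]\<^bsub>tic\<^esub> m = W (mn (of_nat (Suc m) \<odot>\<^bsub>S\<^esub> \<one>\<^bsub>S\<^esub>) m)"
      by (simp add: X0_pow W_ops S.T_smult_pmon del: of_nat_Suc)
    then have "tic.d (W (mn \<one>\<^bsub>S\<^esub> j)) = W (mn (of_nat j \<odot>\<^bsub>S\<^esub> \<one>\<^bsub>S\<^esub>) m) \<odot>\<^bsub>tic.\<Omega>\<^esub> tic.d X0"
      using tic.kd_pow_Suc[OF X0_closed, of m] unfolding X[unfolded Suc] Suc by (simp only:)
    then show ?thesis using st Suc
      by (simp add: tic.\<Omega>.smult_assoc1[symmetric] W_mn_mult S.smult_mult_right del: of_nat_Suc)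
  qed
  finally have "W (mn s i) \<odot>\<^bsub>tic.\<Omega>\<^esub> tic.d (W (mn t j)) = \<Xi> (\<beta>m s i t j)"
    using st by (simp add: \<Xi>_def \<beta>m_def \<Lambda>_kd tic.\<Omega>.M.a_comm)
  then show "\<Xi> (\<Theta> (W (mn s i) \<odot>\<^bsub>tic.\<Omega>\<^esub> tic.d (W (mn t j)))) = W (mn s i) \<odot>\<^bsub>tic.\<Omega>\<^esub> tic.d (W (mn t j))"
    unfolding \<Theta>_pmon[OF st] by (rule sym)
qed

lemma \<Theta>_dx0:
  assumes p: "p \<in> carrier TT" shows "\<Theta> (W p \<odot>\<^bsub>tic.\<Omega>\<^esub> tic.d X0) = (p, \<zero>\<^bsub>BS\<^esub>)"
proof -
  have "\<beta>T p (mn \<one>\<^bsub>S\<^esub> 1) = (p, \<zero>\<^bsub>BS\<^esub>)"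
  proof (rule T_eqI[OF \<beta>T_left(1) _ split_ag _ p])
    show "add_hom TT split (\<lambda>p. (p, \<zero>\<^bsub>BS\<^esub>))" by (rule add_homI) (auto simp: split_simps)
    fix s i assume s: "s \<in> carrier S"
    have "KS.x0pow (i + 1) \<zero>\<^bsub>S.\<Omega>\<^esub> = \<zero>\<^bsub>BS\<^esub>"
      using add_hom_zero[OF KS.x0pow_hom KS.V.M.abelian_group_axioms KS.BC.M.abelian_group_axioms] by simp
    then show "\<beta>T (mn s i) (mn \<one>\<^bsub>S\<^esub> 1) = (mn s i, \<zero>\<^bsub>BS\<^esub>)" using s by (simp add: \<beta>T_pmon \<beta>m_def)
  qed simp
  then show ?thesis using p by (simp add: \<Theta>_kd X0_W)
qed

text \<open>The comparison is made on x_0^k \<otimes> w and there on w = s du. As u is a constant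
  polynomial, the dx_0-component of \<open>\<beta>m\<close> vanishes.\<close>

lemma \<Theta>_\<Lambda>:
  assumes t: "t \<in> carrier BS" shows "\<Theta> (\<Lambda> t) = (\<zero>\<^bsub>TT\<^esub>, t)"
proof (rule add_hom_eqI[OF add_hom_comp[OF \<Lambda>_hom \<Theta>_hom] _ KS.BC.M.abelian_group_axioms split_ag])
  show 1: "add_hom BS split (\<lambda>t. (\<zero>\<^bsub>TT\<^esub>, t))" by (rule add_homI) (auto simp: split_simps)
  show "{KS.x0pow k w | k w. w \<in> carrier (kaehler_K S)} \<subseteq> carrier BS" by auto
  show "t \<in> asum BS {KS.x0pow k w | k w. w \<in> carrier (kaehler_K S)}" using t KS.BC_asum_x0pow by simp
  fix b assume "b \<in> {KS.x0pow k w | k w. w \<in> carrier (kaehler_K S)}"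
  then obtain k w where b: "b = KS.x0pow k w" "w \<in> carrier S.\<Omega>" by auto
  have x0: "add_hom S.\<Omega> BS (KS.x0pow k)" using KS.x0pow_hom[of k] by (simp add: add_hom_def)
  have "\<Theta> (\<Lambda> (KS.x0pow k w)) = (\<zero>\<^bsub>TT\<^esub>, KS.x0pow k w)"
  proof (rule add_hom_eqI[OF add_hom_comp[OF x0 add_hom_comp[OF \<Lambda>_hom \<Theta>_hom]] add_hom_comp[OF x0 1]
        S.\<Omega>.M.abelian_group_axioms split_ag])
    show "w \<in> asum S.\<Omega> {a \<odot>\<^bsub>S.\<Omega>\<^esub> S.d b | a b. a \<in> carrier S \<and> b \<in> carrier S}" using b(2) S.kaehler_asum by simp
    fix v assume "v \<in> {a \<odot>\<^bsub>S.\<Omega>\<^esub> S.d b | a b. a \<in> carrier S \<and> b \<in> carrier S}"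
    then obtain s u where "v = s \<odot>\<^bsub>S.\<Omega>\<^esub> S.d u" "s \<in> carrier S" "u \<in> carrier S" by blast
    then show "\<Theta> (\<Lambda> (KS.x0pow k v)) = (\<zero>\<^bsub>TT\<^esub>, KS.x0pow k v)"
      by (simp add: \<Lambda>_kd \<Theta>_pmon) (simp add: \<beta>m_def)
  qed (auto intro!: S.\<Omega>.smult_closed)
  then show "\<Theta> (\<Lambda> b) = (\<zero>\<^bsub>TT\<^esub>, b)" using b by simp
qed

lemma \<Theta>_\<Xi>: assumes "v \<in> carrier split" shows "\<Theta> (\<Xi> v) = v"
proof -
  have m: "fst v \<in> carrier TT" "snd v \<in> carrier BS" using assms by (auto simp: split_simps)
  have "\<Theta> (\<Xi> v) = \<Theta> (W (fst v) \<odot>\<^bsub>tic.\<Omega>\<^esub> tic.d X0) \<oplus>\<^bsub>split\<^esub> \<Theta> (\<Lambda> (snd v))"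
    unfolding \<Xi>_def by (rule add_hom_add[OF \<Theta>_hom]) (use m add_hom_closed[OF \<Lambda>_hom m(2)] in auto)
  also have "\<dots> = v" using m by (simp add: \<Theta>_dx0 \<Theta>_\<Lambda> split_simps)
  finally show ?thesis .
qed

lemma \<Theta>_bij: "bij_betw \<Theta> (carrier tic.\<Omega>) (carrier split)"
  by (rule bij_betw_byWitness[where f' = \<Xi>])
     (use \<Xi>_\<Theta> \<Theta>_\<Xi> add_hom_closed[OF \<Theta>_hom] add_hom_closed[OF \<Xi>_hom] in auto)

section \<open>Compatibility of the splitting with the gradings\<close>

abbreviation "Rgr \<equiv> kaehler_grade R G"
abbreviation "tgr \<equiv> kaehler_grade tic tgrade"

definition "sgr i = poly_grade S (i - 1) \<times>
    (if i < 0 then {\<zero>\<^bsub>BS\<^esub>} else {KS.x0pow (nat i) w | w. w \<in> carrier S.\<Omega>})"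

lemma tgrade_carrier: "tgrade j \<subseteq> carrier tic" by (auto simp: tgrade_def)

lemma poly_grade_neg: "i < 0 \<Longrightarrow> poly_grade S i = {\<zero>\<^bsub>TT\<^esub>}" by (simp add: poly_grade_def poly_alg1_def)

lemma poly_grade_nat: "poly_grade S (int n) = {mn a n | a. a \<in> carrier S}"
  by (simp add: poly_grade_def S.pmon_def)

lemma tgrade_smult: "a \<in> tgrade j \<Longrightarrow> c \<odot>\<^bsub>tic\<^esub> a \<in> tgrade j"
proof (cases "j < 0")
  case True
  then show "a \<in> tgrade j \<Longrightarrow> c \<odot>\<^bsub>tic\<^esub> a \<in> tgrade j" by (simp add: tgrade_neg)
next
  case False
  then obtain n where j: "j = int n" by (metis nonneg_int_cases not_le)
  show "a \<in> tgrade j \<Longrightarrow> c \<odot>\<^bsub>tic\<^esub> a \<in> tgrade j"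
    unfolding j tgrade_nat by (auto simp: W_ops S.T_smult_pmon)
qed

lemma Rgr_asum: "Rgr i = asum R.\<Omega> (R.kaehler_homs G i)"
  by (rule R.kaehler_grade_asum) (auto intro: G_smult)

lemma tgr_asum: "tgr i = asum tic.\<Omega> (tic.kaehler_homs tgrade i)"
  by (rule tic.kaehler_grade_asum) (use tgrade_carrier tgrade_smult in auto)

lemma sgr_zero: "\<zero>\<^bsub>split\<^esub> \<in> sgr i"
proof -
  have "\<zero>\<^bsub>TT\<^esub> \<in> poly_grade S (i - 1)"
  proof (cases "i - 1 < 0")
    case True then show ?thesis by (simp add: poly_grade_neg)
  next
    case False
    then obtain n where "i - 1 = int n" by (metis nonneg_int_cases not_le)
    then show ?thesis using S.pmon_zero[of n] by (auto simp: poly_grade_nat simp del: S.pmon_zero intro!: exI[of _ "\<zero>\<^bsub>S\<^esub>"])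
  qed
  moreover have "\<zero>\<^bsub>BS\<^esub> = KS.x0pow k \<zero>\<^bsub>S.\<Omega>\<^esub>" for k
    using add_hom_zero[OF KS.x0pow_hom KS.V.M.abelian_group_axioms KS.BC.M.abelian_group_axioms, of k] by simp
  ultimately show ?thesis by (auto simp: sgr_def split_simps)
qed

lemma sgr_add: "v \<in> sgr i \<Longrightarrow> w \<in> sgr i \<Longrightarrow> v \<oplus>\<^bsub>split\<^esub> w \<in> sgr i"
proof -
  assume v: "v \<in> sgr i" and w: "w \<in> sgr i"
  have "fst v \<oplus>\<^bsub>TT\<^esub> fst w \<in> poly_grade S (i - 1)"
  proof (cases "i - 1 < 0")
    case True then show ?thesis using v w by (auto simp: sgr_def poly_grade_neg)
  next
    case False
    then obtain n where "i - 1 = int n" by (metis nonneg_int_cases not_le)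
    then show ?thesis using v w by (auto simp: sgr_def poly_grade_nat S.pmon_add[symmetric])
  qed
  moreover have "snd v \<oplus>\<^bsub>BS\<^esub> snd w \<in> (if i < 0 then {\<zero>\<^bsub>BS\<^esub>} else {KS.x0pow (nat i) w | w. w \<in> carrier S.\<Omega>})"
  proof (cases "i < 0")
    case True then show ?thesis using v w by (auto simp: sgr_def)
  next
    case False
    then obtain a b where "snd v = KS.x0pow (nat i) a" "a \<in> carrier S.\<Omega>" "snd w = KS.x0pow (nat i) b" "b \<in> carrier S.\<Omega>"
      using v w by (auto simp: sgr_def)
    then have "snd v \<oplus>\<^bsub>BS\<^esub> snd w = KS.x0pow (nat i) (a \<oplus>\<^bsub>S.\<Omega>\<^esub> b)" "a \<oplus>\<^bsub>S.\<Omega>\<^esub> b \<in> carrier S.\<Omega>"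
      by (simp_all add: KS_x0pow_add)
    then show ?thesis using False by auto
  qed
  ultimately show ?thesis by (auto simp: sgr_def split_simps)
qed

lemma \<Theta>_tgr_subset: "\<Theta> ` tgr i \<subseteq> sgr i"
proof -
  have hc: "tic.kaehler_homs tgrade i \<subseteq> carrier tic.\<Omega>" by (rule tic.kaehler_homs_carrier) (rule tgrade_carrier)
  have hom: "\<Theta> w \<in> sgr i" if wh: "w \<in> tic.kaehler_homs tgrade i" for w
  proof -
    obtain f g j k where w: "w = f \<odot>\<^bsub>tic.\<Omega>\<^esub> tic.d g" "f \<in> tgrade j" "g \<in> tgrade k" "j + k = i"
      using wh unfolding tic.kaehler_homs_def by blast
    have c: "f \<in> carrier tic" "g \<in> carrier tic" using w tgrade_carrier by auto
    show ?thesis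
    proof (cases "j < 0 \<or> k < 0")
      case True
      have "tic.d \<zero>\<^bsub>tic\<^esub> = \<zero>\<^bsub>tic.\<Omega>\<^esub>"
        using add_hom_zero[OF tic.kd_hom[OF tic.A.one_closed] tic.A.abelian_group_axioms tic.\<Omega>.M.abelian_group_axioms] by simp
      then have "w = \<zero>\<^bsub>tic.\<Omega>\<^esub>" using True w c tgrade_neg by auto
      then show ?thesis
        using sgr_zero add_hom_zero[OF \<Theta>_hom tic.\<Omega>.M.abelian_group_axioms split_ag] by simp
    next
      case False
      then obtain m n where jk: "j = int m" "k = int n" by (metis nonneg_int_cases not_le)
      obtain s t where st: "s \<in> carrier S" "t \<in> carrier S" "f = W (mn s m)" "g = W (mn t n)"
        using w(2,3) unfolding jk tgrade_nat by blast
      have i: "i = int (m + n)" using w(4) jk by simp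
      have 1: "mn (of_nat n \<odot>\<^bsub>S\<^esub> (s \<otimes>\<^bsub>S\<^esub> t)) (m + n - 1) \<in> poly_grade S (i - 1)"
      \<comment> \<open>In degree zero the exponent is truncated, but the coefficient is zero, as
        the zero component in degree -1 demands.\<close>
      proof (cases "m + n")
        case 0 then show ?thesis using st by (simp add: i poly_grade_neg)
      next
        case (Suc l) then have "i - 1 = int l" "m + n - 1 = l" using i by auto
        then show ?thesis using st by (auto simp: poly_grade_nat)
      qed
      have "KS.x0pow (m + n) (s \<odot>\<^bsub>S.\<Omega>\<^esub> S.d t) \<in> {KS.x0pow (nat i) w | w. w \<in> carrier S.\<Omega>}"
      proof -
        have ni: "nat i = m + n" using i by simp
        show ?thesis unfolding ni using S.\<Omega>.smult_closed[OF st(1) S.kd_closed[OF st(2)]] by blast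
      qed
      then have "\<beta>m s m t n \<in> sgr i" unfolding \<beta>m_def sgr_def using 1 i by auto
      then show ?thesis unfolding w(1) st using st by (simp only: \<Theta>_pmon)
    qed
  qed
  have "\<Theta> w \<in> sgr i" if "w \<in> asum tic.\<Omega> (tic.kaehler_homs tgrade i)" for w
    using that
  proof induction
    case asum_zero
    then show ?case using sgr_zero add_hom_zero[OF \<Theta>_hom tic.\<Omega>.M.abelian_group_axioms split_ag] by simp
  next
    case (asum_base b) then show ?case by (rule hom)
  next
    case (asum_add v w)
    then have "v \<in> carrier tic.\<Omega>" "w \<in> carrier tic.\<Omega>"
      using asum_subset[OF tic.\<Omega>.M.abelian_monoid_axioms hc] by auto
    then show ?case using asum_add.IH by (simp only: add_hom_add[OF \<Theta>_hom] sgr_add)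
  qed
  then show ?thesis by (auto simp: tgr_asum)
qed

lemma tgr_add: "v \<in> tgr i \<Longrightarrow> w \<in> tgr i \<Longrightarrow> v \<oplus>\<^bsub>tic.\<Omega>\<^esub> w \<in> tgr i"
  by (simp add: tgr_asum asum_add)

lemma tgr_hom: "f \<in> tgrade j \<Longrightarrow> g \<in> tgrade k \<Longrightarrow> f \<odot>\<^bsub>tic.\<Omega>\<^esub> tic.d g \<in> tgr (j + k)"
  unfolding tgr_asum by (rule asum_base) (auto simp: tic.kaehler_homs_def)

lemma \<Xi>_sgr: assumes v: "v \<in> sgr i" shows "\<Xi> v \<in> tgr i"
proof -
  have x1: "X0 \<in> tgrade 1" using tgrade_nat[of 1] by (auto simp: X0_W)
  have 1: "W (fst v) \<odot>\<^bsub>tic.\<Omega>\<^esub> tic.d X0 \<in> tgr i"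
    using v tgr_hom[OF _ x1, of "W (fst v)" "i - 1"] by (auto simp: tgrade_eq sgr_def)
  have 2: "\<Lambda> (snd v) \<in> tgr i"
  proof (cases "i < 0")
    case True
    then have "snd v = \<zero>\<^bsub>BS\<^esub>" using v by (auto simp: sgr_def)
    then have "\<Lambda> (snd v) = \<zero>\<^bsub>tic.\<Omega>\<^esub>"
      using add_hom_zero[OF \<Lambda>_hom KS.BC.M.abelian_group_axioms tic.\<Omega>.M.abelian_group_axioms] by (simp only:)
    then show ?thesis by (simp add: tgr_asum asum_zero)
  next
    case False
    then obtain n where i: "i = int n" by (metis nonneg_int_cases not_le)
    obtain w where w: "snd v = KS.x0pow n w" "w \<in> carrier S.\<Omega>" using v by (auto simp: sgr_def i)
    have x0: "add_hom S.\<Omega> BS (KS.x0pow n)" using KS.x0pow_hom[of n] by (simp add: add_hom_def)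
    have "\<Lambda> (KS.x0pow n w) \<in> asum tic.\<Omega> ((\<lambda>w. \<Lambda> (KS.x0pow n w)) ` {a \<odot>\<^bsub>S.\<Omega>\<^esub> S.d b | a b. a \<in> carrier S \<and> b \<in> carrier S})"
      by (rule asum_image[OF add_hom_comp[OF x0 \<Lambda>_hom] S.\<Omega>.M.abelian_group_axioms tic.\<Omega>.M.abelian_group_axioms])
         (use w S.kaehler_asum in \<open>auto intro!: S.\<Omega>.smult_closed\<close>)
    also have "\<dots> \<subseteq> tgr i"
      unfolding tgr_asum
    proof (rule asum_mono, rule subsetI)
      fix y assume "y \<in> (\<lambda>w. \<Lambda> (KS.x0pow n w)) ` {a \<odot>\<^bsub>S.\<Omega>\<^esub> S.d b | a b. a \<in> carrier S \<and> b \<in> carrier S}"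
      then obtain s t where st: "s \<in> carrier S" "t \<in> carrier S" "y = \<Lambda> (KS.x0pow n (s \<odot>\<^bsub>S.\<Omega>\<^esub> S.d t))" by blast
      then have "y = W (mn s n) \<odot>\<^bsub>tic.\<Omega>\<^esub> tic.d (W (mn t 0))" by (simp add: \<Lambda>_kd)
      moreover have "W (mn s n) \<in> tgrade (int n)" "W (mn t 0) \<in> tgrade (int 0)"
        using st(1,2) unfolding tgrade_nat by blast+
      ultimately show "y \<in> asum tic.\<Omega> (tic.kaehler_homs tgrade i)"
        using tgr_hom[of "W (mn s n)" "int n" "W (mn t 0)" "int 0"] by (simp add: i tgr_asum)
    qed
    finally show ?thesis using w by simp
  qed
  show ?thesis unfolding \<Xi>_def by (rule tgr_add[OF 1 2])
qed

text \<open>Every element of the target component is reached because the inverse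
  \<open>\<Xi>\<close> preserves degrees as well.\<close>

lemma \<Theta>_tgr: "\<Theta> ` tgr i = sgr i"
proof
  show "\<Theta> ` tgr i \<subseteq> sgr i" by (rule \<Theta>_tgr_subset)
  have "sgr i \<subseteq> carrier split"
  proof -
    have "poly_grade S (i - 1) \<subseteq> carrier TT"
    proof (cases "i - 1 < 0")
      case False
      then obtain n where "i - 1 = int n" by (metis nonneg_int_cases not_le)
      then show ?thesis by (auto simp: poly_grade_nat)
    qed (simp add: poly_grade_neg)
    then show ?thesis by (auto simp: sgr_def split_simps)
  qed
  then have "v = \<Theta> (\<Xi> v)" if "v \<in> sgr i" for v
    by (rule \<Theta>_\<Xi>[OF subsetD, OF _ that, symmetric])
  then show "sgr i \<subseteq> \<Theta> ` tgr i" using \<Xi>_sgr by blast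
qed

lemma \<Theta>_iso: "graded_mod_iso Kx0 KT tgr split sgr \<Theta>"
proof -
  have "mod_hom Kx0 KT split \<Theta>"
    by (intro mod_hom.intro mod_hom_axioms.intro module_KT module_split)
       (auto simp: LinearCombinations.module_hom_def add_hom_closed[OF \<Theta>_hom] add_hom_add[OF \<Theta>_hom] \<Theta>_smult)
  then show ?thesis
    unfolding graded_mod_iso_def graded_mod_hom_def using \<Theta>_bij \<Theta>_tgr by simp
qed

lemma \<Theta>_monomials:
  assumes "p \<in> carrier tic" "q \<in> carrier tic" "s \<in> carrier S" "t \<in> carrier S" "\<psi> p = mn s k" "\<psi> q = mn t 0"
  shows "\<Theta> (p \<odot>\<^bsub>tic.\<Omega>\<^esub> tic.d q) = (\<zero>\<^bsub>TT\<^esub>, KS.x0pow k (s \<odot>\<^bsub>S.\<Omega>\<^esub> S.d t))"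
  using assms by (simp add: \<Theta>_kd \<beta>T_pmon) (simp add: \<beta>m_def)

end

section \<open>Differentials in large degrees\<close>

text \<open>Each element is the sum of the terms x_0^n \<otimes> (its n-th coefficient): this is
  true for the generators, and both sides are additive.\<close>

lemma (in kspace) bcoef_zeroD:
  assumes t: "t \<in> carrier BC" and z: "\<And>n. bcoef t n = \<zero>\<^bsub>N\<^esub>" shows "t = \<zero>\<^bsub>BC\<^esub>"
proof -
  interpret s: suml_loc N BC "UNIV :: nat set" "\<lambda>m k. x0pow k m"
    by (intro suml_loc.intro suml_loc_axioms.intro V.M.abelian_group_axioms BC.M.abelian_group_axioms x0pow_hom)
  let ?f = "\<lambda>t. suml N BC UNIV (\<lambda>m k. x0pow k m) (bcoef t)"
  have "?f t = t"
  proof (rule add_hom_eqI[of BC BC ?f "\<lambda>t. t", OF _ _ BC.M.abelian_group_axioms BC.M.abelian_group_axioms])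
    show "add_hom BC BC ?f"
      by (rule add_homI) (simp_all add: s.suml_closed bcoef_fsupp bcoef_add s.suml_add)
    show "add_hom BC BC (\<lambda>t. t)" by (rule add_homI) auto
    show "t \<in> asum BC {x0pow k m | k m. m \<in> carrier N}" using t BC_asum_x0pow by simp
    fix b assume "b \<in> {x0pow k m | k m. m \<in> carrier N}"
    then obtain k m where "b = x0pow k m" "m \<in> carrier N" by blast
    then show "?f b = b" by (simp add: bcoef_x0pow s.suml_single)
  qed auto
  moreover have "?f t = \<zero>\<^bsub>BC\<^esub>" using z by (simp add: suml_def)
  ultimately show ?thesis by simp
qed

text \<open>Multiplication by x_0^k shifts coefficients. Together with \<open>bcoef_zeroD\<close>
  this makes x_0 injective on the base change, which the description of the torsion uses.\<close>

lemma (in kspace) bcoef_monom: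
  assumes "t \<in> carrier BC" shows "bcoef (up_ring.monom Kx0 1 k \<odot>\<^bsub>BC\<^esub> t) (n + k) = bcoef t n"
proof (rule add_hom_eqI[OF _ bcoef_hom BC.M.abelian_group_axioms V.M.abelian_group_axioms])
  show "add_hom BC N (\<lambda>t. bcoef (up_ring.monom Kx0 1 k \<odot>\<^bsub>BC\<^esub> t) (n + k))"
    by (rule add_hom_comp[OF _ bcoef_hom]) (rule add_homI; simp add: BC.smult_r_distr)
  show "t \<in> asum BC {x0pow k m | k m. m \<in> carrier N}" using assms BC_asum_x0pow by simp
  fix b assume "b \<in> {x0pow k m | k m. m \<in> carrier N}"
  then obtain j m where b: "b = x0pow j m" "m \<in> carrier N" by blast
  have "up_ring.monom Kx0 1 k \<odot>\<^bsub>BC\<^esub> x0pow j m = x0pow (k + j) m"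
    using monom_x0pow[OF b(2), of 1 k j] V.smult_one[of m] b by simp
  then show "bcoef (up_ring.monom Kx0 1 k \<odot>\<^bsub>BC\<^esub> b) (n + k) = bcoef b n"
    using b by (simp add: bcoef_x0pow)
qed auto

context graded_deh
begin

abbreviation "\<Phi> \<equiv> kaehler_map R tic emb"

lemma \<Phi>_closed [simp, intro]: "w \<in> carrier R.\<Omega> \<Longrightarrow> \<Phi> w \<in> carrier tic.\<Omega>"
  using add_hom_closed[OF emb.kaehler_map_hom] .

lemma emb_G: "f \<in> G (int j) \<Longrightarrow> emb f = W (mn (h f) j)"
  using G_carrier[of f] by (simp add: emb_\<chi> \<chi>_G)

lemma \<Theta>\<Phi>_hom: "add_hom R.\<Omega> split (\<lambda>w. \<Theta> (\<Phi> w))"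
  by (rule add_hom_comp[OF emb.kaehler_map_hom \<Theta>_hom])

lemma \<Theta>\<Phi>_homog:
  assumes "f \<in> G (int j)" "g \<in> G (int k)"
  shows "\<Theta> (\<Phi> (f \<odot>\<^bsub>R.\<Omega>\<^esub> R.d g)) = \<beta>m (h f) j (h g) k"
  using assms G_carrier[OF assms(1)] G_carrier[OF assms(2)] by (simp add: emb.kaehler_map_kd emb_G \<Theta>_pmon)

lemma \<Phi>_graded: "\<Phi> ` Rgr i \<subseteq> tgr i"
proof -
  have "R.kaehler_homs G i \<subseteq> carrier R.\<Omega>" by (rule R.kaehler_homs_carrier) (rule G_sub)
  then have "\<Phi> w \<in> asum tic.\<Omega> (\<Phi> ` R.kaehler_homs G i)" if "w \<in> Rgr i" for w
    using asum_image[OF emb.kaehler_map_hom R.\<Omega>.M.abelian_group_axioms tic.\<Omega>.M.abelian_group_axioms] that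
    by (simp add: Rgr_asum)
  moreover have "\<Phi> ` R.kaehler_homs G i \<subseteq> asum tic.\<Omega> (tic.kaehler_homs tgrade i)"
  proof (rule image_subsetI)
    fix w assume "w \<in> R.kaehler_homs G i"
    then obtain f g j k where w: "w = f \<odot>\<^bsub>R.\<Omega>\<^esub> R.d g" "f \<in> G j" "g \<in> G k" "j + k = i"
      unfolding R.kaehler_homs_def by blast
    have "emb f \<in> tgrade j" "emb g \<in> tgrade k"
      using emb_graded w unfolding graded_alg_hom_def by blast+
    then show "\<Phi> w \<in> asum tic.\<Omega> (tic.kaehler_homs tgrade i)"
      using tgr_hom[of "emb f" j "emb g" k] w G_carrier[OF w(2)] G_carrier[OF w(3)]
      by (simp add: emb.kaehler_map_kd tgr_asum)
  qed
  ultimately show ?thesis unfolding tgr_asum using asum_mono by blast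
qed

lemma Rgr_hom: "f \<in> G j \<Longrightarrow> g \<in> G k \<Longrightarrow> f \<odot>\<^bsub>R.\<Omega>\<^esub> R.d g \<in> Rgr (j + k)"
  unfolding Rgr_asum by (rule asum_base) (auto simp: R.kaehler_homs_def)

lemma Rgr_add: "v \<in> Rgr i \<Longrightarrow> w \<in> Rgr i \<Longrightarrow> v \<oplus>\<^bsub>R.\<Omega>\<^esub> w \<in> Rgr i"
  by (simp add: Rgr_asum asum_add)

lemma Rgr_carrier: "Rgr i \<subseteq> carrier R.\<Omega>"
  unfolding Rgr_asum
  by (rule asum_subset[OF R.\<Omega>.M.abelian_monoid_axioms]) (rule R.kaehler_homs_carrier, rule G_sub)

section \<open>Generation of the differentials by dx_0, ..., dx_n\<close>

definition "dgens i = {f \<odot>\<^bsub>R.\<Omega>\<^esub> R.d v | f v. f \<in> G (i - 1) \<and> v \<in> X}"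

lemma dgens_carrier: "dgens i \<subseteq> carrier R.\<Omega>"
  using X_G G_carrier by (auto simp: dgens_def intro!: R.\<Omega>.smult_closed)

text \<open>Induction on the degree of g: the product rule removes one linear factor of g at the
  expense of raising the degree of the coefficient, and constants have differential zero.\<close>

lemma kd_dgens: "f \<in> G j \<Longrightarrow> g \<in> G (int k) \<Longrightarrow> f \<odot>\<^bsub>R.\<Omega>\<^esub> R.d g \<in> asum R.\<Omega> (dgens (j + int k))"
proof (induction k arbitrary: j f g)
  case 0
  then obtain c where g: "g = alg_map R c" using G_gen0 by auto
  have "f \<odot>\<^bsub>R.\<Omega>\<^esub> R.d g = (c \<odot>\<^bsub>R\<^esub> f) \<odot>\<^bsub>R.\<Omega>\<^esub> R.d \<one>\<^bsub>R\<^esub>"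
    unfolding g alg_map_def by (rule R.smult_kd_smult) (use G_carrier[OF 0(1)] in auto)
  then show ?case using G_carrier[OF 0(1)] by (simp add: asum_zero)
next
  case (Suc k)
  have fc: "f \<in> carrier R" using Suc.prems by auto
  have Xc: "v \<in> carrier R" if "v \<in> X" for v using X_G that by auto
  have "(\<lambda>g. f \<odot>\<^bsub>R.\<Omega>\<^esub> R.d g) g \<in> asum R.\<Omega> ((\<lambda>g. f \<odot>\<^bsub>R.\<Omega>\<^esub> R.d g) ` {v \<otimes>\<^bsub>R\<^esub> f | v f. v \<in> X \<and> f \<in> G (int k)})"
    by (rule asum_image[OF R.kd_hom[OF fc] R.A.abelian_group_axioms R.\<Omega>.M.abelian_group_axioms])
       (use Suc.prems(2)[unfolded G_gen] Xc in auto)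
  also have "\<dots> \<subseteq> asum R.\<Omega> (dgens (j + int (Suc k)))"
  proof (rule asum_mono, rule image_subsetI)
    fix y assume "y \<in> {v \<otimes>\<^bsub>R\<^esub> f | v f. v \<in> X \<and> f \<in> G (int k)}"
    then obtain v g' where y: "y = v \<otimes>\<^bsub>R\<^esub> g'" "v \<in> X" "g' \<in> G (int k)" by blast
    have vg: "v \<in> G 1" "v \<in> carrier R" "g' \<in> carrier R" using y X_G G_carrier by auto
    have "f \<odot>\<^bsub>R.\<Omega>\<^esub> R.d y = (f \<otimes>\<^bsub>R\<^esub> v) \<odot>\<^bsub>R.\<Omega>\<^esub> R.d g' \<oplus>\<^bsub>R.\<Omega>\<^esub> (f \<otimes>\<^bsub>R\<^esub> g') \<odot>\<^bsub>R.\<Omega>\<^esub> R.d v"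
      unfolding y(1) using fc vg by (intro R.smult_kd_mult)
    moreover have "(f \<otimes>\<^bsub>R\<^esub> v) \<odot>\<^bsub>R.\<Omega>\<^esub> R.d g' \<in> asum R.\<Omega> (dgens (j + int (Suc k)))"
      using Suc.IH[OF G_mult[OF Suc.prems(1) vg(1)] y(3)] by (simp add: add.assoc)
    moreover have "f \<otimes>\<^bsub>R\<^esub> g' \<in> G (j + int (Suc k) - 1)" using G_mult[OF Suc.prems(1) y(3)] by simp
    then have "(f \<otimes>\<^bsub>R\<^esub> g') \<odot>\<^bsub>R.\<Omega>\<^esub> R.d v \<in> asum R.\<Omega> (dgens (j + int (Suc k)))"
      using y(2) by (intro asum_base) (auto simp: dgens_def)
    ultimately show "f \<odot>\<^bsub>R.\<Omega>\<^esub> R.d y \<in> asum R.\<Omega> (dgens (j + int (Suc k)))" by (simp add: asum_add)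
  qed
  finally show ?case .
qed

text \<open>In a product f dg the degree of f may be too small for f to be recovered as a lift.
  After this reduction g is linear and f has degree i - 1, which is large enough. The same
  generators also show that the component has finite dimension.\<close>

lemma Rgr_dgens: "Rgr i = asum R.\<Omega> (dgens i)"
proof
  show "Rgr i \<subseteq> asum R.\<Omega> (dgens i)"
    unfolding Rgr_asum
  proof (rule asum_mono, rule subsetI)
    fix w assume "w \<in> R.kaehler_homs G i"
    then obtain f g j k where w: "w = f \<odot>\<^bsub>R.\<Omega>\<^esub> R.d g" "f \<in> G j" "g \<in> G k" "j + k = i"
      unfolding R.kaehler_homs_def by blast
    show "w \<in> asum R.\<Omega> (dgens i)"
    proof (cases "k < 0")
      case True
      then have "g = \<zero>\<^bsub>R\<^esub>" using w G_neg by auto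
      then have "w = \<zero>\<^bsub>R.\<Omega>\<^esub>" unfolding w(1)
        using add_hom_zero[OF R.kd_hom[OF G_carrier[OF w(2)]] R.A.abelian_group_axioms R.\<Omega>.M.abelian_group_axioms] by simp
      then show ?thesis by (simp add: asum_zero)
    next
      case False
      then obtain n where "k = int n" by (metis nonneg_int_cases not_le)
      then show ?thesis using kd_dgens[of f j g n] w by simp
    qed
  qed
  show "asum R.\<Omega> (dgens i) \<subseteq> Rgr i"
    unfolding Rgr_asum
  proof (rule asum_mono, rule subsetI)
    fix w assume "w \<in> dgens i"
    then obtain f v where "w = f \<odot>\<^bsub>R.\<Omega>\<^esub> R.d v" "f \<in> G (i - 1)" "v \<in> G 1" using X_G by (auto simp: dgens_def)
    then show "w \<in> asum R.\<Omega> (R.kaehler_homs G i)" using Rgr_hom[of f "i - 1" v 1] by (simp add: Rgr_asum)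
  qed
qed

text \<open>\<open>om n s t\<close> is the candidate for the element of degree \<open>n\<close> that \<open>\<Phi>\<close> maps to \<open>x\<^sub>0\<^sup>n s dt\<close>: the
  multiple of \<open>dx\<^sub>0\<close> cancels the contribution of \<open>d(x\<^sub>0\<^sup>r)\<close>. By \<open>om_eq\<close> the representative of
  \<open>t\<close> may be taken in any degree that leaves room for a representative of \<open>s\<close>.\<close>

definition "om' n s g a = lft (n - a) s \<odot>\<^bsub>R.\<Omega>\<^esub> R.d g \<oplus>\<^bsub>R.\<Omega>\<^esub>
  ((- of_nat a) \<odot>\<^bsub>R\<^esub> lft (n - 1) (s \<otimes>\<^bsub>S\<^esub> h g)) \<odot>\<^bsub>R.\<Omega>\<^esub> R.d x"

definition "om n s t = om' n s (lft r t) r"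

text \<open>Replacing g by x_0 g adds the lift of s h(g) in degree n - 1, times dx_0, by the product
  rule; raising a by one subtracts the same term.\<close>

lemma om'_step:
  assumes s: "s \<in> carrier S" and g: "g \<in> G (int a)" and n: "r + Suc a \<le> n"
  shows "om' n s (x \<otimes>\<^bsub>R\<^esub> g) (Suc a) = om' n s g a"
proof -
  have gc: "g \<in> carrier R" "h g \<in> carrier S" using g by auto
  let ?l = "lft (n - Suc a) s" and ?m = "lft (n - 1) (s \<otimes>\<^bsub>S\<^esub> h g)"
  have l: "?l \<in> carrier R" using s n by (intro lft_carrier) auto
  have m: "?m \<in> carrier R" using s gc n by (intro lft_carrier) auto
  have "n - Suc a + 1 = n - a" using n by simp
  then have lx: "?l \<otimes>\<^bsub>R\<^esub> x = lft (n - a) s"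
    using lft_mult[of "n - Suc a" s x 1] s n x_G by (simp add: h_x)
  have "n - Suc a + a = n - 1" using n by simp
  then have lg: "?l \<otimes>\<^bsub>R\<^esub> g = ?m" using lft_mult[of "n - Suc a" s g a] s n g by simp
  have hx: "h (x \<otimes>\<^bsub>R\<^esub> g) = h g" using gc by (simp add: h.hom_mult h_x)
  have "?l \<odot>\<^bsub>R.\<Omega>\<^esub> R.d (x \<otimes>\<^bsub>R\<^esub> g) = lft (n - a) s \<odot>\<^bsub>R.\<Omega>\<^esub> R.d g \<oplus>\<^bsub>R.\<Omega>\<^esub> ?m \<odot>\<^bsub>R.\<Omega>\<^esub> R.d x"
    using R.smult_kd_mult[OF l x_carrier gc(1)] by (simp add: lx lg)
  moreover have "?m \<odot>\<^bsub>R.\<Omega>\<^esub> R.d x \<oplus>\<^bsub>R.\<Omega>\<^esub> ((- of_nat (Suc a)) \<odot>\<^bsub>R\<^esub> ?m) \<odot>\<^bsub>R.\<Omega>\<^esub> R.d x = ((- of_nat a) \<odot>\<^bsub>R\<^esub> ?m) \<odot>\<^bsub>R.\<Omega>\<^esub> R.d x"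
  proof -
    have "?m \<oplus>\<^bsub>R\<^esub> (- of_nat (Suc a)) \<odot>\<^bsub>R\<^esub> ?m = (- of_nat a) \<odot>\<^bsub>R\<^esub> ?m"
      using R.smult_plus[OF m, of 1 "- of_nat (Suc a)"] m by simp
    then show ?thesis using m by (simp add: R.\<Omega>.smult_l_distr[symmetric] del: of_nat_Suc)
  qed
  moreover have "lft (n - a) s \<odot>\<^bsub>R.\<Omega>\<^esub> R.d g \<in> carrier R.\<Omega>"
    using s n gc by (intro R.\<Omega>.smult_closed lft_carrier R.kd_closed) auto
  ultimately show ?thesis using m by (simp add: om'_def hx R.\<Omega>.M.a_assoc del: of_nat_Suc)
qed

lemma om'_pow:
  assumes s: "s \<in> carrier S" and g: "g \<in> G (int a)"
  shows "r + a + e \<le> n \<Longrightarrow> om' n s (x [^]\<^bsub>R\<^esub> e \<otimes>\<^bsub>R\<^esub> g) (a + e) = om' n s g a"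
proof (induction e)
  case 0
  then show ?case using G_carrier[OF g] by simp
next
  case (Suc e)
  have "x [^]\<^bsub>R\<^esub> e \<otimes>\<^bsub>R\<^esub> g \<in> G (int (a + e))" using G_mult[OF xpow_G g, of e] by (simp add: add.commute)
  moreover have "x [^]\<^bsub>R\<^esub> Suc e \<otimes>\<^bsub>R\<^esub> g = x \<otimes>\<^bsub>R\<^esub> (x [^]\<^bsub>R\<^esub> e \<otimes>\<^bsub>R\<^esub> g)"
    using G_carrier[OF g] by (simp add: R.A.m_ac)
  ultimately show ?case using om'_step[OF s, of "x [^]\<^bsub>R\<^esub> e \<otimes>\<^bsub>R\<^esub> g" "a + e" n] Suc by simp
qed

text \<open>The form g and the lift of h(g) to degree r have the same dehomogenization, so the one
  of lower degree becomes the other after multiplication by a power of x_0. The two bounds on n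
  leave room for lifting s against either representative.\<close>

lemma om_eq:
  assumes s: "s \<in> carrier S" and g: "g \<in> G (int a)" and n: "r + a \<le> n" "2 * r \<le> n"
  shows "om n s (h g) = om' n s g a"
proof -
  have gc: "g \<in> carrier R" using g by auto
  have l: "lft r (h g) \<in> G (int r)" "h (lft r (h g)) = h g" using lft[of r "h g"] gc by auto
  have lc: "lft r (h g) \<in> carrier R" using l(1) by auto
  show ?thesis
  proof (cases "a \<le> r")
    case True
    have "x [^]\<^bsub>R\<^esub> (r - a) \<otimes>\<^bsub>R\<^esub> g = lft r (h g)"
      by (rule h_eqD[of _ "int r"])
         (use G_mult[OF xpow_G g, of "r - a"] True l gc in \<open>auto simp: h.hom_mult h_xpow\<close>)
    then show ?thesis using om'_pow[OF s g, of "r - a" n] True n by (simp add: om_def)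
  next
    case False
    have "x [^]\<^bsub>R\<^esub> (a - r) \<otimes>\<^bsub>R\<^esub> lft r (h g) = g"
      by (rule h_eqD[of _ "int a"])
         (use G_mult[OF xpow_G l(1), of "a - r"] False l lc gc g in \<open>auto simp: h.hom_mult h_xpow\<close>)
    then show ?thesis using om'_pow[OF s l(1), of "a - r" n] False n by (simp add: om_def)
  qed
qed

section \<open>The inverse of \<Phi> on the differentials of S\<close>

context
  fixes n :: nat
  assumes n: "2 * r + 1 \<le> n"
begin

lemma om_closed: "s \<in> carrier S \<Longrightarrow> t \<in> carrier S \<Longrightarrow> om n s t \<in> Rgr (int n)"
proof -
  assume st: "s \<in> carrier S" "t \<in> carrier S"
  have g: "lft r t \<in> G (int r)" using st lft by auto
  have 1: "lft (n - r) s \<in> G (int (n - r))" using st n by (intro lft) auto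
  have "s \<otimes>\<^bsub>S\<^esub> h (lft r t) \<in> carrier S" using st g by auto
  then have 2: "(- of_nat r) \<odot>\<^bsub>R\<^esub> lft (n - 1) (s \<otimes>\<^bsub>S\<^esub> h (lft r t)) \<in> G (int (n - 1))"
    using n by (intro G_smult lft) auto
  show ?thesis unfolding om_def om'_def
    using Rgr_hom[OF 1 g] Rgr_hom[OF 2 x_G] n by (intro Rgr_add) (auto simp: of_nat_diff)
qed

lemma om_carrier [simp, intro]: "s \<in> carrier S \<Longrightarrow> t \<in> carrier S \<Longrightarrow> om n s t \<in> carrier R.\<Omega>"
  using om_closed Rgr_carrier by blast

lemma om_unfold: "t \<in> carrier S \<Longrightarrow> om n s t = lft (n - r) s \<odot>\<^bsub>R.\<Omega>\<^esub> R.d (lft r t) \<oplus>\<^bsub>R.\<Omega>\<^esub>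
  ((- of_nat r) \<odot>\<^bsub>R\<^esub> lft (n - 1) (s \<otimes>\<^bsub>S\<^esub> t)) \<odot>\<^bsub>R.\<Omega>\<^esub> R.d x"
  by (simp add: om_def om'_def lft)

lemma lft_n: "s \<in> carrier S \<Longrightarrow> lft (n - r) s \<in> carrier R" "s \<in> carrier S \<Longrightarrow> lft (n - 1) s \<in> carrier R"
  "s \<in> carrier S \<Longrightarrow> lft r s \<in> carrier R"
  using n by (auto intro!: lft_carrier)

lemma lft_n_add: "s \<in> carrier S \<Longrightarrow> t \<in> carrier S \<Longrightarrow> lft (n - r) (s \<oplus>\<^bsub>S\<^esub> t) = lft (n - r) s \<oplus>\<^bsub>R\<^esub> lft (n - r) t"
  "s \<in> carrier S \<Longrightarrow> t \<in> carrier S \<Longrightarrow> lft (n - 1) (s \<oplus>\<^bsub>S\<^esub> t) = lft (n - 1) s \<oplus>\<^bsub>R\<^esub> lft (n - 1) t"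
  "s \<in> carrier S \<Longrightarrow> t \<in> carrier S \<Longrightarrow> lft r (s \<oplus>\<^bsub>S\<^esub> t) = lft r s \<oplus>\<^bsub>R\<^esub> lft r t"
  using n by (auto intro!: add_hom_add[OF lft_hom])

lemma om_left: assumes t: "t \<in> carrier S" shows "add_hom S R.\<Omega> (\<lambda>s. om n s t)"
proof -
  have 1: "add_hom S R.\<Omega> (\<lambda>s. lft (n - r) s \<odot>\<^bsub>R.\<Omega>\<^esub> R.d (lft r t))"
    using t by (intro add_homI) (simp_all add: lft_n lft_n_add R.\<Omega>.smult_l_distr)
  have 2: "add_hom S R.\<Omega> (\<lambda>s. ((- of_nat r) \<odot>\<^bsub>R\<^esub> lft (n - 1) (s \<otimes>\<^bsub>S\<^esub> t)) \<odot>\<^bsub>R.\<Omega>\<^esub> R.d x)"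
    using t by (intro add_homI)
      (simp_all add: lft_n lft_n_add R.\<Omega>.smult_l_distr S.A.l_distr R.smult_add del: One_nat_def)
  show ?thesis using add_hom_sum[OF 1 2 R.\<Omega>.M.abelian_group_axioms] t by (simp add: om_unfold)
qed

lemma om_right: assumes s: "s \<in> carrier S" shows "add_hom S R.\<Omega> (om n s)"
proof -
  have 1: "add_hom S R.\<Omega> (\<lambda>t. lft (n - r) s \<odot>\<^bsub>R.\<Omega>\<^esub> R.d (lft r t))"
    using s by (intro add_homI) (simp_all add: lft_n lft_n_add R.kd_add R.\<Omega>.smult_r_distr)
  have 2: "add_hom S R.\<Omega> (\<lambda>t. ((- of_nat r) \<odot>\<^bsub>R\<^esub> lft (n - 1) (s \<otimes>\<^bsub>S\<^esub> t)) \<odot>\<^bsub>R.\<Omega>\<^esub> R.d x)"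
    using s by (intro add_homI)
      (simp_all add: lft_n lft_n_add R.\<Omega>.smult_l_distr S.A.r_distr R.smult_add del: One_nat_def)
  note sum = add_hom_sum[OF 1 2 R.\<Omega>.M.abelian_group_axioms]
  show ?thesis
  proof (rule add_homI)
    show "om n s (t \<oplus>\<^bsub>S\<^esub> u) = om n s t \<oplus>\<^bsub>R.\<Omega>\<^esub> om n s u" if "t \<in> carrier S" "u \<in> carrier S" for t u
      using add_hom_add[OF sum that] that by (simp only: om_unfold S.A.a_closed)
  qed (use s in simp)
qed

lemma om_smult:
  assumes "s \<in> carrier S" "t \<in> carrier S" shows "om n s (c \<odot>\<^bsub>S\<^esub> t) = om n (c \<odot>\<^bsub>S\<^esub> s) t"
  using assms n
  by (simp add: om_unfold lft_smult lft_n R.smult_kd_smult S.smult_mult S.smult_mult_right)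

text \<open>The unit of \<open>S\<close> is represented by 1 in degree 0; there d1 = 0 and the
  correction has coefficient 0.\<close>

lemma om_one: "s \<in> carrier S \<Longrightarrow> om n s \<one>\<^bsub>S\<^esub> = \<zero>\<^bsub>R.\<Omega>\<^esub>"
  using om_eq[of s "\<one>\<^bsub>R\<^esub>" 0 n] G_one n lft_carrier[of n s] lft_n(2)[of s]
  by (simp add: om'_def h.hom_one)

text \<open>The rule is formulated for one factor u with s and t arbitrary, so that the set of such
  u is closed under sums and products and can be shown to be all of \<open>S\<close> from
  generators.\<close>

definition "leib u \<longleftrightarrow> u \<in> carrier S \<and> (\<forall>s\<in>carrier S. \<forall>t\<in>carrier S.
  om n s (t \<otimes>\<^bsub>S\<^esub> u) = om n (s \<otimes>\<^bsub>S\<^esub> t) u \<oplus>\<^bsub>R.\<Omega>\<^esub> om n (s \<otimes>\<^bsub>S\<^esub> u) t)"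

text \<open>The product of the lift of t with v has degree r + 1, so s is lifted to degree n - r -
  1, which is at least r by 2r + 1 \<le> n. The corrections match because -(r + 1) = -1 - r: by
  \<open>om_eq\<close>, v may be taken in degree 1 while t stays in degree r.\<close>

lemma leib_degree1:
  assumes v: "v \<in> G 1" shows "leib (h v)"
proof -
  have vc: "v \<in> carrier R" "h v \<in> carrier S" using v by auto
  have "om n s (t \<otimes>\<^bsub>S\<^esub> h v) = om n (s \<otimes>\<^bsub>S\<^esub> t) (h v) \<oplus>\<^bsub>R.\<Omega>\<^esub> om n (s \<otimes>\<^bsub>S\<^esub> h v) t"
    if st: "s \<in> carrier S" "t \<in> carrier S" for s t
  proof -
    let ?g = "lft r t" and ?l = "lft (n - Suc r) s" and ?m = "lft (n - 1) (s \<otimes>\<^bsub>S\<^esub> t \<otimes>\<^bsub>S\<^esub> h v)"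
    have g: "?g \<in> G (int r)" "h ?g = t" "?g \<in> carrier R" using st lft by auto
    have l: "?l \<in> carrier R" using st n by (intro lft_carrier) auto
    have m: "?m \<in> carrier R" using st vc n by (intro lft_carrier) auto
    have gv: "?g \<otimes>\<^bsub>R\<^esub> v \<in> G (int (Suc r))" using G_mult[OF g(1) v] by (simp add: add.commute)
    have e: "n - Suc r + r = n - 1" "n - Suc r + 1 = n - r" using n by auto
    have lg: "?l \<otimes>\<^bsub>R\<^esub> ?g = lft (n - 1) (s \<otimes>\<^bsub>S\<^esub> t)"
      using lft_mult[of "n - Suc r" s ?g r] st n g e by simp
    have lv: "?l \<otimes>\<^bsub>R\<^esub> v = lft (n - r) (s \<otimes>\<^bsub>S\<^esub> h v)"
      using lft_mult[of "n - Suc r" s v 1] st n v e by simp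
    have A: "om n s (t \<otimes>\<^bsub>S\<^esub> h v) = om' n s (?g \<otimes>\<^bsub>R\<^esub> v) (Suc r)"
      using om_eq[OF st(1) gv, of n] n g vc by (simp add: h.hom_mult)
    have B: "om n (s \<otimes>\<^bsub>S\<^esub> t) (h v) = om' n (s \<otimes>\<^bsub>S\<^esub> t) v 1"
      using om_eq[of "s \<otimes>\<^bsub>S\<^esub> t" v 1 n] n v st by simp
    have C: "om n (s \<otimes>\<^bsub>S\<^esub> h v) t = om' n (s \<otimes>\<^bsub>S\<^esub> h v) ?g r" by (simp add: om_def)
    have mm: "s \<otimes>\<^bsub>S\<^esub> h (?g \<otimes>\<^bsub>R\<^esub> v) = s \<otimes>\<^bsub>S\<^esub> t \<otimes>\<^bsub>S\<^esub> h v" "s \<otimes>\<^bsub>S\<^esub> h v \<otimes>\<^bsub>S\<^esub> h ?g = s \<otimes>\<^bsub>S\<^esub> t \<otimes>\<^bsub>S\<^esub> h v"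
      using g vc st by (simp_all add: h.hom_mult S.A.m_ac)
    let ?a = "lft (n - 1) (s \<otimes>\<^bsub>S\<^esub> t) \<odot>\<^bsub>R.\<Omega>\<^esub> R.d v" and ?b = "lft (n - r) (s \<otimes>\<^bsub>S\<^esub> h v) \<odot>\<^bsub>R.\<Omega>\<^esub> R.d ?g"
    let ?c = "\<lambda>k. ((- of_nat k) \<odot>\<^bsub>R\<^esub> ?m) \<odot>\<^bsub>R.\<Omega>\<^esub> R.d x"
    have cl: "?a \<in> carrier R.\<Omega>" "?b \<in> carrier R.\<Omega>" "\<And>k. ?c k \<in> carrier R.\<Omega>"
      using st vc g m lft_n by (auto intro!: R.\<Omega>.smult_closed)
    have cs: "?c (Suc r) = ?c 1 \<oplus>\<^bsub>R.\<Omega>\<^esub> ?c r"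
      using R.smult_plus[OF m, of "- of_nat 1" "- of_nat r"] m by (simp add: R.\<Omega>.smult_l_distr[symmetric])
    have "?l \<odot>\<^bsub>R.\<Omega>\<^esub> R.d (?g \<otimes>\<^bsub>R\<^esub> v) = ?a \<oplus>\<^bsub>R.\<Omega>\<^esub> ?b"
      using R.smult_kd_mult[OF l g(3) vc(1)] by (simp only: lg lv)
    then have "om n s (t \<otimes>\<^bsub>S\<^esub> h v) = (?a \<oplus>\<^bsub>R.\<Omega>\<^esub> ?b) \<oplus>\<^bsub>R.\<Omega>\<^esub> ?c (Suc r)"
      unfolding A om'_def mm by (simp only:)
    also have "\<dots> = (?a \<oplus>\<^bsub>R.\<Omega>\<^esub> ?c 1) \<oplus>\<^bsub>R.\<Omega>\<^esub> (?b \<oplus>\<^bsub>R.\<Omega>\<^esub> ?c r)"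
      unfolding cs using cl(1,2) cl(3)[of 1] cl(3)[of r] by (simp only: R.\<Omega>.M.a_ac R.\<Omega>.M.a_closed)
    also have "\<dots> = om n (s \<otimes>\<^bsub>S\<^esub> t) (h v) \<oplus>\<^bsub>R.\<Omega>\<^esub> om n (s \<otimes>\<^bsub>S\<^esub> h v) t"
      unfolding B C om'_def mm by (simp only:)
    finally show ?thesis .
  qed
  then show ?thesis using vc by (simp add: leib_def)
qed

lemma leib_const: "leib (alg_map S c)"
proof -
  have "om n s (t \<otimes>\<^bsub>S\<^esub> alg_map S c) = om n (s \<otimes>\<^bsub>S\<^esub> t) (alg_map S c) \<oplus>\<^bsub>R.\<Omega>\<^esub> om n (s \<otimes>\<^bsub>S\<^esub> alg_map S c) t"
    if st: "s \<in> carrier S" "t \<in> carrier S" for s t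
    using st by (simp add: alg_map_def S.smult_mult_right om_smult om_one)
  then show ?thesis by (simp add: leib_def)
qed

lemma leib_add: "leib u \<Longrightarrow> leib v \<Longrightarrow> leib (u \<oplus>\<^bsub>S\<^esub> v)"
  by (auto simp: leib_def S.A.r_distr add_hom_add[OF om_right] add_hom_add[OF om_left] R.\<Omega>.M.a_ac)

lemma leib_mult:
  assumes u: "leib u" and v: "leib v" shows "leib (u \<otimes>\<^bsub>S\<^esub> v)"
proof -
  have c: "u \<in> carrier S" "v \<in> carrier S" using u v by (auto simp: leib_def)
  have U: "\<And>s t. s \<in> carrier S \<Longrightarrow> t \<in> carrier S \<Longrightarrow> om n s (t \<otimes>\<^bsub>S\<^esub> u) = om n (s \<otimes>\<^bsub>S\<^esub> t) u \<oplus>\<^bsub>R.\<Omega>\<^esub> om n (s \<otimes>\<^bsub>S\<^esub> u) t"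
    and V: "\<And>s t. s \<in> carrier S \<Longrightarrow> t \<in> carrier S \<Longrightarrow> om n s (t \<otimes>\<^bsub>S\<^esub> v) = om n (s \<otimes>\<^bsub>S\<^esub> t) v \<oplus>\<^bsub>R.\<Omega>\<^esub> om n (s \<otimes>\<^bsub>S\<^esub> v) t"
    using u v by (auto simp: leib_def)
  have "om n s (t \<otimes>\<^bsub>S\<^esub> (u \<otimes>\<^bsub>S\<^esub> v)) = om n (s \<otimes>\<^bsub>S\<^esub> t) (u \<otimes>\<^bsub>S\<^esub> v) \<oplus>\<^bsub>R.\<Omega>\<^esub> om n (s \<otimes>\<^bsub>S\<^esub> (u \<otimes>\<^bsub>S\<^esub> v)) t"
    if st: "s \<in> carrier S" "t \<in> carrier S" for s t
  proof -
    have "om n s (t \<otimes>\<^bsub>S\<^esub> (u \<otimes>\<^bsub>S\<^esub> v)) = om n s ((t \<otimes>\<^bsub>S\<^esub> u) \<otimes>\<^bsub>S\<^esub> v)" using st c by (simp only: S.A.m_assoc)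
    also have "\<dots> = om n (s \<otimes>\<^bsub>S\<^esub> (t \<otimes>\<^bsub>S\<^esub> u)) v \<oplus>\<^bsub>R.\<Omega>\<^esub> (om n (s \<otimes>\<^bsub>S\<^esub> v \<otimes>\<^bsub>S\<^esub> t) u \<oplus>\<^bsub>R.\<Omega>\<^esub> om n (s \<otimes>\<^bsub>S\<^esub> v \<otimes>\<^bsub>S\<^esub> u) t)"
      using st c V[of s "t \<otimes>\<^bsub>S\<^esub> u"] U[of "s \<otimes>\<^bsub>S\<^esub> v" t] by simp
    also have "\<dots> = om n (s \<otimes>\<^bsub>S\<^esub> t) (u \<otimes>\<^bsub>S\<^esub> v) \<oplus>\<^bsub>R.\<Omega>\<^esub> om n (s \<otimes>\<^bsub>S\<^esub> (u \<otimes>\<^bsub>S\<^esub> v)) t"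
      using st c V[of "s \<otimes>\<^bsub>S\<^esub> t" u] by (simp add: R.\<Omega>.M.a_assoc S.A.m_ac)
    finally show ?thesis .
  qed
  then show ?thesis using c by (simp add: leib_def)
qed

text \<open>The element u is the dehomogenization of a form of degree r, and forms are built from
  constants and linear forms by sums and products; so the rule for those suffices.\<close>

lemma leib_all: assumes "u \<in> carrier S" shows "leib u"
proof -
  have "leib (h g)" if "g \<in> G (int k)" for g k
    using that
  proof (induction k arbitrary: g)
    case 0
    then show ?case using G_gen0 leib_const by (auto simp: h.hom_alg_map)
  next
    case (Suc k)
    have sub: "{v \<otimes>\<^bsub>R\<^esub> f | v f. v \<in> X \<and> f \<in> G (int k)} \<subseteq> carrier R" using X_G by auto
    from Suc.prems have "g \<in> asum R {v \<otimes>\<^bsub>R\<^esub> f | v f. v \<in> X \<and> f \<in> G (int k)}" by (simp only: G_gen)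
    then show ?case
    proof induction
      case asum_zero
      then show ?case using leib_const[of 0] by (simp add: h.hom_zero alg_map_def)
    next
      case (asum_base b)
      then obtain v f where b: "b = v \<otimes>\<^bsub>R\<^esub> f" "v \<in> X" "f \<in> G (int k)" by blast
      have "v \<in> carrier R" "f \<in> carrier R" using b X_G by auto
      moreover have "leib (h v)" "leib (h f)" using b X_G leib_degree1 Suc.IH by auto
      ultimately show ?case using b leib_mult by (simp add: h.hom_mult)
    next
      case (asum_add a b)
      then have "a \<in> carrier R" "b \<in> carrier R"
        using asum_subset[OF R.A.abelian_monoid_axioms sub] by auto
      then show ?case using asum_add.IH leib_add by (simp add: h.hom_add)
    qed
  qed
  from this[OF lft(1)[OF order_refl assms]] show ?thesis by (simp only: lft(2)[OF order_refl assms])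
qed

definition "Om = (\<lambda>Y. the_elem (suml S R.\<Omega> (carrier S) (om n) ` Y))"

lemma Om_hom: "add_hom S.\<Omega> R.\<Omega> Om"
  and Om_kd: "s \<in> carrier S \<Longrightarrow> t \<in> carrier S \<Longrightarrow> Om (s \<odot>\<^bsub>S.\<Omega>\<^esub> S.d t) = om n s t"
proof -
  have m: "om n a (b \<otimes>\<^bsub>S\<^esub> c) = om n (a \<otimes>\<^bsub>S\<^esub> b) c \<oplus>\<^bsub>R.\<Omega>\<^esub> om n (a \<otimes>\<^bsub>S\<^esub> c) b"
    if "a \<in> carrier S" "b \<in> carrier S" "c \<in> carrier S" for a b c
    using leib_all[OF that(3)] that by (simp add: leib_def)
  note l = om_left and r = om_right and s = om_smult
  show "add_hom S.\<Omega> R.\<Omega> Om"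
    unfolding Om_def by (rule S.kaehler_lift(1)[OF R.\<Omega>.M.abelian_group_axioms]) (fact l r m s)+
  show "Om (s \<odot>\<^bsub>S.\<Omega>\<^esub> S.d t) = om n s t" if st: "s \<in> carrier S" "t \<in> carrier S" for s t
    unfolding Om_def by (rule S.kaehler_lift(2)[OF R.\<Omega>.M.abelian_group_axioms]) (fact l r m s st)+
qed

end

end

lemma add_hom_zero_map: "abelian_group N \<Longrightarrow> add_hom M N (\<lambda>x. \<zero>\<^bsub>N\<^esub>)"
proof -
  assume "abelian_group N"
  then interpret N: abelian_group N .
  show ?thesis by (rule add_homI) simp_all
qed

text \<open>The integers are not well-ordered, so a lower bound b has to be supplied, and the least
  natural offset from b is taken. Both \<open>r_index\<close> and \<open>regularity_index\<close>
  are such least integers.\<close>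

lemma int_LeastI:
  fixes P :: "int \<Rightarrow> bool"
  assumes a: "P a" and b: "\<And>i. P i \<Longrightarrow> b \<le> i"
  shows "P (LEAST i. P i)" "(LEAST i. P i) \<le> a"
proof -
  define n where "n = (LEAST n::nat. P (b + int n))"
  have ex: "P (b + int (nat (a - b)))" using a b[OF a] by simp
  have n: "P (b + int n)" unfolding n_def by (rule LeastI[of _ "nat (a - b)"]) (rule ex)
  have le: "b + int n \<le> i" if "P i" for i
  proof -
    have "n \<le> nat (i - b)" unfolding n_def by (rule Least_le) (use that b[OF that] in simp)
    then show ?thesis using b[OF that] by simp
  qed
  have "(LEAST i. P i) = b + int n" by (rule Least_equality) (use n le in auto)
  then show "P (LEAST i. P i)" "(LEAST i. P i) \<le> a" using n le[OF a] by auto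
qed

lemma dim_zero_iff:
  assumes "vectorspace K V" "vectorspace.fin_dim K V"
  shows "vectorspace.dim K V = 0 \<longleftrightarrow> carrier V = {\<zero>\<^bsub>V\<^esub>}"
proof -
  interpret V: vectorspace K V by fact
  obtain B where B: "finite B" "V.basis B" using V.finite_basis_exists[OF assms(2)] by blast
  have d: "V.dim = card B" by (rule V.dim_basis[OF B])
  have g: "V.span B = carrier V" "V.lin_indpt B" "B \<subseteq> carrier V" using B by (auto simp: V.basis_def)
  show ?thesis
  proof
    assume "V.dim = 0"
    then have "B = {}" using d B by simp
    then show "carrier V = {\<zero>\<^bsub>V\<^esub>}" using g V.span_empty by simp
  next
    assume c: "carrier V = {\<zero>\<^bsub>V\<^esub>}"
    have "\<zero>\<^bsub>V\<^esub> \<notin> B" by (rule V.vs_zero_lin_dep[OF g(3,2)])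
    then have "B = {}" using g(3) c by auto
    then show "V.dim = 0" using d by simp
  qed
qed

lemma asum_incl: "B \<subseteq> asum M B"
  by (auto intro: asum_base)

lemma (in kalgebra) smult_neg_cancel:
  assumes "a \<in> carrier A" shows "c \<odot>\<^bsub>A\<^esub> a \<oplus>\<^bsub>A\<^esub> (- c) \<odot>\<^bsub>A\<^esub> a = \<zero>\<^bsub>A\<^esub>"
proof -
  have "c \<odot>\<^bsub>A\<^esub> a \<oplus>\<^bsub>A\<^esub> (- c) \<odot>\<^bsub>A\<^esub> a = (c + - c) \<odot>\<^bsub>A\<^esub> a" using smult_plus[OF assms, of c "- c"] by metis
  also have "\<dots> = \<zero>\<^bsub>A\<^esub>"
    using algebra.axioms(1)[OF alg] module.smult_l_null[of base_field A a] assms by (simp add: class_ring_simps)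
  finally show ?thesis .
qed

context graded_deh
begin

abbreviation "hc \<equiv> 2 * r + 1"

lemma lft_dx_hom: "r \<le> n \<Longrightarrow> add_hom S R.\<Omega> (\<lambda>s. lft n s \<odot>\<^bsub>R.\<Omega>\<^esub> R.d x)"
  by (rule add_hom_comp[OF lft_hom R.kd_hom_left]) auto

text \<open>\<open>\<Gamma>\<close> is a left inverse of \<open>\<Theta> \<circ> \<Phi>\<close> in the degrees from \<open>2 r + 1\<close> on; the other degrees are
  sent to \<open>0\<close>.\<close>

definition "\<Gamma>1 p = suml S R.\<Omega> UNIV (\<lambda>s n. if 2 * r \<le> n then lft n s \<odot>\<^bsub>R.\<Omega>\<^esub> R.d x else \<zero>\<^bsub>R.\<Omega>\<^esub>) p"
definition "\<Gamma>2 t = suml (kaehler_K S) R.\<Omega> UNIV (\<lambda>w n. if hc \<le> n then Om n w else \<zero>\<^bsub>R.\<Omega>\<^esub>) (KS.bcoef t)"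
definition "\<Gamma> v = \<Gamma>1 (fst v) \<oplus>\<^bsub>R.\<Omega>\<^esub> \<Gamma>2 (snd v)"

lemma \<Gamma>1: "add_hom TT R.\<Omega> \<Gamma>1" "s \<in> carrier S \<Longrightarrow> 2 * r \<le> n \<Longrightarrow> \<Gamma>1 (mn s n) = lft n s \<odot>\<^bsub>R.\<Omega>\<^esub> R.d x"
proof -
  interpret suml_loc S R.\<Omega> "UNIV :: nat set" "\<lambda>s n. if 2 * r \<le> n then lft n s \<odot>\<^bsub>R.\<Omega>\<^esub> R.d x else \<zero>\<^bsub>R.\<Omega>\<^esub>"
  proof (intro suml_loc.intro suml_loc_axioms.intro S.A.abelian_group_axioms R.\<Omega>.M.abelian_group_axioms)
    fix n :: nat
    show "add_hom S R.\<Omega> (\<lambda>s. if 2 * r \<le> n then lft n s \<odot>\<^bsub>R.\<Omega>\<^esub> R.d x else \<zero>\<^bsub>R.\<Omega>\<^esub>)"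
      using lft_dx_hom[of n] add_hom_zero_map[OF R.\<Omega>.M.abelian_group_axioms] by (cases "2 * r \<le> n") simp_all
  qed
  show "add_hom TT R.\<Omega> \<Gamma>1"
    unfolding \<Gamma>1_def by (rule add_homI) (simp_all add: suml_closed suml_add TT_fsupp S.T_fun(4))
  show "s \<in> carrier S \<Longrightarrow> 2 * r \<le> n \<Longrightarrow> \<Gamma>1 (mn s n) = lft n s \<odot>\<^bsub>R.\<Omega>\<^esub> R.d x"
    unfolding \<Gamma>1_def by (simp add: S.pmon_fun suml_single)
qed

lemma \<Gamma>2: "add_hom BS R.\<Omega> \<Gamma>2" "w \<in> carrier S.\<Omega> \<Longrightarrow> hc \<le> n \<Longrightarrow> \<Gamma>2 (KS.x0pow n w) = Om n w"
proof -
  interpret suml_loc "kaehler_K S" R.\<Omega> "UNIV :: nat set" "\<lambda>w n. if hc \<le> n then Om n w else \<zero>\<^bsub>R.\<Omega>\<^esub>"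
  proof (intro suml_loc.intro suml_loc_axioms.intro KS.V.M.abelian_group_axioms R.\<Omega>.M.abelian_group_axioms)
    fix n :: nat
    have "add_hom (kaehler_K S) R.\<Omega> (Om n)" if "hc \<le> n" using Om_hom[OF that] by (simp add: add_hom_def)
    then show "add_hom (kaehler_K S) R.\<Omega> (\<lambda>w. if hc \<le> n then Om n w else \<zero>\<^bsub>R.\<Omega>\<^esub>)"
      using add_hom_zero_map[OF R.\<Omega>.M.abelian_group_axioms] by (cases "hc \<le> n") simp_all
  qed
  show "add_hom BS R.\<Omega> \<Gamma>2"
    unfolding \<Gamma>2_def
    by (rule add_homI) (simp_all only: suml_closed suml_add KS.bcoef_fsupp KS.bcoef_add)
  show "w \<in> carrier S.\<Omega> \<Longrightarrow> hc \<le> n \<Longrightarrow> \<Gamma>2 (KS.x0pow n w) = Om n w"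
    unfolding \<Gamma>2_def using suml_single[of n w] KS.bcoef_x0pow[of w n] by simp
qed

lemma \<Gamma>_hom: "add_hom split R.\<Omega> \<Gamma>"
proof (rule add_homI)
  note c = add_hom_closed[OF \<Gamma>1(1)] add_hom_closed[OF \<Gamma>2(1)]
  show "\<Gamma> v \<in> carrier R.\<Omega>" if "v \<in> carrier split" for v
    using that c by (auto simp: \<Gamma>_def split_simps)
  fix v w assume "v \<in> carrier split" "w \<in> carrier split"
  then have m: "fst v \<in> carrier TT" "fst w \<in> carrier TT" "snd v \<in> carrier BS" "snd w \<in> carrier BS"
    by (auto simp: split_simps)
  show "\<Gamma> (v \<oplus>\<^bsub>split\<^esub> w) = \<Gamma> v \<oplus>\<^bsub>R.\<Omega>\<^esub> \<Gamma> w"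
    using c(1)[OF m(1)] c(1)[OF m(2)] c(2)[OF m(3)] c(2)[OF m(4)]
    by (simp add: \<Gamma>_def split_simps add_hom_add[OF \<Gamma>1(1) m(1,2)] add_hom_add[OF \<Gamma>2(1) m(3,4)] R.\<Omega>.M.a_ac)
qed

lemma \<Gamma>_homog: "s \<in> carrier S \<Longrightarrow> w \<in> carrier S.\<Omega> \<Longrightarrow> hc \<le> n \<Longrightarrow>
    \<Gamma> (mn s (n - 1), KS.x0pow n w) = lft (n - 1) s \<odot>\<^bsub>R.\<Omega>\<^esub> R.d x \<oplus>\<^bsub>R.\<Omega>\<^esub> Om n w"
  by (simp add: \<Gamma>_def \<Gamma>1(2) \<Gamma>2(2))

text \<open>With s and t the dehomogenizations of f and g, the first component yields k times the
  lift of st, times dx_0, and the correction in the second component cancels it. The bound r \<le> j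
  makes f the lift of its own dehomogenization and lets t be represented by g in degree k.\<close>

lemma \<Gamma>_\<beta>m:
  assumes f: "f \<in> G (int j)" and g: "g \<in> G (int k)" and j: "r \<le> j" and n: "hc \<le> j + k"
  shows "\<Gamma> (\<beta>m (h f) j (h g) k) = f \<odot>\<^bsub>R.\<Omega>\<^esub> R.d g"
proof -
  have c: "f \<in> carrier R" "g \<in> carrier R" "h f \<in> carrier S" "h g \<in> carrier S" using f g by auto
  let ?m = "lft (j + k - 1) (h f \<otimes>\<^bsub>S\<^esub> h g)"
  have m: "?m \<in> carrier R" using c n j by (intro lft_carrier) auto
  have lf: "lft j (h f) = f" by (rule lft_h[OF j f])
  have sm: "lft (j + k - 1) (of_nat k \<odot>\<^bsub>S\<^esub> (h f \<otimes>\<^bsub>S\<^esub> h g)) = of_nat k \<odot>\<^bsub>R\<^esub> ?m"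
    using c n j by (intro lft_smult) auto
  have om: "om (j + k) (h f) (h g) = f \<odot>\<^bsub>R.\<Omega>\<^esub> R.d g \<oplus>\<^bsub>R.\<Omega>\<^esub> ((- of_nat k) \<odot>\<^bsub>R\<^esub> ?m) \<odot>\<^bsub>R.\<Omega>\<^esub> R.d x"
    using om_eq[OF c(3) g, of "j + k"] j n by (simp add: om'_def lf)
  have e: "of_nat k \<odot>\<^bsub>R\<^esub> ?m \<oplus>\<^bsub>R\<^esub> (- of_nat k) \<odot>\<^bsub>R\<^esub> ?m = \<zero>\<^bsub>R\<^esub>"
    by (rule R.smult_neg_cancel[OF m])
  have z: "(of_nat k \<odot>\<^bsub>R\<^esub> ?m) \<odot>\<^bsub>R.\<Omega>\<^esub> R.d x \<oplus>\<^bsub>R.\<Omega>\<^esub> ((- of_nat k) \<odot>\<^bsub>R\<^esub> ?m) \<odot>\<^bsub>R.\<Omega>\<^esub> R.d x = \<zero>\<^bsub>R.\<Omega>\<^esub>"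
    using m by (subst R.\<Omega>.smult_l_distr[symmetric]) (auto simp only: e R.smult_closed R.\<Omega>.smult_l_null R.kd_closed x_carrier)
  have cl: "(of_nat k \<odot>\<^bsub>R\<^esub> ?m) \<odot>\<^bsub>R.\<Omega>\<^esub> R.d x \<in> carrier R.\<Omega>" "((- of_nat k) \<odot>\<^bsub>R\<^esub> ?m) \<odot>\<^bsub>R.\<Omega>\<^esub> R.d x \<in> carrier R.\<Omega>"
    "f \<odot>\<^bsub>R.\<Omega>\<^esub> R.d g \<in> carrier R.\<Omega>" using m c by (auto intro!: R.\<Omega>.smult_closed)
  have "\<Gamma> (\<beta>m (h f) j (h g) k) = (of_nat k \<odot>\<^bsub>R\<^esub> ?m) \<odot>\<^bsub>R.\<Omega>\<^esub> R.d x \<oplus>\<^bsub>R.\<Omega>\<^esub> om (j + k) (h f) (h g)"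
    unfolding \<beta>m_def using c n
    by (subst \<Gamma>_homog) (simp_all add: sm[unfolded One_nat_def] Om_kd)
  also have "\<dots> = f \<odot>\<^bsub>R.\<Omega>\<^esub> R.d g \<oplus>\<^bsub>R.\<Omega>\<^esub> \<zero>\<^bsub>R.\<Omega>\<^esub>"
    unfolding om z[symmetric] using cl by (simp only: R.\<Omega>.M.a_ac R.\<Omega>.M.a_closed)
  finally show ?thesis using cl by simp
qed

text \<open>It suffices to treat f dv with v linear; there f has degree n - 1 \<ge> 2r, so
  \<open>\<Gamma>_\<beta>m\<close> applies.\<close>

lemma \<Gamma>_\<Theta>_\<Phi>:
  assumes n: "hc \<le> n" and w: "w \<in> Rgr (int n)" shows "\<Gamma> (\<Theta> (\<Phi> w)) = w"
proof (rule add_hom_eqI[OF add_hom_comp[OF \<Theta>\<Phi>_hom \<Gamma>_hom] _ R.\<Omega>.M.abelian_group_axioms R.\<Omega>.M.abelian_group_axioms dgens_carrier])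
  show "add_hom R.\<Omega> R.\<Omega> (\<lambda>w. w)" by (rule add_homI) auto
  show "w \<in> asum R.\<Omega> (dgens (int n))" using w by (simp add: Rgr_dgens)
  fix b assume "b \<in> dgens (int n)"
  then obtain f v where b: "b = f \<odot>\<^bsub>R.\<Omega>\<^esub> R.d v" "f \<in> G (int n - 1)" "v \<in> G (int 1)" using X_G by (auto simp: dgens_def)
  have f: "f \<in> G (int (n - 1))" using b n by (simp add: of_nat_diff)
  show "\<Gamma> (\<Theta> (\<Phi> b)) = b"
    unfolding b(1) \<Theta>\<Phi>_homog[OF f b(3)] by (rule \<Gamma>_\<beta>m[OF f b(3)]) (use n in auto)
qed

text \<open>The inverse of \<Phi> in degree n, written on pairs from \<open>S\<close> and its
  differentials with the powers of x_0 removed. As a linear isomorphism it gives the dimension of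
  the component.\<close>

definition "\<Psi> n v = lft (n - 1) (fst v) \<odot>\<^bsub>R.\<Omega>\<^esub> R.d x \<oplus>\<^bsub>R.\<Omega>\<^esub> Om n (snd v)"

lemma \<Theta>\<Phi>_dx:
  assumes n: "hc \<le> n" and s: "s \<in> carrier S"
  shows "\<Theta> (\<Phi> (lft (n - 1) s \<odot>\<^bsub>R.\<Omega>\<^esub> R.d x)) = (mn s (n - 1), \<zero>\<^bsub>BS\<^esub>)"
proof -
  have l: "lft (n - 1) s \<in> G (int (n - 1))" "h (lft (n - 1) s) = s" using lft[of "n - 1" s] s n by auto
  have "\<Phi> (lft (n - 1) s \<odot>\<^bsub>R.\<Omega>\<^esub> R.d x) = W (mn s (n - 1)) \<odot>\<^bsub>tic.\<Omega>\<^esub> tic.d X0"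
    using G_carrier[OF l(1)] emb_G[OF l(1)] l(2) by (simp add: emb.kaehler_map_kd)
  then show ?thesis using s by (simp only: \<Theta>_dx0 S.pmon_closed)
qed

text \<open>The product rule for the lift of t to degree r contributes r s t x_0^(n-1) dx_0; the
  correction in \<open>om\<close> was chosen to remove exactly this.\<close>

lemma \<Theta>\<Phi>_Om:
  assumes n: "hc \<le> n" and w: "w \<in> carrier S.\<Omega>"
  shows "\<Theta> (\<Phi> (Om n w)) = (\<zero>\<^bsub>TT\<^esub>, KS.x0pow n w)"
proof (rule add_hom_eqI[OF add_hom_comp[OF Om_hom[OF n] \<Theta>\<Phi>_hom] _ S.\<Omega>.M.abelian_group_axioms split_ag])
  show "add_hom S.\<Omega> split (\<lambda>w. (\<zero>\<^bsub>TT\<^esub>, KS.x0pow n w))"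
    by (rule add_homI) (simp_all add: split_simps KS_x0pow_add)
  show "w \<in> asum S.\<Omega> {a \<odot>\<^bsub>S.\<Omega>\<^esub> S.d b | a b. a \<in> carrier S \<and> b \<in> carrier S}" using w S.kaehler_asum by simp
  fix b assume "b \<in> {a \<odot>\<^bsub>S.\<Omega>\<^esub> S.d b | a b. a \<in> carrier S \<and> b \<in> carrier S}"
  then obtain s t where b: "b = s \<odot>\<^bsub>S.\<Omega>\<^esub> S.d t" and st: "s \<in> carrier S" "t \<in> carrier S" by blast
  have l: "lft (n - r) s \<in> G (int (n - r))" "h (lft (n - r) s) = s" "lft r t \<in> G (int r)" "h (lft r t) = t"
    using lft[of "n - r" s] lft[of r t] st n by auto
  let ?st = "s \<otimes>\<^bsub>S\<^esub> t"
  have sm: "(- of_nat r) \<odot>\<^bsub>R\<^esub> lft (n - 1) ?st = lft (n - 1) ((- of_nat r) \<odot>\<^bsub>S\<^esub> ?st)"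
    using st n by (intro lft_smult[symmetric]) auto
  have c1: "lft (n - r) s \<odot>\<^bsub>R.\<Omega>\<^esub> R.d (lft r t) \<in> carrier R.\<Omega>"
    using G_carrier[OF l(1)] G_carrier[OF l(3)] by simp
  have c2: "lft (n - 1) ((- of_nat r) \<odot>\<^bsub>S\<^esub> ?st) \<odot>\<^bsub>R.\<Omega>\<^esub> R.d x \<in> carrier R.\<Omega>"
    using lft_n(2)[OF n, of "(- of_nat r) \<odot>\<^bsub>S\<^esub> ?st"] st by simp
  have "\<Theta> (\<Phi> (om n s t)) = \<beta>m s (n - r) t r \<oplus>\<^bsub>split\<^esub> (mn ((- of_nat r) \<odot>\<^bsub>S\<^esub> ?st) (n - 1), \<zero>\<^bsub>BS\<^esub>)"
    unfolding om_unfold[OF n st(2)] sm add_hom_add[OF \<Theta>\<Phi>_hom c1 c2] \<Theta>\<Phi>_homog[OF l(1,3)] l(2,4)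
    using \<Theta>\<Phi>_dx[OF n] st by simp
  also have "\<dots> = (\<zero>\<^bsub>TT\<^esub>, KS.x0pow n (s \<odot>\<^bsub>S.\<Omega>\<^esub> S.d t))"
  proof -
    have "n - r + r = n" using n by simp
    moreover have "mn (of_nat r \<odot>\<^bsub>S\<^esub> ?st) (n - 1) \<oplus>\<^bsub>TT\<^esub> mn ((- of_nat r) \<odot>\<^bsub>S\<^esub> ?st) (n - 1) = \<zero>\<^bsub>TT\<^esub>"
      using st S.smult_neg_cancel[of ?st "of_nat r"]
        S.pmon_add[of "of_nat r \<odot>\<^bsub>S\<^esub> ?st" "(- of_nat r) \<odot>\<^bsub>S\<^esub> ?st" "n - 1"] by simp
    ultimately show ?thesis using st by (simp add: \<beta>m_def split_simps)
  qed
  finally show "\<Theta> (\<Phi> (Om n b)) = (\<zero>\<^bsub>TT\<^esub>, KS.x0pow n b)" using st unfolding b by (simp only: Om_kd[OF n])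
qed (auto intro!: S.\<Omega>.smult_closed)

lemma \<Psi>_Rgr:
  assumes n: "hc \<le> n" and s: "s \<in> carrier S" and w: "w \<in> carrier S.\<Omega>"
  shows "\<Psi> n (s, w) \<in> Rgr (int n)" "\<Theta> (\<Phi> (\<Psi> n (s, w))) = (mn s (n - 1), KS.x0pow n w)"
proof -
  have l: "lft (n - 1) s \<in> G (int (n - 1))" using lft[of "n - 1" s] s n by auto
  have 1: "lft (n - 1) s \<odot>\<^bsub>R.\<Omega>\<^esub> R.d x \<in> Rgr (int n)"
    using Rgr_hom[OF l x_G] n by (simp add: of_nat_diff)
  have "Om n w \<in> asum R.\<Omega> (Om n ` {a \<odot>\<^bsub>S.\<Omega>\<^esub> S.d b | a b. a \<in> carrier S \<and> b \<in> carrier S})"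
    by (rule asum_image[OF Om_hom[OF n] S.\<Omega>.M.abelian_group_axioms R.\<Omega>.M.abelian_group_axioms])
       (use w S.kaehler_asum in \<open>auto intro!: S.\<Omega>.smult_closed\<close>)
  also have "\<dots> \<subseteq> Rgr (int n)"
    unfolding Rgr_asum
  proof (rule asum_mono, rule image_subsetI)
    fix y assume "y \<in> {a \<odot>\<^bsub>S.\<Omega>\<^esub> S.d b | a b. a \<in> carrier S \<and> b \<in> carrier S}"
    then obtain s t where "s \<in> carrier S" "t \<in> carrier S" "y = s \<odot>\<^bsub>S.\<Omega>\<^esub> S.d t" by blast
    then show "Om n y \<in> asum R.\<Omega> (R.kaehler_homs G (int n))"
      using om_closed[OF n] by (simp add: Om_kd[OF n] Rgr_asum)
  qed
  finally have 2: "Om n w \<in> Rgr (int n)" .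
  show "\<Psi> n (s, w) \<in> Rgr (int n)" unfolding \<Psi>_def using Rgr_add[OF 1 2] by simp
  have "\<Theta> (\<Phi> (\<Psi> n (s, w))) = (mn s (n - 1), \<zero>\<^bsub>BS\<^esub>) \<oplus>\<^bsub>split\<^esub> (\<zero>\<^bsub>TT\<^esub>, KS.x0pow n w)"
    unfolding \<Psi>_def fst_conv snd_conv
      add_hom_add[OF \<Theta>\<Phi>_hom subsetD[OF Rgr_carrier 1] subsetD[OF Rgr_carrier 2]] \<Theta>\<Phi>_dx[OF n s] \<Theta>\<Phi>_Om[OF n w] ..
  also have "\<dots> = (mn s (n - 1), KS.x0pow n w)" using s w by (simp add: split_simps)
  finally show "\<Theta> (\<Phi> (\<Psi> n (s, w))) = (mn s (n - 1), KS.x0pow n w)" .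
qed

lemma sgr_large: "hc \<le> n \<Longrightarrow> sgr (int n) = {(mn s (n - 1), KS.x0pow n w) | s w. s \<in> carrier S \<and> w \<in> carrier S.\<Omega>}"
  using poly_grade_nat[of "n - 1"] by (auto simp: sgr_def of_nat_diff)

lemma \<Phi>_bij: assumes n: "hc \<le> n" shows "bij_betw \<Phi> (Rgr (int n)) (tgr (int n))"
proof -
  have "inj_on \<Phi> (Rgr (int n))"
    by (rule inj_on_inverseI[where g = "\<lambda>y. \<Gamma> (\<Theta> y)"]) (rule \<Gamma>_\<Theta>_\<Phi>[OF n])
  moreover have "y \<in> \<Phi> ` Rgr (int n)" if y: "y \<in> tgr (int n)" for y
  proof -
    have yc: "y \<in> carrier tic.\<Omega>"
      using y asum_subset[OF tic.\<Omega>.M.abelian_monoid_axioms tic.kaehler_homs_carrier[of tgrade, OF tgrade_carrier]]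
      unfolding tgr_asum by blast
    have "\<Theta> y \<in> sgr (int n)" using \<Theta>_tgr y by blast
    then obtain s w where sw: "\<Theta> y = (mn s (n - 1), KS.x0pow n w)" "s \<in> carrier S" "w \<in> carrier S.\<Omega>"
      unfolding sgr_large[OF n] by blast
    note P = \<Psi>_Rgr[OF n sw(2,3)]
    \<comment> \<open>Equality with y is tested after applying \<Theta>, which \<Xi>
      inverts.\<close>
    have "\<Phi> (\<Psi> n (s, w)) = \<Xi> (\<Theta> (\<Phi> (\<Psi> n (s, w))))"
      using \<Xi>_\<Theta>[OF \<Phi>_closed[OF subsetD[OF Rgr_carrier P(1)]]] by simp
    also have "\<dots> = y" unfolding P(2) sw(1)[symmetric] by (rule \<Xi>_\<Theta>[OF yc])
    finally show ?thesis using P(1) by blast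
  qed
  ultimately show ?thesis using \<Phi>_graded unfolding bij_betw_def by blast
qed

lemma vectorspace_Rgr: "vectorspace base_field ((kaehler_K R)\<lparr>carrier := Rgr i\<rparr>)"
  by (rule R.vectorspace_kaehler_grade) (rule G_sub)

lemma vectorspace_tgr: "vectorspace base_field ((kaehler_K tic)\<lparr>carrier := tgr i\<rparr>)"
  by (rule tic.vectorspace_kaehler_grade) (rule tgrade_carrier)

lemma \<Phi>_linear: "linear_map base_field ((kaehler_K R)\<lparr>carrier := Rgr i\<rparr>) ((kaehler_K tic)\<lparr>carrier := tgr i\<rparr>) \<Phi>"
proof (rule linear_mapI[OF vectorspace_Rgr vectorspace_tgr])
  show "\<Phi> \<in> carrier ((kaehler_K R)\<lparr>carrier := Rgr i\<rparr>) \<rightarrow> carrier ((kaehler_K tic)\<lparr>carrier := tgr i\<rparr>)"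
    using \<Phi>_graded by auto
qed (use Rgr_carrier in \<open>auto simp: add_hom_add[OF emb.kaehler_map_hom] emb.kaehler_map_smult emb.hom_alg_map subset_iff\<close>)

lemma \<Psi>_linear:
  assumes n: "hc \<le> n"
  shows "linear_map base_field (direct_sum S (kaehler_K S)) ((kaehler_K R)\<lparr>carrier := Rgr (int n)\<rparr>) (\<Psi> n)"
proof (rule linear_mapI[OF direct_sum_is_vs[OF S.vectorspace_A S.vectorspace_kaehler_K] vectorspace_Rgr])
  have D: "carrier (direct_sum S (kaehler_K S)) = carrier S \<times> carrier S.\<Omega>"
    "add (direct_sum S (kaehler_K S)) = (\<lambda>v w. (fst v \<oplus>\<^bsub>S\<^esub> fst w, snd v \<oplus>\<^bsub>S.\<Omega>\<^esub> snd w))"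
    "smult (direct_sum S (kaehler_K S)) = (\<lambda>c v. (c \<odot>\<^bsub>S\<^esub> fst v, alg_map S c \<odot>\<^bsub>S.\<Omega>\<^esub> snd v))"
    by (simp_all add: direct_sum_def)
  have cl: "lft (n - 1) s \<odot>\<^bsub>R.\<Omega>\<^esub> R.d x \<in> carrier R.\<Omega>" if "s \<in> carrier S" for s
    using lft_n(2)[OF n that] by simp
  have co: "Om n w \<in> carrier R.\<Omega>" if "w \<in> carrier S.\<Omega>" for w using add_hom_closed[OF Om_hom[OF n] that] .
  show "\<Psi> n \<in> carrier (direct_sum S (kaehler_K S)) \<rightarrow> carrier ((kaehler_K R)\<lparr>carrier := Rgr (int n)\<rparr>)"
    using \<Psi>_Rgr(1)[OF n] by (auto simp: D)
  fix v assume "v \<in> carrier (direct_sum S (kaehler_K S))"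
  then have v: "fst v \<in> carrier S" "snd v \<in> carrier S.\<Omega>" by (auto simp: D)
  {
    fix w assume "w \<in> carrier (direct_sum S (kaehler_K S))"
    then have w: "fst w \<in> carrier S" "snd w \<in> carrier S.\<Omega>" by (auto simp: D)
    have "lft (n - 1) (fst v \<oplus>\<^bsub>S\<^esub> fst w) \<odot>\<^bsub>R.\<Omega>\<^esub> R.d x = lft (n - 1) (fst v) \<odot>\<^bsub>R.\<Omega>\<^esub> R.d x \<oplus>\<^bsub>R.\<Omega>\<^esub> lft (n - 1) (fst w) \<odot>\<^bsub>R.\<Omega>\<^esub> R.d x"
      by (rule add_hom_add[OF lft_dx_hom v(1) w(1)]) (use n in simp)
    then show "\<Psi> n (v \<oplus>\<^bsub>direct_sum S (kaehler_K S)\<^esub> w) = \<Psi> n v \<oplus>\<^bsub>(kaehler_K R)\<lparr>carrier := Rgr (int n)\<rparr>\<^esub> \<Psi> n w"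
      using cl[OF v(1)] cl[OF w(1)] co[OF v(2)] co[OF w(2)]
      by (simp add: \<Psi>_def D add_hom_add[OF Om_hom[OF n] v(2) w(2)] R.\<Omega>.M.a_ac)
  }
  fix c :: 'k
  \<comment> \<open>\<open>Om\<close> is known to be additive only. On the generators s dt a scalar
    is absorbed by s, and lifts are linear over \<open>K\<close>.\<close>
  have Omc: "Om n (alg_map S c \<odot>\<^bsub>S.\<Omega>\<^esub> w) = alg_map R c \<odot>\<^bsub>R.\<Omega>\<^esub> Om n w" if w: "w \<in> carrier S.\<Omega>" for w
  proof (rule add_hom_eqI[of S.\<Omega> R.\<Omega> "\<lambda>w. Om n (alg_map S c \<odot>\<^bsub>S.\<Omega>\<^esub> w)" "\<lambda>w. alg_map R c \<odot>\<^bsub>R.\<Omega>\<^esub> Om n w"])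
    show "add_hom S.\<Omega> R.\<Omega> (\<lambda>w. Om n (alg_map S c \<odot>\<^bsub>S.\<Omega>\<^esub> w))"
      by (rule add_hom_comp[OF _ Om_hom[OF n]]) (rule add_homI; simp add: S.\<Omega>.smult_r_distr)
    show "add_hom S.\<Omega> R.\<Omega> (\<lambda>w. alg_map R c \<odot>\<^bsub>R.\<Omega>\<^esub> Om n w)"
      by (rule add_hom_comp[OF Om_hom[OF n]]) (rule add_homI; simp add: R.\<Omega>.smult_r_distr)
    show "w \<in> asum S.\<Omega> {a \<odot>\<^bsub>S.\<Omega>\<^esub> S.d b | a b. a \<in> carrier S \<and> b \<in> carrier S}" using w S.kaehler_asum by simp
    fix b assume "b \<in> {a \<odot>\<^bsub>S.\<Omega>\<^esub> S.d b | a b. a \<in> carrier S \<and> b \<in> carrier S}"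
    then obtain s t where b: "b = s \<odot>\<^bsub>S.\<Omega>\<^esub> S.d t" and st: "s \<in> carrier S" "t \<in> carrier S" by blast
    have "alg_map S c \<odot>\<^bsub>S.\<Omega>\<^esub> b = (c \<odot>\<^bsub>S\<^esub> s) \<odot>\<^bsub>S.\<Omega>\<^esub> S.d t"
      unfolding b using st S.\<Omega>.smult_assoc1[of "alg_map S c" s "S.d t"] by (simp add: S.alg_map_mult)
    moreover have "om n (c \<odot>\<^bsub>S\<^esub> s) t = alg_map R c \<odot>\<^bsub>R.\<Omega>\<^esub> om n s t"
    proof -
      have "lft (n - r) (c \<odot>\<^bsub>S\<^esub> s) = alg_map R c \<otimes>\<^bsub>R\<^esub> lft (n - r) s"
        using st n lft_n(1)[OF n st(1)] lft_smult[of "n - r" s c] by (simp add: R.alg_map_mult)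
      moreover have "(- of_nat r) \<odot>\<^bsub>R\<^esub> lft (n - 1) (c \<odot>\<^bsub>S\<^esub> s \<otimes>\<^bsub>S\<^esub> t) = alg_map R c \<otimes>\<^bsub>R\<^esub> ((- of_nat r) \<odot>\<^bsub>R\<^esub> lft (n - 1) (s \<otimes>\<^bsub>S\<^esub> t))"
        using st n lft_n(2)[OF n, of "s \<otimes>\<^bsub>S\<^esub> t"] lft_smult[of "n - 1" "s \<otimes>\<^bsub>S\<^esub> t" c]
        by (simp add: R.alg_map_mult S.smult_mult R.smult_times[symmetric] mult.commute)
      ultimately show ?thesis
        using st lft_n(1)[OF n st(1)] lft_n(2)[OF n, of "s \<otimes>\<^bsub>S\<^esub> t"] lft_n(3)[OF n st(2)]
        unfolding om_unfold[OF n st(2)]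
        by (simp only: R.\<Omega>.smult_assoc1 R.\<Omega>.smult_r_distr R.alg_map_closed R.kd_closed x_carrier R.\<Omega>.smult_closed
            S.A.m_closed R.smult_closed)
    qed
    ultimately show "Om n (alg_map S c \<odot>\<^bsub>S.\<Omega>\<^esub> b) = alg_map R c \<odot>\<^bsub>R.\<Omega>\<^esub> Om n b"
      using st unfolding b by (simp only: Om_kd[OF n] S.smult_closed)
  qed (use w in \<open>auto intro!: S.\<Omega>.abelian_group_axioms R.\<Omega>.M.abelian_group_axioms S.\<Omega>.smult_closed\<close>)
  have "lft (n - 1) (c \<odot>\<^bsub>S\<^esub> fst v) = alg_map R c \<otimes>\<^bsub>R\<^esub> lft (n - 1) (fst v)"
    using v n lft_n(2)[OF n v(1)] lft_smult[of "n - 1" "fst v" c] by (simp add: R.alg_map_mult)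
  then show "\<Psi> n (c \<odot>\<^bsub>direct_sum S (kaehler_K S)\<^esub> v) = c \<odot>\<^bsub>(kaehler_K R)\<lparr>carrier := Rgr (int n)\<rparr>\<^esub> \<Psi> n v"
    using cl[OF v(1)] co[OF v(2)] lft_n(2)[OF n v(1)]
    by (simp add: \<Psi>_def D Omc[OF v(2)] R.\<Omega>.smult_r_distr R.\<Omega>.smult_assoc1)
qed

lemma \<Psi>_bij:
  assumes n: "hc \<le> n"
  shows "inj_on (\<Psi> n) (carrier (direct_sum S (kaehler_K S)))" "\<Psi> n ` carrier (direct_sum S (kaehler_K S)) = Rgr (int n)"
proof -
  have D: "carrier (direct_sum S (kaehler_K S)) = carrier S \<times> carrier S.\<Omega>" by (simp add: direct_sum_def)
  show "inj_on (\<Psi> n) (carrier (direct_sum S (kaehler_K S)))"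
    unfolding D
  proof (rule inj_onI, clarify)
    fix s w s' w' assume c: "s \<in> carrier S" "w \<in> carrier S.\<Omega>" "s' \<in> carrier S" "w' \<in> carrier S.\<Omega>"
      and "\<Psi> n (s, w) = \<Psi> n (s', w')"
    then have e: "(mn s (n - 1), KS.x0pow n w) = (mn s' (n - 1), KS.x0pow n w')"
      using \<Psi>_Rgr(2)[OF n c(1,2)] \<Psi>_Rgr(2)[OF n c(3,4)] by metis
    \<comment> \<open>The n-th coefficient recovers w from x_0^n \<otimes> w.\<close>
    have "KS.bcoef (KS.x0pow n w) n = w" "KS.bcoef (KS.x0pow n w') n = w'"
      using KS.bcoef_x0pow[of w n] KS.bcoef_x0pow[of w' n] c by simp_all
    then have "w = w'" using e by (metis prod.inject)
    moreover have "s = s'" using e S.pmon_inj[OF c(1,3), of "n - 1"] by (simp only: prod.inject)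
    ultimately show "s = s' \<and> w = w'" by simp
  qed
  show "\<Psi> n ` carrier (direct_sum S (kaehler_K S)) = Rgr (int n)"
  proof
    show "\<Psi> n ` carrier (direct_sum S (kaehler_K S)) \<subseteq> Rgr (int n)" using \<Psi>_Rgr(1)[OF n] by (auto simp: D)
    show "Rgr (int n) \<subseteq> \<Psi> n ` carrier (direct_sum S (kaehler_K S))"
    proof
      fix y assume y: "y \<in> Rgr (int n)"
      have "\<Theta> (\<Phi> y) \<in> sgr (int n)" using y \<Phi>_graded \<Theta>_tgr by blast
      then obtain s w where sw: "\<Theta> (\<Phi> y) = (mn s (n - 1), KS.x0pow n w)" "s \<in> carrier S" "w \<in> carrier S.\<Omega>"
        unfolding sgr_large[OF n] by blast
      have "y = \<Gamma> (mn s (n - 1), KS.x0pow n w)" using \<Gamma>_\<Theta>_\<Phi>[OF n y] sw(1) by simp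
      also have "\<dots> = \<Psi> n (s, w)" unfolding \<Gamma>_homog[OF sw(2,3) n] \<Psi>_def by simp
      finally show "y \<in> \<Psi> n ` carrier (direct_sum S (kaehler_K S))" using sw D by blast
    qed
  qed
qed

section \<open>Finite dimension of the components\<close>

lemma G_finite_gen: "\<exists>B. finite B \<and> B \<subseteq> G (int n) \<and> G (int n) = asum R {c \<odot>\<^bsub>R\<^esub> b | c b. b \<in> B}"
proof (induction n)
  case 0
  have sub: "{c \<odot>\<^bsub>R\<^esub> b | c b. b \<in> {\<one>\<^bsub>R\<^esub>}} = G 0" using G_gen0 by (auto simp: alg_map_def)
  have "y \<in> G 0" if "y \<in> asum R (G 0)" for y using that by induction (auto intro: G_zero G_add)
  then have "G 0 = asum R {c \<odot>\<^bsub>R\<^esub> b | c b. b \<in> {\<one>\<^bsub>R\<^esub>}}" unfolding sub by (auto intro: asum_base)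
  then show ?case using G_one by (intro exI[of _ "{\<one>\<^bsub>R\<^esub>}"]) simp
next
  case (Suc n)
  then obtain B where B: "finite B" "B \<subseteq> G (int n)" "G (int n) = asum R {c \<odot>\<^bsub>R\<^esub> b | c b. b \<in> B}" by blast
  let ?B = "(\<lambda>(v, b). v \<otimes>\<^bsub>R\<^esub> b) ` (X \<times> B)"
  let ?C = "{c \<odot>\<^bsub>R\<^esub> b | c b. b \<in> ?B}"
  have B': "?B \<subseteq> G (int (Suc n))" using B X_G G_mult[of _ 1 _ "int n"] by fastforce
  have "G (int (Suc n)) \<subseteq> asum R ?C"
    unfolding G_gen
  proof (rule asum_mono, rule subsetI)
    fix y assume "y \<in> {v \<otimes>\<^bsub>R\<^esub> f | v f. v \<in> X \<and> f \<in> G (int n)}"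
    then obtain v f where y: "y = v \<otimes>\<^bsub>R\<^esub> f" "v \<in> X" "f \<in> G (int n)" by blast
    have vc: "v \<in> carrier R" using y X_G by auto
    have "v \<otimes>\<^bsub>R\<^esub> f \<in> asum R ((\<lambda>f. v \<otimes>\<^bsub>R\<^esub> f) ` {c \<odot>\<^bsub>R\<^esub> b | c b. b \<in> B})"
      by (rule asum_image[OF _ R.A.abelian_group_axioms R.A.abelian_group_axioms])
         (use vc y(3) B G_carrier in \<open>auto intro!: add_homI simp: R.A.r_distr\<close>)
    moreover have "(\<lambda>f. v \<otimes>\<^bsub>R\<^esub> f) ` {c \<odot>\<^bsub>R\<^esub> b | c b. b \<in> B} \<subseteq> ?C"
    proof (rule image_subsetI)
      fix z assume "z \<in> {c \<odot>\<^bsub>R\<^esub> b | c b. b \<in> B}"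
      then obtain c b where z: "z = c \<odot>\<^bsub>R\<^esub> b" "b \<in> B" by blast
      have "v \<otimes>\<^bsub>R\<^esub> z = c \<odot>\<^bsub>R\<^esub> (v \<otimes>\<^bsub>R\<^esub> b)" unfolding z using vc z B by (intro R.smult_mult_right) auto
      then show "v \<otimes>\<^bsub>R\<^esub> z \<in> ?C" using z y by blast
    qed
    moreover note subsetD[OF asum_mono[OF subset_trans[OF this asum_incl[of ?C R]]]]
    ultimately show "y \<in> asum R ?C" unfolding y(1) by blast
  qed
  moreover have "y \<in> G (int (Suc n))" if "y \<in> asum R ?C" for y
    using that by induction (use B' in \<open>auto intro: G_zero G_add G_smult\<close>)
  ultimately show ?case using B(1) B' X_fin by (intro exI[of _ ?B]) auto
qed

text \<open>The elements b dv, with b from a finite spanning set in degree i - 1 and v from the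
  finite set \<open>X\<close>, span the component by \<open>Rgr_dgens\<close>. In degrees i \<le> 0
  the spanning set is empty.\<close>

lemma fin_dim_Rgr: "vectorspace.fin_dim base_field ((kaehler_K R)\<lparr>carrier := Rgr i\<rparr>)"
proof -
  obtain B where B: "finite B" "B \<subseteq> G (i - 1)" "G (i - 1) = asum R {c \<odot>\<^bsub>R\<^esub> b | c b. b \<in> B}"
  proof (cases "i - 1 < 0")
    case True
    have "G (i - 1) = asum R {c \<odot>\<^bsub>R\<^esub> b | c b. b \<in> {}}"
    proof -
      have "y = \<zero>\<^bsub>R\<^esub>" if "y \<in> asum R {}" for y using that by induction auto
      then have "asum R {} = {\<zero>\<^bsub>R\<^esub>}" using asum_zero[of R "{}"] by blast
      then show ?thesis by (simp only: G_neg[OF True] empty_iff simp_thms Collect_empty_eq ex_simps Collect_const if_False)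
    qed
    then show ?thesis using that[of "{}"] by simp
  next
    case False
    then obtain n where "i - 1 = int n" by (metis nonneg_int_cases not_le)
    then show ?thesis using that G_finite_gen[of n] by auto
  qed
  let ?B = "(\<lambda>(b, v). b \<odot>\<^bsub>R.\<Omega>\<^esub> R.d v) ` (B \<times> X)"
  let ?V = "(kaehler_K R)\<lparr>carrier := Rgr i\<rparr>"
  have B': "?B \<subseteq> Rgr i"
    unfolding Rgr_dgens using B(2) by (auto simp: dgens_def intro!: asum_base)
  let ?C = "{c \<odot>\<^bsub>?V\<^esub> b | c b. c \<in> carrier base_field \<and> b \<in> ?B}"
  have "Rgr i = asum R.\<Omega> ?C"
  proof
    show "Rgr i \<subseteq> asum R.\<Omega> ?C"
    proof (rule ord_eq_le_trans[OF Rgr_dgens], rule asum_mono, rule subsetI)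
      fix y assume "y \<in> dgens i"
      then obtain f v where y: "y = f \<odot>\<^bsub>R.\<Omega>\<^esub> R.d v" "f \<in> G (i - 1)" "v \<in> X" by (auto simp: dgens_def)
      have vc: "v \<in> carrier R" using y X_G by auto
      have "f \<odot>\<^bsub>R.\<Omega>\<^esub> R.d v \<in> asum R.\<Omega> ((\<lambda>f. f \<odot>\<^bsub>R.\<Omega>\<^esub> R.d v) ` {c \<odot>\<^bsub>R\<^esub> b | c b. b \<in> B})"
        by (rule asum_image[OF R.kd_hom_left[OF vc] R.A.abelian_group_axioms R.\<Omega>.M.abelian_group_axioms])
           (use y(2) B G_carrier in auto)
      moreover have "(\<lambda>f. f \<odot>\<^bsub>R.\<Omega>\<^esub> R.d v) ` {c \<odot>\<^bsub>R\<^esub> b | c b. b \<in> B} \<subseteq> ?C"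
      proof (rule image_subsetI)
        fix z assume "z \<in> {c \<odot>\<^bsub>R\<^esub> b | c b. b \<in> B}"
        then obtain c b where z: "z = c \<odot>\<^bsub>R\<^esub> b" "b \<in> B" by blast
        have "b \<in> carrier R" using z B by auto
        then have "z \<odot>\<^bsub>R.\<Omega>\<^esub> R.d v = c \<odot>\<^bsub>?V\<^esub> (b \<odot>\<^bsub>R.\<Omega>\<^esub> R.d v)"
          unfolding z using vc by (simp add: R.\<Omega>.smult_assoc1[symmetric] R.alg_map_mult)
        then show "z \<odot>\<^bsub>R.\<Omega>\<^esub> R.d v \<in> ?C" using z y by fastforce
      qed
      moreover note subsetD[OF asum_mono[OF subset_trans[OF this asum_incl[of ?C R.\<Omega>]]]]
      ultimately show "y \<in> asum R.\<Omega> ?C" unfolding y(1) by blast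
    qed
    have sm: "LinearCombinations.submodule base_field (Rgr i) (kaehler_K R)"
      by (rule R.kaehler_grade_submodule) (rule G_sub)
    have C: "?C \<subseteq> Rgr i"
    proof
      fix z assume "z \<in> ?C"
      then obtain c b where "z = c \<odot>\<^bsub>kaehler_K R\<^esub> b" "b \<in> ?B" by auto
      then show "z \<in> Rgr i" using sm B' by (auto simp: LinearCombinations.submodule_def)
    qed
    show "asum R.\<Omega> ?C \<subseteq> Rgr i"
    proof
      fix y assume "y \<in> asum R.\<Omega> ?C" then show "y \<in> Rgr i"
        by induction (use C in \<open>auto simp: Rgr_asum intro: asum_zero asum_add\<close>)
    qed
  qed
  also have "asum R.\<Omega> ?C = asum ?V ?C" by (rule asum_cong) simp_all
  finally have e: "Rgr i = asum ?V ?C" .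
  have c: "carrier ?V = Rgr i" by simp
  have "finite ?B" using B(1) X_fin by simp
  moreover have "?B \<subseteq> carrier ?V" unfolding c by (rule B')
  moreover have "carrier ?V = asum ?V ?C" by (rule trans[OF c e])
  ultimately show ?thesis by (rule fin_dimI_asum[OF vectorspace_Rgr])
qed

text \<open>The map induced by \<open>h\<close> sends the component of degree 2r + 1 onto all
  differentials of \<open>S\<close>: the element s dt is reached by lifting s to degree r + 1 and t
  to degree r.\<close>

lemma fin_dim_\<Omega>S: "vectorspace.fin_dim base_field (kaehler_K S)"
proof -
  have lin: "linear_map base_field ((kaehler_K R)\<lparr>carrier := Rgr (int hc)\<rparr>) (kaehler_K S) (kaehler_map R S h)"
    by (rule linear_mapI[OF vectorspace_Rgr S.vectorspace_kaehler_K])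
       (use Rgr_carrier in \<open>auto simp: add_hom_add[OF h.kaehler_map_hom] h.kaehler_map_smult h.hom_alg_map
          subset_iff intro: add_hom_closed[OF h.kaehler_map_hom]\<close>)
  have "y \<in> kaehler_map R S h ` Rgr (int hc)" if "y \<in> asum S.\<Omega> {a \<odot>\<^bsub>S.\<Omega>\<^esub> S.d b | a b. a \<in> carrier S \<and> b \<in> carrier S}" for y
    using that
  proof induction
    case asum_zero
    have "\<zero>\<^bsub>R.\<Omega>\<^esub> \<in> Rgr (int hc)" by (simp add: Rgr_asum asum.asum_zero)
    then show ?case
      using add_hom_zero[OF h.kaehler_map_hom R.\<Omega>.M.abelian_group_axioms S.\<Omega>.M.abelian_group_axioms] by force
  next
    case (asum_base b)
    then obtain s t where b: "b = s \<odot>\<^bsub>S.\<Omega>\<^esub> S.d t" and st: "s \<in> carrier S" "t \<in> carrier S" by blast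
    have l: "lft (r + 1) s \<in> G (int (r + 1))" "h (lft (r + 1) s) = s" "lft r t \<in> G (int r)" "h (lft r t) = t"
      using lft[of "r + 1" s] lft[of r t] st by (simp_all del: Suc_eq_plus1 add_Suc_right)
    have "int (r + 1) + int r = int hc" by simp
    then have "lft (r + 1) s \<odot>\<^bsub>R.\<Omega>\<^esub> R.d (lft r t) \<in> Rgr (int hc)" using Rgr_hom[OF l(1,3)] by (simp only:)
    moreover have "kaehler_map R S h (lft (r + 1) s \<odot>\<^bsub>R.\<Omega>\<^esub> R.d (lft r t)) = b"
      using h.kaehler_map_kd[OF G_carrier[OF l(1)] G_carrier[OF l(3)]] l b by simp
    ultimately show ?case by blast
  next
    case (asum_add y z)
    then obtain v w where "v \<in> Rgr (int hc)" "w \<in> Rgr (int hc)" "y = kaehler_map R S h v" "z = kaehler_map R S h w" by blast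
    then have "y \<oplus>\<^bsub>S.\<Omega>\<^esub> z = kaehler_map R S h (v \<oplus>\<^bsub>R.\<Omega>\<^esub> w)" "v \<oplus>\<^bsub>R.\<Omega>\<^esub> w \<in> Rgr (int hc)"
      using add_hom_add[OF h.kaehler_map_hom subsetD[OF Rgr_carrier] subsetD[OF Rgr_carrier]] Rgr_add by blast+
    then show ?case by blast
  qed
  then have "kaehler_map R S h ` Rgr (int hc) = carrier S.\<Omega>"
    using add_hom_closed[OF h.kaehler_map_hom] Rgr_carrier S.kaehler_asum by blast
  then show ?thesis
    by (intro linear_map.surj_fin_dim[OF lin fin_dim_Rgr]) simp
qed

section \<open>Hilbert function and regularity index\<close>

abbreviation "HF \<equiv> hilbert_fun (kaehler_K R) Rgr"

lemma HF_large: assumes n: "hc \<le> n" 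
  shows "HF (int n) = vectorspace.dim base_field S + vectorspace.dim base_field (kaehler_K S)"
proof -
  note ds = dim_direct_sum[OF S.vectorspace_A S_fin S.vectorspace_kaehler_K fin_dim_\<Omega>S]
  have "vectorspace.dim base_field ((kaehler_K R)\<lparr>carrier := Rgr (int n)\<rparr>) = vectorspace.dim base_field (direct_sum S (kaehler_K S))"
    by (rule dim_linear_image(2)[OF direct_sum_is_vs[OF S.vectorspace_A S.vectorspace_kaehler_K] vectorspace_Rgr ds(1) \<Psi>_linear[OF n]])
       (use \<Psi>_bij[OF n] in auto)
  then show ?thesis unfolding hilbert_fun_def using ds(2) by simp
qed

text \<open>Provides the lower bound that makes the regularity index an attained minimum: the
  eventual value is positive, so it cannot occur in a negative degree.\<close>

lemma HF_neg: assumes "i < 0" shows "HF i = 0"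
proof -
  have "G (i - 1) = {\<zero>\<^bsub>R\<^esub>}" using G_neg assms by simp
  then have d: "dgens i \<subseteq> {\<zero>\<^bsub>R.\<Omega>\<^esub>}" using X_G R.\<Omega>.smult_l_null[OF R.kd_closed[OF G_carrier]] by (auto simp: dgens_def)
  have "y = \<zero>\<^bsub>R.\<Omega>\<^esub>" if "y \<in> asum R.\<Omega> (dgens i)" for y
    using that by induction (use d in auto)
  then have "Rgr i = {\<zero>\<^bsub>R.\<Omega>\<^esub>}" unfolding Rgr_dgens using asum_zero[of R.\<Omega> "dgens i"] by blast
  then show ?thesis
    unfolding hilbert_fun_def using dim_zero_iff[OF vectorspace_Rgr fin_dim_Rgr, of i] by simp
qed

lemma dim_S_pos: "0 < vectorspace.dim base_field S"
proof -
  have "carrier S \<noteq> {\<zero>\<^bsub>S\<^esub>}" using S_one S.A.one_closed by blast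
  then show ?thesis using dim_zero_iff[OF S.vectorspace_A S_fin] by simp
qed

lemma hilbert_const_HF: "hilbert_const HF = vectorspace.dim base_field S + vectorspace.dim base_field (kaehler_K S)"
  (is "_ = ?c")
proof -
  have ev: "\<forall>\<^sub>F i in at_top. HF i = ?c"
    unfolding eventually_at_top_linorder
  proof (intro exI[of _ "int hc"] allI impI)
    fix i assume "int hc \<le> i"
    then show "HF i = ?c" using HF_large[of "nat i"] by simp
  qed
  show ?thesis unfolding hilbert_const_def
  proof (rule the_equality, rule ev)
    fix c assume "\<forall>\<^sub>F i in at_top. HF i = c"
    with ev have "\<forall>\<^sub>F i::int in at_top. c = ?c" by eventually_elim simp
    then show "c = ?c" by simp
  qed
qed

lemma regularity_HF: "regularity_index HF \<le> int hc"
  unfolding regularity_index_def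
proof (rule int_LeastI(2)[where b = 0])
  show "\<forall>j\<ge>int hc. HF j = hilbert_const HF"
  proof (intro allI impI)
    fix i assume "int hc \<le> i"
    then show "HF i = hilbert_const HF" using HF_large[of "nat i"] by (simp add: hilbert_const_HF)
  qed
  fix i assume i: "\<forall>j\<ge>i. HF j = hilbert_const HF"
  then have "HF i \<noteq> 0" using dim_S_pos by (simp add: hilbert_const_HF)
  then show "0 \<le> i" using HF_neg[of i] by force
qed

lemma kernel_eq_torsion:
  "{w \<in> carrier R.\<Omega>. \<exists>b\<in>\<Union>e. hom_nzd R G e. b \<odot>\<^bsub>R.\<Omega>\<^esub> w = \<zero>\<^bsub>R.\<Omega>\<^esub>} = {w \<in> carrier R.\<Omega>. \<Phi> w = \<zero>\<^bsub>tic.\<Omega>\<^esub>}"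
proof (intro equalityI subsetI CollectI; elim CollectE conjE; intro conjI)
  fix w assume w: "w \<in> carrier R.\<Omega>" and "\<exists>b\<in>\<Union>e. hom_nzd R G e. b \<odot>\<^bsub>R.\<Omega>\<^esub> w = \<zero>\<^bsub>R.\<Omega>\<^esub>"
  then obtain b e where b: "b \<in> hom_nzd R G e" "b \<odot>\<^bsub>R.\<Omega>\<^esub> w = \<zero>\<^bsub>R.\<Omega>\<^esub>" by blast
  note bD = hom_nzdD[OF b(1)] and u = hom_nzd_unit[OF b(1)]
  let ?y = "\<Phi> w" and ?e = "nat e"
  have y: "?y \<in> carrier tic.\<Omega>" using w by simp
  have eb: "emb b = W (mn (h b) ?e)" using emb_\<chi>[OF bD(2)] \<chi>_hom_nzd[OF b(1)] by simp
  have "emb b \<odot>\<^bsub>tic.\<Omega>\<^esub> ?y = \<zero>\<^bsub>tic.\<Omega>\<^esub>"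
    using emb.kaehler_map_smult[OF bD(2) w] b(2)
      add_hom_zero[OF emb.kaehler_map_hom R.\<Omega>.M.abelian_group_axioms tic.\<Omega>.M.abelian_group_axioms] by simp
  \<comment> \<open>The dehomogenization of b is a unit of \<open>S\<close>; multiplying by its
    inverse replaces b by the power x_0^e.\<close>
  then have "W (mn (inv\<^bsub>S\<^esub> h b) 0) \<odot>\<^bsub>tic.\<Omega>\<^esub> (emb b \<odot>\<^bsub>tic.\<Omega>\<^esub> ?y) = \<zero>\<^bsub>tic.\<Omega>\<^esub>" using u by simp
  moreover have "W (mn (inv\<^bsub>S\<^esub> h b) 0) \<otimes>\<^bsub>tic\<^esub> emb b = W (mn \<one>\<^bsub>S\<^esub> ?e)"
    unfolding eb using u by (simp add: W_mn_mult S.A.Units_closed)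
  ultimately have "W (mn \<one>\<^bsub>S\<^esub> ?e) \<odot>\<^bsub>tic.\<Omega>\<^esub> ?y = \<zero>\<^bsub>tic.\<Omega>\<^esub>"
    using y u bD(2) tic.\<Omega>.smult_assoc1[of "W (mn (inv\<^bsub>S\<^esub> h b) 0)" "emb b" ?y] by simp
  then have "ps (up_ring.monom Kx0 1 ?e) \<odot>\<^bsub>tic.\<Omega>\<^esub> ?y = \<zero>\<^bsub>tic.\<Omega>\<^esub>" by (simp add: ps_monom)
  then have z: "up_ring.monom Kx0 1 ?e \<odot>\<^bsub>split\<^esub> \<Theta> ?y = \<zero>\<^bsub>split\<^esub>"
    using \<Theta>_smult[OF KS.monom_closed y, of 1 ?e] add_hom_zero[OF \<Theta>_hom tic.\<Omega>.M.abelian_group_axioms split_ag] by simp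
  have yc: "fst (\<Theta> ?y) \<in> carrier TT" "snd (\<Theta> ?y) \<in> carrier BS"
    using add_hom_closed[OF \<Theta>_hom y] by (auto simp: split_simps)
  have p: "poly_scalar TT (mn \<one>\<^bsub>S\<^esub> 1) (up_ring.monom Kx0 1 ?e) = mn \<one>\<^bsub>S\<^esub> ?e"
    using T.poly_scalar_hom(2)[of "mn \<one>\<^bsub>S\<^esub> 1" 1 ?e] by (simp add: S.pmon_pow[unfolded One_nat_def] S.T_smult_pmon)
  \<comment> \<open>In both components of the splitting, multiplication by x_0^e shifts
    coefficients, so nothing but zero is annihilated.\<close>
  have "fst (\<Theta> ?y) \<otimes>\<^bsub>TT\<^esub> mn \<one>\<^bsub>S\<^esub> ?e = \<zero>\<^bsub>TT\<^esub>"
    using z yc T.A.m_comm[of "fst (\<Theta> ?y)" "mn \<one>\<^bsub>S\<^esub> ?e"] by (simp add: split_simps p[unfolded One_nat_def])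
  then have 1: "fst (\<Theta> ?y) = \<zero>\<^bsub>TT\<^esub>" using pmon_unit_nzd[OF yc(1)] by blast
  have "up_ring.monom Kx0 1 ?e \<odot>\<^bsub>BS\<^esub> snd (\<Theta> ?y) = \<zero>\<^bsub>BS\<^esub>" using z by (simp add: split_simps)
  then have "KS.bcoef (snd (\<Theta> ?y)) n = \<zero>\<^bsub>kaehler_K S\<^esub>" for n
    using KS.bcoef_monom[OF yc(2), of ?e n] KS.bcoef_zero by simp
  then have 2: "snd (\<Theta> ?y) = \<zero>\<^bsub>BS\<^esub>" by (rule KS.bcoef_zeroD[OF yc(2)])
  have "\<Theta> ?y = \<zero>\<^bsub>split\<^esub>" using 1 2 by (simp add: split_simps prod_eq_iff)
  then show "\<Phi> w = \<zero>\<^bsub>tic.\<Omega>\<^esub>"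
    using \<Xi>_\<Theta>[OF y] add_hom_zero[OF \<Xi>_hom split_ag tic.\<Omega>.M.abelian_group_axioms] by simp
next
  fix w assume w: "w \<in> carrier R.\<Omega>" and z: "\<Phi> w = \<zero>\<^bsub>tic.\<Omega>\<^esub>"
  let ?x = "x [^]\<^bsub>R\<^esub> hc"
  have xc: "?x \<in> carrier R" by simp
  have m: "add_hom R.\<Omega> R.\<Omega> (\<lambda>w. ?x \<odot>\<^bsub>R.\<Omega>\<^esub> w)" by (rule add_homI) (use xc in \<open>auto simp: R.\<Omega>.smult_r_distr\<close>)
  \<comment> \<open>The element w need not be homogeneous, so the identity is checked on products f
    dg of homogeneous elements; after multiplication by x_0^(2r+1) each of them lies in a degree
    where \<Gamma> is a left inverse.\<close>
  have "\<Gamma> (\<Theta> (\<Phi> (?x \<odot>\<^bsub>R.\<Omega>\<^esub> w))) = ?x \<odot>\<^bsub>R.\<Omega>\<^esub> w"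
  proof (rule add_hom_eqI[OF add_hom_comp[OF m add_hom_comp[OF \<Theta>\<Phi>_hom \<Gamma>_hom]] m R.\<Omega>.M.abelian_group_axioms R.\<Omega>.M.abelian_group_axioms])
    let ?H = "\<Union>n. G (int n)"
    show "w \<in> asum R.\<Omega> {a \<odot>\<^bsub>R.\<Omega>\<^esub> R.d b | a b. a \<in> ?H \<and> b \<in> ?H}"
      using w R.kaehler_asum_gen[OF homog_carrier R_asum] by simp
    show "{a \<odot>\<^bsub>R.\<Omega>\<^esub> R.d b | a b. a \<in> ?H \<and> b \<in> ?H} \<subseteq> carrier R.\<Omega>"
      by (auto intro!: R.\<Omega>.smult_closed R.kd_closed)
    fix y assume "y \<in> {a \<odot>\<^bsub>R.\<Omega>\<^esub> R.d b | a b. a \<in> ?H \<and> b \<in> ?H}"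
    then obtain f g j k where y: "y = f \<odot>\<^bsub>R.\<Omega>\<^esub> R.d g" "f \<in> G (int j)" "g \<in> G (int k)" by blast
    have fg: "f \<in> carrier R" "g \<in> carrier R" using y by auto
    have "?x \<odot>\<^bsub>R.\<Omega>\<^esub> y = (?x \<otimes>\<^bsub>R\<^esub> f) \<odot>\<^bsub>R.\<Omega>\<^esub> R.d g" unfolding y(1) using fg by (simp add: R.\<Omega>.smult_assoc1)
    moreover have "?x \<otimes>\<^bsub>R\<^esub> f \<in> G (int hc + int j)" by (rule G_mult[OF xpow_G y(2)])
    moreover have "int hc + int j + int k = int (hc + j + k)" by simp
    ultimately have "?x \<odot>\<^bsub>R.\<Omega>\<^esub> y \<in> Rgr (int (hc + j + k))"
      using Rgr_hom[OF _ y(3), of "?x \<otimes>\<^bsub>R\<^esub> f" "int hc + int j"] by metis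
    then show "\<Gamma> (\<Theta> (\<Phi> (?x \<odot>\<^bsub>R.\<Omega>\<^esub> y))) = ?x \<odot>\<^bsub>R.\<Omega>\<^esub> y" by (rule \<Gamma>_\<Theta>_\<Phi>[rotated]) simp
  qed
  moreover have "\<Phi> (?x \<odot>\<^bsub>R.\<Omega>\<^esub> w) = \<zero>\<^bsub>tic.\<Omega>\<^esub>"
    unfolding emb.kaehler_map_smult[OF xc w] z using emb.hom_closed[OF xc] by (rule tic.\<Omega>.smult_r_null)
  ultimately have "?x \<odot>\<^bsub>R.\<Omega>\<^esub> w = \<zero>\<^bsub>R.\<Omega>\<^esub>"
    using add_hom_zero[OF \<Theta>_hom tic.\<Omega>.M.abelian_group_axioms split_ag]
      add_hom_zero[OF \<Gamma>_hom split_ag R.\<Omega>.M.abelian_group_axioms] by simp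
  then show "\<exists>b\<in>\<Union>e. hom_nzd R G e. b \<odot>\<^bsub>R.\<Omega>\<^esub> w = \<zero>\<^bsub>R.\<Omega>\<^esub>" using xpow_hom_nzd[of hc] by blast
qed

end

section \<open>Quotient algebras and graded polynomial rings\<close>

context kalgebra
begin

lemma ideal_submodule:
  assumes "ideal J A" shows "LinearCombinations.submodule base_field J A"
proof -
  interpret J: ideal J A by fact
  have "c \<odot>\<^bsub>A\<^esub> a \<in> J" if "a \<in> J" for c :: 'k and a
    using that J.I_l_closed[OF that alg_map_closed[of c]] by (simp add: alg_map_mult)
  then show ?thesis
    using algebra.axioms(1)[OF alg] J.a_subset by (intro LinearCombinations.submodule.intro) auto
qed

lemma quotient_ideal: "ideal J A \<Longrightarrow> quotient_module base_field A J"
  by (intro quotient_module.intro quotient_module_axioms.intro ideal_submodule algebra.axioms(1)[OF alg])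

lemma quot_mod_hom:
  assumes J: "ideal J A" shows "kalgebra_hom A (quot_mod A J) (\<lambda>a. J +>\<^bsub>A\<^esub> a)"
proof -
  interpret J: ideal J A by fact
  interpret Q: quotient_module base_field A J by (rule quotient_ideal) fact
  have m: "(J +>\<^bsub>A\<^esub> a) \<otimes>\<^bsub>quot_mod A J\<^esub> (J +>\<^bsub>A\<^esub> b) = J +>\<^bsub>A\<^esub> (a \<otimes>\<^bsub>A\<^esub> b)"
    if "a \<in> carrier A" "b \<in> carrier A" for a b
    using that by (simp add: quot_mod_def J.rcoset_mult_add)
  have o: "\<one>\<^bsub>quot_mod A J\<^esub> = J +>\<^bsub>A\<^esub> \<one>\<^bsub>A\<^esub>" by (simp add: quot_mod_def)
  have c: "cring (quot_mod A J)"
    by (rule cring_transport[OF J.quotient_is_cring[OF A.cring_axioms], of id])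
       (auto simp: FactRing_def quot_mod_def)
  have "algebra base_field (quot_mod A J)"
    by (rule algebraI[OF class_cring.is_cring c])
       (auto simp: Q.quot_carrier Q.quot_add Q.quot_smult m o smult_plus smult_add smult_times smult_mult class_ring_simps)
  then show ?thesis
    by (intro kalgebra_hom.intro kalgebra_hom_axioms.intro kalgebraI kalgebra_axioms)
       (auto intro!: ring_hom_memI simp: kalgebraI[OF alg] Q.quot_closed m o Q.quot_add Q.quot_smult)
qed

lemma quot_mod_eq_iff:
  "ideal J A \<Longrightarrow> a \<in> carrier A \<Longrightarrow> b \<in> carrier A \<Longrightarrow> J +>\<^bsub>A\<^esub> a = J +>\<^bsub>A\<^esub> b \<longleftrightarrow> a \<ominus>\<^bsub>A\<^esub> b \<in> J"
  by (rule quotient_module.quot_eq_iff[OF quotient_ideal])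

lemma quot_mod_carrier: "ideal J A \<Longrightarrow> carrier (quot_mod A J) = (\<lambda>a. J +>\<^bsub>A\<^esub> a) ` carrier A"
  by (rule quotient_module.quot_carrier[OF quotient_ideal])

end

lemma poly_ring_simps [simp]:
  "carrier poly_ring = UNIV" "monoid.mult poly_ring = (*)" "\<one>\<^bsub>poly_ring\<^esub> = 1" "\<zero>\<^bsub>poly_ring\<^esub> = 0"
  "add poly_ring = (+)" "smult poly_ring = (\<lambda>c f. Poly_Mapping.single 0 c * f)"
  by (simp_all add: poly_ring_def)

lemma kalgebra_poly_ring: "kalgebra (poly_ring :: ('k::field, ('n::finite, 'k) mpoly) module)"
proof (rule kalgebraI, rule algebraI[OF class_cring.is_cring])
  show "cring (poly_ring :: ('k::field, ('n::finite, 'k) mpoly) module)"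
  proof (intro cringI abelian_groupI comm_monoidI)
    fix x :: "('n, 'k) mpoly"
    show "\<exists>y\<in>carrier poly_ring. y \<oplus>\<^bsub>poly_ring\<^esub> x = \<zero>\<^bsub>poly_ring\<^esub>" by (auto intro!: exI[of _ "- x"])
  qed (auto simp: algebra_simps)
qed (auto simp: single_add mult_single single_one class_ring_simps algebra_simps)

interpretation PR: kalgebra "poly_ring :: ('k::field, ('n::finite, 'k) mpoly) module"
  by (rule kalgebra_poly_ring)

lemma poly_ring_minus [simp]: "f \<ominus>\<^bsub>poly_ring\<^esub> g = f - (g :: ('n::finite, 'k::field) mpoly)"
proof -
  have "\<ominus>\<^bsub>poly_ring\<^esub> g = - g" by (rule PR.A.minus_equality) simp_all
  then show ?thesis by (simp add: a_minus_def)
qed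

lemma ideal_poly_ring_iff:
  fixes I :: "('n::finite, 'k::field) mpoly set"
  shows "ideal I poly_ring \<longleftrightarrow> 0 \<in> I \<and> (\<forall>f\<in>I. \<forall>g\<in>I. f + g \<in> I) \<and> (\<forall>f\<in>I. \<forall>g. g * f \<in> I)"
proof
  assume "ideal I poly_ring"
  then interpret ideal I poly_ring .
  show "0 \<in> I \<and> (\<forall>f\<in>I. \<forall>g\<in>I. f + g \<in> I) \<and> (\<forall>f\<in>I. \<forall>g. g * f \<in> I)"
    using zero_closed a_closed I_l_closed by simp
next
  assume I: "0 \<in> I \<and> (\<forall>f\<in>I. \<forall>g\<in>I. f + g \<in> I) \<and> (\<forall>f\<in>I. \<forall>g. g * f \<in> I)"
  have n: "\<ominus>\<^bsub>poly_ring\<^esub> f = (- 1) * f" for f :: "('n, 'k) mpoly"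
    by (rule PR.A.minus_equality) simp_all
  have "subgroup I (add_monoid poly_ring)"
  proof
    show "inv\<^bsub>add_monoid poly_ring\<^esub> f \<in> I" if "f \<in> I" for f
      unfolding n[unfolded a_inv_def] using I that by blast
  qed (use I in auto)
  then show "ideal I poly_ring"
    using I by (intro idealI PR.A.ring_axioms) (auto simp: mult.commute)
qed

section \<open>Degrees and homogeneous components of polynomials\<close>

definition mdeg :: "('v::finite \<Rightarrow>\<^sub>0 nat) \<Rightarrow> nat" where
  "mdeg m = (\<Sum>v\<in>UNIV. Poly_Mapping.lookup m v)"

lemma mdeg_add: "mdeg (m + m') = mdeg m + mdeg m'"
  by (simp add: mdeg_def lookup_add sum.distrib)

lemma mdeg_single [simp]: "mdeg (Poly_Mapping.single v n) = n"
  by (simp add: mdeg_def lookup_single when_def)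

lemma homogeneous_iff: "homogeneous (int n) f \<longleftrightarrow> (\<forall>m\<in>Poly_Mapping.keys f. mdeg m = n)"
  by (simp only: homogeneous_def mdeg_def of_nat_eq_iff)

lemma homogeneous_neg: "homogeneous d f \<Longrightarrow> d < 0 \<Longrightarrow> f = 0"
proof (rule ccontr)
  assume h: "homogeneous d f" "d < 0" "f \<noteq> 0"
  then obtain m where "m \<in> Poly_Mapping.keys f" using keys_eq_empty[of f] by blast
  then show False using h(1,2) of_nat_0_le_iff[where 'a = int, of "mdeg m"] by (auto simp: homogeneous_def mdeg_def)
qed

lemma homogeneous_0 [simp]: "homogeneous d 0" by (simp add: homogeneous_def)

lemma homogeneous_add: "homogeneous d f \<Longrightarrow> homogeneous d g \<Longrightarrow> homogeneous d (f + g)"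
  using keys_add[of f g] by (auto simp: homogeneous_def)

lemma homogeneous_diff: "homogeneous d f \<Longrightarrow> homogeneous d g \<Longrightarrow> homogeneous d (f - g)"
  using keys_diff[of f g] by (auto simp: homogeneous_def)

lemma homogeneous_mult:
  assumes "homogeneous d f" "homogeneous e g" shows "homogeneous (d + e) (f * g)"
  unfolding homogeneous_def
proof
  fix m assume "m \<in> Poly_Mapping.keys (f * g)"
  then obtain a b where "m = a + b" "a \<in> Poly_Mapping.keys f" "b \<in> Poly_Mapping.keys g" using keys_mult[of f g] by blast
  then show "int (\<Sum>v\<in>UNIV. Poly_Mapping.lookup m v) = d + e"
    using assms by (auto simp: homogeneous_def lookup_add sum.distrib)
qed

lemma homogeneous_single: "mdeg m = n \<Longrightarrow> homogeneous (int n) (Poly_Mapping.single m c)"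
  by (simp add: homogeneous_iff)

lemma homogeneous_mvar: "homogeneous 1 (mvar v)"
  using homogeneous_single[of "Poly_Mapping.single v 1" 1 1] by (simp add: mvar_def)

lemma homogeneous_1: "homogeneous 0 1"
  using homogeneous_single[of "0" 0 1] by (simp add: mdeg_def single_one)

text \<open>Components are indexed by natural numbers, whereas \<open>homogeneous\<close> allows
  integer degrees. The two fit together because in negative degrees only 0 is homogeneous.\<close>

definition hpart :: "nat \<Rightarrow> ('n::finite, 'k::field) mpoly \<Rightarrow> ('n, 'k) mpoly" where
  "hpart n f = Poly_Mapping.mapp (\<lambda>m c. c when mdeg m = n) f"

lemma lookup_hpart: "Poly_Mapping.lookup (hpart n f) m = (Poly_Mapping.lookup f m when mdeg m = n)"
  by (auto simp: hpart_def lookup_mapp when_def in_keys_iff)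

lemma hpart_add: "hpart n (f + g) = hpart n f + hpart n g"
  by (rule poly_mapping_eqI) (simp add: lookup_hpart lookup_add when_def)

lemma hpart_diff: "hpart n (f - g) = hpart n f - hpart n g"
  by (rule poly_mapping_eqI) (simp add: lookup_hpart lookup_minus when_def)

lemma hpart_homogeneous: "homogeneous (int n) (hpart n f)"
  by (auto simp: homogeneous_iff in_keys_iff lookup_hpart when_def split: if_splits)

lemma hpart_of_homogeneous: "homogeneous (int m) f \<Longrightarrow> hpart n f = (if n = m then f else 0)"
  by (rule poly_mapping_eqI) (auto simp: lookup_hpart when_def homogeneous_iff in_keys_iff)

lemma hpart_0 [simp]: "hpart n 0 = 0"
  by (rule poly_mapping_eqI) (simp add: lookup_hpart when_def)

lemma hpart_bounded: "\<exists>N. \<forall>n>N. hpart n f = 0"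
proof -
  obtain N where N: "\<forall>k\<in>mdeg ` Poly_Mapping.keys f. k \<le> N"
    using finite_nat_set_iff_bounded_le[of "mdeg ` Poly_Mapping.keys f"] by auto
  have "hpart n f = 0" if "n > N" for n
    by (rule poly_mapping_eqI) (use N that in \<open>force simp: lookup_hpart when_def in_keys_iff\<close>)
  then show ?thesis by blast
qed

lemma hpart_sum:
  assumes N: "\<And>n. N < n \<Longrightarrow> hpart n f = 0" shows "f = (\<Sum>n\<le>N. hpart n f)"
proof (rule poly_mapping_eqI)
  fix m
  have "Poly_Mapping.lookup f m = 0" if "N < mdeg m"
    using N[OF that] lookup_hpart[of "mdeg m" f m] by simp
  then show "Poly_Mapping.lookup f m = Poly_Mapping.lookup (\<Sum>n\<le>N. hpart n f) m"
    by (cases "mdeg m \<le> N") (auto simp: lookup_sum lookup_hpart when_def)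
qed

lemma homogeneous_induct:
  assumes "\<And>n f. homogeneous (int n) f \<Longrightarrow> P f" "\<And>f g. P f \<Longrightarrow> P g \<Longrightarrow> P (f + g)"
  shows "P f"
proof -
  obtain N where N: "\<And>n. N < n \<Longrightarrow> hpart n f = 0" using hpart_bounded by blast
  have "P (\<Sum>n\<le>M. hpart n f)" for M
    by (induction M) (auto intro!: assms(2) assms(1)[OF hpart_homogeneous])
  then show ?thesis using hpart_sum[OF N] by metis
qed

lemma homogeneous_monom_induct:
  assumes f: "homogeneous (int n) f" and "P 0"
    "\<And>m c. mdeg m = n \<Longrightarrow> P (Poly_Mapping.single m c)" "\<And>f g. P f \<Longrightarrow> P g \<Longrightarrow> P (f + g)"
  shows "P f"
proof -
  have "f = (\<Sum>m\<in>Poly_Mapping.keys f. Poly_Mapping.single m (Poly_Mapping.lookup f m))"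
    by (rule poly_mapping_eqI) (auto simp: lookup_sum lookup_single when_def in_keys_iff)
  moreover have "P (\<Sum>m\<in>B. Poly_Mapping.single m (Poly_Mapping.lookup f m))"
    if "finite B" "B \<subseteq> Poly_Mapping.keys f" for B
    using that by induction (use f assms(2-4) in \<open>auto simp: homogeneous_iff\<close>)
  ultimately show ?thesis by (metis finite_keys order_refl)
qed

lemma hpart_mult_homogeneous:
  assumes f: "homogeneous (int m) f"
  shows "hpart n (f * g) = (if m \<le> n then f * hpart (n - m) g else 0)"
proof (induction g rule: homogeneous_induct)
  case (1 k g)
  have "homogeneous (int (m + k)) (f * g)" using homogeneous_mult[OF f 1] by simp
  from hpart_of_homogeneous[OF this, of n] hpart_of_homogeneous[OF 1, of "n - m"]
  show ?case by auto
next
  case (2 g g') then show ?case by (auto simp: distrib_left hpart_add)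
qed

lemma hpart_mult: "hpart n (f * g) = (\<Sum>i\<le>n. hpart i f * hpart (n - i) g)"
proof (induction f rule: homogeneous_induct)
  case (1 k f)
  have "(\<Sum>i\<le>n. hpart i f * hpart (n - i) g) = (\<Sum>i\<le>n. if i = k then f * hpart (n - k) g else 0)"
    by (rule sum.cong) (auto simp: hpart_of_homogeneous[OF 1])
  then show ?case by (simp add: hpart_mult_homogeneous[OF 1])
next
  case (2 f f') then show ?case by (simp add: distrib_right hpart_add sum.distrib)
qed

section \<open>Homogeneous ideals\<close>

definition hideal :: "('n::finite, 'k::field) mpoly set \<Rightarrow> bool" where
  "hideal I \<longleftrightarrow> ideal I poly_ring \<and> (\<forall>f\<in>I. \<forall>n. hpart n f \<in> I)"

lemma hidealD:
  assumes "hideal I"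
  shows "0 \<in> I" "f \<in> I \<Longrightarrow> g \<in> I \<Longrightarrow> f + g \<in> I" "f \<in> I \<Longrightarrow> g * f \<in> I" "f \<in> I \<Longrightarrow> f * g \<in> I"
    "f \<in> I \<Longrightarrow> hpart n f \<in> I" "f \<in> I \<Longrightarrow> - f \<in> I" "f \<in> I \<Longrightarrow> g \<in> I \<Longrightarrow> f - g \<in> I"
proof -
  note I = assms[unfolded hideal_def ideal_poly_ring_iff]
  show "0 \<in> I" "f \<in> I \<Longrightarrow> hpart n f \<in> I" using I by auto
  show a: "f \<in> I \<Longrightarrow> g \<in> I \<Longrightarrow> f + g \<in> I" "f \<in> I \<Longrightarrow> g * f \<in> I" for f g using I by auto
  then show "f \<in> I \<Longrightarrow> f * g \<in> I" by (simp add: mult.commute)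
  show b: "f \<in> I \<Longrightarrow> - f \<in> I" for f using a(2)[of f "- 1"] by simp
  show "f \<in> I \<Longrightarrow> g \<in> I \<Longrightarrow> f - g \<in> I" using a(1)[of f "- g"] b[of g] by simp
qed

lemma hideal_sum: "hideal I \<Longrightarrow> (\<And>i. i \<in> B \<Longrightarrow> f i \<in> I) \<Longrightarrow> sum f B \<in> I"
  by (induction B rule: infinite_finite_induct) (auto intro: hidealD)

lemma hidealI:
  assumes "0 \<in> I" "\<And>f g. f \<in> I \<Longrightarrow> g \<in> I \<Longrightarrow> f + g \<in> I" "\<And>f g. f \<in> I \<Longrightarrow> g * f \<in> I"
    "\<And>f n. f \<in> I \<Longrightarrow> hpart n f \<in> I"
  shows "hideal I"
  using assms by (auto simp: hideal_def ideal_poly_ring_iff)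

text \<open>In one direction, the members of \<open>I\<close> all of whose components lie in
  \<open>I\<close> form an ideal that contains the homogeneous members, hence the ideal they
  generate. In the other, each member is the finite sum of its components.\<close>

lemma homogeneous_ideal_iff: "homogeneous_ideal I \<longleftrightarrow> hideal I"
proof
  let ?H = "{f \<in> I. \<exists>d. homogeneous d f}"
  {
    assume h: "homogeneous_ideal I"
    then have i: "ideal I poly_ring" and g: "genideal poly_ring ?H = I" by (auto simp: homogeneous_ideal_def)
    note I = i[unfolded ideal_poly_ring_iff]
    let ?J = "{f \<in> I. \<forall>n. hpart n f \<in> I}"
    have m: "g * f \<in> ?J" if "f \<in> ?J" for f g
      using that
    proof (induction g rule: homogeneous_induct)
      case (1 k g) then show ?case using I by (auto simp: hpart_mult_homogeneous[OF 1(1)])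
    next
      case (2 g g') then show ?case using I by (auto simp: distrib_right hpart_add)
    qed
    have "ideal ?J poly_ring"
      unfolding ideal_poly_ring_iff using I m by (auto simp: hpart_add)
    moreover have "?H \<subseteq> ?J"
    proof
      fix f assume "f \<in> ?H"
      then obtain d where f: "f \<in> I" "homogeneous d f" by blast
      show "f \<in> ?J"
      proof (cases "d < 0")
        case True then show ?thesis using f homogeneous_neg[OF f(2)] I by auto
      next
        case False
        then obtain n where "d = int n" by (metis nonneg_int_cases not_le)
        then show ?thesis using f I hpart_of_homogeneous[of n f] by auto
      qed
    qed
    ultimately have "I \<subseteq> ?J" using PR.A.genideal_minimal[of ?J ?H] g by blast
    then show "hideal I" using i by (auto simp: hideal_def)
  next
    assume h: "hideal I"
    then have i: "ideal I poly_ring" by (simp add: hideal_def)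
    have gi: "ideal (genideal poly_ring ?H) poly_ring" by (rule PR.A.genideal_ideal) simp
    have ga: "f + g \<in> genideal poly_ring ?H" if "f \<in> genideal poly_ring ?H" "g \<in> genideal poly_ring ?H" for f g
      using gi that unfolding ideal_poly_ring_iff by blast
    have sub: "?H \<subseteq> genideal poly_ring ?H" by (rule PR.A.genideal_self) simp
    have "f \<in> genideal poly_ring ?H" if "f \<in> I" for f
    proof -
      obtain N where N: "\<And>n. N < n \<Longrightarrow> hpart n f = 0" using hpart_bounded by blast
      have "hpart n f \<in> genideal poly_ring ?H" for n
        using sub hidealD(5)[OF h that, of n] hpart_homogeneous[of n f] by blast
      then have "(\<Sum>n\<le>M. hpart n f) \<in> genideal poly_ring ?H" for M
        by (induction M) (simp_all only: atMost_0 sum.insert sum.empty finite.emptyI empty_iff not_False_eq_True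
            add_0_right sum.atMost_Suc ga)
      from this[of N] show ?thesis by (simp only: hpart_sum[OF N, symmetric])
    qed
    then have "genideal poly_ring ?H = I" using PR.A.genideal_minimal[OF i, of ?H] by blast
    then show "homogeneous_ideal I" using i by (simp add: homogeneous_ideal_def)
  }
qed

text \<open>The component of degree n of a g is a times the component of degree n - k of g. This is
  used for enlarging an ideal in a maximality argument and for adding x_0 to the vanishing
  ideal.\<close>

lemma hideal_adjoin:
  fixes p :: "('n::finite, 'k::field) mpoly set"
  assumes p: "hideal p" and a: "homogeneous (int k) a"
  shows "hideal {q + a * g | q g. q \<in> p}" (is "hideal ?X")
proof (rule hidealI)
  note pD = hidealD[OF p]
  have X: "q + a * g \<in> ?X" if "q \<in> p" for q g using that by blast
  show "0 \<in> ?X" using X[OF pD(1), of 0] by simp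
  fix f assume "f \<in> ?X"
  then obtain q g where f: "f = q + a * g" "q \<in> p" by blast
  show "f' * f \<in> ?X" for f' using X[OF pD(3)[OF f(2)], of f' "f' * g"] by (simp add: f(1) algebra_simps)
  show "hpart n f \<in> ?X" for n
    using X[OF pD(5)[OF f(2)], of n "hpart (n - k) g"] X[OF pD(5)[OF f(2)], of n 0]
    by (cases "k \<le> n") (simp_all add: f(1) hpart_add hpart_mult_homogeneous[OF a])
  fix f' assume "f' \<in> ?X"
  then obtain q' g' where f': "f' = q' + a * g'" "q' \<in> p" by blast
  show "f + f' \<in> ?X" using X[OF pD(2)[OF f(2) f'(2)], of "g + g'"] by (simp add: f(1) f'(1) algebra_simps)
qed

text \<open>By Zorn's lemma there is a maximal homogeneous ideal avoiding the powers of the variable; it is prime.\<close>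

lemma prime_avoiding_powers:
  fixes J :: "('n::finite, 'k::field) mpoly set"
  assumes J: "hideal J" and v: "\<And>N::nat. mvar v ^ N \<notin> J"
  obtains p where "primeideal p poly_ring" "hideal p" "J \<subseteq> p" "mvar v \<notin> p"
proof -
  let ?A = "{p. hideal p \<and> J \<subseteq> p \<and> (\<forall>N. mvar v ^ N \<notin> p)}"
  have "\<exists>M\<in>?A. \<forall>X\<in>?A. M \<subseteq> X \<longrightarrow> X = M"
  proof (rule subset_Zorn_nonempty)
    show "?A \<noteq> {}" using J v by blast
    fix C assume ne: "C \<noteq> {}" and "subset.chain ?A C"
    then have C: "C \<subseteq> ?A" "\<And>X Y. X \<in> C \<Longrightarrow> Y \<in> C \<Longrightarrow> X \<subseteq> Y \<or> Y \<subseteq> X" by (auto simp: subset_chain_def)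
    have h: "hideal X" if "X \<in> C" for X using C(1) that by auto
    have "hideal (\<Union>C)"
    proof (rule hidealI)
      show "0 \<in> \<Union>C" using ne h hidealD(1) by blast
      fix f g assume "f \<in> \<Union>C" "g \<in> \<Union>C"
      then obtain X Y where "X \<in> C" "Y \<in> C" "f \<in> X" "g \<in> Y" by blast
      then have "\<exists>Z\<in>C. f \<in> Z \<and> g \<in> Z" using C(2)[of X Y] by blast
      then show "f + g \<in> \<Union>C" using h hidealD(2) by blast
    qed (use h hidealD(3,5) in blast)+
    then show "\<Union>C \<in> ?A" using ne C(1) by auto
  qed
  then obtain p where pA: "p \<in> ?A" and mx: "\<forall>X\<in>?A. p \<subseteq> X \<longrightarrow> X = p" by (rule bexE)
  have p: "hideal p" "J \<subseteq> p" "\<And>N. mvar v ^ N \<notin> p" using pA by simp_all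
  have max: "X = p" if "hideal X" "p \<subseteq> X" "\<And>N. mvar v ^ N \<notin> X" for X
    by (rule mx[rule_format, OF _ that(2)]) (use that p(2) in simp)
  note pD = hidealD[OF p(1)]
  \<comment> \<open>By maximality, adjoining a homogeneous element outside p produces an ideal that
    contains a power of the variable.\<close>
  have ext: "\<exists>N q g. q \<in> p \<and> mvar v ^ N = q + a * g" if a: "homogeneous (int k) a" "a \<notin> p" for k a
  proof (rule ccontr)
    assume n: "\<not> ?thesis"
    let ?X = "{q + a * g | q g. q \<in> p}"
    have X: "q + a * g \<in> ?X" if "q \<in> p" for q g using that by blast
    have "hideal ?X" by (rule hideal_adjoin[OF p(1) a(1)])
    moreover have "p \<subseteq> ?X" using X[of _ 0] by auto
    moreover have "mvar v ^ N \<notin> ?X" for N using n by blast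
    ultimately have "?X = p" by (rule max)
    then show False using X[OF pD(1), of 1] a(2) by simp
  qed
  have prime_hom: "a * b \<notin> p" if ab: "homogeneous (int k) a" "a \<notin> p" "homogeneous (int l) b" "b \<notin> p" for a b k l
  proof
    assume in_p: "a * b \<in> p"
    obtain N q g M q' g' where 1: "q \<in> p" "mvar v ^ N = q + a * g" and 2: "q' \<in> p" "mvar v ^ M = q' + b * g'"
      using ext[OF ab(1,2)] ext[OF ab(3,4)] by blast
    \<comment> \<open>Multiplying the two expressions, every term involves q or q' except one, and
      that one is a multiple of a b.\<close>
    have "mvar v ^ (N + M) = (q' + b * g') * q + (a * g) * q' + (g * g') * (a * b)"
      by (simp add: power_add 1 2 algebra_simps)
    also have "\<dots> \<in> p" by (intro in_p 1(1) 2(1) pD(2) pD(3))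
    finally show False using p(3) by blast
  qed
  \<comment> \<open>Primality for arbitrary factors is reduced to homogeneous ones through the
    component of highest degree outside p. It exists because almost all components vanish and not
    all of them can lie in p.\<close>
  have mx: "\<exists>n. hpart n a \<notin> p \<and> (\<forall>k>n. hpart k a \<in> p)" if "a \<notin> p" for a
  proof -
    obtain N where N: "\<And>n. N < n \<Longrightarrow> hpart n a = 0" using hpart_bounded by blast
    let ?S = "{n. hpart n a \<notin> p}"
    have "?S \<subseteq> {..N}" using N pD(1) by (auto simp: not_less[symmetric])
    then have fin: "finite ?S" by (rule finite_subset) simp
    have "?S \<noteq> {}"
    proof
      assume "?S = {}"
      then have "(\<Sum>n\<le>N. hpart n a) \<in> p" by (intro hideal_sum[OF p(1)]) blast
      then show False using that by (simp only: hpart_sum[OF N, symmetric])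
    qed
    then have "Max ?S \<in> ?S" using Max_in[OF fin] by blast
    moreover have "hpart k a \<in> p" if "k > Max ?S" for k using that Max_ge[OF fin, of k] by force
    ultimately show ?thesis by blast
  qed
  have "primeideal p poly_ring"
  proof (rule primeidealI)
    show "ideal p poly_ring" using p(1) by (simp add: hideal_def)
    show "cring (poly_ring :: ('k, ('n, 'k) mpoly) module)" by (rule PR.A.cring_axioms)
    show "carrier poly_ring \<noteq> p" using p(3)[of 0] by auto
    fix a b :: "('n, 'k) mpoly" assume ab: "a \<otimes>\<^bsub>poly_ring\<^esub> b \<in> p"
    show "a \<in> p \<or> b \<in> p"
    proof (rule ccontr)
      assume "\<not> ?thesis"
      then have nab: "a \<notin> p" "b \<notin> p" by simp_all
      obtain m where m: "hpart m a \<notin> p" "\<And>i. i > m \<Longrightarrow> hpart i a \<in> p" using mx[OF nab(1)] by blast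
      obtain k where k: "hpart k b \<notin> p" "\<And>i. i > k \<Longrightarrow> hpart i b \<in> p" using mx[OF nab(2)] by blast
      let ?t = "\<lambda>i. hpart i a * hpart (m + k - i) b"
      \<comment> \<open>In degree m + k of the product, every term other than the chosen one has a
        factor of degree above m from a or above k from b, and this factor lies in p.\<close>
      have r: "sum ?t ({..m + k} - {m}) \<in> p"
      proof (rule hideal_sum[OF p(1)])
        fix i assume i: "i \<in> {..m + k} - {m}"
        show "?t i \<in> p"
        proof (cases "i > m")
          case True then show ?thesis using m(2) pD(4) by blast
        next
          case False then show ?thesis using i k(2)[of "m + k - i"] pD(3) by auto
        qed
      qed
      have e: "hpart (m + k) (a * b) = ?t m + sum ?t ({..m + k} - {m})"
        unfolding hpart_mult by (rule sum.remove) auto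
      have "hpart (m + k) (a * b) \<in> p" using pD(5)[OF ab] by simp
      from pD(7)[OF this r] have "?t m \<in> p" unfolding e by (simp only: add_diff_cancel_right')
      then have "hpart m a * hpart k b \<in> p" by simp
      then show False using prime_hom[OF hpart_homogeneous m(1) hpart_homogeneous k(1)] by blast
    qed
  qed
  moreover have "mvar v \<notin> p" using p(3)[of 1] by simp
  ultimately show ?thesis using p(1,2) by (intro that)
qed

lemma mvar_power: "mvar v ^ n = Poly_Mapping.single (Poly_Mapping.single v n) 1"
  by (induction n) (simp_all add: single_one mvar_def mult_single flip: single_add)

lemma single_plus_minus:
  "(n :: nat) \<le> Poly_Mapping.lookup m v \<Longrightarrow> Poly_Mapping.single v n + (m - Poly_Mapping.single v n) = m"
  by (rule poly_mapping_eqI) (auto simp: lookup_add lookup_minus lookup_single when_def)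

lemma single_mvar_power:
  "n \<le> Poly_Mapping.lookup m v \<Longrightarrow>
    Poly_Mapping.single m c = mvar v ^ n * Poly_Mapping.single (m - Poly_Mapping.single v n) c"
  by (simp add: mvar_power mult_single single_plus_minus)

text \<open>Pigeonhole: if the K-th power of every variable lies in \<open>J\<close>, then a
  monomial whose degree exceeds the number of variables times K is divisible by one of these
  powers.\<close>

lemma high_degree_mem:
  fixes J :: "('n::finite, 'k::field) mpoly set"
  assumes J: "hideal J" and v: "\<And>v. \<exists>N. mvar v ^ N \<in> J"
  obtains N where "\<And>n g. N \<le> n \<Longrightarrow> homogeneous (int n) g \<Longrightarrow> g \<in> J"
proof -
  obtain N where N: "\<And>v. mvar v ^ N v \<in> J" using v by metis
  let ?K = "\<Sum>v\<in>UNIV. N v"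
  have K: "mvar v ^ ?K \<in> J" for v
  proof -
    have "N v \<le> ?K" by (rule member_le_sum) auto
    then have "mvar v ^ ?K = mvar v ^ (?K - N v) * mvar v ^ N v" by (simp flip: power_add)
    then show ?thesis by (rule ssubst) (rule hidealD(3)[OF J N[of v]])
  qed
  have "g \<in> J" if n: "card (UNIV :: 'n option set) * ?K + 1 \<le> n" and g: "homogeneous (int n) g" for n g
  proof (rule homogeneous_monom_induct[OF g])
    fix m :: "'n option \<Rightarrow>\<^sub>0 nat" and c :: 'k assume m: "mdeg m = n"
    have "\<exists>v. ?K \<le> Poly_Mapping.lookup m v"
    proof (rule ccontr)
      assume "\<not> ?thesis"
      then have "mdeg m \<le> (\<Sum>v\<in>(UNIV :: 'n option set). ?K)"
        unfolding mdeg_def by (intro sum_mono) (auto simp: not_le less_imp_le)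
      then show False using n m by simp
    qed
    then show "Poly_Mapping.single m c \<in> J" using single_mvar_power[of ?K m _ c] hidealD(4)[OF J K] by metis
  qed (use hidealD(1,2)[OF J] in auto)
  then show ?thesis by (rule that)
qed

section \<open>Zero-dimensional schemes\<close>

locale zero_dim =
  fixes I :: "('n::finite, 'k::field) mpoly set"
  assumes zds: "zero_dim_scheme I" and affine: "\<forall>p\<in>proj_points I. mvar None \<notin> p"
begin

abbreviation "z \<equiv> mvar None :: ('n, 'k) mpoly"
abbreviation "R \<equiv> coord_ring I"
abbreviation "S \<equiv> aff_ring I"
abbreviation "G \<equiv> coord_grade I"
abbreviation cs :: "('n, 'k) mpoly \<Rightarrow> ('n, 'k) mpoly set" where "cs f \<equiv> I +>\<^bsub>poly_ring\<^esub> f"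

lemma hI: "hideal I" using zds by (simp add: zero_dim_scheme_def homogeneous_ideal_iff)

lemma iI: "ideal I poly_ring" using hI by (simp add: hideal_def)

lemmas ID = hidealD[OF hI]

lemma one_notin: "1 \<notin> I"
proof
  assume 1: "1 \<in> I"
  obtain p where "p \<in> proj_points I" using zds by (auto simp: zero_dim_scheme_def)
  then have p: "primeideal p poly_ring" "hideal p" "I \<subseteq> p" by (auto simp: proj_points_def homogeneous_ideal_iff)
  have "g \<in> p" for g using hidealD(3)[OF p(2), of 1 g] 1 p(3) by auto
  then show False using primeideal.I_notcarr[OF p(1)] by auto
qed

text \<open>Otherwise a homogeneous prime over \<open>J\<close> that avoids the variable would be a
  point of the scheme on the hyperplane x_0 = 0.\<close>

lemma nilpotent:
  assumes J: "hideal J" "I \<subseteq> J" "z \<in> J" shows "\<exists>N. mvar v ^ N \<in> J"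
proof (rule ccontr)
  assume "\<not> ?thesis"
  then obtain p where p: "primeideal p poly_ring" "hideal p" "J \<subseteq> p" "mvar v \<notin> p"
    using prime_avoiding_powers[OF J(1), of v] by blast
  moreover have "\<not> range mvar \<subseteq> p" using p(4) by blast
  ultimately have "p \<in> proj_points I" using J(2) by (auto simp: proj_points_def homogeneous_ideal_iff)
  then show False using affine p(3) J(3) by blast
qed

text \<open>The colon ideal of f is homogeneous and contains \<open>I\<close> and \<open>z\<close>,
  hence all forms of large degree; saturation then puts f into \<open>I\<close>.\<close>

lemma z_cancel:
  assumes f: "homogeneous (int m) f" and zf: "z * f \<in> I" shows "f \<in> I"
proof -
  let ?J = "{g. f * g \<in> I}"
  have J: "hideal ?J"
  proof (rule hidealI)
    show "hpart n g \<in> ?J" if "g \<in> ?J" for g n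
      using that ID(5)[of "f * g" "n + m"] hpart_mult_homogeneous[OF f, of "n + m" g] by simp
    show "0 \<in> ?J" using ID(1) by simp
    show "g + g' \<in> ?J" if "g \<in> ?J" "g' \<in> ?J" for g g' using that ID(2) by (simp add: distrib_left)
    show "g' * g \<in> ?J" if "g \<in> ?J" for g g' using that ID(3)[of "f * g" g'] by (simp add: mult.left_commute)
  qed
  have "I \<subseteq> ?J" "z \<in> ?J" using ID(3) zf by (auto simp: mult.commute)
  then obtain N where N: "\<And>n g. N \<le> n \<Longrightarrow> homogeneous (int n) g \<Longrightarrow> g \<in> ?J"
    using high_degree_mem[OF J nilpotent[OF J]] by blast
  then have "\<exists>N::nat. \<forall>g. homogeneous (int N) g \<longrightarrow> f * g \<in> I" by blast
  then show ?thesis using zds by (auto simp: zero_dim_scheme_def saturated_def)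
qed

text \<open>The ideal generated by \<open>I\<close> and \<open>z\<close> contains all forms of large
  degree, and the cofactor of \<open>z\<close> becomes homogeneous by passing to components.\<close>

lemma z_divides:
  obtains N where "\<And>n g. N \<le> n \<Longrightarrow> homogeneous (int (Suc n)) g \<Longrightarrow> \<exists>h. homogeneous (int n) h \<and> g - z * h \<in> I"
proof -
  let ?J = "{q + z * g | q g. q \<in> I}"
  have z1: "homogeneous (int 1) z" using homogeneous_mvar by simp
  have J: "hideal ?J" by (rule hideal_adjoin[OF hI z1])
  have X: "q + z * g \<in> ?J" if "q \<in> I" for q g using that by blast
  have "I \<subseteq> ?J" using X[of _ 0] by auto
  moreover have "z \<in> ?J" using X[OF ID(1), of 1] by simp
  ultimately obtain N where N: "\<And>n g. N \<le> n \<Longrightarrow> homogeneous (int n) g \<Longrightarrow> g \<in> ?J"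
    using high_degree_mem[OF J nilpotent[OF J]] by blast
  have "\<exists>h. homogeneous (int n) h \<and> g - z * h \<in> I" if n: "N \<le> n" and g: "homogeneous (int (Suc n)) g" for n g
  proof -
    obtain q h where q: "g = q + z * h" "q \<in> I" using N[OF _ g] n by auto
    have "hpart (Suc n) g = hpart (Suc n) q + z * hpart n h"
      by (simp add: q(1) hpart_add hpart_mult_homogeneous[OF z1])
    then have "g - z * hpart n h = hpart (Suc n) q" using hpart_of_homogeneous[OF g, of "Suc n"] by simp
    then show ?thesis using ID(5)[OF q(2), of "Suc n"] hpart_homogeneous[of n h] by metis
  qed
  then show ?thesis by (rule that)
qed

sublocale q: kalgebra_hom poly_ring R cs
  unfolding coord_ring_def by (rule PR.quot_mod_hom[OF iI])

lemma cs_eq: "cs f = cs g \<longleftrightarrow> f - g \<in> I"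
  using PR.quot_mod_eq_iff[OF iI, of f g] by simp

lemma cs_simps: "cs f \<in> carrier R" "cs (f + g) = cs f \<oplus>\<^bsub>R\<^esub> cs g" "cs (f * g) = cs f \<otimes>\<^bsub>R\<^esub> cs g"
  "cs (Poly_Mapping.single 0 c * f) = c \<odot>\<^bsub>R\<^esub> cs f" "cs 0 = \<zero>\<^bsub>R\<^esub>" "cs 1 = \<one>\<^bsub>R\<^esub>"
  using q.hom_closed[of f] q.hom_add[of f g] q.hom_mult[of f g] q.hom_smult[of f c] q.hom_zero q.hom_one
  by simp_all

lemma cs_diff: "cs (f - g) = cs f \<ominus>\<^bsub>R\<^esub> cs g"
  using add_hom_minus[OF q.add_hom PR.A.abelian_group_axioms q.B.A.abelian_group_axioms, of f g] by simp

lemma R_carrier: "carrier R = range cs"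
  unfolding coord_ring_def using PR.quot_mod_carrier[OF iI] by simp

lemma x_cs: "xR I v = cs (mvar v)" by (simp add: xR_def)

lemma iD: "ideal (deh_ideal I) R"
  unfolding deh_ideal_def by (rule q.B.A.genideal_ideal) (simp add: x_cs cs_simps)

lemma deh_ideal_eq: "deh_ideal I = range (\<lambda>h. cs (h * (z - 1)))"
proof -
  have "deh_ideal I = {a \<otimes>\<^bsub>R\<^esub> cs (z - 1) | a. a \<in> carrier R}"
    unfolding deh_ideal_def x_cs cs_diff cs_simps(6)
    by (subst q.B.A.cgenideal_eq_genideal[symmetric]) (simp_all add: cgenideal_def cs_simps)
  then show ?thesis by (auto simp: R_carrier cs_simps(3))
qed

sublocale dh: kalgebra_hom R S "deh I"
proof -
  have "deh I = (\<lambda>f. deh_ideal I +>\<^bsub>R\<^esub> f)" by (rule ext) (simp add: deh_def)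
  then show "kalgebra_hom R S (deh I)" unfolding aff_ring_def using q.B.quot_mod_hom[OF iD] by simp
qed

abbreviation "D f \<equiv> deh I (cs f)"

lemma D_eq: "D f = D g \<longleftrightarrow> (\<exists>h. f - g - (z - 1) * h \<in> I)"
proof -
  have "D f = D g \<longleftrightarrow> cs (f - g) \<in> deh_ideal I"
    using q.B.quot_mod_eq_iff[OF iD cs_simps(1) cs_simps(1), of f g] by (simp add: deh_def cs_diff)
  also have "\<dots> \<longleftrightarrow> (\<exists>h. f - g - (z - 1) * h \<in> I)"
    unfolding deh_ideal_eq image_iff by (simp only: cs_eq mult.commute UNIV_I bex_simps simp_thms)
  finally show ?thesis .
qed

lemma D_simps: "D f \<in> carrier S" "D (f + g) = D f \<oplus>\<^bsub>S\<^esub> D g" "D (f * g) = D f \<otimes>\<^bsub>S\<^esub> D g"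
  "D (Poly_Mapping.single 0 c * f) = c \<odot>\<^bsub>S\<^esub> D f" "D 0 = \<zero>\<^bsub>S\<^esub>" "D 1 = \<one>\<^bsub>S\<^esub>"
  unfolding cs_simps(4) unfolding cs_simps(2,3,5,6)
  using dh.hom_closed[OF cs_simps(1)[of f]] dh.hom_add[OF cs_simps(1)[of f] cs_simps(1)[of g]]
    dh.hom_mult[OF cs_simps(1)[of f] cs_simps(1)[of g]] dh.hom_smult[OF cs_simps(1)[of f], of c] dh.hom_zero dh.hom_one
  by (simp_all only:)

lemma D_z: "D z = \<one>\<^bsub>S\<^esub>"
proof -
  have "D z = D 1" unfolding D_eq using ID(1) by (intro exI[of _ 1]) simp
  then show ?thesis by (simp only: D_simps)
qed

lemma D_z_mult: "D (z * f) = D f"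
  by (simp only: D_simps(3) D_z dh.B.A.l_one[OF D_simps(1)])

lemma S_carrier: "carrier S = range D"
  unfolding aff_ring_def using q.B.quot_mod_carrier[OF iD]
  by (simp add: deh_def[abs_def] R_carrier image_image)

text \<open>Comparing the components of \<open>e - (z - 1) h \<in> I\<close> with \<open>e\<close> homogeneous of degree \<open>n\<close>, those below
  \<open>n\<close> give \<open>h\<^sub>k \<in> I\<close> for \<open>k < n\<close> by ascending and those above give \<open>h\<^sub>k \<in> I\<close> for \<open>k \<ge> n\<close> by descending
  induction.\<close>

lemma homogeneous_deh_ideal:
  assumes e: "homogeneous (int n) e" and h: "e - (z - 1) * h \<in> I"
  shows "e \<in> I"
proof -
  have z1: "homogeneous (int 1) z" using homogeneous_mvar by simp
  have p: "hpart k e - (if 1 \<le> k then z * hpart (k - 1) h else 0) + hpart k h \<in> I" for k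
  proof -
    have "hpart k (e - (z - 1) * h) = hpart k e - (hpart k (z * h) - hpart k h)"
      by (simp only: left_diff_distrib hpart_diff mult_1_left)
    also have "\<dots> = hpart k e - (if 1 \<le> k then z * hpart (k - 1) h else 0) + hpart k h"
      by (simp only: hpart_mult_homogeneous[OF z1] diff_diff_eq2 add_diff_eq diff_add_eq)
    finally show ?thesis using ID(5)[OF h, of k] by simp
  qed
  have lo: "hpart k h \<in> I" if "k < n" for k
    using that
  proof (induction k)
    case 0 then show ?case using p[of 0] by (simp add: hpart_of_homogeneous[OF e])
  next
    case (Suc k)
    then have "z * hpart k h \<in> I" using ID(3) by simp
    moreover have "hpart (Suc k) h - z * hpart k h \<in> I" using p[of "Suc k"] Suc.prems by (simp add: hpart_of_homogeneous[OF e])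
    ultimately show ?case using ID(2)[of "hpart (Suc k) h - z * hpart k h" "z * hpart k h"] by simp
  qed
  obtain N where N: "\<And>k. N < k \<Longrightarrow> hpart k h = 0" using hpart_bounded by blast
  have hi: "hpart n h \<in> I"
  \<comment> \<open>The descent starts at N + 1, where the component is zero; if n lies beyond, the
    component in question is zero already.\<close>
  proof (cases "n \<le> Suc N")
    case True
    then show ?thesis
    proof (induction rule: inc_induct)
      case base then show ?case using N[of "Suc N"] ID(1) by simp
    next
      case (step k)
      then have "hpart (Suc k) h - z * hpart k h \<in> I" using p[of "Suc k"] by (simp add: hpart_of_homogeneous[OF e])
      then have "hpart (Suc k) h - (hpart (Suc k) h - z * hpart k h) \<in> I" using ID(7) step.IH by blast
      then show ?case using z_cancel[OF hpart_homogeneous] by simp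
    qed
  next
    case False then show ?thesis using N[of n] ID(1) by simp
  qed
  let ?t = "if 1 \<le> n then z * hpart (n - 1) h else 0"
  have t: "?t \<in> I" using lo[of "n - 1"] ID(1,3) by auto
  have "(hpart n e - ?t + hpart n h) - hpart n h + ?t \<in> I" by (intro ID(2,7) p hi t)
  then show ?thesis by (simp add: hpart_of_homogeneous[OF e])
qed

lemma G_iff: "a \<in> G i \<longleftrightarrow> (\<exists>f. homogeneous i f \<and> a = cs f)"
  by (auto simp: coord_grade_def)

lemma G_cases: assumes "a \<in> G i" obtains f where "homogeneous i f" "a = cs f"
  using assms by (auto simp: G_iff)

lemma GI: "homogeneous i f \<Longrightarrow> cs f \<in> G i" by (auto simp: G_iff)

lemma G_neg: assumes "i < 0" shows "G i = {\<zero>\<^bsub>R\<^esub>}"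
proof -
  have "homogeneous i f \<longleftrightarrow> f = 0" for f :: "('n, 'k) mpoly" using homogeneous_neg[OF _ assms] by auto
  then show ?thesis by (auto simp: coord_grade_def cs_simps)
qed

lemma deh_inj: "inj_on (deh I) (G i)"
proof (rule inj_onI)
  fix a b assume "a \<in> G i" "b \<in> G i" and eq: "deh I a = deh I b"
  then obtain f g where f: "homogeneous i f" "a = cs f" and g: "homogeneous i g" "b = cs g" by (auto simp: G_iff)
  obtain h where h: "f - g - (z - 1) * h \<in> I" using eq D_eq f g by blast
  have d: "homogeneous i (f - g)" by (rule homogeneous_diff[OF f(1) g(1)])
  have "f - g \<in> I"
  proof (cases "i < 0")
    case True then show ?thesis using homogeneous_neg[OF d] ID(1) by simp
  next
    case False
    then obtain n where "i = int n" by (metis nonneg_int_cases not_le)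
    then show ?thesis using homogeneous_deh_ideal[OF _ h] d by simp
  qed
  then show "a = b" using f g cs_eq by simp
qed

definition "cmp n a = cs (hpart n (SOME f. cs f = a))"

text \<open>The choice of a representative does not matter: two of them differ by an element of
  \<open>I\<close>, and the components of that element lie in \<open>I\<close>.\<close>

lemma cmp_cs: "cmp n (cs f) = cs (hpart n f)"
proof -
  have "cs (SOME g. cs g = cs f) = cs f" by (rule someI) (rule refl)
  then show ?thesis unfolding cmp_def cs_eq hpart_diff[symmetric] using ID(5) by (simp only: cs_eq)
qed

section \<open>Dehomogenized forms exhaust S\<close>

abbreviation "A n \<equiv> deh I ` G (int n)"

lemma A_iff: "y \<in> A n \<longleftrightarrow> (\<exists>f. homogeneous (int n) f \<and> y = D f)"
  unfolding image_iff Bex_def G_iff by blast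

text \<open>Multiplication by \<open>z\<close> raises the degree by one and leaves the
  dehomogenization unchanged.\<close>

lemma A_mono: assumes "n \<le> m" shows "A n \<subseteq> A m"
proof (rule lift_Suc_mono_le[OF _ assms])
  fix n
  show "A n \<subseteq> A (Suc n)"
  proof
    fix y assume "y \<in> A n"
    then obtain f where f: "homogeneous (int n) f" "y = D f" unfolding A_iff by blast
    have "homogeneous (int (Suc n)) (z * f)" using homogeneous_mult[OF homogeneous_mvar f(1), of None] by (simp add: add.commute)
    then show "y \<in> A (Suc n)" unfolding A_iff using f(2) D_z_mult[of f] by metis
  qed
qed

text \<open>From degree N on, a form is \<open>z\<close> times a form modulo \<open>I\<close>, so
  the ascending chain stops growing. Its union is all of \<open>S\<close>, because every polynomial
  is a sum of forms and these can be brought to a common degree.\<close>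

lemma A_full: obtains N where "\<And>n. N \<le> n \<Longrightarrow> A n = carrier S"
proof -
  obtain N where N: "\<And>n g. N \<le> n \<Longrightarrow> homogeneous (int (Suc n)) g \<Longrightarrow> \<exists>h. homogeneous (int n) h \<and> g - z * h \<in> I"
    using z_divides by blast
  have dn: "A n \<subseteq> A N" if "N \<le> n" for n
    using that
  proof (induction rule: dec_induct)
    case base then show ?case by simp
  next
    case (step n)
    have "A (Suc n) \<subseteq> A n"
    proof
      fix y assume "y \<in> A (Suc n)"
      then obtain g where g: "homogeneous (int (Suc n)) g" "y = D g" unfolding A_iff by blast
      then obtain h where h: "homogeneous (int n) h" "g - z * h \<in> I" using N[OF step.hyps(1)] by blast
      then have "y = D h" using g(2) cs_eq[of g "z * h"] D_z_mult[of h] by simp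
      then show "y \<in> A n" unfolding A_iff using h(1) by blast
    qed
    then show ?case using step.IH by blast
  qed
  have all: "D f \<in> A N" for f
  proof (induction f rule: homogeneous_induct)
    case (1 n f)
    then have "D f \<in> A n" using A_iff by blast
    then have "D f \<in> A (max n N)" using A_mono[OF max.cobounded1] by blast
    then show ?case using dn[of "max n N"] by auto
  next
    case (2 f g) then show ?case unfolding A_iff using homogeneous_add D_simps(2) by metis
  qed
  have "A n = carrier S" if "N \<le> n" for n
  proof
    show "A n \<subseteq> carrier S" unfolding coord_grade_def using D_simps(1) by blast
    show "carrier S \<subseteq> A n" using all A_mono[OF that] unfolding S_carrier by blast
  qed
  then show ?thesis by (rule that)
qed

lemma finite_mdeg: "finite {m :: 'n option \<Rightarrow>\<^sub>0 nat. mdeg m = N}"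
proof (rule finite_subset)
  show "{m :: 'n option \<Rightarrow>\<^sub>0 nat. mdeg m = N} \<subseteq> Poly_Mapping.Abs_poly_mapping ` (PiE UNIV (\<lambda>_. {..N}))"
  proof
    fix m :: "'n option \<Rightarrow>\<^sub>0 nat" assume m: "m \<in> {m. mdeg m = N}"
    have "Poly_Mapping.lookup m v \<le> N" for v
      using m member_le_sum[of v UNIV "Poly_Mapping.lookup m"] by (simp add: mdeg_def)
    then have "Poly_Mapping.lookup m \<in> PiE UNIV (\<lambda>_. {..N})" by auto
    then show "m \<in> Poly_Mapping.Abs_poly_mapping ` (PiE UNIV (\<lambda>_. {..N}))"
      by (metis imageI Poly_Mapping.lookup_inverse)
  qed
  show "finite (Poly_Mapping.Abs_poly_mapping ` (PiE (UNIV :: 'n option set) (\<lambda>_. {..N})))"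
    by (intro finite_imageI finite_PiE) auto
qed

text \<open>Since \<open>S\<close> is the image of the forms of a single degree N, it is spanned by
  the images of the finitely many monomials of that degree.\<close>

lemma S_fin: "vectorspace.fin_dim base_field S"
proof -
  obtain N where "\<And>n. N \<le> n \<Longrightarrow> A n = carrier S" using A_full by blast
  then have AN: "A N = carrier S" by simp
  have N: "\<exists>f. homogeneous (int N) f \<and> y = D f" if "y \<in> carrier S" for y
    using that unfolding AN[symmetric] A_iff .
  let ?B = "(\<lambda>m. D (Poly_Mapping.single m 1)) ` {m. mdeg m = N}"
  let ?C = "{c \<odot>\<^bsub>S\<^esub> b | c b. c \<in> carrier base_field \<and> b \<in> ?B}"
  show ?thesis
  proof (rule fin_dimI_asum[OF dh.B.vectorspace_A])
    show "finite ?B" using finite_mdeg by blast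
    show B: "?B \<subseteq> carrier S" using D_simps(1) by blast
    have "asum S ?C \<subseteq> carrier S"
      by (rule asum_subset[OF dh.B.A.abelian_monoid_axioms]) (use B in auto)
    moreover have "y \<in> asum S ?C" if "y \<in> carrier S" for y
    proof -
      obtain f where f: "homogeneous (int N) f" "y = D f" using N \<open>y \<in> carrier S\<close> by blast
      have "D f \<in> asum S ?C"
      proof (rule homogeneous_monom_induct[OF f(1)])
        show "D 0 \<in> asum S ?C" unfolding D_simps by (rule asum_zero)
        show "D (f + g) \<in> asum S ?C" if "D f \<in> asum S ?C" "D g \<in> asum S ?C" for f g
          unfolding D_simps using that by (rule asum_add)
        fix m :: "'n option \<Rightarrow>\<^sub>0 nat" and c :: 'k assume "mdeg m = N"
        moreover have "D (Poly_Mapping.single m c) = c \<odot>\<^bsub>S\<^esub> D (Poly_Mapping.single m 1)"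
          using D_simps(4)[of c "Poly_Mapping.single m 1"] by (simp add: mult_single)
        ultimately show "D (Poly_Mapping.single m c) \<in> asum S ?C" by (intro asum_base) auto
      qed
      then show ?thesis using f(2) by simp
    qed
    ultimately show "carrier S = asum S ?C" by blast
  qed
qed

lemma S_one: "\<one>\<^bsub>S\<^esub> \<noteq> \<zero>\<^bsub>S\<^esub>"
proof
  assume "\<one>\<^bsub>S\<^esub> = \<zero>\<^bsub>S\<^esub>"
  then have "D 1 = D 0" by (simp only: D_simps)
  then obtain h where "1 - 0 - (z - 1) * h \<in> I" unfolding D_eq by blast
  then have "1 \<in> I" using homogeneous_deh_ideal[of 0 1 h] homogeneous_1 by simp
  then show False using one_notin by simp
qed

lemma G_add: "a \<in> G i \<Longrightarrow> b \<in> G i \<Longrightarrow> a \<oplus>\<^bsub>R\<^esub> b \<in> G i"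
  unfolding G_iff using homogeneous_add cs_simps(2) by metis

lemma G_smult: "a \<in> G i \<Longrightarrow> c \<odot>\<^bsub>R\<^esub> a \<in> G i"
proof (elim G_cases)
  fix f assume f: "homogeneous i f" "a = cs f"
  have "homogeneous i (Poly_Mapping.single 0 c * f)"
    using homogeneous_mult[OF homogeneous_single[of 0 0 c] f(1)] by (simp add: mdeg_def)
  then show "c \<odot>\<^bsub>R\<^esub> a \<in> G i" unfolding f(2) cs_simps(4)[symmetric] by (rule GI)
qed

lemma G_sub: "G i \<subseteq> carrier R" using cs_simps(1) by (auto simp: coord_grade_def)

lemma G_zero: "\<zero>\<^bsub>R\<^esub> \<in> G i" using GI[OF homogeneous_0] by (simp only: cs_simps)

lemma G_subspace: "VectorSpace.subspace base_field (G i) R"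
  using q.B.vectorspace_A algebra.axioms(1)[OF q.B.alg] G_add G_smult G_sub G_zero
  by (intro VectorSpace.subspace.intro LinearCombinations.submodule.intro) auto

lemma A_subspace: "VectorSpace.subspace base_field (deh I ` G i) S"
proof (intro VectorSpace.subspace.intro LinearCombinations.submodule.intro)
  show "deh I ` G i \<subseteq> carrier S" using G_sub dh.hom_closed by blast
  show "v \<oplus>\<^bsub>S\<^esub> w \<in> deh I ` G i" if "v \<in> deh I ` G i" "w \<in> deh I ` G i" for v w
  proof -
    from that obtain a b where ab: "a \<in> G i" "b \<in> G i" "v = deh I a" "w = deh I b" by blast
    have "v \<oplus>\<^bsub>S\<^esub> w = deh I (a \<oplus>\<^bsub>R\<^esub> b)"
      unfolding ab(3,4) by (rule dh.hom_add[symmetric]) (use ab(1,2) G_sub in blast)+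
    then show ?thesis using imageI[OF G_add[OF ab(1,2)]] by (simp only:)
  qed
  show "\<zero>\<^bsub>S\<^esub> \<in> deh I ` G i" using G_zero dh.hom_zero by (metis imageI)
  show "c \<odot>\<^bsub>S\<^esub> v \<in> deh I ` G i" if "v \<in> deh I ` G i" for c v
  proof -
    obtain a where a: "a \<in> G i" "v = deh I a" using \<open>v \<in> deh I ` G i\<close> by blast
    then have "c \<odot>\<^bsub>S\<^esub> v = deh I (c \<odot>\<^bsub>R\<^esub> a)" using dh.hom_smult[of a c] G_sub by auto
    then show ?thesis using G_smult[OF a(1)] by blast
  qed
qed (use dh.B.vectorspace_A algebra.axioms(1)[OF dh.B.alg] in auto)

text \<open>Finite dimension is known on the side of \<open>S\<close>, so the isomorphism is taken
  in the direction of the inverse of dehomogenization.\<close>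

lemma hilbert_fun_R: "hilbert_fun R G i = vectorspace.dim base_field (S\<lparr>carrier := deh I ` G i\<rparr>)"
proof -
  let ?V = "R\<lparr>carrier := G i\<rparr>" and ?W = "S\<lparr>carrier := deh I ` G i\<rparr>" and ?g = "inv_into (G i) (deh I)"
  have V: "vectorspace base_field ?V" by (rule vectorspace.subspace_is_vs[OF q.B.vectorspace_A G_subspace])
  have W: "vectorspace base_field ?W" by (rule vectorspace.subspace_is_vs[OF dh.B.vectorspace_A A_subspace])
  have fd: "vectorspace.fin_dim base_field ?W"
    by (rule vectorspace.fin_dim_subspace[OF dh.B.vectorspace_A S_fin A_subspace])
  have g: "?g (deh I a) = a" if "a \<in> G i" for a using inv_into_f_f[OF deh_inj that] .
  have "linear_map base_field ?W ?V ?g"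
  proof (rule linear_mapI[OF W V])
    show "?g \<in> carrier ?W \<rightarrow> carrier ?V" using g by auto
    fix v assume "v \<in> carrier ?W"
    then obtain a where a: "a \<in> G i" "v = deh I a" by auto
    have ac: "a \<in> carrier R" using a(1) G_sub by blast
    show "?g (c \<odot>\<^bsub>?W\<^esub> v) = c \<odot>\<^bsub>?V\<^esub> ?g v" for c
      using g[OF a(1)] g[OF G_smult[OF a(1), of c]] by (simp add: a(2) flip: dh.hom_smult[OF ac])
    fix w assume "w \<in> carrier ?W"
    then obtain b where b: "b \<in> G i" "w = deh I b" by auto
    have bc: "b \<in> carrier R" using b(1) G_sub by blast
    show "?g (v \<oplus>\<^bsub>?W\<^esub> w) = ?g v \<oplus>\<^bsub>?V\<^esub> ?g w"
      using g[OF a(1)] g[OF b(1)] g[OF G_add[OF a(1) b(1)]] by (simp add: a(2) b(2) flip: dh.hom_add[OF ac bc])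
  qed
  moreover have "inj_on ?g (carrier ?W)" by (rule inj_on_inverseI[where g = "deh I"]) (auto simp: g)
  moreover have "?g ` carrier ?W = carrier ?V" using g by (force simp: image_image)
  ultimately show ?thesis unfolding hilbert_fun_def by (rule dim_linear_image(2)[OF W V fd])
qed

text \<open>A subspace of full dimension in the finite-dimensional space \<open>S\<close> is
  everything. Thus the numerical definition of \<open>r_index\<close> becomes the surjectivity of
  dehomogenization, which is the form used in the construction of lifts.\<close>

lemma hilbert_fun_R_iff: "hilbert_fun R G i = scheme_degree I \<longleftrightarrow> deh I ` G i = carrier S"
proof
  assume "hilbert_fun R G i = scheme_degree I"
  then show "deh I ` G i = carrier S"
    unfolding hilbert_fun_R scheme_degree_def by (rule vectorspace.subspace_eq_carrier[OF dh.B.vectorspace_A S_fin A_subspace])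
next
  assume e: "deh I ` G i = carrier S"
  have "S\<lparr>carrier := carrier S\<rparr> = S" by simp
  then show "hilbert_fun R G i = scheme_degree I" unfolding hilbert_fun_R e scheme_degree_def by simp
qed

text \<open>The minimum exists: the condition holds from some degree on by \<open>A_full\<close>,
  and it fails in negative degrees, where the component is zero while \<open>S\<close> is
  not.\<close>

lemma r_index: "0 \<le> r_index I" "r_index I \<le> i \<Longrightarrow> deh I ` G i = carrier S"
proof -
  let ?P = "\<lambda>i. \<forall>j\<ge>i. hilbert_fun R G j = scheme_degree I"
  obtain N where N: "\<And>n. N \<le> n \<Longrightarrow> A n = carrier S" using A_full by blast
  have a: "?P (int N)"
  proof (intro allI impI)
    fix j assume "int N \<le> j"
    then show "hilbert_fun R G j = scheme_degree I" using N[of "nat j"] by (simp add: hilbert_fun_R_iff)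
  qed
  have b: "0 \<le> i" if "?P i" for i
  proof (rule ccontr)
    assume "\<not> 0 \<le> i"
    then have "G i = {\<zero>\<^bsub>R\<^esub>}" by (intro G_neg) simp
    moreover have "deh I ` G i = carrier S" using that hilbert_fun_R_iff by simp
    ultimately have "carrier S = {\<zero>\<^bsub>S\<^esub>}" using dh.hom_zero by simp
    then show False using S_one dh.B.A.one_closed by blast
  qed
  note P = int_LeastI(1)[of ?P, OF a b, folded r_index_def]
  show "0 \<le> r_index I" by (rule b) (rule P)
  show "r_index I \<le> i \<Longrightarrow> deh I ` G i = carrier S" using P hilbert_fun_R_iff by blast
qed

lemma mdeg_eq_0: "mdeg m = 0 \<longleftrightarrow> m = 0"
  by (auto simp: mdeg_def intro: poly_mapping_eqI)

section \<open>The coordinate ring as an instance of the abstract setting\<close>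

sublocale gd: graded_deh R S "deh I" G cmp "xR I None" "range (xR I)" "nat (r_index I)"
proof unfold_locales
  show "a \<otimes>\<^bsub>R\<^esub> b \<in> G (i + j)" if "a \<in> G i" "b \<in> G j" for a b i j
    using that unfolding G_iff using homogeneous_mult cs_simps(3) by metis
  show "\<one>\<^bsub>R\<^esub> \<in> G 0" using GI[OF homogeneous_1] by (simp only: cs_simps)
  show "add_hom R R (cmp n)" for n
    by (rule add_homI) (auto simp: R_carrier cmp_cs hpart_add cs_simps simp flip: cs_simps(2))
  show "cmp n a = (if n = m then a else \<zero>\<^bsub>R\<^esub>)" if "a \<in> G (int m)" for a m n
    using that unfolding G_iff by (auto simp: cmp_cs hpart_of_homogeneous cs_simps)
  have "cs f \<in> asum R (\<Union>n. G (int n))" for f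
  proof (induction f rule: homogeneous_induct)
    case (1 n f) then show ?case using GI by (intro asum_base) blast
  next
    case (2 f g) then show ?case unfolding cs_simps by (rule asum_add)
  qed
  then show "carrier R = asum R (\<Union>n. G (int n))"
    using asum_subset[OF q.B.A.abelian_monoid_axioms, of "\<Union>n. G (int n)"] G_sub unfolding R_carrier by blast
  have x1: "xR I v \<in> G 1" for v unfolding x_cs by (rule GI[OF homogeneous_mvar])
  show "xR I None \<in> G 1" by (rule x1)
  show "range (xR I) \<subseteq> G 1" using x1 by blast
  show "deh I (xR I None) = \<one>\<^bsub>S\<^esub>" unfolding x_cs by (rule D_z)
  show "deh I ` G i = carrier S" if "int (nat (r_index I)) \<le> i" for i using that r_index by simp
  show "G (int (Suc n)) = asum R {v \<otimes>\<^bsub>R\<^esub> f | v f. v \<in> range (xR I) \<and> f \<in> G (int n)}" for n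
  proof
    let ?C = "{v \<otimes>\<^bsub>R\<^esub> f | v f. v \<in> range (xR I) \<and> f \<in> G (int n)}"
    have C: "?C \<subseteq> G (int (Suc n))"
    proof
      fix y assume "y \<in> ?C"
      then obtain v f where y: "y = cs (mvar v) \<otimes>\<^bsub>R\<^esub> cs f" "homogeneous (int n) f" by (auto simp: x_cs G_iff)
      have "homogeneous (int (Suc n)) (mvar v * f)" using homogeneous_mult[OF homogeneous_mvar y(2)] by (simp add: add.commute)
      then show "y \<in> G (int (Suc n))" unfolding y(1) cs_simps(3)[symmetric] by (rule GI)
    qed
    show "asum R ?C \<subseteq> G (int (Suc n))"
    proof
      fix y assume "y \<in> asum R ?C" then show "y \<in> G (int (Suc n))"
        by induction (use C G_zero G_add in blast)+
    qed
    show "G (int (Suc n)) \<subseteq> asum R ?C"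
    proof
      fix y assume "y \<in> G (int (Suc n))"
      then obtain f where f: "homogeneous (int (Suc n)) f" "y = cs f" by (rule G_cases)
      have "cs f \<in> asum R ?C"
      proof (rule homogeneous_monom_induct[OF f(1)])
        show "cs 0 \<in> asum R ?C" unfolding cs_simps by (rule asum_zero)
        show "cs (f + g) \<in> asum R ?C" if "cs f \<in> asum R ?C" "cs g \<in> asum R ?C" for f g
          unfolding cs_simps using that by (rule asum_add)
        fix m :: "'n option \<Rightarrow>\<^sub>0 nat" and c :: 'k assume m: "mdeg m = Suc n"
        \<comment> \<open>A monomial of positive degree contains some variable, which is split
          off.\<close>
        obtain v where "Poly_Mapping.lookup m v \<noteq> 0"
          using m by (auto simp: mdeg_def dest: sum_SucD)
        then have v: "1 \<le> Poly_Mapping.lookup m v" by simp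
        let ?m = "m - Poly_Mapping.single v 1"
        have "mdeg ?m = n"
          using m mdeg_add[of "Poly_Mapping.single v 1" ?m] unfolding single_plus_minus[OF v] by simp
        then have "cs (Poly_Mapping.single ?m c) \<in> G (int n)" by (intro GI homogeneous_single)
        moreover have "cs (Poly_Mapping.single m c) = xR I v \<otimes>\<^bsub>R\<^esub> cs (Poly_Mapping.single ?m c)"
          unfolding single_mvar_power[OF v, of c] by (simp add: cs_simps x_cs)
        ultimately show "cs (Poly_Mapping.single m c) \<in> asum R ?C" by (intro asum_base) blast
      qed
      then show "y \<in> asum R ?C" using f(2) by simp
    qed
  qed
  have am: "alg_map R c = cs (Poly_Mapping.single 0 c)" for c
    using cs_simps(4)[of c 1] by (simp add: alg_map_def cs_simps)
  show "G 0 = range (alg_map R)"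
  proof
    show "range (alg_map R) \<subseteq> G 0"
      using GI[OF homogeneous_single[of 0 0]] by (auto simp: am mdeg_eq_0)
    show "G 0 \<subseteq> range (alg_map R)"
    proof
      fix y assume "y \<in> G 0"
      then obtain f where f: "homogeneous (int 0) f" "y = cs f" by (auto simp: G_iff)
      then have k: "mdeg m = 0" if "m \<in> Poly_Mapping.keys f" for m using that by (simp only: homogeneous_iff)
      \<comment> \<open>Degree zero leaves only the exponent 0, so f is its constant term.\<close>
      have "f = Poly_Mapping.single 0 (Poly_Mapping.lookup f 0)"
        by (rule poly_mapping_eqI) (use k in \<open>auto simp: mdeg_eq_0 lookup_single when_def in_keys_iff\<close>)
      then show "y \<in> range (alg_map R)" unfolding f(2) am by (metis rangeI)
    qed
  qed
qed (use G_sub G_zero G_add G_smult G_neg deh_inj S_fin S_one in auto)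

end

section \<open>Translation into the notions of the theorem\<close>

context zero_dim
begin

lemma tic_eq: "tic_ring I = gd.tic" "tic_grade I = gd.tgrade" "tic_emb I = gd.emb"
proof -
  show t: "tic_ring I = gd.tic" by (simp add: tic_ring_def Let_def gd.tic_def)
  show "tic_grade I = gd.tgrade" by (rule ext) (simp add: tic_grade_def gd.tgrade_def t)
  show "tic_emb I = gd.emb" by (rule ext) (simp add: tic_emb_def gd.emb_def)
qed

lemma kaehler_tic_eq: "kaehler_tic I = gd.KT" by (simp add: kaehler_tic_def tic_eq)

lemma Phi_eq: "Phi I = gd.\<Phi>" by (simp add: Phi_def tic_eq)

lemma x0_tensor_eq: "x0_tensor I = gd.KS.x0pow"
  by (intro ext) (simp add: x0_tensor_def gd.KS.x0pow_def)

lemma split_eq: "split_mod I = gd.split" "split_grade I = gd.sgr"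
proof -
  show "split_mod I = gd.split" by (simp add: split_mod_def gd.split_def dh.B.pmon_def)
  show "split_grade I = gd.sgr" by (rule ext) (simp add: split_grade_def gd.sgr_def x0_tensor_eq)
qed

lemma tic_iso: "is_tic_iso I gd.\<psi>"
  unfolding is_tic_iso_def tic_eq
  using gd.\<psi>_iso gd.hom_nzd_unit gd.\<psi>_hfrac by (simp add: dh.B.pmon_def)

lemma split_iso: "is_split_iso I gd.\<psi> gd.\<Theta>"
  unfolding is_split_iso_def tic_eq kaehler_tic_eq split_eq x0_tensor_eq
proof (intro conjI ballI allI impI)
  show "graded_mod_iso Kx0 gd.KT gd.tgr gd.split gd.sgr gd.\<Theta>" by (rule gd.\<Theta>_iso)
  show "gd.\<Theta> (p \<odot>\<^bsub>kaehler gd.tic\<^esub> kd gd.tic (gd.emb (xR I None))) = (gd.\<psi> p, \<zero>\<^bsub>base_change Kx0 (kaehler_K S)\<^esub>)"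
    if p: "p \<in> carrier gd.tic" for p
  proof -
    have "gd.\<psi> p \<in> carrier (poly_alg1 S)"
      using gd.\<psi>_iso p by (auto simp: graded_alg_iso_def bij_betw_def)
    from gd.\<Theta>_dx0[OF this] show ?thesis unfolding gd.W_\<psi>[OF p] .
  qed
  show "gd.\<Theta> (p \<odot>\<^bsub>kaehler gd.tic\<^esub> kd gd.tic q) = (\<zero>\<^bsub>UP S\<^esub>, gd.KS.x0pow k (s \<odot>\<^bsub>kaehler S\<^esub> kd S t))"
    if "p \<in> carrier gd.tic" "q \<in> carrier gd.tic" "s \<in> carrier S" "t \<in> carrier S"
      "gd.\<psi> p = up_ring.monom (UP S) s k" "gd.\<psi> q = up_ring.monom (UP S) t 0" for p q s t k
    using gd.\<Theta>_monomials[OF that(1-4), folded dh.B.pmon_def, OF that(5,6)[folded dh.B.pmon_def]]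
    by (simp add: poly_alg1_def)
qed

text \<open>Linearity requires that the embedding carry the action of polynomials through x_0 in
  \<open>R\<close> to their action through the image of x_0. Both are additive in the polynomial, so
  monomials suffice.\<close>

lemma Phi_mod_hom: "graded_mod_hom Kx0 (kaehler_R I) (kaehler_R_grade I) (kaehler_tic I) (kaehler_tic_grade I) (Phi I)"
  unfolding kaehler_tic_eq Phi_eq tic_eq graded_mod_hom_def
proof (intro conjI allI gd.\<Phi>_graded)
  let ?pr = "poly_scalar R (xR I None)"
  have xc: "xR I None \<in> carrier R" by (rule gd.x_carrier)
  note pr = q.B.poly_scalar_hom[OF xc] and pt = gd.tic.poly_scalar_hom[OF gd.X0_closed]
  have M: "Module.module Kx0 (kaehler_R I)"
    unfolding kaehler_R_def
    by (rule module_restrict_scalars[OF q.B.\<Omega>.module_axioms gd.KS.KX.A.cring_axioms pr(1)])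
  have pow: "gd.emb (xR I None [^]\<^bsub>R\<^esub> n) = gd.emb (xR I None) [^]\<^bsub>gd.tic\<^esub> n" for n :: nat
    by (induction n) (use xc in \<open>simp_all add: gd.emb.hom_one gd.emb.hom_mult\<close>)
  have e: "gd.emb (?pr c) = gd.ps c" if "c \<in> carrier Kx0" for c :: "nat \<Rightarrow> 'k"
  proof (rule gd.Kx0_eqI[OF _ _ gd.tic.A.abelian_group_axioms _ that])
    show "add_hom Kx0 gd.tic (\<lambda>c. gd.emb (?pr c))"
      by (rule add_homI) (simp_all add: ring_hom_closed[OF pr(1)] ring_hom_add[OF pr(1)] gd.emb.hom_add)
    show "add_hom Kx0 gd.tic gd.ps"
      by (rule add_homI) (simp_all add: ring_hom_add[OF pt(1)])
    show "gd.emb (?pr (up_ring.monom Kx0 c n)) = gd.ps (up_ring.monom Kx0 c n)" for c :: 'k and n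
      unfolding pr(2) pt(2) using xc by (simp add: gd.emb.hom_smult pow)
  qed
  show "mod_hom Kx0 (kaehler_R I) gd.KT gd.\<Phi>"
  proof (intro mod_hom.intro mod_hom_axioms.intro M gd.module_KT)
    show "gd.\<Phi> \<in> LinearCombinations.module_hom Kx0 (kaehler_R I) gd.KT"
      by (auto simp: LinearCombinations.module_hom_def kaehler_R_def restrict_scalars_def
          add_hom_add[OF gd.emb.kaehler_map_hom] gd.emb.kaehler_map_smult ring_hom_closed[OF pr(1)] e)
  qed
qed

lemma Phi_kd: "f \<in> carrier R \<Longrightarrow> g \<in> carrier R \<Longrightarrow>
    Phi I (f \<odot>\<^bsub>kaehler R\<^esub> kd R g) = tic_emb I f \<odot>\<^bsub>kaehler (tic_ring I)\<^esub> kd (tic_ring I) (tic_emb I g)"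
  unfolding Phi_eq tic_eq by (rule gd.emb.kaehler_map_kd)

lemma xR_G: "xR I v \<in> G (int 1)" using gd.X_G by auto

text \<open>The formula \<open>\<beta>m\<close> for a second factor of degree 1: the coefficient is
  1 and the exponent of x_0 in front of dx_0 is k + 1 - 1.\<close>

lemma Theta_Phi_x:
  assumes f: "f \<in> G (int k)"
  shows "gd.\<Theta> (Phi I (f \<odot>\<^bsub>kaehler R\<^esub> kd R (xR I v))) =
    (up_ring.monom (UP S) (deh I f \<otimes>\<^bsub>S\<^esub> deh I (xR I v)) k,
     x0_tensor I (k + 1) (deh I f \<odot>\<^bsub>kaehler S\<^esub> kd S (deh I (xR I v))))"
proof -
  have c: "deh I f \<otimes>\<^bsub>S\<^esub> deh I (xR I v) \<in> carrier S"
    using gd.G_carrier[OF f] gd.G_carrier[OF xR_G[of v]] by simp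
  have "of_nat 1 \<odot>\<^bsub>S\<^esub> (deh I f \<otimes>\<^bsub>S\<^esub> deh I (xR I v)) = deh I f \<otimes>\<^bsub>S\<^esub> deh I (xR I v)"
    using dh.B.smult_one[OF c] by simp
  then show ?thesis
    unfolding Phi_eq gd.\<Theta>\<Phi>_homog[OF f xR_G] gd.\<beta>m_def x0_tensor_eq
    by (simp only: dh.B.pmon_def add_diff_cancel_right')
qed

lemma Theta_Phi_x0:
  assumes f: "f \<in> G (int k)"
  shows "gd.\<Theta> (Phi I (f \<odot>\<^bsub>kaehler R\<^esub> kd R (xR I None))) =
    (up_ring.monom (UP S) (deh I f) k, \<zero>\<^bsub>base_change Kx0 (kaehler_K S)\<^esub>)"
proof -
  have fc: "f \<in> carrier R" "deh I f \<in> carrier S" using gd.G_carrier[OF f] by auto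
  have "Phi I (f \<odot>\<^bsub>kaehler R\<^esub> kd R (xR I None)) =
      gd.W (dh.B.pmon (deh I f) k) \<odot>\<^bsub>kaehler gd.tic\<^esub> kd gd.tic (gd.emb (xR I None))"
    unfolding Phi_kd[OF fc(1) gd.x_carrier] unfolding tic_eq gd.emb_G[OF f] ..
  then show ?thesis using gd.\<Theta>_dx0[OF dh.B.pmon_closed[OF fc(2)]] by (simp only: dh.B.pmon_def)
qed

lemma torsion_eq: "torsion_R I = a_kernel (kaehler R) (kaehler (tic_ring I)) (Phi I)"
  unfolding torsion_R_def Phi_eq tic_eq gd.kernel_eq_torsion
  by (simp add: a_kernel_def kernel_def)

end

theorem proposition3p8:
  fixes I :: "('n::finite, 'k::field) mpoly set"
  assumes "perfect_field TYPE('k)"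
    and "zero_dim_scheme I"
    and "\<forall>p\<in>proj_points I. mvar None \<notin> p"
  shows "\<exists>\<psi> \<Theta>. is_tic_iso I \<psi> \<and> is_split_iso I \<psi> \<Theta> \<and>
    \<comment> \<open>(a)\<close>
    (graded_alg_hom (coord_ring I) (coord_grade I) (tic_ring I) (tic_grade I) (tic_emb I) \<and>
     inj_on (tic_emb I) (carrier (coord_ring I)) \<and>
     (\<forall>k::nat. \<forall>f\<in>coord_grade I (int k).
        \<psi> (tic_emb I f) = up_ring.monom (UP (aff_ring I)) (deh I f) k) \<and>
     graded_mod_hom Kx0 (kaehler_R I) (kaehler_R_grade I)
       (kaehler_tic I) (kaehler_tic_grade I) (Phi I) \<and>
     (\<forall>f\<in>carrier (coord_ring I). \<forall>g\<in>carrier (coord_ring I).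
        Phi I (f \<odot>\<^bsub>kaehler (coord_ring I)\<^esub> kd (coord_ring I) g) =
          tic_emb I f \<odot>\<^bsub>kaehler (tic_ring I)\<^esub> kd (tic_ring I) (tic_emb I g)) \<and>
     (\<forall>k::nat. \<forall>f\<in>coord_grade I (int k).
        (\<forall>i::'n.
           \<Theta> (Phi I (f \<odot>\<^bsub>kaehler (coord_ring I)\<^esub> kd (coord_ring I) (xR I (Some i)))) =
             (up_ring.monom (UP (aff_ring I))
                (deh I f \<otimes>\<^bsub>aff_ring I\<^esub> deh I (xR I (Some i))) k,
              x0_tensor I (k + 1)
                (deh I f \<odot>\<^bsub>kaehler (aff_ring I)\<^esub>
                   kd (aff_ring I) (deh I (xR I (Some i)))))) \<and>
        \<Theta> (Phi I (f \<odot>\<^bsub>kaehler (coord_ring I)\<^esub> kd (coord_ring I) (xR I None))) =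
          (up_ring.monom (UP (aff_ring I)) (deh I f) k,
           \<zero>\<^bsub>base_change Kx0 (kaehler_K (aff_ring I))\<^esub>))) \<and>
    \<comment> \<open>(b)\<close>
    (\<forall>i \<ge> 2 * r_index I + 1.
       linear_map base_field
         ((kaehler_K (coord_ring I))\<lparr>carrier := kaehler_R_grade I i\<rparr>)
         ((kaehler_K (tic_ring I))\<lparr>carrier := kaehler_tic_grade I i\<rparr>) (Phi I) \<and>
       bij_betw (Phi I) (kaehler_R_grade I i) (kaehler_tic_grade I i)) \<and>
    \<comment> \<open>(c)\<close>
    (vectorspace.fin_dim base_field (aff_ring I) \<and>
     vectorspace.fin_dim base_field (kaehler_K (aff_ring I)) \<and>
     (\<forall>i. vectorspace.fin_dim base_field
            ((kaehler_K (coord_ring I))\<lparr>carrier := kaehler_R_grade I i\<rparr>)) \<and>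
     hilbert_const (hilbert_fun (kaehler_K (coord_ring I)) (kaehler_R_grade I)) =
       scheme_degree I + vectorspace.dim base_field (kaehler_K (aff_ring I)) \<and>
     regularity_index (hilbert_fun (kaehler_K (coord_ring I)) (kaehler_R_grade I))
       \<le> 2 * r_index I + 1) \<and>
    \<comment> \<open>(d)\<close>
    torsion_R I = a_kernel (kaehler (coord_ring I)) (kaehler (tic_ring I)) (Phi I)"
proof -
  interpret zero_dim I using assms(2,3) by (rule zero_dim.intro)
  \<comment> \<open>The abstract setting measures degrees of lifts by a natural number; it agrees
    with the integer \<open>r_index\<close>, which is non-negative.\<close>
  have r: "int (nat (r_index I)) = r_index I" using r_index(1) by simp
  show ?thesis
  proof (intro exI[of _ gd.\<psi>] exI[of _ gd.\<Theta>] conjI ballI allI impI tic_iso split_iso Phi_mod_hom torsion_eq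
      S_fin gd.fin_dim_\<Omega>S gd.fin_dim_Rgr Phi_kd Theta_Phi_x Theta_Phi_x0)
    show "graded_alg_hom R G (tic_ring I) (tic_grade I) (tic_emb I)" unfolding tic_eq by (rule gd.emb_graded)
    show "inj_on (tic_emb I) (carrier R)" unfolding tic_eq by (rule gd.emb_inj)
    show "gd.\<psi> (tic_emb I f) = up_ring.monom (UP S) (deh I f) k" if "f \<in> G (int k)" for f k
      using gd.\<psi>_emb[OF that] unfolding tic_eq dh.B.pmon_def .
    show "linear_map base_field ((kaehler_K R)\<lparr>carrier := kaehler_R_grade I i\<rparr>)
        ((kaehler_K (tic_ring I))\<lparr>carrier := kaehler_tic_grade I i\<rparr>) (Phi I)" for i
      unfolding tic_eq Phi_eq by (rule gd.\<Phi>_linear)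
    show "bij_betw (Phi I) (kaehler_R_grade I i) (kaehler_tic_grade I i)" if "2 * r_index I + 1 \<le> i" for i
    proof -
      have "i = int (nat i)" "2 * nat (r_index I) + 1 \<le> nat i" using that r_index(1) by simp_all
      then show ?thesis unfolding tic_eq Phi_eq using gd.\<Phi>_bij[of "nat i"] by metis
    qed
    show "hilbert_const (hilbert_fun (kaehler_K R) (kaehler_R_grade I)) =
        scheme_degree I + vectorspace.dim base_field (kaehler_K S)"
      unfolding scheme_degree_def by (rule gd.hilbert_const_HF)
    show "regularity_index (hilbert_fun (kaehler_K R) (kaehler_R_grade I)) \<le> 2 * r_index I + 1"
      using gd.regularity_HF r by simp
  qed
qed

end
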